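(* Assume (F1)–(F4), (G1) and (G3) of the context, and let $\ell>0$. Let $\mathbf{A}_\ell$ be the global attractor of the dynamical system $(\mathcal{H},S_\ell(t))$ generated by the Bresse system. Then: (i) $\mathbf{A}_\ell$ has finite fractal dimension. (ii) Any full trajectory $(\varphi(t),\psi(t),w(t),\varphi_t(t),\psi_t(t),w_t(t))$, $t\in\mathbb{R}$, inside $\mathbf{A}_\ell$ satisfies, for some $C_\ell>0$ and all $t\in\mathbb{R}$, $$\|(\varphi,\psi,w)\|_{(H^2)^3}+\|(\varphi_t,\psi_t,w_t)\|_{(H^1_0)^3}+\|(\varphi_{tt},\psi_{tt},w_{tt})\|_{(L^2)^3}\le C_\ell .$$ (iii) $(\mathcal{H},S_\ell(t))$ possesses a generalized exponential attractor $\mathbf{A}^{\rm exp}_\ell$ with finite fractal dimension in the extended space $\widetilde{\mathcal{H}}_{-\eta}$, for any $\eta\in(0,1]$.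
   Context: Fix $L>0$, $\rho_1,\rho_2,b,k,k_0>0$, $\ell>0$; $\|\cdot\|$ is the $L^2(0,L)$ norm; $\mathcal{H}=H^1_0(0,L)^3\times L^2(0,L)^3$. The Bresse system is $\rho_1\varphi_{tt}-k(\varphi_x+\psi+\ell w)_x-k_0\ell(w_x-\ell\varphi)+g_1(\varphi_t)+f_1(\varphi,\psi,w)=0$, $\rho_2\psi_{tt}-b\psi_{xx}+k(\varphi_x+\psi+\ell w)+g_2(\psi_t)+f_2(\varphi,\psi,w)=0$, $\rho_1w_{tt}-k_0(w_x-\ell\varphi)_x+k\ell(\varphi_x+\psi+\ell w)+g_3(w_t)+f_3(\varphi,\psi,w)=0$ on $(0,L)\times\mathbb{R}^+$, with $\varphi=\psi=w=0$ at $x=0,L$; it is well posed in $\mathcal{H}$, $S_\ell(t)$ is its solution semigroup, and under these hypotheses it has a global attractor $\mathbf{A}_\ell$ (compact, $S_\ell(t)\mathbf{A}_\ell=\mathbf{A}_\ell$, attracting every bounded set). Let $\gamma_3>0$ satisfy $\|\varphi_x\|^2+\|\psi_x\|^2+\|w_x\|^2\le\gamma_3(b\|\psi_x\|^2+k\|\varphi_x+\psi+\ell w\|^2+k_0\|w_x-\ell\varphi\|^2)$ for all $\varphi,\psi,w\in H^1_0(0,L)$. Hypotheses: (F1) $F\in C^2(\mathbb{R}^3)$, $\nabla F=(f_1,f_2,f_3)$; (F2) there are $\beta,m_F\ge0$, $0\le\beta<\pi^2/(2\gamma_3L^2)$, with $F(u,v,w)\ge-\beta(u^2+v^2+w^2)-m_F$;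 (F3) there are $p\ge1$, $C_f>0$ with $|\nabla f_i(u,v,w)|\le C_f(1+|u|^{p-1}+|v|^{p-1}+|w|^{p-1})$; (F4) $\nabla F(u,v,w)\cdot(u,v,w)-F(u,v,w)\ge-\beta(u^2+v^2+w^2)-m_F$; (G1) $g_i\in C^1(\mathbb{R})$ increasing, $g_i(0)=0$; (G3) there are $m_i,M_i>0$ with $m_i\le g_i'(s)\le M_i$ for all $s\in\mathbb{R}$, $i=1,2,3$. Fractal dimension of a compact set $A$ in a metric space: $\dim_FA=\limsup_{\varepsilon\to0}\ln N_\varepsilon(A)/\ln(1/\varepsilon)$, where $N_\varepsilon(A)$ is the minimal number of closed balls of radius $2\varepsilon$ covering $A$. Extended spaces: $\widetilde{\mathcal{H}}_0=\mathcal{H}$, $\widetilde{\mathcal{H}}_{-1}=L^2(0,L)^3\times H^{-1}(0,L)^3$, and $\widetilde{\mathcal{H}}_{-\eta}$ for $\eta\in(0,1)$ is the interpolation space between them. A generalized exponential attractor is a compact set $\mathbf{A}^{\rm exp}\subset\mathcal{H}$ that is positively invariant, attracts the trajectories from every bounded subset of $\mathcal{H}$ exponentially fast, and has finite fractal dimension in the extended space. *)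

theory Defs
  imports "HOL-Analysis.Analysis"
begin

section \<open>Function spaces on (0,L), realised on functions real => real (up to a.e. equality)\<close>

definition L2 :: "real \<Rightarrow> (real \<Rightarrow> real) \<Rightarrow> bool" where
  "L2 L f \<longleftrightarrow> f measurable_on {0..L} \<and> (\<lambda>x. (f x)^2) integrable_on {0..L}"

definition l2norm :: "real \<Rightarrow> (real \<Rightarrow> real) \<Rightarrow> real" where
  "l2norm L f = sqrt (integral {0..L} (\<lambda>x. (f x)^2))"

definition ip :: "real \<Rightarrow> (real \<Rightarrow> real) \<Rightarrow> (real \<Rightarrow> real) \<Rightarrow> real" where
  "ip L f g = integral {0..L} (\<lambda>x. f x * g x)"

definition fdiff :: "(real \<Rightarrow> real) \<Rightarrow> (real \<Rightarrow> real) \<Rightarrow> real \<Rightarrow> real" where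
  "fdiff f g = (\<lambda>x. f x - g x)"

text \<open>g is (a representative of) the weak derivative of f on (0,L):
  f is a.e. equal to an absolutely continuous function with derivative g in L2.\<close>
definition weak_deriv :: "real \<Rightarrow> (real \<Rightarrow> real) \<Rightarrow> (real \<Rightarrow> real) \<Rightarrow> bool" where
  "weak_deriv L f g \<longleftrightarrow> L2 L g \<and>
     (\<exists>c. negligible {x \<in> {0..L}. f x \<noteq> c + integral {0..x} g})"

definition dx :: "real \<Rightarrow> (real \<Rightarrow> real) \<Rightarrow> real \<Rightarrow> real" where
  "dx L f = (SOME g. weak_deriv L f g)"

definition H10 :: "real \<Rightarrow> (real \<Rightarrow> real) \<Rightarrow> bool" where
  "H10 L f \<longleftrightarrow> L2 L f \<and> (\<exists>g. L2 L g \<and> integral {0..L} g = 0 \<and>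
       negligible {x \<in> {0..L}. f x \<noteq> integral {0..x} g})"

definition H2 :: "real \<Rightarrow> (real \<Rightarrow> real) \<Rightarrow> bool" where
  "H2 L f \<longleftrightarrow> L2 L f \<and> (\<exists>g h. weak_deriv L f g \<and> weak_deriv L g h)"

definition h2norm :: "real \<Rightarrow> (real \<Rightarrow> real) \<Rightarrow> real" where
  "h2norm L f = sqrt ((l2norm L f)^2 + (l2norm L (dx L f))^2 + (l2norm L (dx L (dx L f)))^2)"

text \<open>Spectral (Dirichlet sine basis) Sobolev norms of order s in [-1,1]; they realise the
  interpolation scale between H^1_0 / L^2 / H^{-1}.\<close>
definition sine_coeff :: "real \<Rightarrow> (real \<Rightarrow> real) \<Rightarrow> nat \<Rightarrow> real" where
  "sine_coeff L f n = sqrt (2 / L) * integral {0..L} (\<lambda>x. f x * sin (real n * pi * x / L))"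

definition snorm :: "real \<Rightarrow> real \<Rightarrow> (real \<Rightarrow> real) \<Rightarrow> real" where
  "snorm L s f = sqrt (\<Sum>n. ((real (Suc n) * pi / L) powr (2 * s)) * (sine_coeff L f (Suc n))^2)"

definition L2_deriv_at :: "real \<Rightarrow> (real \<Rightarrow> real \<Rightarrow> real) \<Rightarrow> (real \<Rightarrow> real) \<Rightarrow> real \<Rightarrow> real set \<Rightarrow> bool" where
  "L2_deriv_at L u a t X \<longleftrightarrow> L2 L a \<and>
     ((\<lambda>s. l2norm L (\<lambda>x. (u s x - u t x) / (s - t) - a x)) \<longlongrightarrow> 0) (at t within X)"

record bst =
  phi :: "real \<Rightarrow> real"
  psi :: "real \<Rightarrow> real"
  ww :: "real \<Rightarrow> real"
  phi_t :: "real \<Rightarrow> real"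
  psi_t :: "real \<Rightarrow> real"
  ww_t :: "real \<Rightarrow> real"

definition zero_st :: bst where
  "zero_st = \<lparr>phi = (\<lambda>_. 0), psi = (\<lambda>_. 0), ww = (\<lambda>_. 0),
              phi_t = (\<lambda>_. 0), psi_t = (\<lambda>_. 0), ww_t = (\<lambda>_. 0)\<rparr>"

definition Hsp :: "real \<Rightarrow> bst \<Rightarrow> bool" where
  "Hsp L U \<longleftrightarrow> H10 L (phi U) \<and> H10 L (psi U) \<and> H10 L (ww U) \<and>
               L2 L (phi_t U) \<and> L2 L (psi_t U) \<and> L2 L (ww_t U)"

text \<open>(pseudo)distance of H (functions are identified up to a.e. equality)\<close>
definition dH :: "real \<Rightarrow> bst \<Rightarrow> bst \<Rightarrow> real" where
  "dH L U V = sqrt (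
     (l2norm L (dx L (fdiff (phi U) (phi V))))^2 + (l2norm L (dx L (fdiff (psi U) (psi V))))^2
   + (l2norm L (dx L (fdiff (ww U) (ww V))))^2
   + (l2norm L (fdiff (phi_t U) (phi_t V)))^2 + (l2norm L (fdiff (psi_t U) (psi_t V)))^2
   + (l2norm L (fdiff (ww_t U) (ww_t V)))^2)"

text \<open>distance of the extended space H_{-eta} = [H, L^2^3 x H^{-1}^3]_eta,
  i.e. (H^{1-eta})^3 x (H^{-eta})^3\<close>
definition dext :: "real \<Rightarrow> real \<Rightarrow> bst \<Rightarrow> bst \<Rightarrow> real" where
  "dext L \<eta> U V = sqrt (
     (snorm L (1 - \<eta>) (fdiff (phi U) (phi V)))^2 + (snorm L (1 - \<eta>) (fdiff (psi U) (psi V)))^2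
   + (snorm L (1 - \<eta>) (fdiff (ww U) (ww V)))^2
   + (snorm L (- \<eta>) (fdiff (phi_t U) (phi_t V)))^2 + (snorm L (- \<eta>) (fdiff (psi_t U) (psi_t V)))^2
   + (snorm L (- \<eta>) (fdiff (ww_t U) (ww_t V)))^2)"

definition bresse_weak_sol ::
  "real \<Rightarrow> real \<Rightarrow> real \<Rightarrow> real \<Rightarrow> real \<Rightarrow> real \<Rightarrow> real \<Rightarrow>
   (real \<Rightarrow> real) \<Rightarrow> (real \<Rightarrow> real) \<Rightarrow> (real \<Rightarrow> real) \<Rightarrow>
   (real \<times> real \<times> real \<Rightarrow> real) \<Rightarrow> (real \<times> real \<times> real \<Rightarrow> real) \<Rightarrow> (real \<times> real \<times> real \<Rightarrow> real) \<Rightarrow>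
   (real \<Rightarrow> bst) \<Rightarrow> bool" where
  "bresse_weak_sol L \<rho>1 \<rho>2 b k k0 l g1 g2 g3 f1 f2 f3 U \<longleftrightarrow>
     (\<forall>t\<ge>0. Hsp L (U t)) \<and>
     (\<forall>t\<ge>0. ((\<lambda>s. dH L (U s) (U t)) \<longlongrightarrow> 0) (at t within {0..})) \<and>
     (\<forall>t\<ge>0. L2_deriv_at L (\<lambda>s. phi (U s)) (phi_t (U t)) t {0..}
           \<and> L2_deriv_at L (\<lambda>s. psi (U s)) (psi_t (U t)) t {0..}
           \<and> L2_deriv_at L (\<lambda>s. ww (U s)) (ww_t (U t)) t {0..}) \<and>
     (\<forall>\<zeta> t. H10 L \<zeta> \<and> t \<ge> 0 \<longrightarrow>
       (let V = U t;
            sh = (\<lambda>x. dx L (phi V) x + psi V x + l * ww V x);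
            ax = (\<lambda>x. dx L (ww V) x - l * phi V x);
            nl = (\<lambda>f x. f (phi V x, psi V x, ww V x))
        in
        ((\<lambda>s. \<rho>1 * ip L (phi_t (U s)) \<zeta>) has_real_derivative
           (- k * ip L sh (dx L \<zeta>) + k0 * l * ip L ax \<zeta>
            - ip L (\<lambda>x. g1 (phi_t V x)) \<zeta> - ip L (nl f1) \<zeta>)) (at t within {0..}) \<and>
        ((\<lambda>s. \<rho>2 * ip L (psi_t (U s)) \<zeta>) has_real_derivative
           (- b * ip L (dx L (psi V)) (dx L \<zeta>) - k * ip L sh \<zeta>
            - ip L (\<lambda>x. g2 (psi_t V x)) \<zeta> - ip L (nl f2) \<zeta>)) (at t within {0..}) \<and>
        ((\<lambda>s. \<rho>1 * ip L (ww_t (U s)) \<zeta>) has_real_derivative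
           (- k0 * ip L ax (dx L \<zeta>) - k * l * ip L sh \<zeta>
            - ip L (\<lambda>x. g3 (ww_t V x)) \<zeta> - ip L (nl f3) \<zeta>)) (at t within {0..})))"

definition pcompact :: "('a \<Rightarrow> 'a \<Rightarrow> real) \<Rightarrow> 'a set \<Rightarrow> bool" where
  "pcompact d A \<longleftrightarrow> (\<forall>X::nat \<Rightarrow> 'a. (\<forall>n. X n \<in> A) \<longrightarrow>
      (\<exists>r a. strict_mono r \<and> a \<in> A \<and> ((\<lambda>n. d (X (r n)) a) \<longlonglongrightarrow> 0)))"

definition Hbounded :: "real \<Rightarrow> bst set \<Rightarrow> bool" where
  "Hbounded L B \<longleftrightarrow> B \<subseteq> {U. Hsp L U} \<and> (\<exists>R. \<forall>U\<in>B. dH L U zero_st \<le> R)"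

definition global_attractor :: "real \<Rightarrow> (real \<Rightarrow> bst \<Rightarrow> bst) \<Rightarrow> bst set \<Rightarrow> bool" where
  "global_attractor L S A \<longleftrightarrow>
     A \<subseteq> {U. Hsp L U} \<and> pcompact (dH L) A \<and>
     (\<forall>t\<ge>0. (\<forall>a\<in>A. \<exists>b\<in>A. dH L (S t a) b = 0) \<and> (\<forall>b\<in>A. \<exists>a\<in>A. dH L (S t a) b = 0)) \<and>
     (\<forall>B. Hbounded L B \<longrightarrow>
        (\<forall>\<epsilon>>0. \<exists>T. \<forall>t\<ge>T. \<forall>U\<in>B. \<exists>a\<in>A. dH L (S t U) a < \<epsilon>))"

definition full_traj :: "real \<Rightarrow> (real \<Rightarrow> bst \<Rightarrow> bst) \<Rightarrow> bst set \<Rightarrow> (real \<Rightarrow> bst) \<Rightarrow> bool" where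
  "full_traj L S A \<Gamma> \<longleftrightarrow> (\<forall>t. \<Gamma> t \<in> A) \<and>
     (\<forall>t \<tau>. \<tau> \<ge> 0 \<longrightarrow> dH L (S \<tau> (\<Gamma> t)) (\<Gamma> (t + \<tau>)) = 0)"

text \<open>Generalized exponential attractor (finite dimensionality stated separately)\<close>
definition exp_attracting_set :: "real \<Rightarrow> (real \<Rightarrow> bst \<Rightarrow> bst) \<Rightarrow> bst set \<Rightarrow> bool" where
  "exp_attracting_set L S E \<longleftrightarrow>
     E \<subseteq> {U. Hsp L U} \<and> pcompact (dH L) E \<and>
     (\<forall>t\<ge>0. \<forall>a\<in>E. \<exists>b\<in>E. dH L (S t a) b = 0) \<and>
     (\<forall>B. Hbounded L B \<longrightarrow> (\<exists>C \<gamma>. \<gamma> > 0 \<and>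
        (\<forall>t\<ge>0. \<forall>U\<in>B. \<exists>a\<in>E. dH L (S t U) a \<le> C * exp (- \<gamma> * t))))"

definition cover_num :: "('a \<Rightarrow> 'a \<Rightarrow> real) \<Rightarrow> 'a set \<Rightarrow> real \<Rightarrow> nat" where
  "cover_num d A \<epsilon> = Inf {n. \<exists>F. finite F \<and> card F = n \<and> F \<subseteq> A \<and>
                                A \<subseteq> (\<Union>c\<in>F. {x. d c x \<le> 2 * \<epsilon>})}"

definition fractal_dim :: "('a \<Rightarrow> 'a \<Rightarrow> real) \<Rightarrow> 'a set \<Rightarrow> ereal" where
  "fractal_dim d A =
     (if \<forall>\<epsilon>>0. \<exists>F. finite F \<and> F \<subseteq> A \<and> A \<subseteq> (\<Union>c\<in>F. {x. d c x \<le> 2 * \<epsilon>})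
      then Limsup (at_right 0) (\<lambda>\<epsilon>. ereal (ln (real (cover_num d A \<epsilon>)) / ln (1 / \<epsilon>)))
      else \<infinity>)"

definition rpow :: "real \<Rightarrow> real \<Rightarrow> real" where
  "rpow a e = (if e = 0 then 1 else a powr e)"

definition damping_ok :: "(real \<Rightarrow> real) \<Rightarrow> bool" where
  "damping_ok g \<longleftrightarrow> g 0 = 0 \<and> strict_mono g \<and>
     (\<exists>g' m M. 0 < m \<and> 0 < M \<and> continuous_on UNIV g' \<and>
        (\<forall>s. (g has_real_derivative g' s) (at s) \<and> m \<le> g' s \<and> g' s \<le> M))"

definition C1_growth :: "real \<Rightarrow> real \<Rightarrow> (real \<times> real \<times> real \<Rightarrow> real) \<Rightarrow> bool" where
  "C1_growth Cf p f \<longleftrightarrow> (\<exists>Df. continuous_on UNIV Df \<and>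
     (\<forall>x. (f has_derivative (\<lambda>h. Df x \<bullet> h)) (at x)) \<and>
     (\<forall>u v w. norm (Df (u, v, w)) \<le> Cf * (1 + rpow \<bar>u\<bar> (p - 1) + rpow \<bar>v\<bar> (p - 1) + rpow \<bar>w\<bar> (p - 1))))"

end

theory Submission
  imports Defs
begin

text \<open>The system is an abstract second-order evolution equation \<open>M v' + A W + G = 0\<close> on a Hilbert space. Strong damping and
  the compactness of \<open>H\<^sup>1\<close> in \<open>L\<^sup>2\<close> make the semiflow quasi-stable on a bounded absorbing set: the distance of two orbits
  is contracted up to finitely many functionals. Counting boxes along iterates of the time-\<open>\<tau>\<close> map bounds the number of
  balls needed to cover the attractor, and adding to the attractor late orbit pieces of finite nets gives the exponential
  attractor; there time translation is Hoelder continuous in the weaker norm of order \<open>\<eta>\<close>. The same dissipation estimate, applied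
  to difference quotients of a full trajectory and with the initial time sent to \<open>-\<infinity>\<close>, shows that the trajectory
  is differentiable in the energy space with bounded derivative; the equation then gives the \<open>H\<^sup>2\<close> bound.\<close>

text \<open>The equation is only tested with elements of \<open>K\<close>, while the velocity lies
  in the pivot space; hence the energy identity itself needs a proof by difference quotients. The
  other obstacle is the damping. Its derivative is merely continuous, so the difference of two
  difference quotients of a trajectory satisfies a damped equation only up to a linearisation error,
  and this error is small only where the velocity moves little in the sup norm, which the energy
  does not control. Regularity therefore takes two passes: the first shows that full trajectories
  are Lipschitz in the energy space, interpolation converts this into sup-norm continuity of the
  velocity, and the second shows that the quotients are Cauchy. In all uses of the dissipation
  estimate the disturbance enters as one number \<open>\<rho>\<close>: an \<open>L^2\<close> norm of
  the displacement difference for quasi-stability, a multiple of the time shift in the first pass,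
  an arbitrarily small error in the second. States are concrete functions with a pseudo-distance;
  the map \<open>io\<close> sends them to a Hilbert space, and uniqueness of solutions lets the
  semiflow act there.\<close>

section \<open>The Hilbert space of square integrable functions as a type\<close>

definition sqi :: "(real => real) => bool" where
 "sqi f \<longleftrightarrow> f \<in> borel_measurable lebesgue & integrable lebesgue (%x. (f x)^2)"

lemma sqi_measurable: "sqi f ==> f \<in> borel_measurable lebesgue"
 by (simp add: sqi_def)

lemma sqi_bound:
 assumes "f \<in> borel_measurable lebesgue" "sqi g" "AE x in lebesgue. \<bar>f x\<bar> <= \<bar>g x\<bar>"
 shows "sqi f"
 using assms unfolding sqi_def
 by (auto intro!: Bochner_Integration.integrable_bound[where f = "%x. (g x)^2"] simp: abs_le_square_iff)

lemma sqi_mult_integrable: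
 assumes "sqi f" "sqi g"
 shows "integrable lebesgue (%x. f x * g x)"
proof (rule Bochner_Integration.integrable_bound)
 show "integrable lebesgue (%x. (f x)^2 + (g x)^2)"
  using assms by (auto simp: sqi_def)
 show "(%x. f x * g x) \<in> borel_measurable lebesgue"
  using assms by (auto simp: sqi_def)
 show "AE x in lebesgue. norm (f x * g x) <= norm ((f x)^2 + (g x)^2)"
 proof (rule AE_I2)
  fix x
  have "2 * (\<bar>f x\<bar> * \<bar>g x\<bar>) <= (f x)^2 + (g x)^2"
   using sum_squares_bound[of "\<bar>f x\<bar>" "\<bar>g x\<bar>"] by simp
  then show "norm (f x * g x) <= norm ((f x)^2 + (g x)^2)"
   by (simp add: abs_mult) (smt (verit) mult_nonneg_nonneg abs_ge_zero)
 qed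
qed

lemma sqi_add: "sqi f ==> sqi g ==> sqi (%x. f x + g x)"
 using sqi_mult_integrable[of f g] by (auto simp: sqi_def power2_sum mult.assoc)

lemma sqi_scale: "sqi f ==> sqi (%x. c * f x)"
 by (auto simp: sqi_def power_mult_distrib)

lemma sqi_uminus: "sqi f ==> sqi (%x. - f x)"
 by (auto simp: sqi_def)

lemma sqi_diff: "sqi f ==> sqi g ==> sqi (%x. f x - g x)"
 using sqi_add[OF _ sqi_uminus, of f g] by simp

lemma sqi_zero: "sqi (%x. 0)"
 by (auto simp: sqi_def)

definition l2rel :: "(real => real) => (real => real) => bool" where
 "l2rel f g \<longleftrightarrow> sqi f & sqi g & (AE x in lebesgue. f x = g x)"

\<comment> \<open>The type lives on the whole line so that it does not depend on \<open>L\<close>;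
  functions on \<open>{0..L}\<close> enter after a cut-off. The quotient is partial: only square
  integrable functions are related to themselves.\<close>
quotient_type l2 = "real => real" / partial: l2rel
proof (rule part_equivpI)
 show "\<exists>x. l2rel x x" using sqi_zero by (auto simp: l2rel_def)
 show "symp l2rel" by (auto simp: symp_def l2rel_def elim: AE_mp)
 show "transp l2rel" by (auto simp: transp_def l2rel_def)
qed

instantiation l2 :: real_inner
begin

lift_definition zero_l2 :: l2 is "%x. 0" by (simp add: l2rel_def sqi_zero)

lift_definition plus_l2 :: "l2 => l2 => l2" is "%f g x. f x + g x"
 by (auto simp: l2rel_def sqi_add)

lift_definition uminus_l2 :: "l2 => l2" is "%f x. - f x"
 by (auto simp: l2rel_def sqi_uminus)

lift_definition minus_l2 :: "l2 => l2 => l2" is "%f g x. f x - g x"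
 by (auto simp: l2rel_def sqi_diff)

lift_definition scaleR_l2 :: "real => l2 => l2" is "%c f x. c * f x"
 by (auto simp: l2rel_def sqi_scale)

lift_definition inner_l2 :: "l2 => l2 => real" is "%f g. integral\<^sup>L lebesgue (%x. f x * g x)"
 unfolding l2rel_def
 apply (rule integral_cong_AE)
 using sqi_measurable by (auto intro!: borel_measurable_times)

definition norm_l2 :: "l2 => real" where "norm_l2 x = sqrt (inner x x)"
definition sgn_l2 :: "l2 => l2" where "sgn_l2 x = scaleR (inverse (norm x)) x"
definition dist_l2 :: "l2 => l2 => real" where "dist_l2 x y = norm (x - y)"
definition uniformity_l2 :: "(l2 \<times> l2) filter" where
 "uniformity_l2 = (INF e\<in>{0<..}. principal {(x, y). dist x y < e})"
definition open_l2 :: "l2 set => bool" where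
 "open_l2 U = (\<forall>x\<in>U. eventually (%(x', y). x' = x --> y \<in> U) uniformity)"

instance
proof
 fix x y z :: l2 and a b :: real and U :: "l2 set"
 show "x + y + z = x + (y + z)" by transfer (auto simp: l2rel_def sqi_add add.assoc)
 show "x + y = y + x" by transfer (auto simp: l2rel_def sqi_add add.commute)
 show "0 + x = x" by transfer (auto simp: l2rel_def)
 show "- x + x = 0" by transfer (auto simp: l2rel_def sqi_zero)
 show "x - y = x + - y" by transfer (auto simp: l2rel_def sqi_diff)
 show "a *\<^sub>R (x + y) = a *\<^sub>R x + a *\<^sub>R y"
  by transfer (auto simp: l2rel_def sqi_add sqi_scale algebra_simps)
 show "(a + b) *\<^sub>R x = a *\<^sub>R x + b *\<^sub>R x"
  by transfer (auto simp: l2rel_def sqi_add sqi_scale algebra_simps)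
 show "a *\<^sub>R b *\<^sub>R x = (a * b) *\<^sub>R x"
  by transfer (auto simp: l2rel_def sqi_scale mult.assoc)
 show "1 *\<^sub>R x = x" by transfer (auto simp: l2rel_def)
 show "dist x y = norm (x - y)" by (simp add: dist_l2_def)
 show "sgn x = scaleR (inverse (norm x)) x" by (simp add: sgn_l2_def)
 show "norm x = sqrt (inner x x)" by (simp add: norm_l2_def)
 show "uniformity = (INF e\<in>{0<..}. principal {(x :: l2, y). dist x y < e})"
  by (simp add: uniformity_l2_def)
 show "open U = (\<forall>x\<in>U. eventually (%(x', y). x' = x --> y \<in> U) uniformity)"
  by (simp add: open_l2_def)
 show "inner x y = inner y x" by transfer (simp add: mult.commute)
 show "inner (x + y) z = inner x z + inner y z"
  by transfer (simp add: l2rel_def distrib_right sqi_mult_integrable)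
 show "inner (a *\<^sub>R x) y = a * inner x y"
  by transfer (simp add: l2rel_def mult.assoc)
 show "0 <= inner x x" by transfer simp
 show "(inner x x = 0) = (x = 0)"
 proof (transfer)
  fix f assume "l2rel f f"
  then have f: "sqi f" by (simp add: l2rel_def)
  have "(integral\<^sup>L lebesgue (%x. f x * f x) = 0) \<longleftrightarrow> (AE x in lebesgue. f x * f x = 0)"
   using f by (intro integral_nonneg_eq_0_iff_AE) (auto simp: sqi_mult_integrable)
  then show "(integral\<^sup>L lebesgue (%x. f x * f x) = 0) = l2rel f (%x. 0)"
   using f by (simp add: l2rel_def sqi_zero)
 qed
qed

end

definition rep :: "l2 => real => real" where "rep e = (SOME f. sqi f & abs_l2 f = e)"

lemma rep: "sqi (rep e)" "abs_l2 (rep e) = e"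
proof -
 have "\<exists>f. sqi f & abs_l2 f = e"
  by (metis Quotient_rep_reflp l2rel_def Quotient_abs_rep Quotient_l2)
 from someI_ex[OF this] show "sqi (rep e)" "abs_l2 (rep e) = e"
  by (auto simp: rep_def)
qed

lemma abs_l2_eq_iff: "sqi f ==> sqi g ==> abs_l2 f = abs_l2 g \<longleftrightarrow> (AE x in lebesgue. f x = g x)"
 using Quotient_rel[OF Quotient_l2, of f g] by (auto simp: l2rel_def)

lemma rep_abs: "sqi f ==> AE x in lebesgue. rep (abs_l2 f) x = f x"
 using rep[of "abs_l2 f"] abs_l2_eq_iff by blast

lemma eq_onp_l2: "sqi f ==> l2rel f f" by (simp add: l2rel_def)

lemma abs_l2_add: "sqi f ==> sqi g ==> abs_l2 f + abs_l2 g = abs_l2 (%x. f x + g x)"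
 by (simp add: plus_l2.abs_eq eq_onp_l2)
lemma abs_l2_diff: "sqi f ==> sqi g ==> abs_l2 f - abs_l2 g = abs_l2 (%x. f x - g x)"
 by (simp add: minus_l2.abs_eq eq_onp_l2)
lemma abs_l2_scale: "sqi f ==> c *\<^sub>R abs_l2 f = abs_l2 (%x. c * f x)"
 by (simp add: scaleR_l2.abs_eq eq_onp_l2)
lemma abs_l2_inner: "sqi f ==> sqi g ==> inner (abs_l2 f) (abs_l2 g) = integral\<^sup>L lebesgue (%x. f x * g x)"
 by (simp add: inner_l2.abs_eq eq_onp_l2)
lemma norm_abs_l2: "sqi f ==> (norm (abs_l2 f))^2 = integral\<^sup>L lebesgue (%x. (f x)^2)"
 unfolding power2_norm_eq_inner by (simp add: abs_l2_inner power2_eq_square)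

text \<open>Riesz--Fischer: along a subsequence with summable increments the increments are summable almost everywhere.\<close>

lemma l2_fast_Cauchy_converges:
 fixes X :: "nat => l2"
 assumes X: "!!n. norm (X (Suc n) - X n) <= (1/2)^n"
 shows "convergent X"
proof -
 define f where "f n = rep (X n)" for n
 have f: "sqi (f n)" "abs_l2 (f n) = X n" for n by (simp_all add: f_def rep)
 have fm[measurable]: "f n \<in> borel_measurable lebesgue" for n using f by (simp add: sqi_measurable)
 define D where "D n = (%x. \<bar>f (Suc n) x - f n x\<bar>)" for n
 have Dm[measurable]: "D n \<in> borel_measurable lebesgue" for n by (simp add: D_def)
 have sD: "sqi (D n)" for n
  by (rule sqi_bound[OF _ sqi_diff[OF f(1)[of "Suc n"] f(1)[of n]]]) (simp_all add: D_def)
 have nD: "norm (abs_l2 (D n)) <= (1/2)^n" for n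
 proof -
  have "(norm (abs_l2 (D n)))^2 = (norm (X (Suc n) - X n))^2"
   unfolding norm_abs_l2[OF sD] f(2)[symmetric] abs_l2_diff[OF f(1) f(1)] norm_abs_l2[OF sqi_diff[OF f(1) f(1)]]
   by (simp add: D_def)
  then show ?thesis using X[of n] by simp
 qed
 define P where "P m = (%x. \<Sum>n<m. D n x)" for m
 have Pm[measurable]: "P n \<in> borel_measurable lebesgue" for n by (simp add: P_def)
 have P: "sqi (P m) & norm (abs_l2 (P m)) <= (\<Sum>n<m. (1/2)^n)" for m
 proof (induction m)
  case 0
  then show ?case by (simp add: P_def sqi_zero flip: zero_l2_def)
 next
  case (Suc m)
  have *: "P (Suc m) = (%x. P m x + D m x)" by (simp add: P_def)
  then have "abs_l2 (P (Suc m)) = abs_l2 (P m) + abs_l2 (D m)"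
   using Suc sD by (simp add: abs_l2_add)
  then show ?case using Suc sD[of m] nD[of m] *
   by (auto simp: sqi_add intro: order_trans[OF norm_triangle_ineq] add_mono)
 qed
 have P2: "norm (abs_l2 (P m)) <= 2" for m
 proof -
  have "(\<Sum>n<m. (1/2::real)^n) = 2 - 2 * (1/2)^m"
   by (subst sum_gp_strict) (simp add: field_simps)
  then show ?thesis using P[of m] by (smt (verit) zero_le_power zero_le_divide_1_iff)
 qed
 have nnP: "(\<integral>\<^sup>+x. ennreal ((P m x)^2) \<partial>lebesgue) <= 4" for m
 proof -
  have "(\<integral>\<^sup>+x. ennreal ((P m x)^2) \<partial>lebesgue) = ennreal (integral\<^sup>L lebesgue (%x. (P m x)^2))"
   using P[of m] by (intro nn_integral_eq_integral) (auto simp: sqi_def)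
  also have "... = ennreal ((norm (abs_l2 (P m)))^2)" using P by (simp add: norm_abs_l2)
  also have "... <= ennreal 4" using P2[of m] power_mono[OF P2[of m], of 2] by (intro ennreal_leI) simp
  finally show ?thesis by simp
 qed
 \<comment> \<open>The square of the total variation of the sequence at \<open>x\<close>, as an
   extended real: monotone convergence bounds its integral by 4, so it is finite almost everywhere
   and, as \<open>g\<close>, dominates all later quantities.\<close>
 define G where "G x = (SUP m. ennreal ((P m x)^2))" for x
 have Dpos: "0 <= D n x" for n x by (simp add: D_def)
 have Pmono: "P m x <= P n x" if "m <= n" for m n x
  unfolding P_def using that Dpos by (intro sum_mono2) auto
 have P0: "0 <= P m x" for m x unfolding P_def using Dpos by (simp add: sum_nonneg)
 have "(\<integral>\<^sup>+x. G x \<partial>lebesgue) = (SUP m. \<integral>\<^sup>+x. ennreal ((P m x)^2) \<partial>lebesgue)"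
  unfolding G_def
  by (intro nn_integral_monotone_convergence_SUP)
   (auto simp: incseq_def le_fun_def intro!: ennreal_leI power_mono Pmono P0)
 also have "... <= 4" using nnP by (intro SUP_least) auto
 finally have Gint: "(\<integral>\<^sup>+x. G x \<partial>lebesgue) <= 4" .
 have Gm[measurable]: "G \<in> borel_measurable lebesgue" unfolding G_def by measurable
 have "AE x in lebesgue. G x ~= \<infinity>"
  using Gint by (intro nn_integral_PInf_AE) (auto simp: top_unique)
 then have ae: "AE x in lebesgue. G x < \<infinity>" by (auto simp: less_top)
 define g where "g x = enn2real (G x)" for x
 have gm[measurable]: "g \<in> borel_measurable lebesgue" unfolding g_def by measurable
 have gint: "integrable lebesgue g"
 proof (rule integrableI_nonneg)
  have "(\<integral>\<^sup>+x. ennreal (g x) \<partial>lebesgue) = (\<integral>\<^sup>+x. G x \<partial>lebesgue)"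
   using ae by (intro nn_integral_cong_AE) (auto simp: g_def less_top)
  then show "(\<integral>\<^sup>+x. ennreal (g x) \<partial>lebesgue) < \<infinity>"
   using Gint by (auto simp: less_top[symmetric] top_unique)
 qed (auto simp: g_def)
 have Pg: "AE x in lebesgue. \<forall>m. (P m x)^2 <= g x"
  using ae
 proof eventually_elim
  case (elim x)
  show ?case
  proof
   fix m
   have "ennreal ((P m x)^2) <= G x" unfolding G_def by (auto intro: SUP_upper)
   also have "G x = ennreal (g x)" using elim by (simp add: g_def less_top)
   finally show "(P m x)^2 <= g x" by (simp add: g_def)
  qed
 qed
 \<comment> \<open>\<open>lim\<close> is measurable in \<open>x\<close> without any knowledge of
   convergence; almost everywhere it is the true limit.\<close>
 define h where "h x = lim (%n. f n x)" for x
 have hm[measurable]: "h \<in> borel_measurable lebesgue" unfolding h_def by measurable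
 have dist: "\<bar>f n x - f m x\<bar> <= P n x" if "m <= n" for m n x
  using that
 proof (induction n rule: dec_induct)
  case base then show ?case by (simp add: P0)
 next
  case (step n) then show ?case by (simp add: P_def D_def)
 qed
 have conv: "AE x in lebesgue. (%n. f n x) \<longlonglongrightarrow> h x"
  using Pg
 proof eventually_elim
  case (elim x)
  have "summable (%n. D n x)"
  proof (rule bounded_imp_summable[where B = "sqrt (g x)"])
   fix n
   show "0 <= D n x" by (rule Dpos)
   have "P (Suc n) x <= sqrt (g x)" using elim by (intro real_le_rsqrt) auto
   then show "(\<Sum>k\<le>n. D k x) <= sqrt (g x)" by (simp add: P_def lessThan_Suc_atMost)
  qed
  then have "summable (%n. f (Suc n) x - f n x)"
   unfolding D_def by (rule summable_rabs_cancel)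
  then have "convergent (%n. \<Sum>k<n. f (Suc k) x - f k x)" by (simp add: summable_iff_convergent)
  then have "convergent (%n. f n x - f 0 x)" using sum_lessThan_telescope[of "%n. f n x"] by simp
  then have "convergent (%n. (f n x - f 0 x) + f 0 x)" by (intro convergent_add convergent_const)
  then show ?case by (simp add: h_def convergent_LIMSEQ_iff)
 qed
 have bnd: "AE x in lebesgue. \<forall>n. (f n x - h x)^2 <= 4 * g x"
  using Pg conv
 proof eventually_elim
  case (elim x)
  show ?case
  proof
   fix n
   have 1: "P k x <= sqrt (g x)" for k using elim by (intro real_le_rsqrt) auto
   have "(%k. \<bar>f n x - f k x\<bar>) \<longlonglongrightarrow> \<bar>f n x - h x\<bar>"
    using elim by (intro tendsto_intros) auto
   moreover have "\<bar>f n x - f k x\<bar> <= sqrt (g x)" for k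
    using dist[of n k x] dist[of k n x] 1[of n] 1[of k] by (cases "n <= k") (auto simp: abs_minus_commute)
   ultimately have "\<bar>f n x - h x\<bar> <= sqrt (g x)"
    by (intro LIMSEQ_le_const2) auto
   then have "(f n x - h x)^2 <= g x"
    by (metis abs_le_square_iff abs_ge_zero abs_of_nonneg g_def enn2real_nonneg order.trans real_sqrt_ge_0_iff real_sqrt_pow2)
   then show "(f n x - h x)^2 <= 4 * g x"
    by (smt (verit) g_def enn2real_nonneg)
  qed
 qed
 have s0: "sqi (%x. f n x - h x)" for n
  unfolding sqi_def
 proof
  show "(%x. f n x - h x) \<in> borel_measurable lebesgue" by measurable
  show "integrable lebesgue (%x. (f n x - h x)^2)"
   using bnd
   by (intro Bochner_Integration.integrable_bound[OF integrable_mult_right[OF gint, of 4]])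
    (auto simp: abs_mult g_def elim!: AE_mp)
 qed
 have sh: "sqi h" using sqi_diff[OF f(1)[of 0] s0[of 0]] by simp
 have "(%n. integral\<^sup>L lebesgue (%x. (f n x - h x)^2)) \<longlonglongrightarrow> integral\<^sup>L lebesgue (%x::real. 0)"
 proof (rule Bochner_Integration.integral_dominated_convergence[where w = "%x. 4 * g x" and s = "%n x. (f n x - h x)^2"])
  show "AE x in lebesgue. (%n. (f n x - h x)^2) \<longlonglongrightarrow> 0"
   using conv
  proof eventually_elim
   case (elim x)
   have "(%n. (f n x - h x)^2) \<longlonglongrightarrow> (h x - h x)^2" using elim by (intro tendsto_intros)
   then show ?case by simp
  qed
  show "AE x in lebesgue. norm ((f n x - h x)^2) <= 4 * g x" for n
   using bnd by eventually_elim auto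
 qed (use gint in auto)
 then have "(%n. (norm (X n - abs_l2 h))^2) \<longlonglongrightarrow> 0"
  unfolding f(2)[symmetric] abs_l2_diff[OF f(1) sh] norm_abs_l2[OF s0] by simp
 then have "(%n. sqrt ((norm (X n - abs_l2 h))^2)) \<longlonglongrightarrow> sqrt 0" by (rule tendsto_real_sqrt)
 then have "X \<longlonglongrightarrow> abs_l2 h" by (simp add: tendsto_norm_zero_iff LIM_zero_iff)
 then show ?thesis by (auto simp: convergent_def)
qed

text \<open>A Cauchy sequence converges as soon as one subsequence does. The subsequence
  \<open>r\<close> is built to have increments at most \<open>(1/2)^n\<close>; the
  \<open>max\<close> in its recursion keeps it strictly increasing and beyond the moduli
  \<open>N\<close>.\<close>

instance l2 :: complete_space
proof
 fix X :: "nat => l2"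
 assume C: "Cauchy X"
 have "\<exists>N. \<forall>m\<ge>N. \<forall>n\<ge>N. dist (X m) (X n) < (1/2)^k" for k
  using C[unfolded Cauchy_def, rule_format, of "(1/2)^k"] by simp
 then obtain N where N: "!!k m n. m \<ge> N k ==> n \<ge> N k ==> dist (X m) (X n) < (1/2)^k" by metis
 define r where "r = rec_nat (N 0) (%k p. max (Suc p) (N (Suc k)))"
 have r: "r 0 = N 0" "r (Suc k) = max (Suc (r k)) (N (Suc k))" for k by (simp_all add: r_def)
 have sm: "strict_mono r" by (auto simp: strict_mono_Suc_iff r)
 have rN: "r k \<ge> N k" for k by (cases k) (auto simp: r)
 have "convergent (%k. X (r k))"
 proof (rule l2_fast_Cauchy_converges)
  fix n show "norm (X (r (Suc n)) - X (r n)) <= (1/2)^n"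
   using N[of n "r (Suc n)" "r n"] rN[of n] strict_monoD[OF sm, of n "Suc n"]
   by (simp add: dist_norm)
 qed
 then obtain l where l: "(X \<circ> r) \<longlonglongrightarrow> l" by (auto simp: convergent_def o_def)
 have "X \<longlonglongrightarrow> l" by (rule Cauchy_converges_subseq[OF C sm l])
 then show "convergent X" by (auto simp: convergent_def)
qed

section \<open>Functions on \<open>{0..L}\<close> as elements of \<open>l2\<close>, and two facts
  about indefinite integrals\<close>

definition cut :: "real => (real => real) => real => real" where
 "cut L f = (%x. if x \<in> {0..L} then f x else 0)"

definition toL :: "real => (real => real) => l2" where
 "toL L f = abs_l2 (cut L f)"

text \<open>For nonnegative integrands the Henstock-Kurzweil integral and the Lebesgue integral have
  the same domain. This is what allows the gauge-integral definition of \<open>L2\<close> to be read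
  in \<open>l2\<close>.\<close>

lemma integrable_cut_iff:
 assumes "!!x. 0 <= f x"
 shows "f integrable_on {0..L} \<longleftrightarrow> integrable lebesgue (cut L f)"
proof -
 have "f integrable_on {0..L} \<longleftrightarrow> f absolutely_integrable_on {0..L}"
  using assms by (simp add: absolutely_integrable_on_iff_nonneg)
 also have "... \<longleftrightarrow> integrable lebesgue (cut L f)"
  unfolding set_integrable_def cut_def by (intro arg_cong[where f = "integrable lebesgue"]) (auto simp: indicator_def)
 finally show ?thesis .
qed

lemma integral_cut:
 assumes "integrable lebesgue (cut L f)"
 shows "f absolutely_integrable_on {0..L}" "integral {0..L} f = integral\<^sup>L lebesgue (cut L f)"
proof -
 have "(cut L f has_integral integral\<^sup>L lebesgue (cut L f)) UNIV"
  using assms by (rule has_integral_integral_lebesgue)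
 then have "(f has_integral integral\<^sup>L lebesgue (cut L f)) {0..L}"
  unfolding cut_def by (simp only: has_integral_restrict_UNIV)
 then show "integral {0..L} f = integral\<^sup>L lebesgue (cut L f)" by (rule integral_unique)
 show "f absolutely_integrable_on {0..L}"
  using assms unfolding set_integrable_def cut_def
  by (rule Bochner_Integration.integrable_cong[THEN iffD1, rotated -1]) (auto simp: indicator_def)
qed

lemma L2_iff: "L2 L f \<longleftrightarrow> sqi (cut L f)"
proof -
 have "f measurable_on {0..L} \<longleftrightarrow> cut L f \<in> borel_measurable lebesgue"
  unfolding cut_def by (simp add: measurable_on_iff_borel_measurable borel_measurable_if del: atLeastAtMost_iff)
 moreover have "(%x. (f x)^2) integrable_on {0..L} \<longleftrightarrow> integrable lebesgue (%x. (cut L f x)^2)"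
 proof -
  have "cut L (%x. (f x)^2) = (%x. (cut L f x)^2)" by (auto simp: cut_def)
  then show ?thesis using integrable_cut_iff[of "%x. (f x)^2" L] by simp
 qed
 ultimately show ?thesis by (simp add: L2_def sqi_def)
qed

lemma cut_add: "cut L (%x. f x + g x) = (%x. cut L f x + cut L g x)"
 and cut_diff: "cut L (%x. f x - g x) = (%x. cut L f x - cut L g x)"
 and cut_mult: "cut L (%x. f x * g x) = (%x. cut L f x * cut L g x)"
 and cut_scale: "cut L (%x. c * f x) = (%x. c * cut L f x)"
 by (auto simp: cut_def)

lemma L2_add: "L2 L f ==> L2 L g ==> L2 L (%x. f x + g x)"
 and L2_diff: "L2 L f ==> L2 L g ==> L2 L (%x. f x - g x)"
 and L2_scale: "L2 L f ==> L2 L (%x. c * f x)"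
 by (simp_all add: L2_iff cut_add cut_diff cut_scale sqi_add sqi_diff sqi_scale)

lemma toL_add: "L2 L f ==> L2 L g ==> toL L (%x. f x + g x) = toL L f + toL L g"
 and toL_diff: "L2 L f ==> L2 L g ==> toL L (%x. f x - g x) = toL L f - toL L g"
 and toL_scale: "L2 L f ==> toL L (%x. c * f x) = c *\<^sub>R toL L f"
 by (simp_all add: L2_iff toL_def cut_add cut_diff cut_scale abs_l2_add abs_l2_diff abs_l2_scale)

lemma L2_mult_abs_integrable:
 assumes "L2 L f" "L2 L g"
 shows "(%x. f x * g x) absolutely_integrable_on {0..L}"
 using assms by (intro integral_cut) (simp add: cut_mult L2_iff sqi_mult_integrable)

lemma ip_eq_inner: "L2 L f ==> L2 L g ==> ip L f g = inner (toL L f) (toL L g)"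
 unfolding ip_def toL_def
 by (subst integral_cut) (simp_all add: cut_mult L2_iff sqi_mult_integrable abs_l2_inner)

lemma inner_toL: "L2 L f ==> L2 L g ==> inner (toL L f) (toL L g) = integral {0..L} (%x. f x * g x)"
 by (simp add: ip_eq_inner[symmetric] ip_def)

lemma l2norm_eq_norm: "L2 L f ==> l2norm L f = norm (toL L f)"
 using ip_eq_inner[of L f f] by (simp add: l2norm_def ip_def norm_eq_sqrt_inner power2_eq_square)

lemma toL_eq_iff:
 assumes "L2 L f" "L2 L g"
 shows "toL L f = toL L g \<longleftrightarrow> negligible {x \<in> {0..L}. f x ~= g x}"
proof -
 have "toL L f = toL L g \<longleftrightarrow> (AE x in lebesgue. cut L f x = cut L g x)"
  using assms by (simp add: toL_def L2_iff abs_l2_eq_iff)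
 also have "... \<longleftrightarrow> {x. cut L f x ~= cut L g x} \<in> null_sets lebesgue"
  by (simp add: completion.AE_iff_null_sets)
 also have "{x. cut L f x ~= cut L g x} = {x \<in> {0..L}. f x ~= g x}"
  by (auto simp: cut_def)
 finally show ?thesis by (simp add: negligible_iff_null_sets)
qed

lemma continuous_L2: "continuous_on {0..L} f ==> L2 L f"
 unfolding L2_def
 by (auto intro!: integrable_continuous_interval continuous_intros continuous_imp_measurable_on_sets_lebesgue
   simp: measurable_on_iff_borel_measurable)

lemma L2_const: "L2 L (%x. c)" by (simp add: continuous_L2)

lemma L2_abs_integrable: "L2 L f ==> f absolutely_integrable_on {0..L}"
 using L2_mult_abs_integrable[OF _ L2_const[of L 1]] by simp

lemma integral_eq_inner_1: "L2 L f ==> integral {0..L} f = inner (toL L f) (toL L (%x. 1))"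
 using ip_eq_inner[OF _ L2_const[of L 1], of f] by (simp add: ip_def)

lemma norm_toL_mono:
 assumes "L2 L f" "L2 L g" "negligible {x \<in> {0..L}. ~ \<bar>f x\<bar> <= \<bar>g x\<bar>}"
 shows "norm (toL L f) <= norm (toL L g)"
proof -
 have "integral\<^sup>L lebesgue (%x. (cut L f x)^2) <= integral\<^sup>L lebesgue (%x. (cut L g x)^2)"
 proof (rule integral_mono_AE)
  have "{x \<in> {0..L}. ~ \<bar>f x\<bar> <= \<bar>g x\<bar>} \<in> null_sets lebesgue"
   using assms(3) by (simp add: negligible_iff_null_sets)
  then show "AE x in lebesgue. (cut L f x)^2 <= (cut L g x)^2"
   by (rule AE_I') (auto simp: cut_def abs_le_square_iff[symmetric])
 qed (use assms in \<open>auto simp: L2_iff sqi_def\<close>)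
 then have "(norm (toL L f))^2 <= (norm (toL L g))^2"
  using assms by (simp add: toL_def norm_abs_l2 L2_iff)
 then show ?thesis by (rule power2_le_imp_le) simp
qed

lemma norm_toL_const: "0 <= L ==> norm (toL L (%x. B)) = sqrt L * \<bar>B\<bar>"
 by (simp add: l2norm_eq_norm[symmetric] L2_const l2norm_def real_sqrt_mult)

lemma norm_toL_le_sup:
 assumes "0 <= L" "L2 L f" "0 <= B" "negligible {x \<in> {0..L}. ~ \<bar>f x\<bar> <= B}"
 shows "norm (toL L f) <= sqrt L * B"
 using norm_toL_mono[OF assms(2) L2_const[of L B]] assms by (simp add: norm_toL_const)

text \<open>Over a short interval the increment of the product equals the integral of \<open>f G + F g\<close> up to the
 oscillation of \<open>F\<close> and \<open>G\<close>, so the difference of the two sides has zero variation.\<close>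

lemma product_rule_integral:
 fixes f g F G :: "real => real"
 assumes ab: "a <= b" and f: "f absolutely_integrable_on {a..b}" and g: "g absolutely_integrable_on {a..b}"
  and F: "!!x. x \<in> {a..b} ==> F x = F a + integral {a..x} f"
  and G: "!!x. x \<in> {a..b} ==> G x = G a + integral {a..x} g"
 shows "((%x. f x * G x + F x * g x) has_integral (F b * G b - F a * G a)) {a..b}"
  and "(%x. f x * G x) absolutely_integrable_on {a..b}"
  and "(%x. F x * g x) absolutely_integrable_on {a..b}"
proof -
 have fi: "f integrable_on {a..b}" and gi: "g integrable_on {a..b}"
  using f g by (auto intro: set_lebesgue_integral_eq_integral)
 have cF: "continuous_on {a..b} F"
 proof (rule continuous_on_eq)
  show "continuous_on {a..b} (%x. F a + integral {a..x} f)"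
   using indefinite_integral_continuous_1[OF fi] by (rule continuous_on_add[OF continuous_on_const])
 qed (rule F[symmetric])
 have cG: "continuous_on {a..b} G"
 proof (rule continuous_on_eq)
  show "continuous_on {a..b} (%x. G a + integral {a..x} g)"
   using indefinite_integral_continuous_1[OF gi] by (rule continuous_on_add[OF continuous_on_const])
 qed (rule G[symmetric])
 have bm: "H \<in> borel_measurable (lebesgue_on {a..b})" "bounded (H ` {a..b})" if "continuous_on {a..b} H" for H :: "real => real"
  using that by (auto intro!: continuous_imp_measurable_on_sets_lebesgue compact_imp_bounded compact_continuous_image)
 show fG: "(%x. f x * G x) absolutely_integrable_on {a..b}"
  using absolutely_integrable_bounded_measurable_product_real[OF bm(1)[OF cG] _ bm(2)[OF cG] f] by (simp add: mult.commute)
 show Fg: "(%x. F x * g x) absolutely_integrable_on {a..b}"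
  using absolutely_integrable_bounded_measurable_product_real[OF bm(1)[OF cF] _ bm(2)[OF cF] g] by simp
 define h where "h = (%x. f x * G x + F x * g x)"
 have hi: "h integrable_on {a..b}"
  unfolding h_def using fG Fg by (auto intro!: integrable_add set_lebesgue_integral_eq_integral)
 define k where "k = (%x. \<bar>f x\<bar> + \<bar>g x\<bar>)"
 have ki: "k integrable_on {a..b}"
  unfolding k_def using f g by (auto intro!: integrable_add simp: absolutely_integrable_on_def)
 define P where "P x = F x * G x - integral {a..x} h" for x
 define K where "K x = integral {a..x} k" for x
 have sub: "u integrable_on {x..y}" if "u integrable_on {a..b}" "a <= x" "y <= b" for u :: "real => real" and x y
  using that by (meson integrable_on_subinterval atLeastatMost_subset_iff)
 have split: "integral {a..y} u = integral {a..x} u + integral {x..y} u"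
  if "u integrable_on {a..b}" "a <= x" "x <= y" "y <= b" for u :: "real => real" and x y
  using Henstock_Kurzweil_Integration.integral_combine[of a x y u] sub[of u a y] that by simp
 have step: "\<bar>P y - P x\<bar> <= e * (K y - K x)"
  if xy: "a <= x" "x <= y" "y <= b"
   and osc: "!!z. x <= z ==> z <= y ==> \<bar>F z - F x\<bar> <= e & \<bar>G z - G y\<bar> <= e" for x y e
 proof -
  have i: "f integrable_on {x..y}" "g integrable_on {x..y}" "h integrable_on {x..y}" "k integrable_on {x..y}"
   using sub fi gi hi ki xy by auto
  have m: "x \<in> {a..b}" "y \<in> {a..b}" using xy by auto
  have dF: "F y - F x = integral {x..y} f" and dG: "G y - G x = integral {x..y} g"
   using F[OF m(1)] F[OF m(2)] G[OF m(1)] G[OF m(2)] split[OF fi xy] split[OF gi xy] by linarith+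
  \<comment> \<open>With \<open>G\<close> frozen at the right end and \<open>F\<close> at the left
    end the identity is exact, so the only error against the integral of \<open>h\<close> is the
    oscillation of \<open>F\<close> and \<open>G\<close> over \<open>{x..y}\<close>.\<close>
  have "F y * G y - F x * G x = G y * integral {x..y} f + F x * integral {x..y} g"
   unfolding dF[symmetric] dG[symmetric] by (simp add: algebra_simps)
  also have "... = integral {x..y} (%z. G y * f z + F x * g z)"
   using i by (simp add: Henstock_Kurzweil_Integration.integral_add integrable_on_mult_right)
  finally have "P y - P x = integral {x..y} (%z. G y * f z + F x * g z) - integral {x..y} h"
   using split[OF hi xy] by (simp add: P_def)
  also have "... = integral {x..y} (%z. (G y * f z + F x * g z) - h z)"
   using i by (intro Henstock_Kurzweil_Integration.integral_diff[symmetric] integrable_add integrable_on_mult_right) auto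
  finally have eq: "P y - P x = integral {x..y} (%z. (G y * f z + F x * g z) - h z)" .
  have "norm (integral {x..y} (%z. (G y * f z + F x * g z) - h z)) <= integral {x..y} (%z. e * k z)"
  proof (rule integral_norm_bound_integral)
   show "(%z. (G y * f z + F x * g z) - h z) integrable_on {x..y}"
    using i by (intro integrable_diff integrable_add integrable_on_mult_right) auto
   show "(%z. e * k z) integrable_on {x..y}" using i by (intro integrable_on_mult_right)
   fix z assume "z \<in> {x..y}"
   then have o: "\<bar>F z - F x\<bar> <= e" "\<bar>G z - G y\<bar> <= e" using osc by auto
   have "(G y * f z + F x * g z) - h z = - ((G z - G y) * f z) - (F z - F x) * g z"
    by (simp add: h_def algebra_simps)
   also have "\<bar>...\<bar> <= \<bar>G z - G y\<bar> * \<bar>f z\<bar> + \<bar>F z - F x\<bar> * \<bar>g z\<bar>"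
    unfolding abs_mult[symmetric] by linarith
   also have "... <= e * \<bar>f z\<bar> + e * \<bar>g z\<bar>"
    using o by (intro add_mono mult_right_mono) auto
   finally show "norm ((G y * f z + F x * g z) - h z) <= e * k z"
    by (simp add: k_def algebra_simps)
  qed
  also have "... = e * (K y - K x)"
   using split[OF ki xy] by (simp add: K_def)
  finally show ?thesis using eq by simp
 qed
 have small: "\<bar>P b - P a\<bar> <= e * (K b - K a)" if e: "e > 0" for e
 proof -
  have "uniformly_continuous_on {a..b} F" "uniformly_continuous_on {a..b} G"
   using cF cG by (auto intro: compact_uniformly_continuous)
  then obtain d1 d2 where d: "d1 > 0" "d2 > 0"
   and d1: "!!x y. x \<in> {a..b} ==> y \<in> {a..b} ==> dist y x < d1 ==> dist (F y) (F x) < e"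
   and d2: "!!x y. x \<in> {a..b} ==> y \<in> {a..b} ==> dist y x < d2 ==> dist (G y) (G x) < e"
   using e unfolding uniformly_continuous_on_def by metis
  obtain m :: nat where "(b - a) / min d1 d2 < real m"
   using reals_Archimedean2 by blast
  then obtain n :: nat where n: "(b - a) / min d1 d2 < real n" "n > 0"
   using that[of "Suc m"] by simp
  define t where "t i = a + real i * ((b - a) / real n)" for i :: nat
  have tn: "t n = b" "t 0 = a" using n by (auto simp: t_def)
  have md: "0 < min d1 d2" using d by simp
  have small: "(b - a) / real n < min d1 d2"
   using n(1)[unfolded pos_divide_less_eq[OF md]] n(2) by (simp only: pos_divide_less_eq of_nat_0_less_iff mult.commute)
  have tb: "a <= t i" "t i <= b" if "i <= n" for i
  proof -
   show "a <= t i" using ab by (simp add: t_def)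
   have "real i * ((b - a) / real n) <= real n * ((b - a) / real n)"
    using that ab by (intro mult_right_mono) auto
   then show "t i <= b" using n by (simp add: t_def)
  qed
  have ts: "t (Suc i) = t i + (b - a) / real n" for i by (simp add: t_def distrib_right add_divide_distrib)
  have "\<bar>P (t i) - P a\<bar> <= e * (K (t i) - K a)" if "i <= n" for i
   using that
  proof (induction i)
   case 0 then show ?case by (simp add: tn)
  next
   case (Suc i)
   have "\<bar>P (t (Suc i)) - P (t i)\<bar> <= e * (K (t (Suc i)) - K (t i))"
   proof (rule step)
    show "a <= t i" "t (Suc i) <= b" using tb Suc.prems by auto
    show "t i <= t (Suc i)" using ab by (simp add: ts)
    fix z assume z: "t i <= z" "z <= t (Suc i)"
    have "z \<in> {a..b}" "t i \<in> {a..b}" "t (Suc i) \<in> {a..b}" "dist z (t i) < d1" "dist z (t (Suc i)) < d2"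
     using z tb[of i] tb[of "Suc i"] Suc.prems small ts[of i] by (auto simp: dist_real_def)
    then show "\<bar>F z - F (t i)\<bar> <= e & \<bar>G z - G (t (Suc i))\<bar> <= e"
     using d1[of "t i" z] d2[of "t (Suc i)" z] by (simp add: dist_real_def)
   qed
   then show ?case using Suc by (simp add: algebra_simps)
  qed
  from this[of n] show ?thesis by (simp add: tn)
 qed
 have "\<bar>P b - P a\<bar> <= 0 + d" if "d > 0" for d :: real
 proof -
  have "K b - K a \<ge> 0" using ki by (simp add: K_def k_def Henstock_Kurzweil_Integration.integral_nonneg)
  \<comment> \<open>The summand 1 keeps the denominator positive when
    \<open>K b = K a\<close>.\<close>
  then have "d / (K b - K a + 1) * (K b - K a) <= d" using that by (simp add: field_simps)
  then show ?thesis using small[of "d / (K b - K a + 1)"] that \<open>K b - K a \<ge> 0\<close> by fastforce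
 qed
 then have "\<bar>P b - P a\<bar> <= 0" by (rule field_le_epsilon)
 then have "integral {a..b} h = F b * G b - F a * G a" by (simp add: P_def)
 then show "((%x. f x * G x + F x * g x) has_integral (F b * G b - F a * G a)) {a..b}"
  using hi by (simp add: has_integral_integrable_integral h_def)
qed

text \<open>By Henstock's lemma the Riemann sums of \<open>\<bar>g\<bar>\<close> are small as soon as all integrals over subintervals vanish.\<close>

lemma zero_indefinite_integral_negligible:
 fixes g :: "real => real"
 assumes g: "g integrable_on {0..b}" and z: "!!x. x \<in> {0..b} ==> integral {0..x} g = 0"
 shows "negligible {x \<in> {0..b}. g x ~= 0}"
proof -
 define a where "a = (0::real)"
 note g = g[folded a_def] and z = z[folded a_def]
 have zi: "integral {c..d} g = 0" if "{c..d} \<subseteq> {a..b}" for c d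
 proof (cases "c <= d")
  case True
  then have "a <= c" "d <= b" using that by auto
  have "integral {a..c} g + integral {c..d} g = integral {a..d} g"
   using True \<open>a <= c\<close> \<open>d <= b\<close> g
   by (intro Henstock_Kurzweil_Integration.integral_combine) (auto intro: integrable_on_subinterval)
  then show ?thesis using z[of c] z[of d] True \<open>a <= c\<close> \<open>d <= b\<close> by auto
 qed simp
 have "((%x. \<bar>g x\<bar>) has_integral 0) {a..b}"
  unfolding has_integral_real
 proof (intro allI impI)
  fix e :: real assume "e > 0"
  then obtain gmz where gmz: "gauge gmz" "!!p. \<lbrakk>p tagged_partial_division_of (cbox a b); gmz fine p\<rbrakk> \<Longrightarrow>
    (\<Sum>(x,k) \<in> p. norm (measure lborel k *\<^sub>R g x - integral k g)) < e"
   using Henstock_lemma[of g a b e] g by (auto simp: box_real)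
  have "norm ((\<Sum>(x, k)\<in>D. measure lborel k *\<^sub>R \<bar>g x\<bar>) - 0) < e"
   if D: "D tagged_division_of {a..b}" "gmz fine D" for D
  proof -
   have "(\<Sum>(x,k) \<in> D. norm (measure lborel k *\<^sub>R g x - integral k g)) = (\<Sum>(x, k)\<in>D. measure lborel k *\<^sub>R \<bar>g x\<bar>)"
   proof (rule sum.cong[OF refl], clarify)
    fix x k assume "(x, k) \<in> D"
    then obtain c d where "k = {c..d}" "k \<subseteq> {a..b}" using D(1)
     by (metis tagged_division_ofD(3) tagged_division_ofD(4) box_real(2))
    then show "norm (measure lborel k *\<^sub>R g x - integral k g) = measure lborel k *\<^sub>R \<bar>g x\<bar>"
     using zi by (simp add: abs_mult)
   qed
   moreover have "0 <= (\<Sum>(x, k)\<in>D. measure lborel k *\<^sub>R \<bar>g x\<bar>)"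
    by (intro sum_nonneg) auto
   moreover have "D tagged_partial_division_of (cbox a b)"
    using D(1) by (simp add: box_real tagged_division_of_def)
   ultimately show ?thesis using gmz(2)[of D] D(2) by simp
  qed
  then show "\<exists>gmz. gauge gmz & (\<forall>\<D>. \<D> tagged_division_of {a..b} & gmz fine \<D> -->
    norm ((\<Sum>(x, k)\<in>\<D>. measure lborel k *\<^sub>R \<bar>g x\<bar>) - 0) < e)"
   using gmz(1) by blast
 qed
 then have i: "(%x. \<bar>g x\<bar>) integrable_on {0..b}" and i0: "integral {0..b} (%x. \<bar>g x\<bar>) = 0"
  by (auto simp: a_def has_integral_integrable_integral)
 have c: "integrable lebesgue (cut b (%x. \<bar>g x\<bar>))" using i by (subst integrable_cut_iff[symmetric]) auto
 then have "integral\<^sup>L lebesgue (cut b (%x. \<bar>g x\<bar>)) = 0" using i0 integral_cut(2) by metis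
 then have "AE x in lebesgue. cut b (%x. \<bar>g x\<bar>) x = 0"
  using c by (subst (asm) integral_nonneg_eq_0_iff_AE) (auto simp: cut_def)
 then have "{x. cut b (%x. \<bar>g x\<bar>) x ~= 0} \<in> null_sets lebesgue"
  by (simp add: completion.AE_iff_null_sets)
 also have "{x. cut b (%x. \<bar>g x\<bar>) x ~= 0} = {x \<in> {0..b}. g x ~= 0}" by (auto simp: cut_def)
 finally show ?thesis by (simp add: negligible_iff_null_sets)
qed

section \<open>Primitives, weak derivatives and the graph of the derivative on
  \<open>H10\<close>\<close>

definition prim :: "(real => real) => real => real" where
 "prim g x = integral {0..x} g"

lemma toL_cong: "(!!x. x \<in> {0..L} ==> f x = g x) ==> toL L f = toL L g"
 unfolding toL_def by (rule arg_cong[where f = abs_l2]) (auto simp: cut_def)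

lemma L2_integrable: "L2 L g ==> g integrable_on {0..L}"
 using L2_abs_integrable by (blast intro: set_lebesgue_integral_eq_integral(1))

lemma L2_integrable_sub: "L2 L g ==> 0 <= x ==> y <= L ==> g integrable_on {x..y}"
 using L2_integrable by (rule integrable_on_subinterval) auto

lemma prim_0 [simp]: "prim g 0 = 0"
 by (simp add: prim_def)

lemma prim_continuous: "L2 L g ==> continuous_on {0..L} (prim g)"
 unfolding prim_def using L2_integrable by (rule indefinite_integral_continuous_1)

lemma prim_L2: "L2 L g ==> L2 L (prim g)"
 by (rule continuous_L2[OF prim_continuous])

lemma prim_diff_integral:
 assumes "L2 L g" "0 <= x" "x <= y" "y <= L"
 shows "prim g y - prim g x = integral {x..y} g"
 using Henstock_Kurzweil_Integration.integral_combine[of 0 x y g] L2_integrable_sub[OF assms(1), of 0 y] assms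
 by (simp add: prim_def)

lemma prim_add: "L2 L f ==> L2 L g ==> x \<in> {0..L} ==> prim (%x. f x + g x) x = prim f x + prim g x"
 unfolding prim_def by (intro Henstock_Kurzweil_Integration.integral_add) (auto intro: L2_integrable_sub)

lemma prim_diff: "L2 L f ==> L2 L g ==> x \<in> {0..L} ==> prim (%x. f x - g x) x = prim f x - prim g x"
 unfolding prim_def by (intro Henstock_Kurzweil_Integration.integral_diff) (auto intro: L2_integrable_sub)

lemma prim_scale: "prim (%x. c * f x) x = c * prim f x"
 by (simp add: prim_def)

lemma L2_indicat: "L2 L (indicat_real {x..y})"
proof -
 have "L2 L (%z. if z \<in> {x..y} then 1 else 0 :: real)"
  unfolding L2_def
 proof
  show "(%z. if z \<in> {x..y} then 1 else 0 :: real) measurable_on {0..L}"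
  proof -
   have "indicat_real {x..y} \<in> borel_measurable (lebesgue_on {0..L})"
    by (intro measurable_restrict_space1 borel_measurable_indicator) simp
   moreover have "(%z. if z \<in> {x..y} then 1 else 0 :: real) = indicat_real {x..y}"
    by (auto simp: indicator_def)
   ultimately show ?thesis by (subst measurable_on_iff_borel_measurable) auto
  qed
  have "(%z. 1::real) integrable_on ({x..y} \<inter> {0..L})"
   by (simp add: integrable_continuous_interval)
  then have "(%z. if z \<in> {x..y} then 1 else 0 :: real) integrable_on {0..L}"
   by (simp only: integrable_restrict_Int)
  then show "(%z. (if z \<in> {x..y} then 1 else 0 :: real)^2) integrable_on {0..L}"
   by (simp add: if_distrib[of "%x. x^2"] cong: if_cong)
 qed
 moreover have "(%z. if z \<in> {x..y} then 1 else 0 :: real) = indicat_real {x..y}"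
  by (auto simp: indicator_def)
 ultimately show ?thesis by simp
qed

text \<open>Values and increments of a primitive become inner products with indicator functions.
  Cauchy-Schwarz then gives the Hoelder bound of primitives, and the finitely many functionals of
  the compactness argument are of this form.\<close>

lemma integral_sub_inner:
 assumes "L2 L g" "0 <= x" "y <= L"
 shows "integral {x..y} g = inner (toL L g) (toL L (indicat_real {x..y}))"
proof -
 have "integral {0..L} (%z. g z * indicat_real {x..y} z) = integral {0..L} (%z. if z \<in> {x..y} then g z else 0)"
  by (rule arg_cong[where f = "integral {0..L}"]) (auto simp: indicator_def)
 also have "... = integral {x..y} g"
  using assms L2_integrable_sub[OF assms(1), of x y]
  by (intro integral_unique) (subst has_integral_restrict, auto intro: integrable_integral)
 finally show ?thesis using assms by (simp add: inner_toL L2_indicat)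
qed

lemma norm_indicat:
 assumes "0 <= x" "x <= y" "y <= L"
 shows "norm (toL L (indicat_real {x..y})) = sqrt (y - x)"
proof -
 have "inner (toL L (indicat_real {x..y})) (toL L (indicat_real {x..y})) = integral {x..y} (indicat_real {x..y})"
  using assms by (simp add: integral_sub_inner L2_indicat)
 also have "... = integral {x..y} (%z. 1)"
  by (rule Henstock_Kurzweil_Integration.integral_cong) auto
 finally show ?thesis using assms by (simp add: norm_eq_sqrt_inner)
qed

lemma prim_holder:
 assumes "L2 L g" "0 <= x" "x <= y" "y <= L"
 shows "\<bar>prim g y - prim g x\<bar> <= sqrt (y - x) * norm (toL L g)"
 using Cauchy_Schwarz_ineq2[of "toL L g" "toL L (indicat_real {x..y})"] assms
 by (simp add: prim_diff_integral integral_sub_inner norm_indicat mult.commute)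

lemma prim_sup:
 assumes "L2 L g" "x \<in> {0..L}"
 shows "\<bar>prim g x\<bar> <= sqrt L * norm (toL L g)"
proof -
 have "\<bar>prim g x - prim g 0\<bar> <= sqrt (x - 0) * norm (toL L g)"
  using assms by (intro prim_holder) auto
 also have "... <= sqrt L * norm (toL L g)"
  using assms by (intro mult_right_mono) auto
 finally show ?thesis by simp
qed

lemma norm_prim_le:
 assumes "0 < L" "L2 L g"
 shows "norm (toL L (prim g)) <= L * norm (toL L g)"
proof -
 have "norm (toL L (prim g)) <= sqrt L * (sqrt L * norm (toL L g))"
 proof (rule norm_toL_le_sup)
  show "negligible {x \<in> {0..L}. ~ \<bar>prim g x\<bar> <= sqrt L * norm (toL L g)}"
   using prim_sup[OF assms(2)] by (intro empty_imp_negligible) auto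
 qed (use assms prim_L2 in auto)
 then show ?thesis using assms by (simp add: mult.assoc[symmetric])
qed

lemma continuous_ae_zero:
 fixes f :: "real => real"
 assumes "0 < L" "continuous_on {0..L} f" "toL L f = 0" "x \<in> {0..L}"
 shows "f x = 0"
proof -
 have l: "L2 L f" using assms by (simp add: continuous_L2)
 have "integral {0..L} (%x. f x * f x) = 0" using inner_toL[OF l l] assms by simp
 moreover have "(%x. f x * f x) integrable_on {0..L}"
  using assms by (intro integrable_continuous_interval continuous_intros)
 ultimately have "((%x. f x * f x) has_integral 0) (cbox 0 L)"
  by (simp add: has_integral_integrable_integral)
 then have "f x * f x = 0"
  by (rule has_integral_0_cbox_imp_0[rotated 2]) (use assms in \<open>auto intro!: continuous_intros\<close>)
 then show ?thesis by simp
qed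

lemma toL_zero: "toL L (%x. 0) = 0"
 using toL_scale[OF L2_const[of L 0], of 0] by simp

text \<open>Continuity upgrades the almost everywhere equality to all points; the value at 0 forces
  \<open>k = 0\<close>, and a vanishing primitive has a vanishing integrand.\<close>

lemma prim_ae_const_imp_zero:
 assumes "0 < L" "L2 L u" "negligible {x \<in> {0..L}. prim u x ~= k}"
 shows "toL L u = 0"
proof -
 have "toL L (prim u) = toL L (%x. k)"
  using assms by (simp add: toL_eq_iff prim_L2 L2_const)
 then have "toL L (%x. prim u x - k) = 0"
  using assms by (simp add: toL_diff prim_L2 L2_const)
 then have z: "prim u x - k = 0" if "x \<in> {0..L}" for x
  using that assms by (intro continuous_ae_zero[of L "%x. prim u x - k"]) (auto intro!: continuous_intros prim_continuous)
 from z[of 0] have "k = 0" using assms by simp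
 with z have "integral {0..x} u = 0" if "x \<in> {0..L}" for x using that by (simp add: prim_def)
 then have "negligible {x \<in> {0..L}. u x ~= 0}"
  using assms by (intro zero_indefinite_integral_negligible L2_integrable) auto
 then have "toL L u = toL L (%x. 0)" using assms by (simp add: toL_eq_iff L2_const)
 then show ?thesis by (simp add: toL_zero)
qed

text \<open>Makes the choice in \<open>dx\<close> harmless: whichever weak derivative is selected,
  its class in \<open>l2\<close> is the same.\<close>

lemma weak_deriv_unique:
 assumes "0 < L" "weak_deriv L f g" "weak_deriv L f h"
 shows "toL L g = toL L h"
proof -
 obtain c c' where c: "negligible {x \<in> {0..L}. f x ~= c + integral {0..x} g}" "negligible {x \<in> {0..L}. f x ~= c' + integral {0..x} h}"
  and l: "L2 L g" "L2 L h"
  using assms unfolding weak_deriv_def by blast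
 have "toL L (%x. g x - h x) = 0"
 proof (rule prim_ae_const_imp_zero)
  have "{x \<in> {0..L}. prim (%x. g x - h x) x ~= c' - c} \<subseteq>
    {x \<in> {0..L}. f x ~= c + integral {0..x} g} \<union> {x \<in> {0..L}. f x ~= c' + integral {0..x} h}"
  proof
   fix x assume "x \<in> {x \<in> {0..L}. prim (%x. g x - h x) x ~= c' - c}"
   then have x: "x \<in> {0..L}" "prim (%x. g x - h x) x ~= c' - c" by auto
   have "prim g x - prim h x ~= c' - c" using x(2) unfolding prim_diff[OF l x(1)] .
   then have "c + prim g x ~= c' + prim h x" by auto
   then show "x \<in> {x \<in> {0..L}. f x ~= c + integral {0..x} g} \<union> {x \<in> {0..L}. f x ~= c' + integral {0..x} h}"
    using x(1) unfolding prim_def by (cases "f x = c + integral {0..x} g") auto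
  qed
  then show "negligible {x \<in> {0..L}. prim (%x. g x - h x) x ~= c' - c}"
   by (rule negligible_subset[OF negligible_Un[OF c]])
 qed (use assms l in \<open>auto simp: L2_diff\<close>)
 then show ?thesis using l by (simp add: toL_diff)
qed

lemma weak_deriv_dx:
 assumes "0 < L" "weak_deriv L f g"
 shows "weak_deriv L f (dx L f)" "L2 L (dx L f)" "toL L (dx L f) = toL L g"
proof -
 show 1: "weak_deriv L f (dx L f)" unfolding dx_def using assms(2) by (rule someI[of "weak_deriv L f"])
 then show "L2 L (dx L f)" by (simp add: weak_deriv_def)
 show "toL L (dx L f) = toL L g" by (rule weak_deriv_unique[OF assms(1) 1 assms(2)])
qed

text \<open>The Dirichlet Sobolev space as the graph of its derivative: first the function, then its
  derivative, both in \<open>l2\<close>. The boundary value at 0 is built into \<open>prim\<close>,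
  the one at \<open>L\<close> is the vanishing mean of \<open>g\<close>. With the graph at hand no
  derivative operator on \<open>l2\<close> is required.\<close>

definition K1 :: "real => (l2 \<times> l2) set" where
 "K1 L = {(toL L (prim g), toL L g) | g. L2 L g & integral {0..L} g = 0}"

lemma K1E:
 assumes "(e, d) \<in> K1 L"
 obtains g where "L2 L g" "prim g L = 0" "e = toL L (prim g)" "d = toL L g"
 using assms by (auto simp: K1_def prim_def)

lemma K1I: "L2 L g ==> prim g L = 0 ==> (toL L (prim g), toL L g) \<in> K1 L"
 by (auto simp: K1_def prim_def)

lemma K1_add: "0 < L ==> (e, d) \<in> K1 L ==> (e', d') \<in> K1 L ==> (e + e', d + d') \<in> K1 L"
proof (elim K1E)
 fix g g' assume L: "0 < L" and g: "L2 L g" "prim g L = 0" "e = toL L (prim g)" "d = toL L g"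
  "L2 L g'" "prim g' L = 0" "e' = toL L (prim g')" "d' = toL L g'"
 have "(toL L (prim (%x. g x + g' x)), toL L (%x. g x + g' x)) \<in> K1 L"
  using L g by (intro K1I) (auto simp: L2_add prim_add)
 moreover have "toL L (prim (%x. g x + g' x)) = toL L (%x. prim g x + prim g' x)"
  using g by (intro toL_cong) (rule prim_add)
 ultimately show "(e + e', d + d') \<in> K1 L" using g by (simp add: toL_add prim_L2)
qed

lemma K1_scale: "(e, d) \<in> K1 L ==> (c *\<^sub>R e, c *\<^sub>R d) \<in> K1 L"
proof (elim K1E)
 fix g assume g: "L2 L g" "prim g L = 0" "e = toL L (prim g)" "d = toL L g"
 have "(toL L (prim (%x. c * g x)), toL L (%x. c * g x)) \<in> K1 L"
  using g by (intro K1I) (auto simp: L2_scale prim_scale)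
 then show "(c *\<^sub>R e, c *\<^sub>R d) \<in> K1 L" using g by (simp add: prim_scale[abs_def] toL_scale prim_L2)
qed

lemma K1_zero: "0 < L ==> (0, 0) \<in> K1 L"
 using K1I[OF L2_const[of L 0]] by (simp add: toL_zero prim_def[abs_def])

lemma K1_poincare: "0 < L ==> (e, d) \<in> K1 L ==> norm e <= L * norm d"
 by (elim K1E) (simp add: norm_prim_le)

lemma H10_K1:
 assumes "0 < L" "H10 L f"
 shows "L2 L f" "L2 L (dx L f)" "weak_deriv L f (dx L f)" "(toL L f, toL L (dx L f)) \<in> K1 L"
proof -
 obtain g where f: "L2 L f" and g: "L2 L g" "integral {0..L} g = 0" "negligible {x \<in> {0..L}. f x ~= integral {0..x} g}"
  using assms unfolding H10_def by blast
 show "L2 L f" by (rule f)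
 have "weak_deriv L f g" unfolding weak_deriv_def using g by (auto intro!: exI[of _ 0])
 note d = weak_deriv_dx[OF assms(1) this]
 show "L2 L (dx L f)" "weak_deriv L f (dx L f)" by (rule d)+
 have "toL L f = toL L (prim g)"
  using g f toL_eq_iff[OF f prim_L2[OF g(1)]] by (simp add: prim_def)
 then show "(toL L f, toL L (dx L f)) \<in> K1 L"
  using K1I[OF g(1)] g d(3) by (simp add: prim_def)
qed

lemma K1_H10:
 assumes "0 < L" "L2 L f" "(toL L f, d) \<in> K1 L"
 shows "H10 L f" "toL L (dx L f) = d"
proof -
 obtain g where g: "L2 L g" "prim g L = 0" "toL L f = toL L (prim g)" "d = toL L g"
  using assms(3) by (auto elim: K1E)
 have n: "negligible {x \<in> {0..L}. f x ~= integral {0..x} g}"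
  using g toL_eq_iff[OF assms(2) prim_L2[OF g(1)]] by (simp add: prim_def)
 then show h: "H10 L f" unfolding H10_def using assms g by (auto simp: prim_def)
 have "weak_deriv L f g" unfolding weak_deriv_def using g n by (auto intro!: exI[of _ 0])
 then show "toL L (dx L f) = d" using weak_deriv_dx(3)[OF assms(1)] g by simp
qed

lemma L2_rep: "L2 L (rep x)"
proof -
 have c: "cut L (rep x) = (%z. indicat_real {0..L} z * rep x z)" by (auto simp: cut_def indicator_def)
 have m: "rep x \<in> borel_measurable lebesgue" using rep(1) by (rule sqi_measurable)
 show ?thesis
  unfolding L2_iff
 proof (rule sqi_bound[OF _ rep(1)[of x]])
  show "cut L (rep x) \<in> borel_measurable lebesgue"
   unfolding c by (intro borel_measurable_times borel_measurable_indicator m) simp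
 qed (simp add: cut_def)
qed

lemma toL_rep_toL:
 assumes "L2 L f" shows "toL L (rep (toL L f)) = toL L f"
proof -
 define r where "r = rep (toL L f)"
 have "AE x in lebesgue. r x = cut L f x"
  unfolding r_def using assms by (simp add: toL_def rep_abs L2_iff)
 then have ae: "AE x in lebesgue. cut L r x = cut L f x"
  by eventually_elim (simp add: cut_def)
 have "toL L r = toL L f"
  unfolding toL_def using assms L2_rep[of L "toL L f"] ae by (subst abs_l2_eq_iff) (auto simp: L2_iff r_def)
 then show ?thesis by (simp add: r_def)
qed

text \<open>Restriction of a class to \<open>{0..L}\<close> is a contraction. Hence limits of
  classes that come from \<open>{0..L}\<close> come from \<open>{0..L}\<close> again, which turns
  abstract limits back into functions.\<close>

lemma toL_rep_contract: "norm (toL L (rep x) - toL L (rep y)) <= norm (x - y)"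
proof -
 have s: "sqi (%z. rep x z - rep y z)" using rep(1) by (simp add: sqi_diff)
 have l: "L2 L (%z. rep x z - rep y z)" by (simp add: L2_diff L2_rep)
 have xy: "x - y = abs_l2 (%z. rep x z - rep y z)"
  using abs_l2_diff[OF rep(1)[of x] rep(1)[of y]] by (simp add: rep(2))
 have "(norm (toL L (%z. rep x z - rep y z)))^2 <= (norm (x - y))^2"
  unfolding xy norm_abs_l2[OF s] toL_def norm_abs_l2[OF l[unfolded L2_iff]]
 proof (rule integral_mono)
  show "integrable lebesgue (%z. (cut L (%z. rep x z - rep y z) z)^2)"
   using l by (simp add: L2_iff sqi_def)
  show "integrable lebesgue (%z. (rep x z - rep y z)^2)"
   using s by (simp add: sqi_def)
 qed (simp add: cut_def)
 then have "norm (toL L (%z. rep x z - rep y z)) <= norm (x - y)"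
  by (rule power2_le_imp_le) simp
 then show ?thesis by (simp add: toL_diff L2_rep)
qed

lemma toL_limit:
 assumes "!!n. L2 L (f n)" "(%n. toL L (f n)) \<longlonglongrightarrow> d"
 shows "toL L (rep d) = d"
proof -
 have "(%n. toL L (f n)) \<longlonglongrightarrow> toL L (rep d)"
 proof (rule metric_tendsto_imp_tendsto[OF assms(2)], rule always_eventually, rule allI)
  fix n show "dist (toL L (f n)) (toL L (rep d)) <= dist (toL L (f n)) d"
   using toL_rep_contract[of L "toL L (f n)" d] assms(1) by (simp add: dist_norm toL_rep_toL)
 qed
 then show ?thesis using assms(2) LIMSEQ_unique by blast
qed

text \<open>The mean value is an inner product with the constant 1 and \<open>prim\<close> is
  bounded on \<open>L2\<close>, so both conditions in the graph survive limits.\<close>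

lemma K1_closed:
 assumes L: "0 < L" shows "closed (K1 L)"
 unfolding closed_sequential_limits
proof (intro allI impI, elim conjE)
 fix X :: "nat => l2 \<times> l2" and l assume X: "\<forall>n. X n \<in> K1 L" and lim: "X \<longlonglongrightarrow> l"
 obtain e d where l: "l = (e, d)" by (cases l)
 have "\<exists>g. L2 L g & prim g L = 0 & X n = (toL L (prim g), toL L g)" for n
  using X[rule_format, of n] by (auto simp: K1_def prim_def)
 then obtain g where g: "!!n. L2 L (g n)" "!!n. prim (g n) L = 0" "!!n. X n = (toL L (prim (g n)), toL L (g n))"
  by metis
 have le: "(%n. toL L (prim (g n))) \<longlonglongrightarrow> e" and ld: "(%n. toL L (g n)) \<longlonglongrightarrow> d"
  using tendsto_fst[OF lim] tendsto_snd[OF lim] by (simp_all add: g l)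
 define h where "h = rep d"
 have h: "L2 L h" "toL L h = d" using toL_limit[OF g(1) ld] by (simp_all add: h_def L2_rep)
 have "(%n. inner (toL L (g n)) (toL L (%x. 1))) \<longlonglongrightarrow> inner d (toL L (%x. 1))"
  by (intro tendsto_intros ld)
 moreover have "inner (toL L (g n)) (toL L (%x. 1)) = 0" for n
  using g(1,2)[of n] by (simp add: integral_eq_inner_1[symmetric] prim_def)
 ultimately have "inner d (toL L (%x. 1)) = 0" by (simp add: LIMSEQ_const_iff)
 then have h0: "prim h L = 0" using h by (simp add: prim_def integral_eq_inner_1)
 have "(%n. toL L (prim (g n))) \<longlonglongrightarrow> toL L (prim h)"
 proof (rule metric_tendsto_imp_tendsto[OF tendsto_mult_right_zero])
  show "(%n. norm (toL L (g n) - d)) \<longlonglongrightarrow> 0" using ld by (simp add: LIM_zero tendsto_norm_zero)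
  show "\<forall>\<^sub>F n in sequentially. dist (toL L (prim (g n))) (toL L (prim h)) <= dist (L * norm (toL L (g n) - d)) 0"
  proof (rule always_eventually, rule allI)
   fix n
   have "toL L (prim (g n)) - toL L (prim h) = toL L (prim (%x. g n x - h x))"
    unfolding toL_diff[OF prim_L2[OF g(1)] prim_L2[OF h(1)], symmetric]
    by (intro toL_cong prim_diff[symmetric]) (auto simp: g h)
   then show "dist (toL L (prim (g n))) (toL L (prim h)) <= dist (L * norm (toL L (g n) - d)) 0"
    using norm_prim_le[OF L, of "%x. g n x - h x"] L g h by (simp add: dist_norm L2_diff toL_diff)
  qed
 qed
 then have "e = toL L (prim h)" using le LIMSEQ_unique by blast
 then show "l \<in> K1 L" using K1I[OF h(1) h0] h l by simp
qed

section \<open>Inequalities on \<open>K1\<close>: interpolation, Wirtinger, essential bounds,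
  compactness\<close>

lemma cut_abs: "cut L (%x. \<bar>f x\<bar>) = (%x. \<bar>cut L f x\<bar>)"
 by (auto simp: cut_def)

lemma L2_abs: "L2 L f ==> L2 L (%x. \<bar>f x\<bar>)"
 unfolding L2_iff by (rule sqi_bound[of _ "cut L f"]) (auto simp: sqi_def cut_abs)

lemma norm_toL_abs: "L2 L f ==> norm (toL L (%x. \<bar>f x\<bar>)) = norm (toL L f)"
 by (intro antisym norm_toL_mono) (auto simp: L2_abs)

lemma prim_product:
 assumes "0 <= L" "L2 L f" "L2 L g"
 shows "((%x. f x * prim g x + prim f x * g x) has_integral (prim f L * prim g L)) {0..L}"
 using product_rule_integral(1)[of 0 L f g "prim f" "prim g"] assms
 by (simp add: L2_abs_integrable prim_def)

text \<open>The square of \<open>prim g\<close> is itself a primitive, namely of twice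
  \<open>prim g\<close> times \<open>g\<close>; Cauchy-Schwarz on that integral gives the product of
  the two norms. The square root of the small factor is what later transfers \<open>L^2\<close>
  smallness to the sup norm.\<close>

lemma K1_sup_pointwise:
 assumes "L2 L g" "x \<in> {0..L}"
 shows "(prim g x)^2 <= 2 * norm (toL L (prim g)) * norm (toL L g)"
proof -
 define u where "u z = g z * prim g z + prim g z * g z" for z
 have xL: "0 <= x" "x <= L" using assms by auto
 have ga: "g absolutely_integrable_on {0..y}" if "0 <= y" "y <= L" for y
  using L2_abs_integrable[OF assms(1)] by (rule set_integrable_subset) (use that in auto)
 have u1: "(u has_integral (prim g x * prim g x)) {0..x}"
  using product_rule_integral(1)[of 0 x g g "prim g" "prim g"] xL ga by (simp add: prim_def u_def[abs_def])
 have ua: "u absolutely_integrable_on {0..L}"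
  unfolding u_def[abs_def]
  by (intro set_integral_add product_rule_integral(2,3)[of 0 L g g "prim g" "prim g"])
   (use xL ga[of L] in \<open>auto simp: prim_def\<close>)
 have ai: "(%z. \<bar>u z\<bar>) integrable_on {0..L}" using ua by (simp add: absolutely_integrable_on_def)
 have m: "L2 L (%z. \<bar>prim g z\<bar>)" "L2 L (%z. \<bar>g z\<bar>)"
  using L2_abs prim_L2 assms(1) by blast+
 have "(prim g x)^2 = integral {0..x} u"
  using u1 by (simp add: integral_unique power2_eq_square)
 also have "... <= integral {0..x} (%z. \<bar>u z\<bar>)"
  using u1 ai xL by (intro integral_le) (auto intro: integrable_on_subinterval)
 also have "... <= integral {0..L} (%z. \<bar>u z\<bar>)"
  using ai xL by (intro integral_subset_le) (auto intro: integrable_on_subinterval)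
 also have "... = integral {0..L} (%z. 2 * (\<bar>prim g z\<bar> * \<bar>g z\<bar>))"
  by (intro arg_cong[where f = "integral {0..L}"]) (auto simp: u_def abs_mult)
 also have "... = 2 * inner (toL L (%z. \<bar>prim g z\<bar>)) (toL L (%z. \<bar>g z\<bar>))"
  using m by (simp add: inner_toL)
 also have "... <= 2 * (norm (toL L (%z. \<bar>prim g z\<bar>)) * norm (toL L (%z. \<bar>g z\<bar>)))"
  by (simp add: norm_cauchy_schwarz)
 also have "... = 2 * norm (toL L (prim g)) * norm (toL L g)"
  using assms(1) by (simp add: norm_toL_abs prim_L2)
 finally show ?thesis .
qed

text \<open>du Bois-Reymond: test with the mean-free part of \<open>w - prim r\<close>.\<close>

lemma K1_weak_deriv:
 assumes L: "0 < L" and w: "L2 L w" and r: "L2 L r"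
  and t: "!!e d. (e, d) \<in> K1 L ==> inner (toL L w) d = - inner (toL L r) e"
 shows "weak_deriv L w r"
proof -
 define c where "c = integral {0..L} (%x. w x - prim r x) / L"
 define g where "g x = (w x - prim r x) - c" for x
 have g: "L2 L g" unfolding g_def using w r by (intro L2_diff prim_L2 L2_const)
 have ig: "prim g L = 0"
 proof -
  have "prim g L = integral {0..L} (%x. w x - prim r x) - integral {0..L} (%x. c)"
   unfolding prim_def[of g] g_def using w r
   by (intro Henstock_Kurzweil_Integration.integral_diff L2_integrable L2_diff prim_L2 L2_const)
  then show ?thesis using L by (simp add: c_def)
 qed
 have k: "inner (toL L w) (toL L g) = - inner (toL L r) (toL L (prim g))"
  by (rule t[OF K1I[OF g ig]])
 have "inner (toL L r) (toL L (prim g)) + inner (toL L (prim r)) (toL L g) = 0"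
 proof -
  have "((%x. r x * prim g x + prim r x * g x) has_integral 0) {0..L}"
   using prim_product[of L r g] L r g ig by simp
  then have "integral {0..L} (%x. r x * prim g x + prim r x * g x) = 0" by (rule integral_unique)
  then show ?thesis
   using r g by (simp add: inner_toL prim_L2 Henstock_Kurzweil_Integration.integral_add set_lebesgue_integral_eq_integral(1)[OF L2_mult_abs_integrable])
 qed
 then have "inner (toL L w - toL L (prim r)) (toL L g) = 0" using k by (simp add: inner_diff_left)
 moreover have "inner (toL L (%x. c)) (toL L g) = 0"
 proof -
  have "toL L (%x. c) = c *\<^sub>R toL L (%x. 1)" using toL_scale[OF L2_const[of L 1], of c] by simp
  then show ?thesis using integral_eq_inner_1[OF g] ig by (simp add: prim_def inner_commute)
 qed
 ultimately have "inner (toL L g) (toL L g) = 0"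
  unfolding g_def using w r by (simp add: toL_diff L2_diff prim_L2 L2_const inner_diff_left)
 then have "toL L g = toL L (%x. 0)" by (simp add: toL_zero)
 then have "negligible {x \<in> {0..L}. g x ~= 0}" using g by (simp add: toL_eq_iff L2_const)
 then have "negligible {x \<in> {0..L}. w x ~= c + integral {0..x} r}"
  by (rule negligible_subset) (auto simp: g_def prim_def)
 then show ?thesis using r by (auto simp: weak_deriv_def)
qed

text \<open>The weight \<open>c tan (c (x - L/2))\<close> solves \<open>w' = c\<^sup>2 + w\<^sup>2\<close>; expanding the square in \<open>\<integral>(f' + w f)\<^sup>2 \<ge> 0\<close>
 gives the inequality with constant \<open>c\<close> for every \<open>c < pi / L\<close>.\<close>

lemma K1_wirtinger:
 assumes L: "0 < L" and ed: "(e, d) \<in> K1 L"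
 shows "pi / L * norm e <= norm d"
proof -
 obtain g where g: "L2 L g" "prim g L = 0" "e = toL L (prim g)" "d = toL L g"
  using ed by (rule K1E)
 have *: "c * norm e <= norm d" if c: "0 < c" "c < pi / L" for c
 proof -
  define w where "w x = c * tan (c * (x - L/2))" for x
  define w' where "w' x = c^2 + (w x)^2" for x
  have cosn: "cos (c * (x - L/2)) ~= 0" if "x \<in> {0..L}" for x
  proof -
   have "c * L < pi" using c L by (simp add: field_simps)
   have "\<bar>x - L/2\<bar> <= L/2" using that unfolding abs_le_iff by auto
   then have "c * \<bar>x - L/2\<bar> <= c * (L/2)" using c by (intro mult_left_mono) auto
   then have "\<bar>c * (x - L/2)\<bar> <= c * L / 2" using c by (simp add: abs_mult)
   then have "cos (c * (x - L/2)) > 0" using \<open>c * L < pi\<close> by (intro cos_gt_zero_pi) auto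
   then show ?thesis by simp
  qed
  have der: "(w has_real_derivative w' x) (at x within {0..L})" if "x \<in> {0..L}" for x
   unfolding w_def w'_def using cosn[OF that]
   by (auto intro!: derivative_eq_intros simp: tan_def power2_eq_square field_simps)
  have wc: "continuous_on {0..L} w" using der by (rule DERIV_continuous_on)
  have w'c: "continuous_on {0..L} w'" unfolding w'_def by (intro continuous_intros wc)
  have ww: "w x = w 0 + integral {0..x} w'" if "x \<in> {0..L}" for x
  proof -
   have "(w' has_integral (w x - w 0)) {0..x}"
    using that by (intro fundamental_theorem_of_calculus)
     (auto simp: has_real_derivative_iff_has_vector_derivative[symmetric] intro: DERIV_subset[OF der])
   then show ?thesis by (simp add: integral_unique)
  qed
  define f where "f = prim g"
  have f: "L2 L f" "continuous_on {0..L} f" by (simp_all add: f_def prim_L2 prim_continuous g)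
  have f0: "f 0 = 0" "f L = 0" using g by (simp_all add: f_def)
  define q where "q x = g x * f x + f x * g x" for x
  have ga: "g absolutely_integrable_on {0..y}" if "0 <= y" "y <= L" for y
   using L2_abs_integrable[OF g(1)] by (rule set_integrable_subset) (use that in auto)
  have p1: "f y * f y = f 0 * f 0 + integral {0..y} q" if "y \<in> {0..L}" for y
  proof -
   have "(q has_integral (f y * f y - f 0 * f 0)) {0..y}"
    unfolding q_def[abs_def]
    by (rule product_rule_integral(1)) (use that ga[of y] in \<open>auto simp: f_def prim_def\<close>)
   then show ?thesis by (simp add: integral_unique)
  qed
  have qa: "q absolutely_integrable_on {0..L}"
   unfolding q_def[abs_def]
   by (intro set_integral_add product_rule_integral(2,3)[of 0 L g g f f])
    (use L ga[of L] in \<open>auto simp: f_def prim_def\<close>)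
  \<comment> \<open>The integrand is the derivative of \<open>f^2 * w\<close>, whose boundary values
    vanish because \<open>f\<close> is zero at both ends.\<close>
  have "((%x. q x * w x + (f x * f x) * w' x) has_integral (f L * f L * w L - f 0 * f 0 * w 0)) {0..L}"
   by (rule product_rule_integral(1)[OF _ qa _ p1 ww])
    (use L w'c in \<open>auto intro: absolutely_integrable_continuous_real\<close>)
  then have 1: "integral {0..L} (%x. q x * w x + (f x * f x) * w' x) = 0" using f0 by (simp add: integral_unique)
  have lw: "L2 L (%x. w x * f x)" using wc f by (intro continuous_L2 continuous_intros)
  have prod: "((%x. u x * v x) has_integral inner (toL L u) (toL L v)) {0..L}" if "L2 L u" "L2 L v" for u v
   using set_lebesgue_integral_eq_integral(1)[OF L2_mult_abs_integrable[OF that]] inner_toL[OF that]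
   by (simp add: has_integral_integrable_integral)
  have "((%x. 2 * (g x * (w x * f x)) + c^2 * (f x * f x) + (w x * f x) * (w x * f x)) has_integral
    (2 * inner d (toL L (%x. w x * f x)) + c^2 * inner e e + inner (toL L (%x. w x * f x)) (toL L (%x. w x * f x)))) {0..L}"
   unfolding g(3,4) f_def[symmetric]
   by (intro has_integral_add has_integral_mult_right prod g f lw)
  also have "(%x. 2 * (g x * (w x * f x)) + c^2 * (f x * f x) + (w x * f x) * (w x * f x)) = (%x. q x * w x + (f x * f x) * w' x)"
   by (auto simp: q_def w'_def algebra_simps power2_eq_square)
  finally have 2: "2 * inner d (toL L (%x. w x * f x)) + c^2 * inner e e + inner (toL L (%x. w x * f x)) (toL L (%x. w x * f x)) = 0"
   using 1 by (simp add: integral_unique)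
  have "0 <= inner (d + toL L (%x. w x * f x)) (d + toL L (%x. w x * f x))" by simp
  also have "... = inner d d - c^2 * inner e e"
   using 2 by (simp add: inner_add_left inner_add_right inner_commute)
  finally have "(c * norm e)^2 <= (norm d)^2"
   by (simp add: power_mult_distrib power2_norm_eq_inner)
  then show ?thesis by (rule power2_le_imp_le) simp
 qed
 show ?thesis
 proof (cases "norm e = 0")
  case False
  have "c <= norm d / norm e" if "c < pi / L" for c
  proof (cases "0 < c")
   case True
   then show ?thesis using *[of c] that False by (simp add: pos_le_divide_eq)
  next
   case c: False
   have "0 <= norm d / norm e" by simp
   with c show ?thesis by linarith
  qed
  \<comment> \<open>The weight is singular at the end points for \<open>c = pi / L\<close>, so this
    constant is only reached as a supremum.\<close>
  then have "pi / L <= norm d / norm e" by (rule dense_le)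
  then show ?thesis using False by (simp add: pos_le_divide_eq)
 qed simp
qed

text \<open>An essential bound for an abstract class, taken on the whole line; for classes of the
  form \<open>toL L f\<close> it only sees \<open>{0..L}\<close>, since the cut-off is zero
  elsewhere.\<close>

definition supb :: "l2 => real => bool" where
 "supb e c \<longleftrightarrow> (AE x in lebesgue. \<bar>rep e x\<bar> <= c)"

lemma supb_toL_iff:
 assumes "L2 L f" "0 <= c"
 shows "supb (toL L f) c \<longleftrightarrow> negligible {x \<in> {0..L}. ~ \<bar>f x\<bar> <= c}"
proof -
 have a: "AE x in lebesgue. rep (toL L f) x = cut L f x"
  using assms by (simp add: toL_def rep_abs L2_iff)
 have "supb (toL L f) c \<longleftrightarrow> (AE x in lebesgue. \<bar>cut L f x\<bar> <= c)"
  unfolding supb_def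
 proof
  assume "AE x in lebesgue. \<bar>rep (toL L f) x\<bar> <= c"
  with a show "AE x in lebesgue. \<bar>cut L f x\<bar> <= c" by eventually_elim simp
 next
  assume "AE x in lebesgue. \<bar>cut L f x\<bar> <= c"
  with a show "AE x in lebesgue. \<bar>rep (toL L f) x\<bar> <= c" by eventually_elim simp
 qed
 also have "... \<longleftrightarrow> {x. ~ \<bar>cut L f x\<bar> <= c} \<in> null_sets lebesgue"
  by (simp add: completion.AE_iff_null_sets)
 also have "{x. ~ \<bar>cut L f x\<bar> <= c} = {x \<in> {0..L}. ~ \<bar>f x\<bar> <= c}"
  using assms by (auto simp: cut_def)
 finally show ?thesis by (simp add: negligible_iff_null_sets)
qed

lemma supb_mono: "supb e c ==> c <= c' ==> supb e c'"
 unfolding supb_def by (erule AE_mp) auto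

lemma rep_diff: "AE x in lebesgue. rep (a - b) x = rep a x - rep b x"
 using abs_l2_eq_iff[OF rep(1)[of "a - b"] sqi_diff[OF rep(1)[of a] rep(1)[of b]]]
  abs_l2_diff[OF rep(1)[of a] rep(1)[of b]] by (simp add: rep(2))

text \<open>The excess of \<open>b\<close> over the level \<open>c\<close> is pointwise at most the
  distance to \<open>a n\<close>, so its norm is at most \<open>norm (b - a n)\<close> for every
  \<open>n\<close> and therefore zero.\<close>

lemma supb_limit:
 assumes "0 <= c" "!!n. supb (a n) c" "a \<longlonglongrightarrow> b"
 shows "supb b c"
proof -
 define h where "h x = max 0 (\<bar>rep b x\<bar> - c)" for x
 have hs: "sqi h"
  by (rule sqi_bound[OF _ rep(1)[of b]]) (use rep(1)[of b] assms(1) in \<open>auto simp: h_def[abs_def] sqi_def\<close>)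
 have "norm (abs_l2 h) <= norm (b - a n)" for n
 proof -
  have ba: "b - a n = abs_l2 (rep (b - a n))" by (simp add: rep)
  have "integral\<^sup>L lebesgue (%x. (h x)^2) <= integral\<^sup>L lebesgue (%x. (rep (b - a n) x)^2)"
  proof (rule integral_mono_AE)
   show "AE x in lebesgue. (h x)^2 <= (rep (b - a n) x)^2"
    using assms(2)[of n, unfolded supb_def] rep_diff[of b "a n"]
    by eventually_elim (auto simp: abs_le_square_iff[symmetric] h_def)
  qed (use hs rep(1)[of "b - a n"] in \<open>auto simp: sqi_def\<close>)
  then have "(norm (abs_l2 h))^2 <= (norm (b - a n))^2"
   by (subst ba) (simp add: norm_abs_l2 hs rep(1))
  then show ?thesis by (rule power2_le_imp_le) simp
 qed
 moreover have "(%n. norm (b - a n)) \<longlonglongrightarrow> 0"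
  using tendsto_norm[OF tendsto_diff[OF tendsto_const assms(3), of b]] by simp
 ultimately have "norm (abs_l2 h) <= 0" by (intro LIMSEQ_le_const) auto
 then have "abs_l2 h = abs_l2 (%x. 0)" by (simp add: zero_l2_def)
 then have "AE x in lebesgue. h x = 0" using abs_l2_eq_iff[OF hs sqi_zero] by simp
 then show ?thesis unfolding supb_def by eventually_elim (auto simp: h_def)
qed

lemma K1_supb:
 assumes "(e, d) \<in> K1 L"
 shows "supb e (sqrt (2 * norm e * norm d))" "0 <= L ==> supb e (sqrt L * norm d)"
proof -
 obtain g where g: "L2 L g" "prim g L = 0" "e = toL L (prim g)" "d = toL L g"
  using assms by (rule K1E)
 have "\<bar>prim g x\<bar> <= sqrt (2 * norm e * norm d)" if "x \<in> {0..L}" for x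
  using K1_sup_pointwise[OF g(1) that] by (intro real_le_rsqrt) (simp add: g(3,4))
 then have "negligible {x \<in> {0..L}. ~ \<bar>prim g x\<bar> <= sqrt (2 * norm e * norm d)}"
  by (intro empty_imp_negligible) auto
 then show "supb e (sqrt (2 * norm e * norm d))"
  using supb_toL_iff[OF prim_L2[OF g(1)], of "sqrt (2 * norm e * norm d)"] g(3) by simp
 show "supb e (sqrt L * norm d)" if L: "0 <= L"
 proof -
  have "negligible {x \<in> {0..L}. ~ \<bar>prim g x\<bar> <= sqrt L * norm d}"
   using prim_sup[OF g(1)] g(4) by (intro empty_imp_negligible) auto
  then show ?thesis
   using supb_toL_iff[OF prim_L2[OF g(1)], of "sqrt L * norm d"] g(3) L by simp
 qed
qed

text \<open>A function with derivative in \<open>L\<^sup>2\<close> is determined up to \<open>sqrt (L / N)\<close> by its values on a grid of \<open>N\<close> points,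
 and these are inner products of the derivative with indicator functions.\<close>

lemma K1_finite_functionals:
 assumes L: "0 < L" and eps: "0 < (epsz::real)"
 shows "\<exists>F. finite F & (\<forall>(e, d) \<in> K1 L. norm e <= epsz * norm d + (\<Sum>a\<in>F. \<bar>inner d a\<bar>))"
proof -
 obtain N :: nat where "(L / epsz)^2 < real N" using reals_Archimedean2 by blast
 moreover have "0 <= (L / epsz)^2" by simp
 ultimately have N: "(L / epsz)^2 < real N" "N > 0" by (auto intro: gr0I)
 define pt where "pt i = real i * (L / real N)" for i
 have ptb: "0 <= pt i" "pt i <= L" if "i <= N" for i
 proof -
  show "0 <= pt i" using L by (simp add: pt_def)
  have "real i * (L / real N) <= real N * (L / real N)"
   using that L by (intro mult_right_mono) auto
  then show "pt i <= L" using N by (simp add: pt_def)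
 qed
 define v where "v i = sqrt L *\<^sub>R toL L (indicat_real {0..pt i})" for i
 define F where "F = v ` {..<N}"
 \<comment> \<open>The claim sums over a set of vectors, so different grid points must give
   different vectors; their norms already differ.\<close>
 have inj: "(\<Sum>i<N. \<bar>inner d (v i)\<bar>) = (\<Sum>a\<in>F. \<bar>inner d a\<bar>)" for d
 proof -
  have "inj_on v {..<N}"
  proof (rule inj_onI)
   fix i j assume "i \<in> {..<N}" "j \<in> {..<N}" "v i = v j"
   then have "norm (toL L (indicat_real {0..pt i})) = norm (toL L (indicat_real {0..pt j}))"
    using L by (simp add: v_def)
   then have "pt i = pt j" using ptb[of i] ptb[of j] \<open>i \<in> _\<close> \<open>j \<in> _\<close> by (simp add: norm_indicat)
   then show "i = j" using L N by (simp add: pt_def)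
  qed
  then show ?thesis by (simp add: F_def sum.reindex)
 qed
 have "norm e <= epsz * norm d + (\<Sum>a\<in>F. \<bar>inner d a\<bar>)" if ed: "(e, d) \<in> K1 L" for e d
 proof -
  obtain g where g: "L2 L g" "prim g L = 0" "e = toL L (prim g)" "d = toL L g"
   using ed by (rule K1E)
  define B where "B = (\<Sum>i<N. \<bar>prim g (pt i)\<bar>) + sqrt (L / real N) * norm d"
  have B0: "0 <= B" unfolding B_def using L by (intro add_nonneg_nonneg sum_nonneg) auto
  have pw: "\<bar>prim g x\<bar> <= B" if x: "x \<in> {0..L}" for x
  proof -
   \<comment> \<open>The index of the grid cell containing \<open>x\<close>. The \<open>min\<close>
     treats \<open>x = L\<close>, where the floor would give \<open>N\<close> and leave the
     grid.\<close>
   define i where "i = min (N - 1) (nat \<lfloor>x / (L / real N)\<rfloor>)"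
   have iN: "i < N" using N by (simp add: i_def)
   have hN: "0 < L / real N" using L N by simp
   have q0: "0 <= x / (L / real N)" using x hN by (intro divide_nonneg_pos) auto
   then have "real (nat \<lfloor>x / (L / real N)\<rfloor>) <= x / (L / real N)"
    by (rule of_nat_floor)
   then have "real i <= x / (L / real N)" by (simp add: i_def min_def split: if_splits)
   then have lo: "pt i <= x" using hN unfolding pt_def by (simp only: pos_le_divide_eq)
   have up: "x <= pt i + L / real N"
   proof (cases "nat \<lfloor>x / (L / real N)\<rfloor> <= N - 1")
    case True
    then have "i = nat \<lfloor>x / (L / real N)\<rfloor>" by (simp add: i_def)
    then have "x / (L / real N) <= real i + 1"
     using q0 real_of_int_floor_add_one_ge[of "x / (L / real N)"] of_nat_nat[of "\<lfloor>x / (L / real N)\<rfloor>", where 'a = real]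
     by simp
    then have "x <= (real i + 1) * (L / real N)" using hN by (simp only: pos_divide_le_eq)
    then show ?thesis by (simp add: pt_def distrib_right add_divide_distrib)
   next
    case False
    then have iN1: "real i + 1 = real N" using N by (simp add: i_def min_def)
    have "real N * (L / real N) = pt i + L / real N"
     using distrib_right[of "real i" 1 "L / real N"] iN1 by (simp only: pt_def mult_1)
    moreover have "real N * (L / real N) = L" using N by simp
    ultimately show ?thesis using x by simp
   qed
   have "\<bar>prim g x - prim g (pt i)\<bar> <= sqrt (x - pt i) * norm (toL L g)"
    using lo x ptb[of i] iN g by (intro prim_holder) auto
   also have "... <= sqrt (L / real N) * norm d"
    using up g hN by (intro mult_mono) auto
   finally have 1: "\<bar>prim g x - prim g (pt i)\<bar> <= sqrt (L / real N) * norm d" .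
   have "\<bar>prim g (pt i)\<bar> <= (\<Sum>i<N. \<bar>prim g (pt i)\<bar>)"
    using iN by (intro member_le_sum[of i "{..<N}" "%i. \<bar>prim g (pt i)\<bar>"]) auto
   then show ?thesis using 1 unfolding B_def by linarith
  qed
  have "norm e <= sqrt L * B"
   unfolding g(3) by (rule norm_toL_le_sup) (use L B0 pw prim_L2[OF g(1)] in \<open>auto intro!: empty_imp_negligible\<close>)
  also have "... = (\<Sum>i<N. \<bar>inner d (v i)\<bar>) + sqrt L * sqrt (L / real N) * norm d"
  proof -
   have "sqrt L * \<bar>prim g (pt i)\<bar> = \<bar>inner d (v i)\<bar>" if "i < N" for i
    using integral_sub_inner[OF g(1), of 0 "pt i"] ptb[of i] that L
    by (simp add: v_def g(4) prim_def abs_mult)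
   then show ?thesis by (simp add: B_def distrib_left sum_distrib_left)
  qed
  also have "... <= (\<Sum>i<N. \<bar>inner d (v i)\<bar>) + epsz * norm d"
  proof -
   have "sqrt L * sqrt (L / real N) = sqrt (L * L / real N)" by (simp flip: real_sqrt_mult)
   also have "... <= sqrt (epsz^2)"
    using N eps by (intro real_sqrt_le_mono) (simp add: power_divide pos_divide_less_eq pos_divide_le_eq power2_eq_square mult.commute)
   finally show ?thesis using eps by (intro add_left_mono mult_right_mono) auto
  qed
  finally show ?thesis by (simp add: inj add.commute)
 qed
 then show ?thesis by (intro exI[of _ F]) (auto simp: F_def)
qed

section \<open>The abstract damped wave equation: energy identity and dissipation\<close>

lemma has_vector_derivative_iff_quotient:
 "(f has_vector_derivative D) (at x within S) \<longleftrightarrow>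
  ((%y. (f y - f x) /\<^sub>R (y - x)) \<longlongrightarrow> D) (at x within S)"
proof -
 have "(f has_vector_derivative D) (at x within S) \<longleftrightarrow>
   ((%y. norm ((f y - f x) - (y - x) *\<^sub>R D) / norm (y - x)) \<longlongrightarrow> 0) (at x within S)"
  unfolding has_vector_derivative_def has_derivative_iff_norm
  by (simp add: bounded_linear_scaleR_left)
 also have "... \<longleftrightarrow> ((%y. norm ((f y - f x) /\<^sub>R (y - x) - D)) \<longlongrightarrow> 0) (at x within S)"
 proof (rule filterlim_cong[OF refl refl])
  show "\<forall>\<^sub>F y in at x within S. norm ((f y - f x) - (y - x) *\<^sub>R D) / norm (y - x) =
    norm ((f y - f x) /\<^sub>R (y - x) - D)"
  proof (rule eventually_at_filter[THEN iffD2], rule always_eventually, intro allI impI)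
   fix y assume "y ~= x" "y \<in> S"
   then have "(f y - f x) /\<^sub>R (y - x) - D = ((f y - f x) - (y - x) *\<^sub>R D) /\<^sub>R (y - x)"
    by (simp add: scaleR_diff_right)
   then show "norm ((f y - f x) - (y - x) *\<^sub>R D) / norm (y - x) = norm ((f y - f x) /\<^sub>R (y - x) - D)"
    by (simp add: divide_inverse mult.commute)
  qed
 qed
 also have "... \<longleftrightarrow> ((%y. (f y - f x) /\<^sub>R (y - x)) \<longlongrightarrow> D) (at x within S)"
  by (simp add: tendsto_norm_zero_iff LIM_zero_iff)
 finally show ?thesis .
qed

lemma has_vector_derivative_shift_within:
 fixes f :: "real => 'a::real_normed_vector"
 assumes "(f has_vector_derivative D) (at (t + h) within S)"
 shows "((%t. f (t + h)) has_vector_derivative D) (at t within (%x. x - h) ` S)"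
proof -
 have i: "(%t. t + h) ` (%x. x - h) ` S = S" by (auto simp: image_image)
 have "((%t. t + h) has_vector_derivative 1) (at t within (%x. x - h) ` S)"
  by (auto intro!: derivative_eq_intros)
 then have "(f \<circ> (%t. t + h) has_vector_derivative (1 *\<^sub>R D)) (at t within (%x. x - h) ` S)"
  by (rule vector_diff_chain_within) (simp add: i assms)
 then show ?thesis by (simp add: o_def)
qed

text \<open>\<open>K\<close> is a subspace rather than a whole type because it will be a graph
  inside a product space, and the form is coercive only there.\<close>

locale wave_form =
 fixes K :: "'v::real_inner set" and J :: "'v => 'h::real_inner" and a :: "'v => 'v => real"
  and M :: "'h => 'h" and c0 m0 :: real
 assumes K: "subspace K"
  and J: "bounded_linear J"
  and a: "bounded_bilinear a"
  and a_sym: "a x y = a y x"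
  and c0: "0 < c0"
  and coercive: "x \<in> K ==> c0 * (norm x)^2 <= a x x"
  and M: "bounded_linear M"
  and M_sym: "inner (M u) v = inner u (M v)"
  and m0: "0 < m0"
  and M_pos: "m0 * (norm u)^2 <= inner (M u) u"
begin

interpretation J: bounded_linear J by (rule J)
interpretation M: bounded_linear M by (rule M)
interpretation a: bounded_bilinear a by (rule a)

text \<open>\<open>J\<close> embeds the energy space into the pivot space; \<open>sol s W v G\<close> says that \<open>v\<close> is the velocity of \<open>J W\<close> and
 that \<open>M v' + A W + G = 0\<close> weakly on \<open>[s, \<infinity>)\<close>, where \<open>A\<close> is the operator of the form \<open>a\<close>.\<close>

definition sol :: "real => (real => 'v) => (real => 'h) => (real => 'h) => bool" where
 "sol s W v G \<longleftrightarrow> (\<forall>t\<ge>s. W t \<in> K) & continuous_on {s..} W & continuous_on {s..} v & continuous_on {s..} G \<and>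
  (\<forall>t\<ge>s. ((%t. J (W t)) has_vector_derivative v t) (at t within {s..})) \<and>
  (\<forall>x\<in>K. \<forall>t\<ge>s. ((%t. inner (M (v t)) (J x)) has_real_derivative
    (- a (W t) x - inner (G t) (J x))) (at t within {s..}))"

definition energy :: "'v => 'h => real" where
 "energy x u = (a x x + inner (M u) u) / 2"

lemma energy_nonneg: "x \<in> K ==> 0 <= energy x u"
 using coercive[of x] M_pos[of u] c0 m0
 by (simp add: energy_def) (smt (verit) mult_nonneg_nonneg zero_le_power2)

lemma energy_bounds:
 shows "x \<in> K ==> (norm x)^2 <= 2 / c0 * energy x u" "x \<in> K ==> (norm u)^2 <= 2 / m0 * energy x u"
proof -
 assume x: "x \<in> K"
 have 1: "c0 * (norm x)^2 <= a x x" "0 <= c0 * (norm x)^2" using coercive[OF x] c0 by auto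
 have 2: "m0 * (norm u)^2 <= inner (M u) u" "0 <= m0 * (norm u)^2" using M_pos[of u] m0 by auto
 show "(norm x)^2 <= 2 / c0 * energy x u" using 1 2 c0 by (simp add: energy_def field_simps)
 show "(norm u)^2 <= 2 / m0 * energy x u" using 1 2 m0 by (simp add: energy_def field_simps)
qed

lemma energy_upper: "\<exists>C>0. \<forall>x u. energy x u <= C * ((norm x)^2 + (norm u)^2)"
proof -
 obtain B where B: "B > 0" "!!x y. norm (a x y) <= norm x * norm y * B" using a.pos_bounded by blast
 obtain B' where B': "B' > 0" "!!x. norm (M x) <= norm x * B'" using M.pos_bounded by blast
 have "energy x u <= (B + B') * ((norm x)^2 + (norm u)^2)" for x u
 proof -
  have "a x x <= B * (norm x)^2" using B(2)[of x x] by (simp add: power2_eq_square mult_ac)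
  moreover have "inner (M u) u <= norm (M u) * norm u" by (rule norm_cauchy_schwarz)
  moreover have "norm (M u) * norm u <= (norm u * B') * norm u" by (intro mult_right_mono B') simp
  moreover have "0 <= B * (norm x)^2" "0 <= B' * (norm u)^2" "0 <= B' * (norm x)^2" "0 <= B * (norm u)^2"
   using B(1) B'(1) by auto
  ultimately show ?thesis by (simp add: energy_def power2_eq_square algebra_simps)
 qed
 then show ?thesis using B(1) B'(1) by (intro exI[of _ "B + B'"]) auto
qed

lemma solD:
 assumes "sol s W v G" "s <= t"
 shows "W t \<in> K" "((%t. J (W t)) has_vector_derivative v t) (at t within {s..})"
  "x \<in> K ==> ((%t. inner (M (v t)) (J x)) has_real_derivative (- a (W t) x - inner (G t) (J x))) (at t within {s..})"
 using assms by (auto simp: sol_def)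

lemma sol_cont:
 assumes "sol s W v G"
 shows "continuous_on {s..} W" "continuous_on {s..} v" "continuous_on {s..} G"
 using assms by (auto simp: sol_def)

lemma sol_mono:
 assumes "sol s W v G" "s <= s'"
 shows "sol s' W v G"
proof -
 have sub: "{s'..} \<subseteq> {s..}" using assms(2) by auto
 show ?thesis
  using assms unfolding sol_def
  by (auto intro: continuous_on_subset[OF _ sub] has_vector_derivative_within_subset[OF _ sub] DERIV_subset[OF _ sub])
qed

lemma sol_diff:
 assumes "sol s W v G" "sol s W' v' G'"
 shows "sol s (%t. W t - W' t) (%t. v t - v' t) (%t. G t - G' t)"
 unfolding sol_def
proof (intro conjI allI ballI impI)
 fix t assume t: "s <= t"
 show "W t - W' t \<in> K" using solD(1)[OF assms(1) t] solD(1)[OF assms(2) t] K by (simp add: subspace_diff)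
 show "((%t. J (W t - W' t)) has_vector_derivative v t - v' t) (at t within {s..})"
  unfolding J.diff by (intro derivative_intros solD(2)[OF assms(1) t] solD(2)[OF assms(2) t])
 fix x assume x: "x \<in> K"
 show "((%t. inner (M (v t - v' t)) (J x)) has_real_derivative
   - a (W t - W' t) x - inner (G t - G' t) (J x)) (at t within {s..})"
  unfolding M.diff inner_diff_left
  by (rule DERIV_cong[OF DERIV_diff[OF solD(3)[OF assms(1) t x] solD(3)[OF assms(2) t x]]])
   (simp add: a.diff_left inner_diff_left)
qed (intro continuous_intros sol_cont[OF assms(1)] sol_cont[OF assms(2)])+

lemma sol_scale:
 assumes "sol s W v G"
 shows "sol s (%t. c *\<^sub>R W t) (%t. c *\<^sub>R v t) (%t. c *\<^sub>R G t)"
 unfolding sol_def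
proof (intro conjI allI ballI impI)
 fix t assume t: "s <= t"
 show "c *\<^sub>R W t \<in> K" using solD(1)[OF assms(1) t] K by (simp add: subspace_scale)
 show "((%t. J (c *\<^sub>R W t)) has_vector_derivative c *\<^sub>R v t) (at t within {s..})"
  unfolding J.scaleR using solD(2)[OF assms t] by (auto intro!: derivative_eq_intros)
 fix x assume x: "x \<in> K"
 show "((%t. inner (M (c *\<^sub>R v t)) (J x)) has_real_derivative
   - a (c *\<^sub>R W t) x - inner (c *\<^sub>R G t) (J x)) (at t within {s..})"
  unfolding M.scaleR inner_scaleR_left
  by (rule DERIV_cong[OF DERIV_cmult[OF solD(3)[OF assms(1) t x]]])
   (simp add: a.scaleR_left algebra_simps)
qed (intro continuous_intros sol_cont[OF assms(1)])+

lemma sol_shift: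
 assumes "sol s W v G"
 shows "sol (s - h) (%t. W (t + h)) (%t. v (t + h)) (%t. G (t + h))"
proof -
 have i: "(%x. x - h) ` {s..} = {s - h..}"
  by (auto simp: image_iff intro!: bexI[of _ "_ + h"])
 have c: "continuous_on {s - h..} (%t. f (t + h))" if "continuous_on {s..} f" for f :: "real => 'z::topological_space"
  by (rule continuous_on_compose2[OF that]) (auto intro!: continuous_intros)
 show ?thesis
  unfolding sol_def
 proof (intro conjI allI ballI impI c sol_cont[OF assms])
  fix t assume "s - h <= t"
  then have t: "s <= t + h" by simp
  show "W (t + h) \<in> K" by (rule solD(1)[OF assms t])
  show "((%t. J (W (t + h))) has_vector_derivative v (t + h)) (at t within {s - h..})"
   using has_vector_derivative_shift_within[OF solD(2)[OF assms t]] by (simp only: i)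
  fix x assume x: "x \<in> K"
  show "((%t. inner (M (v (t + h))) (J x)) has_real_derivative
   - a (W (t + h)) x - inner (G (t + h)) (J x)) (at t within {s - h..})"
   using has_vector_derivative_shift_within[OF solD(3)[OF assms t x, unfolded has_real_derivative_iff_has_vector_derivative]]
   by (simp only: i has_real_derivative_iff_has_vector_derivative)
 qed
qed

text \<open>Only the weak derivative of \<open>M v\<close> is available, but the other factor is \<open>J\<close> of an element of \<open>K\<close>
 and differentiable in the pivot space, so the product rule holds.\<close>

lemma pairing_deriv:
 assumes s: "sol s W v G" and t: "s <= t" and y: "!!r. s <= r ==> y r \<in> K"
  and y': "((%r. J (y r)) has_vector_derivative u) (at t within {s..})"
 shows "((%r. inner (M (v r)) (J (y r))) has_real_derivative
  (- a (W t) (y t) - inner (G t) (J (y t)) + inner (M (v t)) u)) (at t within {s..})"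
proof -
 have "((%r. inner (M (v r)) (J (y r) - J (y t))) has_real_derivative inner (M (v t)) u) (at t within {s..})"
  unfolding has_field_derivative_iff
 proof -
  have "((%r. inner (M (v r)) ((J (y r) - J (y t)) /\<^sub>R (r - t))) \<longlongrightarrow> inner (M (v t)) u) (at t within {s..})"
   using y'[unfolded has_vector_derivative_iff_quotient] sol_cont(2)[OF s] t
   by (intro tendsto_inner M.tendsto) (auto simp: continuous_on_def)
  then show "((%r. (inner (M (v r)) (J (y r) - J (y t)) - inner (M (v t)) (J (y t) - J (y t))) / (r - t))
    \<longlongrightarrow> inner (M (v t)) u) (at t within {s..})"
   by (simp add: inner_scaleR_right divide_inverse mult.commute)
 qed
 from DERIV_add[OF solD(3)[OF s t y[OF t]] this] show ?thesis
  by (simp add: inner_diff_right)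
qed

lemma sol_velocity_bound:
 assumes s: "sol s W v G" and st: "s <= p" "p <= q" and x0: "x0 \<in> {p..q}"
  and B: "!!x. x \<in> {p..q} ==> norm (v x - v x0) <= B"
 shows "norm (J (W q) - J (W p) - (q - p) *\<^sub>R v x0) <= (q - p) * B"
proof -
 have "norm (J (W q) - J (W p) - (q - p) *\<^sub>R v x0) <= norm (q - p) * B"
 proof (rule vector_differentiable_bound_linearization[where S = "{p..q}" and f' = v])
  show "((%t. J (W t)) has_vector_derivative v x) (at x within {p..q})" if "x \<in> {p..q}" for x
   by (rule has_vector_derivative_within_subset[OF solD(2)[OF s]]) (use that st in auto)
 qed (use st x0 B in \<open>auto simp: closed_segment_eq_real_ivl\<close>)
 then show ?thesis using st by simp
qed

lemma sol_lipschitz: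
 assumes s: "sol s W v G" and st: "s <= p" "p <= q" and B: "!!x. x \<in> {p..q} ==> norm (v x) <= B"
 shows "norm (J (W q) - J (W p)) <= (q - p) * B"
proof -
 have "norm (J (W q) - J (W p)) <= B * norm (q - p)"
 proof (rule differentiable_bound[where S = "{p..q}" and f' = "%x h. h *\<^sub>R v x"])
  show "((%t. J (W t)) has_derivative (%h. h *\<^sub>R v x)) (at x within {p..q})" if "x \<in> {p..q}" for x
   unfolding has_vector_derivative_def[symmetric]
   by (rule has_vector_derivative_within_subset[OF solD(2)[OF s]]) (use that st in auto)
  show "onorm (%h. h *\<^sub>R v x) <= B" if "x \<in> {p..q}" for x
  proof (rule onorm_bound)
   show "norm (h *\<^sub>R v x) <= B * norm h" for h :: real
    using mult_left_mono[OF B[OF that], of "norm h"] by (simp add: mult.commute)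
   show "0 <= B" using B[OF that] norm_ge_zero order_trans by blast
  qed
 qed (use st in auto)
 then show ?thesis using st by (simp add: mult.commute)
qed

text \<open>The symmetric difference quotient \<open>q\<^sub>d\<close> of \<open>J W\<close> is an admissible multiplier. With
 \<open>f\<^sub>d(t) = - a(W t, W(t + d)) + (M v(t), v(t + d))\<close>, the derivative of \<open>(M v, 2 d q\<^sub>d)\<close> is
 \<open>f\<^sub>d(t) - f\<^sub>d(t - d) - 2 d (G, q\<^sub>d)\<close> by the symmetry of \<open>a\<close> and \<open>M\<close>; subtracting the mean of \<open>f\<^sub>d\<close> over
 \<open>[t - d, t]\<close> leaves a quantity that tends to the energy and has derivative \<open>- (G, q\<^sub>d)\<close>.\<close>

lemma energy_identity_aux:
 assumes s: "sol s W v G" and t1: "s < t1" and t2: "t1 <= t2"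
 shows "energy (W t2) (v t2) - energy (W t1) (v t1) = - integral {t1..t2} (%t. inner (G t) (v t))"
proof -
 note cW = sol_cont(1)[OF s] and cv = sol_cont(2)[OF s] and cG = sol_cont(3)[OF s]
 define p where "p r q = - a (W r) (W q) + inner (M (v r)) (v q)" for r q
 define X where "X d t = integral {s..t} (%r. p r (r + d))" for d t
 define q where "q d t = (1 / (2 * d)) *\<^sub>R (J (W (t + d)) - J (W (t - d)))" for d t
 define Q where "Q d t = inner (M (v t)) (q d t) - (X d t - X d (t - d)) / (2 * d)" for d t
 have cpd: "continuous_on {s..} (%r. p r (r + d))" if "d \<ge> 0" for d
  unfolding p_def using that
  by (intro continuous_intros a.continuous_on M.continuous_on cW cv continuous_on_compose2[OF cW] continuous_on_compose2[OF cv]) auto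
 have Xd: "(X d has_real_derivative p t (t + d)) (at t)" if "d \<ge> 0" "s < t" for d t
 proof -
  have "(X d has_real_derivative p t (t + d)) (at t within {s..t + 1})"
   unfolding X_def
   by (rule integral_has_real_derivative) (use that in \<open>auto intro: continuous_on_subset[OF cpd]\<close>)
  then show ?thesis using that by (simp add: at_within_Icc_at)
 qed
 \<comment> \<open>By this symmetry the shifted term \<open>p (t - d) t\<close> can be read as
   \<open>p t (t - d)\<close>, which cancels the backward terms in the derivative of
   \<open>inner (M (v t)) (q d t)\<close>.\<close>
 have psym: "p r q = p q r" for r q
  using M_sym[of "v r" "v q"] inner_commute[of "v r" "M (v q)"] by (simp add: p_def a_sym[of "W r"])
 have p_lim: "\<exists>d0>0. \<forall>r q. s <= r --> s <= q --> \<bar>r - t\<bar> < d0 --> \<bar>q - t\<bar> < d0 --> \<bar>p r q - p t t\<bar> < etz"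
  if t: "s <= t" and etz: "etz > 0" for t etz
 proof -
  have cp: "continuous_on ({s..} \<times> {s..}) (%z. p (fst z) (snd z))"
   unfolding p_def
   by (intro continuous_intros a.continuous_on M.continuous_on continuous_on_compose2[OF cW] continuous_on_compose2[OF cv]) auto
  have "\<exists>d>0. \<forall>z\<in>{s..} \<times> {s..}. dist z (t, t) < d --> dist (p (fst z) (snd z)) (p t t) < etz"
   using cp[unfolded continuous_on_iff, rule_format, of "(t, t)" etz] t etz by auto
  then obtain d where d: "d > 0" "!!z. z \<in> {s..} \<times> {s..} ==> dist z (t, t) < d ==> dist (p (fst z) (snd z)) (p t t) < etz"
   by blast
  show ?thesis
  proof (intro exI[of _ "d/2"] conjI allI impI)
   fix r q assume h: "s <= r" "s <= q" "\<bar>r - t\<bar> < d/2" "\<bar>q - t\<bar> < d/2"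
   have "dist (r, q) (t, t) <= \<bar>r - t\<bar> + \<bar>q - t\<bar>"
    using sqrt_sum_squares_le_sum_abs[of "r - t" "q - t"] by (simp add: dist_Pair_Pair dist_real_def)
   then show "\<bar>p r q - p t t\<bar> < etz" using d(2)[of "(r, q)"] h by (simp add: dist_real_def)
  qed (use d in auto)
 qed
 have A: "((%d. (X d t - X d (t - d)) / d) \<longlongrightarrow> p t t) (at_right 0)" if t: "s < t" for t
 proof (rule tendstoI)
  fix etz :: real assume etz: "etz > 0"
  obtain d0 where d0: "d0 > 0" "!!r q. s <= r ==> s <= q ==> \<bar>r - t\<bar> < d0 ==> \<bar>q - t\<bar> < d0 ==> \<bar>p r q - p t t\<bar> < etz"
   using p_lim[of t etz] t etz by auto
  show "\<forall>\<^sub>F d in at_right 0. dist ((X d t - X d (t - d)) / d) (p t t) < etz"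
   unfolding eventually_at_right_field
  proof (intro exI[of _ "min d0 (t - s)"] conjI allI impI)
   fix d assume d: "0 < d" "d < min d0 (t - s)"
   have "\<exists>z. t - d < z & z < t & X d t - X d (t - d) = (t - (t - d)) * p z (z + d)"
    by (rule MVT2) (use d Xd in auto)
   then obtain z where z: "t - d < z" "z < t" "X d t - X d (t - d) = d * p z (z + d)" by auto
   then have "(X d t - X d (t - d)) / d = p z (z + d)" using d by simp
   then show "dist ((X d t - X d (t - d)) / d) (p t t) < etz"
    using d0(2)[of z "z + d"] z d by (simp add: dist_real_def)
  qed (use d0 t in auto)
 qed
 have qv: "norm (q d t - v t) <= etz"
  if d: "0 < d" "s <= t - d" and b: "!!x. x \<in> {t - d..t + d} ==> norm (v x - v t) <= etz" for d t etz
 proof -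
  have "norm (J (W (t + d)) - J (W (t - d)) - ((t + d) - (t - d)) *\<^sub>R v t) <= ((t + d) - (t - d)) * etz"
   using d b by (intro sol_velocity_bound[OF s]) auto
  moreover have "J (W (t + d)) - J (W (t - d)) - ((t + d) - (t - d)) *\<^sub>R v t = (2 * d) *\<^sub>R (q d t - v t)"
   using d by (simp add: q_def scaleR_diff_right)
  ultimately show ?thesis using d by simp
 qed
 \<comment> \<open>The strict inequality \<open>s < t1\<close> leaves room for the backward shift,
   and uniform continuity of \<open>v\<close> makes the estimate uniform in \<open>t\<close>, as the
   mean value argument below requires.\<close>
 have unif: "\<exists>d0>0. \<forall>d t. 0 < d --> d < d0 --> t \<in> {t1..t2} --> s < t - d & norm (q d t - v t) <= etz" if etz: "etz > 0" for etz
 proof -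
  have "uniformly_continuous_on {s..t2 + 1} v"
   by (rule compact_uniformly_continuous) (auto intro: continuous_on_subset[OF cv])
  then obtain d1 where d1: "d1 > 0" "!!x y. x \<in> {s..t2 + 1} ==> y \<in> {s..t2 + 1} ==> dist y x < d1 ==> dist (v y) (v x) < etz"
   using etz unfolding uniformly_continuous_on_def by metis
  show ?thesis
  proof (intro exI[of _ "min d1 (min 1 (t1 - s))"] conjI allI impI)
   fix d t assume d: "0 < d" "d < min d1 (min 1 (t1 - s))" and t: "t \<in> {t1..t2}"
   show "s < t - d" using d t by auto
   show "norm (q d t - v t) <= etz"
   proof (rule qv)
    fix x assume x: "x \<in> {t - d..t + d}"
    then have "dist x t < d1" using d by (auto simp: dist_real_def abs_less_iff)
    moreover have "t \<in> {s..t2 + 1}" "x \<in> {s..t2 + 1}" using x d t t1 by auto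
    ultimately show "norm (v x - v t) <= etz" using d1(2)[of t x] by (simp add: dist_norm)
   qed (use d t in auto)
  qed (use d1 t1 in auto)
 qed
 have qlim: "((%d. q d t) \<longlongrightarrow> v t) (at_right 0)" if "t \<in> {t1..t2}" for t
 proof (rule tendstoI)
  fix etz :: real assume "etz > 0"
  then obtain d0 where "d0 > 0" "!!d t. 0 < d ==> d < d0 ==> t \<in> {t1..t2} ==> norm (q d t - v t) <= etz/2"
   using unif[of "etz/2"] by auto
  then show "\<forall>\<^sub>F d in at_right 0. dist (q d t) (v t) < etz"
   unfolding eventually_at_right_field using that \<open>etz > 0\<close>
   by (intro exI[of _ d0]) (fastforce simp: dist_norm)
 qed
 have Qlim: "((%d. Q d t) \<longlongrightarrow> energy (W t) (v t)) (at_right 0)" if t: "t \<in> {t1..t2}" for t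
 proof -
  have "((%d. inner (M (v t)) (q d t) - (X d t - X d (t - d)) / d / 2) \<longlongrightarrow> inner (M (v t)) (v t) - p t t / 2) (at_right 0)"
   using t t1 by (intro tendsto_intros qlim A) auto
  then show ?thesis by (simp add: Q_def energy_def p_def field_simps)
 qed
 have Qder: "(Q d has_real_derivative - inner (G t) (q d t)) (at t)" if d: "0 < d" "s < t - d" for d t
 proof -
  have sd: "sol (s + d) W v G" by (rule sol_mono[OF s]) (use d in simp)
  have sp: "sol (s + d) (%t. W (t + d)) (%t. v (t + d)) (%t. G (t + d))"
   by (rule sol_mono[OF sol_shift[OF s]]) (use d in simp)
  have sm: "sol (s + d) (%t. W (t - d)) (%t. v (t - d)) (%t. G (t - d))"
   using sol_shift[OF s, of "- d"] by simp
  note y = sol_scale[OF sol_diff[OF sp sm], of "1 / (2 * d)"]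
  have td: "s + d <= t" using d by simp
  have "((%r. inner (M (v r)) (J ((1 / (2 * d)) *\<^sub>R (W (r + d) - W (r - d))))) has_real_derivative
    (- a (W t) ((1 / (2 * d)) *\<^sub>R (W (t + d) - W (t - d))) - inner (G t) (J ((1 / (2 * d)) *\<^sub>R (W (t + d) - W (t - d))))
    + inner (M (v t)) ((1 / (2 * d)) *\<^sub>R (v (t + d) - v (t - d))))) (at t within {s + d..})"
   by (rule pairing_deriv[OF sd td solD(1)[OF y] solD(2)[OF y td]])
  moreover have "J ((1 / (2 * d)) *\<^sub>R (W (r + d) - W (r - d))) = q d r" for r
   by (simp add: q_def J.scaleR J.diff)
  ultimately have 1: "((%r. inner (M (v r)) (q d r)) has_real_derivative
    (- a (W t) ((1 / (2 * d)) *\<^sub>R (W (t + d) - W (t - d))) - inner (G t) (q d t)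
    + inner (M (v t)) ((1 / (2 * d)) *\<^sub>R (v (t + d) - v (t - d))))) (at t)"
   using d by (simp add: at_within_interior[of t "{s + d..}"])
  have 2: "((%t. X d (t - d)) has_real_derivative p (t - d) t) (at t)"
  proof -
   have "(X d has_real_derivative p (t - d) t) (at (t - d))" using Xd[of d "t - d"] d by simp
   moreover have "((%t. t - d) has_real_derivative 1) (at t)" by (auto intro!: derivative_eq_intros)
   ultimately show ?thesis using DERIV_chain2[of "X d" "p (t - d) t" "%t. t - d" t 1 UNIV] by simp
  qed
  have "(Q d has_real_derivative
    (- a (W t) ((1 / (2 * d)) *\<^sub>R (W (t + d) - W (t - d))) - inner (G t) (q d t)
    + inner (M (v t)) ((1 / (2 * d)) *\<^sub>R (v (t + d) - v (t - d)))) - (p t (t + d) - p (t - d) t) / (2 * d)) (at t)"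
   unfolding Q_def using d by (intro DERIV_diff 1 DERIV_cdivide 2 Xd) auto
  also have "(- a (W t) ((1 / (2 * d)) *\<^sub>R (W (t + d) - W (t - d))) - inner (G t) (q d t)
    + inner (M (v t)) ((1 / (2 * d)) *\<^sub>R (v (t + d) - v (t - d)))) - (p t (t + d) - p (t - d) t) / (2 * d)
    = - inner (G t) (q d t)"
   unfolding psym[of "t - d"]
   by (simp add: p_def a.scaleR_right a.diff_right inner_diff_right algebra_simps add_divide_distrib diff_divide_distrib)
  finally show ?thesis .
 qed
 define I where "I t = integral {t1..t} (%t. inner (G t) (v t))" for t
 have cGv: "continuous_on {t1..t2} (%t. inner (G t) (v t))"
  using t1 by (intro continuous_intros continuous_on_subset[OF cG] continuous_on_subset[OF cv]) auto
 have Id: "(I has_real_derivative inner (G t) (v t)) (at t within {t1..t2})" if "t \<in> {t1..t2}" for t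
  unfolding I_def by (rule integral_has_real_derivative[OF cGv that])
 have "bounded (G ` {t1..t2})"
  using t1 by (intro compact_imp_bounded compact_continuous_image continuous_on_subset[OF cG]) auto
 then obtain B where B: "B > 0" "!!t. t \<in> {t1..t2} ==> norm (G t) <= B"
  unfolding bounded_pos by auto
 \<comment> \<open>The derivative of \<open>Q d + I\<close> is the pairing of \<open>G\<close> with
   \<open>v - q d\<close>, hence uniformly small; the mean value inequality bounds the increment
   over \<open>{t1..t2}\<close> before \<open>d\<close> tends to 0.\<close>
 have C: "((%d. Q d t2 - Q d t1 + I t2) \<longlongrightarrow> 0) (at_right 0)"
 proof (rule tendstoI)
  fix etz :: real assume etz: "etz > 0"
  define \<theta> where "\<theta> = etz / (2 * B * (t2 - t1 + 1))"
  have \<theta>: "\<theta> > 0" using etz B(1) t2 by (simp add: \<theta>_def)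
  obtain d0 where d0: "d0 > 0" "!!d t. 0 < d ==> d < d0 ==> t \<in> {t1..t2} ==> s < t - d & norm (q d t - v t) <= \<theta>"
   using unif[OF \<theta>] by auto
  have "dist (Q d t2 - Q d t1 + I t2) 0 < etz" if d: "0 < d" "d < d0" for d
  proof -
   have "norm ((Q d t2 + I t2) - (Q d t1 + I t1)) <= B * \<theta> * norm (t2 - t1)"
   proof (rule field_differentiable_bound[where S = "{t1..t2}" and f' = "%t. - inner (G t) (q d t) + inner (G t) (v t)"])
    fix t assume t: "t \<in> {t1..t2}"
    show "((%t. Q d t + I t) has_real_derivative - inner (G t) (q d t) + inner (G t) (v t)) (at t within {t1..t2})"
     using d0(2)[OF d t] d by (intro DERIV_add Id t has_field_derivative_at_within[OF Qder]) auto
    have "- inner (G t) (q d t) + inner (G t) (v t) = - inner (G t) (q d t - v t)" by (simp add: inner_diff_right)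
    also have "norm ... <= norm (G t) * norm (q d t - v t)" using Cauchy_Schwarz_ineq2[of "G t" "q d t - v t"] by simp
    also have "... <= B * \<theta>" using B(1) B(2)[OF t] d0(2)[OF d t] by (intro mult_mono) auto
    finally show "norm (- inner (G t) (q d t) + inner (G t) (v t)) <= B * \<theta>" .
   qed (use t2 in auto)
   also have "... < etz"
   proof -
    have "B * \<theta> = etz / 2 / (t2 - t1 + 1)" using B(1) by (simp add: \<theta>_def)
    also have "... * norm (t2 - t1) < etz"
     using etz t2 by (simp add: pos_divide_less_eq)
    finally show ?thesis .
   qed
   finally show ?thesis by (simp add: I_def)
  qed
  then show "\<forall>\<^sub>F d in at_right 0. dist (Q d t2 - Q d t1 + I t2) 0 < etz"
   unfolding eventually_at_right_field using d0(1) by blast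
 qed
 moreover have "((%d. Q d t2 - Q d t1 + I t2) \<longlongrightarrow> energy (W t2) (v t2) - energy (W t1) (v t1) + I t2) (at_right 0)"
  using t2 by (intro tendsto_intros Qlim) auto
 ultimately have "energy (W t2) (v t2) - energy (W t1) (v t1) + I t2 = 0"
  by (rule tendsto_unique[OF trivial_limit_at_right_real, symmetric])
 then show ?thesis by (simp add: I_def)
qed

lemma energy_continuous:
 assumes s: "sol s W v G"
 shows "continuous_on {s..} (%t. energy (W t) (v t))"
 unfolding energy_def
 by (intro continuous_intros a.continuous_on M.continuous_on sol_cont[OF s]) auto

text \<open>The integral identity is available only from times after \<open>s\<close>, so it is
  differentiated with a base point strictly between \<open>s\<close> and \<open>t\<close>.\<close>

lemma energy_deriv:
 assumes s: "sol s W v G" and t: "s < t"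
 shows "((%t. energy (W t) (v t)) has_real_derivative - inner (G t) (v t)) (at t)"
proof -
 define r where "r = (s + t) / 2"
 have r: "s < r" "r < t" using t by (auto simp: r_def)
 have c: "continuous_on {r..t + 1} (%t. inner (G t) (v t))"
  using r by (intro continuous_intros continuous_on_subset[OF sol_cont(3)[OF s]] continuous_on_subset[OF sol_cont(2)[OF s]]) auto
 have "((%x. energy (W r) (v r) - integral {r..x} (%t. inner (G t) (v t))) has_real_derivative 0 - inner (G t) (v t)) (at t within {r..t + 1})"
  by (intro DERIV_diff DERIV_const integral_has_real_derivative c) (use r in auto)
 then have "((%t. energy (W t) (v t)) has_real_derivative 0 - inner (G t) (v t)) (at t within {r..t + 1})"
  by (rule has_field_derivative_transform_within[OF _ zero_less_one])
   (use r energy_identity_aux[OF s r(1)] in \<open>auto simp: algebra_simps\<close>)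
 then show ?thesis using r by (simp add: at_within_Icc_at)
qed

lemma energy_gronwall:
 assumes s: "sol s W v G" and st: "s <= t"
  and k: "!!r. s <= r ==> r <= t ==> - inner (G r) (v r) <= k * energy (W r) (v r)"
 shows "energy (W t) (v t) <= exp (k * (t - s)) * energy (W s) (v s)"
proof (cases "s = t")
 case False
 have "exp (- k * (t - s)) * energy (W t) (v t) <= exp (- k * (s - s)) * energy (W s) (v s)"
 proof (rule DERIV_nonpos_imp_decreasing_open[of s t "%r. exp (- k * (r - s)) * energy (W r) (v r)"])
  fix r assume r: "s < r" "r < t"
  have "((%r. exp (- k * (r - s)) * energy (W r) (v r)) has_real_derivative
    exp (- k * (r - s)) * (- inner (G r) (v r) - k * energy (W r) (v r))) (at r)"
   by (rule derivative_eq_intros energy_deriv[OF s r(1)] refl)+ (simp add: algebra_simps)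
  moreover have "exp (- k * (r - s)) * (- inner (G r) (v r) - k * energy (W r) (v r)) <= 0"
   using k[of r] r by (intro mult_nonneg_nonpos) auto
  ultimately show "\<exists>y. ((%r. exp (- k * (r - s)) * energy (W r) (v r)) has_real_derivative y) (at r) & y <= 0" by blast
 next
  show "continuous_on {s..t} (%r. exp (- k * (r - s)) * energy (W r) (v r))"
   by (intro continuous_intros continuous_on_subset[OF energy_continuous[OF s]]) auto
 qed (use st False in auto)
 then have "exp (k * (t - s)) * (exp (- k * (t - s)) * energy (W t) (v t)) <= exp (k * (t - s)) * energy (W s) (v s)"
  by (intro mult_left_mono) auto
 then show ?thesis by (simp add: mult.assoc[symmetric] exp_add[symmetric])
qed simp

text \<open>Dissipation is recovered from the damping by adding a small multiple of \<open>(M v, J W)\<close> to the energy.\<close>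

lemma energy_dissipation:
 assumes m: "0 < m" and N: "0 <= N"
 shows "\<exists>C>0. \<exists>gmz>0. \<forall>s t W v G \<rho>. sol s W v G --> s <= t --> 0 <= \<rho> -->
  (\<forall>r\<in>{s..t}. m * (norm (v r))^2 - \<rho> * norm (v r) <= inner (G r) (v r) & norm (G r) <= N * norm (v r) + \<rho>) -->
  energy (W t) (v t) <= C * (exp (- gmz * (t - s)) * energy (W s) (v s) + \<rho>^2)"
proof -
 obtain B where B: "B > 0" "!!x. norm (M x) <= norm x * B" using M.pos_bounded by blast
 obtain D where D: "D > 0" "!!x. norm (J x) <= norm x * D" using J.pos_bounded by blast
 define j where "j = D / sqrt c0"
 have j: "0 < j" using D c0 by (simp add: j_def)
 \<comment> \<open>With this \<open>n\<close> both parts of the energy dominate: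
   \<open>n * (V^2 + A^2)\<close> is at most twice the energy.\<close>
 define n where "n = min 1 m0"
 have n: "0 < n" "n <= 1" "n <= m0" using m0 by (auto simp: n_def)
 \<comment> \<open>The weight of the cross term. The first bound keeps the perturbed energy
   \<open>P\<close> within half of the energy; the second keeps the velocity terms produced by the
   cross term below a quarter of the damping constant \<open>m\<close>.\<close>
 define epsz where "epsz = min (n / (2 * (B * j + 1))) (m / (4 * (N\<^sup>2 * j\<^sup>2 + B + 1)))"
 have den: "0 < B * j + 1" "0 < N\<^sup>2 * j\<^sup>2 + B + 1" using B j by (auto intro: add_nonneg_pos add_pos_pos)
 have epsz: "0 < epsz" using n m den by (simp add: epsz_def)
 have e1: "epsz * (B * j) <= n / 2"
 proof -
  have "epsz * (B * j + 1) <= n / (2 * (B * j + 1)) * (B * j + 1)"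
   using den by (intro mult_right_mono) (auto simp: epsz_def)
  also have "... = n / 2" using den by (simp add: field_simps)
  finally show ?thesis using epsz by (simp add: distrib_left)
 qed
 have e2: "epsz * (N\<^sup>2 * j\<^sup>2 + B) <= m / 4"
 proof -
  have "epsz * (N\<^sup>2 * j\<^sup>2 + B + 1) <= m / (4 * (N\<^sup>2 * j\<^sup>2 + B + 1)) * (N\<^sup>2 * j\<^sup>2 + B + 1)"
   using den by (intro mult_right_mono) (auto simp: epsz_def)
  also have "... = m / 4" using den by (simp add: field_simps)
  finally show ?thesis using epsz by (simp add: distrib_left)
 qed
 \<comment> \<open>After the absorptions the dissipation is \<open>epsz / 2\<close> times
   \<open>A^2\<close> plus \<open>m / 2\<close> times \<open>V^2\<close>, while \<open>P\<close> is
   at most 3/4 of \<open>A^2 + B * V^2\<close>. The rate is the largest multiple of \<open>P\<close>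
   that these bounds allow, with \<open>B + 1\<close> for \<open>B\<close> to be safe.\<close>
 define gmz where "gmz = min (2 * epsz / 3) (2 * m / (3 * (B + 1)))"
 have gmz: "0 < gmz" using epsz m B by (simp add: gmz_def)
 have g1: "3 / 4 * gmz <= epsz / 2" by (simp add: gmz_def min_def)
 have g2: "3 / 4 * gmz * B <= m / 2"
 proof -
  have "gmz * (B + 1) <= 2 * m / (3 * (B + 1)) * (B + 1)"
   using B by (intro mult_right_mono) (auto simp: gmz_def)
  also have "... = 2 * m / 3" using B by (simp add: field_simps)
  finally have "gmz * B + gmz <= 2 * m / 3" by (simp add: distrib_left)
  moreover have "3 / 4 * gmz * B = 3 / 4 * (gmz * B)" by simp
  ultimately show ?thesis using gmz by linarith
 qed
 \<comment> \<open>The cost of \<open>\<rho>\<close> in Young's inequality: \<open>1 / m\<close>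
   from the damping pairing, \<open>epsz * j^2\<close> from the pairing of \<open>G\<close> with
   \<open>J W\<close>.\<close>
 define c where "c = 1 / m + epsz * j^2"
 have c: "0 < c" using m epsz by (auto simp: c_def intro!: add_pos_nonneg)
 have Jb: "norm (J x) <= j * sqrt (a x x)" if "x \<in> K" for x
 proof -
  have "sqrt c0 * norm x = sqrt (c0 * (norm x)^2)" by (simp add: real_sqrt_mult)
  also have "... <= sqrt (a x x)" by (rule real_sqrt_le_mono[OF coercive[OF that]])
  finally have "norm x <= sqrt (a x x) / sqrt c0" using c0 by (simp add: field_simps)
  then have "norm x * D <= sqrt (a x x) / sqrt c0 * D" using D by (intro mult_right_mono) auto
  then show ?thesis using D(2)[of x] by (simp add: j_def mult.commute)
 qed
 have key: "energy (W t) (v t) <= (3 + 2 * c / gmz) * (exp (- gmz * (t - s)) * energy (W s) (v s) + \<rho>^2)"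
  if s: "sol s W v G" and st: "s <= t" and \<rho>: "0 <= \<rho>"
   and h: "!!r. r \<in> {s..t} ==> m * (norm (v r))^2 - \<rho> * norm (v r) <= inner (G r) (v r)"
    "!!r. r \<in> {s..t} ==> norm (G r) <= N * norm (v r) + \<rho>" for s t W v G \<rho>
 proof -
  define P where "P r = energy (W r) (v r) + epsz * inner (M (v r)) (J (W r))" for r
  define A where "A r = sqrt (a (W r) (W r))" for r
  define V where "V r = norm (v r)" for r
  have A2: "a (W r) (W r) = (A r)^2" and A0: "0 <= A r" and WK: "W r \<in> K" if "s <= r" for r
  proof -
   show "W r \<in> K" by (rule solD(1)[OF s that])
   then have "0 <= a (W r) (W r)" using coercive[of "W r"] c0 by (smt (verit) mult_nonneg_nonneg zero_le_power2)
   then show "a (W r) (W r) = (A r)^2" "0 <= A r" by (auto simp: A_def)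
  qed
  have V0: "0 <= V r" for r by (simp add: V_def)
  have Mv: "n * (V r)^2 <= inner (M (v r)) (v r)" "inner (M (v r)) (v r) <= B * (V r)^2" for r
  proof -
   have "n * (V r)^2 <= m0 * (V r)^2" using n by (intro mult_right_mono) auto
   then show "n * (V r)^2 <= inner (M (v r)) (v r)" using M_pos[of "v r"] by (simp add: V_def)
   have "inner (M (v r)) (v r) <= norm (M (v r)) * norm (v r)" by (rule norm_cauchy_schwarz)
   also have "... <= (norm (v r) * B) * norm (v r)" by (intro mult_right_mono B) simp
   finally show "inner (M (v r)) (v r) <= B * (V r)^2" by (simp add: V_def power2_eq_square mult_ac)
  qed
  have JA: "norm (J (W r)) <= j * A r" if "s <= r" for r using Jb[OF WK[OF that]] by (simp add: A_def)
  have Pe: "\<bar>P r - energy (W r) (v r)\<bar> <= energy (W r) (v r) / 2" if r: "s <= r" for r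
  proof -
   have "\<bar>inner (M (v r)) (J (W r))\<bar> <= norm (M (v r)) * norm (J (W r))" by (rule Cauchy_Schwarz_ineq2)
   also have "... <= (V r * B) * (j * A r)"
    using B(2)[of "v r"] JA[OF r] B(1) V0[of r] by (intro mult_mono) (auto simp: V_def)
   finally have "epsz * \<bar>inner (M (v r)) (J (W r))\<bar> <= epsz * ((V r * B) * (j * A r))"
    using epsz by (intro mult_left_mono) auto
   also have "... = (epsz * (B * j)) * (V r * A r)" by simp
   also have "... <= n / 2 * (V r * A r)" using e1 V0 A0[OF r] by (intro mult_right_mono) auto
   also have "... <= n / 2 * (((V r)^2 + (A r)^2) / 2)"
    using n sum_squares_bound[of "V r" "A r"] by (intro mult_left_mono) auto
   also have "... <= energy (W r) (v r) / 2"
   proof -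
    have "n * (A r)^2 <= 1 * (A r)^2" using n by (intro mult_right_mono) auto
    then show ?thesis using Mv(1)[of r] A2[OF r] by (simp add: energy_def algebra_simps)
   qed
   finally show ?thesis using epsz by (simp add: P_def abs_mult)
  qed
  have Pd: "\<exists>y. (P has_real_derivative y) (at r) & y <= - gmz * P r + c * \<rho>^2" if r: "s < r" "r < t" for r
  proof -
   have r': "s <= r" "r \<in> {s..t}" using r by auto
   have 1: "((%r. inner (M (v r)) (J (W r))) has_real_derivative
     (- a (W r) (W r) - inner (G r) (J (W r)) + inner (M (v r)) (v r))) (at r)"
    using pairing_deriv[OF s r'(1) WK solD(2)[OF s r'(1)]] r by (simp add: at_within_interior[of r "{s..}"])
   have "(P has_real_derivative - inner (G r) (v r) + epsz * (- a (W r) (W r) - inner (G r) (J (W r)) + inner (M (v r)) (v r))) (at r)"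
    unfolding P_def by (intro DERIV_add DERIV_cmult energy_deriv[OF s r(1)] 1)
   moreover have "- inner (G r) (v r) + epsz * (- a (W r) (W r) - inner (G r) (J (W r)) + inner (M (v r)) (v r)) <= - gmz * P r + c * \<rho>^2"
   proof -
    have GJ: "- inner (G r) (J (W r)) <= (N * V r + \<rho>) * (j * A r)"
    proof -
     have "- inner (G r) (J (W r)) <= norm (G r) * norm (J (W r))" using Cauchy_Schwarz_ineq2[of "G r" "J (W r)"] by linarith
     also have "... <= (N * V r + \<rho>) * (j * A r)"
      using h(2)[OF r'(2)] JA[OF r'(1)] N V0[of r] \<rho> by (intro mult_mono) (auto simp: V_def)
     finally show ?thesis .
    qed
    have y1: "\<rho> * V r <= m / 4 * (V r)^2 + \<rho>^2 / m"
    proof -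
     have "0 <= (m / 2 * V r - \<rho>)^2 / m" using m by simp
     also have "... = m / 4 * (V r)^2 + \<rho>^2 / m - \<rho> * V r" using m by (simp add: power2_eq_square field_simps)
     finally show ?thesis by simp
    qed
    have y2: "N * V r * (j * A r) <= (A r)\<^sup>2 / 4 + N\<^sup>2 * j\<^sup>2 * (V r)\<^sup>2"
     using zero_le_power2[of "A r / 2 - N * j * V r"] by (simp add: power2_eq_square algebra_simps)
    have y3: "\<rho> * (j * A r) <= (A r)^2 / 4 + \<rho>^2 * j^2"
     using zero_le_power2[of "A r / 2 - \<rho> * j"] by (simp add: power2_eq_square algebra_simps)
    have "epsz * (- a (W r) (W r) - inner (G r) (J (W r)) + inner (M (v r)) (v r))
      <= epsz * (- (A r)\<^sup>2 / 2 + N\<^sup>2 * j\<^sup>2 * (V r)\<^sup>2 + \<rho>\<^sup>2 * j\<^sup>2 + B * (V r)\<^sup>2)"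
     using epsz GJ y2 y3 Mv(2)[of r] A2[OF r'(1)] by (intro mult_left_mono) (auto simp: distrib_right)
    also have "... = - epsz / 2 * (A r)\<^sup>2 + epsz * (N\<^sup>2 * j\<^sup>2 + B) * (V r)\<^sup>2 + epsz * j\<^sup>2 * \<rho>\<^sup>2"
     by (simp add: algebra_simps)
    also have "... <= - epsz / 2 * (A r)^2 + m / 4 * (V r)^2 + epsz * j^2 * \<rho>^2"
     by (intro add_mono mult_right_mono e2 order_refl) simp
    finally have "- inner (G r) (v r) + epsz * (- a (W r) (W r) - inner (G r) (J (W r)) + inner (M (v r)) (v r))
      <= - (epsz / 2) * (A r)^2 - m / 2 * (V r)^2 + c * \<rho>^2"
     using h(1)[OF r'(2)] y1 by (simp add: V_def c_def distrib_right)
    moreover have "gmz * P r <= (epsz / 2) * (A r)^2 + m / 2 * (V r)^2"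
    proof -
     have "energy (W r) (v r) <= (A r)^2 / 2 + B * (V r)^2 / 2"
      using A2[OF r'(1)] Mv(2)[of r] by (simp add: energy_def)
     then have "P r <= 3 / 4 * (A r)^2 + 3 / 4 * B * (V r)^2"
      using Pe[OF r'(1)] by linarith
     then have "gmz * P r <= gmz * (3 / 4 * (A r)^2 + 3 / 4 * B * (V r)^2)" using gmz by (intro mult_left_mono) auto
     also have "... = (3 / 4 * gmz) * (A r)^2 + (3 / 4 * gmz * B) * (V r)^2" by (simp add: algebra_simps)
     also have "... <= (epsz / 2) * (A r)^2 + m / 2 * (V r)^2"
      by (intro add_mono mult_right_mono g1 g2) auto
     finally show ?thesis .
    qed
    ultimately show ?thesis by simp
   qed
   ultimately show ?thesis by blast
  qed
  \<comment> \<open>The equilibrium level of the inequality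
    \<open>y \<le> - gmz * P r + c * \<rho>^2\<close>; above it \<open>P - R\<close> decays
    exponentially.\<close>
  define R where "R = c * \<rho>^2 / gmz"
  have R: "0 <= R" using c gmz by (simp add: R_def)
  have "exp (gmz * (t - s)) * (P t - R) <= exp (gmz * (s - s)) * (P s - R)"
  proof (cases "s = t")
   case False
   show ?thesis
   proof (rule DERIV_nonpos_imp_decreasing_open[of s t "%r. exp (gmz * (r - s)) * (P r - R)"])
    fix r assume r: "s < r" "r < t"
    obtain y where y: "(P has_real_derivative y) (at r)" "y <= - gmz * P r + c * \<rho>^2" using Pd[OF r] by blast
    have "((%r. exp (gmz * (r - s)) * (P r - R)) has_real_derivative exp (gmz * (r - s)) * (y + gmz * (P r - R))) (at r)"
     by (rule derivative_eq_intros y refl)+ (simp add: algebra_simps)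
    moreover have "exp (gmz * (r - s)) * (y + gmz * (P r - R)) <= 0"
     using y(2) gmz by (intro mult_nonneg_nonpos) (auto simp: R_def right_diff_distrib)
    ultimately show "\<exists>y. ((%r. exp (gmz * (r - s)) * (P r - R)) has_real_derivative y) (at r) & y <= 0" by blast
   next
    have "continuous_on {s..} P"
     unfolding P_def
     by (intro continuous_intros energy_continuous[OF s] M.continuous_on J.continuous_on sol_cont[OF s])
    then show "continuous_on {s..t} (%r. exp (gmz * (r - s)) * (P r - R))"
     by (intro continuous_intros) (auto intro: continuous_on_subset)
   qed (use st False in auto)
  qed simp
  then have "exp (- gmz * (t - s)) * (exp (gmz * (t - s)) * (P t - R)) <= exp (- gmz * (t - s)) * (P s - R)"
   by (intro mult_left_mono) auto
  then have "P t - R <= exp (- gmz * (t - s)) * (P s - R)" by (simp add: mult.assoc[symmetric] exp_add[symmetric])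
  also have "... <= exp (- gmz * (t - s)) * P s" using R by (intro mult_left_mono) auto
  finally have 1: "P t <= exp (- gmz * (t - s)) * P s + R" by simp
  have 2: "exp (- gmz * (t - s)) * P s <= exp (- gmz * (t - s)) * (3 / 2 * energy (W s) (v s))"
  proof (intro mult_left_mono)
   have "P s - energy (W s) (v s) <= energy (W s) (v s) / 2" using Pe[of s] by linarith
   then show "P s <= 3 / 2 * energy (W s) (v s)" by simp
  qed simp
  have "energy (W t) (v t) <= 2 * P t" using Pe[OF st] energy_nonneg[OF WK[OF st], of "v t"] by linarith
  then have "energy (W t) (v t) <= 3 * (exp (- gmz * (t - s)) * energy (W s) (v s)) + 2 * c / gmz * \<rho>^2"
  proof -
   have "exp (- gmz * (t - s)) * (3 / 2 * energy (W s) (v s)) = 3 / 2 * (exp (- gmz * (t - s)) * energy (W s) (v s))"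
    by simp
   moreover have "2 * c / gmz * \<rho>^2 = 2 * R" by (simp add: R_def)
   ultimately show ?thesis using 1 2 \<open>energy (W t) (v t) <= 2 * P t\<close> by linarith
  qed
  also have "... <= (3 + 2 * c / gmz) * (exp (- gmz * (t - s)) * energy (W s) (v s)) + (3 + 2 * c / gmz) * \<rho>^2"
   using c gmz energy_nonneg[OF WK[of s], of "v s"] by (intro add_mono mult_right_mono) auto
  finally show ?thesis by (simp add: distrib_left)
 qed
 show ?thesis
  using c gmz by (intro exI[of _ "3 + 2 * c / gmz"] exI[of _ gmz] conjI allI impI key) (auto intro: add_pos_pos)
qed

end

section \<open>Coverings by pieces of small diameter, and fractal dimension\<close>

text \<open>\<open>D\<close> need not be a metric, so distances of images under a flow and
  pseudo-distances of states are covered by the same notion. Pieces are measured by diameter and lie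
  in \<open>A\<close>, so any point of a piece can serve as its centre.\<close>

definition covered :: "('a => 'a => real) => 'a set => real => real => bool" where
 "covered D A c r \<longleftrightarrow> (\<exists>\<Q>. finite \<Q> & real (card \<Q>) <= c & A \<subseteq> \<Union>\<Q> \<and>
  (\<forall>Q\<in>\<Q>. Q \<subseteq> A & (\<forall>x\<in>Q. \<forall>y\<in>Q. D x y <= r)))"

lemma coveredI:
 assumes "finite \<Q>" "real (card \<Q>) <= c" "A \<subseteq> \<Union>\<Q>" "!!Q x y. Q \<in> \<Q> ==> x \<in> Q ==> y \<in> Q ==> x \<in> A ==> y \<in> A ==> D x y <= r"
 shows "covered D A c r"
 unfolding covered_def
proof (intro exI conjI ballI)
 show "finite ((\<inter>) A ` \<Q>)" using assms(1) by simp
 have "real (card ((\<inter>) A ` \<Q>)) <= real (card \<Q>)" using card_image_le[OF assms(1)] by simp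
 then show "real (card ((\<inter>) A ` \<Q>)) <= c" using assms(2) by linarith
 show "A \<subseteq> \<Union> ((\<inter>) A ` \<Q>)" using assms(3) by blast
 fix Q assume "Q \<in> (\<inter>) A ` \<Q>"
 then obtain P where P: "P \<in> \<Q>" "Q = A \<inter> P" by blast
 then show "Q \<subseteq> A" by blast
 fix x y assume "x \<in> Q" "y \<in> Q"
 then show "D x y <= r" using assms(4)[OF P(1)] P(2) by blast
qed

lemma coveredE:
 assumes "covered D A c r"
 obtains \<Q> where "finite \<Q>" "real (card \<Q>) <= c" "A \<subseteq> \<Union>\<Q>" "\<forall>Q\<in>\<Q>. Q \<subseteq> A"
  "\<forall>Q\<in>\<Q>. \<forall>x\<in>Q. \<forall>y\<in>Q. D x y <= r"
proof -
 obtain \<Q> where h: "finite \<Q> & real (card \<Q>) <= c & A \<subseteq> \<Union>\<Q> \<and>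
  (\<forall>Q\<in>\<Q>. Q \<subseteq> A & (\<forall>x\<in>Q. \<forall>y\<in>Q. D x y <= r))"
  using assms unfolding covered_def by (rule exE)
 show thesis by (rule that[of \<Q>]) (use h in blast)+
qed

lemma covered_mono:
 assumes "covered D A c r" "c <= c'" "r <= r'" shows "covered D A c' r'"
 using assms(1)
proof (rule coveredE)
 fix \<Q> assume Q: "finite \<Q>" "real (card \<Q>) <= c" "A \<subseteq> \<Union>\<Q>" "\<forall>Q\<in>\<Q>. \<forall>x\<in>Q. \<forall>y\<in>Q. D x y <= r"
 show ?thesis
  by (rule coveredI[OF Q(1) order_trans[OF Q(2) assms(2)] Q(3)]) (rule order_trans[OF Q(4)[rule_format] assms(3)])
qed

lemma covered_subset:
 assumes "covered D A c r" "B \<subseteq> A" shows "covered D B c r"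
 using assms(1)
proof (rule coveredE)
 fix \<Q> assume Q: "finite \<Q>" "real (card \<Q>) <= c" "A \<subseteq> \<Union>\<Q>" "\<forall>Q\<in>\<Q>. \<forall>x\<in>Q. \<forall>y\<in>Q. D x y <= r"
 show ?thesis
  by (rule coveredI[OF Q(1,2) order_trans[OF assms(2) Q(3)] Q(4)[rule_format]])
qed

lemma covered_Un:
 assumes "covered D A c r" "covered D B c' r"
 shows "covered D (A \<union> B) (c + c') r"
proof -
 obtain \<Q> where Q: "finite \<Q>" "real (card \<Q>) <= c" "A \<subseteq> \<Union>\<Q>" "\<forall>Q\<in>\<Q>. Q \<subseteq> A"
  "\<forall>Q\<in>\<Q>. \<forall>x\<in>Q. \<forall>y\<in>Q. D x y <= r"
  by (rule coveredE[OF assms(1)])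
 obtain \<R> where R: "finite \<R>" "real (card \<R>) <= c'" "B \<subseteq> \<Union>\<R>" "\<forall>Q\<in>\<R>. Q \<subseteq> B"
  "\<forall>Q\<in>\<R>. \<forall>x\<in>Q. \<forall>y\<in>Q. D x y <= r"
  by (rule coveredE[OF assms(2)])
 have "card (\<Q> \<union> \<R>) <= card \<Q> + card \<R>" by (rule card_Un_le)
 then have c: "real (card (\<Q> \<union> \<R>)) <= c + c'" using Q(2) R(2) by linarith
 show ?thesis
 proof (rule coveredI[OF _ c])
  show "finite (\<Q> \<union> \<R>)" using Q(1) R(1) by simp
  show "A \<union> B \<subseteq> \<Union> (\<Q> \<union> \<R>)" using Q(3) R(3) by blast
  show "D x y <= r" if "Z \<in> \<Q> \<union> \<R>" "x \<in> Z" "y \<in> Z" for Z x y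
   using that(1) Q(5)[rule_format, OF _ that(2,3)] R(5)[rule_format, OF _ that(2,3)] by blast
 qed
qed

lemma covered_UN:
 assumes "finite I" "!!i. i \<in> I ==> covered D (A i) c r"
 shows "covered D (\<Union>i\<in>I. A i) (real (card I) * c) r"
 using assms
proof (induction I rule: finite_induct)
 case empty
 show ?case by (rule coveredI[of "{}"]) auto
next
 case (insert i I)
 have "covered D (A i \<union> (\<Union>i\<in>I. A i)) (c + real (card I) * c) r"
  using insert by (intro covered_Un) auto
 then show ?case using insert by (simp add: distrib_right)
qed

text \<open>The transport principle: counts pass from one space to another, or from images back to
  initial points, whenever \<open>f\<close> does not decrease the distance used.\<close>

lemma covered_vimage:
 assumes "covered D A c r" "!!x. x \<in> B ==> f x \<in> A" "!!x y. x \<in> B ==> y \<in> B ==> D' x y <= D (f x) (f y)"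
 shows "covered D' B c r"
proof -
 obtain \<Q> where Q: "finite \<Q>" "real (card \<Q>) <= c" "A \<subseteq> \<Union>\<Q>" "\<forall>Q\<in>\<Q>. Q \<subseteq> A"
  "\<forall>Q\<in>\<Q>. \<forall>x\<in>Q. \<forall>y\<in>Q. D x y <= r"
  by (rule coveredE[OF assms(1)])
 have c: "real (card ((-`) f ` \<Q>)) <= c" using card_image_le[OF Q(1), of "(-`) f"] Q(2) by linarith
 show ?thesis
 proof (rule coveredI[OF _ c])
  fix P x y assume "P \<in> (-`) f ` \<Q>" "x \<in> P" "y \<in> P" and xy: "x \<in> B" "y \<in> B"
  then obtain Q where "Q \<in> \<Q>" "f x \<in> Q" "f y \<in> Q" by blast
  then have "D (f x) (f y) <= r" by (rule Q(5)[rule_format])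
  then show "D' x y <= r" using assms(3)[OF xy] by linarith
 next
  show "B \<subseteq> \<Union> ((-`) f ` \<Q>)"
  proof
   fix x assume "x \<in> B"
   then obtain Q where "Q \<in> \<Q>" "f x \<in> Q" using assms(2) Q(3) by blast
   then show "x \<in> \<Union> ((-`) f ` \<Q>)" by blast
  qed
 qed (use Q(1) in simp)
qed

text \<open>For a given radius take the first \<open>n\<close> with \<open>C * \<theta> ^ n\<close>
  below it; this \<open>n\<close> grows like \<open>ln (1 / epsz)\<close>, and so does the logarithm
  of the number of pieces.\<close>

lemma fractal_dim_finite:
 assumes C: "1 <= C" and N: "1 <= N" and \<theta>: "0 < \<theta>" "\<theta> < 1"
  and cov: "!!n. covered D A (C * N ^ n) (C * \<theta> ^ n)"
 shows "fractal_dim D A < \<infinity>"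
proof -
 have cover: "\<exists>F. finite F & real (card F) <= C * N ^ n & F \<subseteq> A & A \<subseteq> (\<Union>c\<in>F. {x. D c x <= 2 * epsz})"
  if "C * \<theta> ^ n <= 2 * epsz" for n epsz
 proof -
  obtain \<Q> where Q: "finite \<Q>" "real (card \<Q>) <= C * N ^ n" "A \<subseteq> \<Union>\<Q>"
   "\<forall>Q\<in>\<Q>. Q \<subseteq> A" "\<forall>Q\<in>\<Q>. \<forall>x\<in>Q. \<forall>y\<in>Q. D x y <= C * \<theta> ^ n"
   by (rule coveredE[OF cov[of n]])
  \<comment> \<open>The centres in \<open>cover_num\<close> must belong to the set itself, so they
    are picked from the nonempty pieces.\<close>
  define pk where "pk Q = (SOME x. x \<in> Q)" for Q :: "'a set"
  have pk: "pk Q \<in> Q" if "Q ~= {}" for Q using that unfolding pk_def by (simp add: some_in_eq)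
  define F where "F = pk ` (\<Q> - {{}})"
  have "card F <= card (\<Q> - {{}})" unfolding F_def using Q(1) by (intro card_image_le) simp
  also have "... <= card \<Q>" using Q(1) by (intro card_mono) auto
  finally have cF: "real (card F) <= C * N ^ n" using Q(2) by linarith
  have "A \<subseteq> (\<Union>c\<in>F. {x. D c x <= 2 * epsz})"
  proof
   fix x assume "x \<in> A"
   then obtain P where P: "P \<in> \<Q>" "x \<in> P" using Q(3) by blast
   then have "pk P \<in> F" "D (pk P) x <= C * \<theta> ^ n" using pk[of P] Q(5)[rule_format, of P "pk P" x] by (auto simp: F_def)
   then show "x \<in> (\<Union>c\<in>F. {x. D c x <= 2 * epsz})" using that by force
  qed
  moreover have "F \<subseteq> A"
   unfolding F_def by (rule image_subsetI) (use pk Q(4) in blast)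
  moreover have "finite F" using Q(1) by (simp add: F_def)
  ultimately show ?thesis using cF by blast
 qed
 define \<mu> where "\<mu> = ln (1 / \<theta>)"
 have \<mu>: "\<mu> > 0" using \<theta> by (simp add: \<mu>_def)
 have nex: "\<exists>n. C * \<theta> ^ n <= 2 * epsz & real n <= 1 + (ln C + ln (1 / epsz)) / \<mu>" if epsz: "0 < epsz" "epsz < exp (- 1)" for epsz
 proof -
  define x where "x = (ln C + ln (1 / epsz)) / \<mu>"
  have "epsz < 1" using epsz(2) by (smt (verit) exp_less_one_iff)
  then have "0 <= ln (1 / epsz)" using epsz by simp
  then have x0: "0 <= x" using C \<mu> by (simp add: x_def)
  define n where "n = nat \<lceil>x\<rceil>"
  have n: "x <= real n" "real n <= 1 + x" using x0 by (auto simp: n_def) linarith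
  have "\<theta> ^ n = exp (- (real n * \<mu>))"
   using \<theta> by (simp add: \<mu>_def ln_div exp_of_nat_mult)
  also have "... <= exp (- (x * \<mu>))" using n \<mu> by (simp add: mult_right_mono)
  also have "... = epsz / C" using \<mu> C epsz by (simp add: x_def exp_diff exp_minus exp_add ln_div) 
  finally have "C * \<theta> ^ n <= epsz" using C by (simp add: field_simps)
  then show ?thesis using n epsz by (intro exI[of _ n]) (auto simp: x_def)
 qed
 have all: "\<forall>epsz>0. \<exists>F. finite F & F \<subseteq> A & A \<subseteq> (\<Union>c\<in>F. {x. D c x <= 2 * epsz})"
 proof (intro allI impI)
  fix epsz :: real assume epsz: "epsz > 0"
  define e where "e = min epsz (exp (- 1) / 2)"
  have "0 < e" "e < exp (- 1)" "e <= epsz" using epsz by (auto simp: e_def min_def)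
  then obtain n where "C * \<theta> ^ n <= 2 * e" using nex by blast
  then show "\<exists>F. finite F & F \<subseteq> A & A \<subseteq> (\<Union>c\<in>F. {x. D c x <= 2 * epsz})"
   using cover[of n epsz] \<open>e <= epsz\<close> by auto
 qed
 \<comment> \<open>For radii below \<open>exp (- 1)\<close> one has
   \<open>ln (1 / epsz) > 1\<close>, so the additive constants \<open>ln C\<close> and 1 are
   absorbed into multiples of this logarithm.\<close>
 define b where "b = ln C + (1 + ln C / \<mu> + 1 / \<mu>) * ln N"
 have "Limsup (at_right 0) (%epsz. ereal (ln (real (cover_num D A epsz)) / ln (1 / epsz))) <= ereal b"
 proof (rule Limsup_bounded)
  show "\<forall>\<^sub>F epsz in at_right 0. ereal (ln (real (cover_num D A epsz)) / ln (1 / epsz)) <= ereal b"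
   unfolding eventually_at_right_field
  proof (intro exI[of _ "exp (- 1) :: real"] conjI allI impI)
   fix epsz :: real assume epsz: "0 < epsz" "epsz < exp (- 1)"
   obtain n where n: "C * \<theta> ^ n <= 2 * epsz" "real n <= 1 + (ln C + ln (1 / epsz)) / \<mu>" using nex[OF epsz] by blast
   obtain F where F: "finite F" "real (card F) <= C * N ^ n" "F \<subseteq> A" "A \<subseteq> (\<Union>c\<in>F. {x. D c x <= 2 * epsz})"
    using cover[OF n(1)] by blast
   have "cover_num D A epsz <= card F"
    unfolding cover_num_def by (rule cInf_lower) (use F in auto)
   then have cn: "real (cover_num D A epsz) <= C * N ^ n" using F(2) by linarith
   have l1: "1 < ln (1 / epsz)"
   proof -
    have "ln epsz < ln (exp (- 1))" using epsz by (subst ln_less_cancel_iff) auto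
    then show ?thesis using epsz by (simp add: ln_div)
   qed
   have CN: "1 <= C * N ^ n" using mult_mono[of 1 C 1 "N ^ n"] C N by simp
   have "ln (real (cover_num D A epsz)) <= ln (C * N ^ n)"
   proof (cases "cover_num D A epsz = 0")
    \<comment> \<open>The cover number of an empty set is 0, and \<open>ln 0 = 0\<close> by
      convention.\<close>
    case True then show ?thesis using CN by simp
   next
    case False then show ?thesis using cn CN by (subst ln_le_cancel_iff) auto
   qed
   also have "... = ln C + real n * ln N" using C N by (simp add: ln_mult ln_realpow)
   also have "... <= ln C + (1 + (ln C + ln (1 / epsz)) / \<mu>) * ln N"
    using n(2) N by (intro add_left_mono mult_right_mono) auto
   also have "... <= b * ln (1 / epsz)"
   proof -
    have p: "0 <= ln C" "0 <= ln N" "0 <= ln C / \<mu>" using C N \<mu> by auto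
    have "ln C <= ln C * ln (1 / epsz)" using p l1 by (simp add: mult_le_cancel_left1)
    moreover have "1 + (ln C + ln (1 / epsz)) / \<mu> <= (1 + ln C / \<mu> + 1 / \<mu>) * ln (1 / epsz)"
    proof -
     have "1 + ln C / \<mu> <= (1 + ln C / \<mu>) * ln (1 / epsz)" using p l1 mult_left_mono[of 1 "ln (1 / epsz)" "1 + ln C / \<mu>"] by simp
     then show ?thesis by (simp add: add_divide_distrib distrib_right)
    qed
    then have "(1 + (ln C + ln (1 / epsz)) / \<mu>) * ln N <= (1 + ln C / \<mu> + 1 / \<mu>) * ln (1 / epsz) * ln N"
     using p by (intro mult_right_mono) auto
    ultimately show ?thesis by (simp add: b_def algebra_simps)
   qed
   finally show "ereal (ln (real (cover_num D A epsz)) / ln (1 / epsz)) <= ereal b"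
    using l1 by (simp add: pos_divide_le_eq)
  qed simp
 qed
 then show ?thesis using all by (auto simp: fractal_dim_def intro: le_less_trans)
qed

section \<open>Semiflows with a compact attractor: absorbing set, quasi-stability, exponential
  attractor\<close>

locale attracted_semiflow =
 fixes X :: "'e::metric_space set" and sg :: "real => 'e => 'e" and A :: "'e set"
 assumes maps: "0 <= t ==> x \<in> X ==> sg t x \<in> X"
  and zero: "x \<in> X ==> sg 0 x = x"
  and semigroup: "0 <= s ==> 0 <= t ==> x \<in> X ==> sg (s + t) x = sg s (sg t x)"
  and cont: "x \<in> X ==> continuous_on {0..} (%t. sg t x)"
  and X_ne: "X ~= {}"
  and A_sub: "A \<subseteq> X"
  and A_compact: "compact A"
  and A_inv: "0 <= t ==> sg t ` A = A"
  and attracts: "B \<subseteq> X ==> bounded B ==> 0 < epsz ==> \<exists>T. \<forall>t\<ge>T. \<forall>x\<in>B. \<exists>a\<in>A. dist (sg t x) a < epsz"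
begin

definition nbhd :: "'e set" where "nbhd = {x \<in> X. \<exists>a\<in>A. dist x a < 1}"

definition absorb_time :: real where
 "absorb_time = (SOME T. 0 <= T & (\<forall>t\<ge>T. sg t ` nbhd \<subseteq> nbhd))"

text \<open>The 1-neighbourhood of \<open>A\<close> absorbs bounded sets but need not be invariant.
  Its forward images from the time on at which it absorbs itself form an invariant set that still
  lies inside it and still absorbs.\<close>

definition absorbing :: "'e set" where
 "absorbing = (\<Union>t\<in>{absorb_time..}. sg t ` nbhd)"

lemma A_ne: "A ~= {}"
proof -
 obtain x where x: "x \<in> X" using X_ne by blast
 obtain T where "\<forall>t\<ge>T. \<forall>x\<in>{x}. \<exists>a\<in>A. dist (sg t x) a < 1"
  using attracts[of "{x}" 1] x by auto
 then show ?thesis by force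
qed

lemma nbhd_absorbs:
 assumes "B \<subseteq> X" "bounded B"
 shows "\<exists>T\<ge>0. \<forall>t\<ge>T. sg t ` B \<subseteq> nbhd"
proof -
 obtain T where T: "\<forall>t\<ge>T. \<forall>x\<in>B. \<exists>a\<in>A. dist (sg t x) a < 1"
  using attracts[OF assms zero_less_one] by blast
 then show ?thesis using assms(1) maps
  by (intro exI[of _ "max 0 T"]) (auto simp: nbhd_def)
qed

lemma nbhd_bounded: "nbhd \<subseteq> X" "bounded nbhd"
proof -
 obtain a0 r where "\<forall>a\<in>A. dist a0 a <= r" using compact_imp_bounded[OF A_compact] by (auto simp: bounded_def)
 then have "dist a0 x <= r + 1" if "x \<in> nbhd" for x
  using that unfolding nbhd_def by (smt (verit) dist_triangle dist_commute mem_Collect_eq)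
 then show "bounded nbhd" unfolding bounded_def by blast
qed (auto simp: nbhd_def)

lemma absorb_time: "0 <= absorb_time" "absorb_time <= t ==> sg t ` nbhd \<subseteq> nbhd"
proof -
 have "\<exists>T. 0 <= T & (\<forall>t\<ge>T. sg t ` nbhd \<subseteq> nbhd)" using nbhd_absorbs[OF nbhd_bounded] by blast
 from someI_ex[OF this] show "0 <= absorb_time" "absorb_time <= t ==> sg t ` nbhd \<subseteq> nbhd"
  by (auto simp: absorb_time_def)
qed

lemma absorbing_sub: "absorbing \<subseteq> nbhd" "absorbing \<subseteq> X" "bounded absorbing"
proof -
 show "absorbing \<subseteq> nbhd" using absorb_time(2) by (fastforce simp: absorbing_def)
 then show "absorbing \<subseteq> X" "bounded absorbing" using nbhd_bounded by (auto intro: bounded_subset)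
qed

lemma absorbing_inv:
 assumes "0 <= t" "x \<in> absorbing" shows "sg t x \<in> absorbing"
proof -
 obtain s y where s: "absorb_time <= s" "y \<in> nbhd" "x = sg s y" using assms by (auto simp: absorbing_def)
 then have "sg t x = sg (t + s) y" using assms absorb_time(1) nbhd_bounded(1) by (subst semigroup) auto
 then show ?thesis using s assms by (auto simp: absorbing_def)
qed

lemma A_absorbing: "A \<subseteq> absorbing"
proof -
 have "A = sg absorb_time ` A" using A_inv[OF absorb_time(1)] by simp
 also have "... \<subseteq> sg absorb_time ` nbhd"
 proof (rule image_mono, rule subsetI)
  fix x assume "x \<in> A"
  then show "x \<in> nbhd" using A_sub unfolding nbhd_def by (intro CollectI conjI bexI[of _ x]) auto
 qed
 also have "... \<subseteq> absorbing" by (auto simp: absorbing_def)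
 finally show ?thesis .
qed

lemma absorbing_absorbs:
 assumes "B \<subseteq> X" "bounded B"
 shows "\<exists>T\<ge>0. \<forall>t\<ge>T. sg t ` B \<subseteq> absorbing"
proof -
 obtain T where T: "0 <= T" "\<forall>t\<ge>T. sg t ` B \<subseteq> nbhd" using nbhd_absorbs[OF assms] by blast
 have "sg t x \<in> absorbing" if "absorb_time + T <= t" "x \<in> B" for t x
 proof -
  have "sg (absorb_time + (t - absorb_time)) x = sg absorb_time (sg (t - absorb_time) x)"
   using that absorb_time(1) T assms(1) by (intro semigroup) auto
  moreover have "sg (t - absorb_time) x \<in> nbhd" using T(2)[rule_format, of "t - absorb_time"] that by auto
  ultimately show ?thesis by (force simp: absorbing_def)
 qed
 then show ?thesis using T absorb_time(1) by (intro exI[of _ "absorb_time + T"]) auto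
qed

end

text \<open>Quasi-stability: up to finitely many Lipschitz functionals the time-\<open>\<tau>\<close> map is a contraction of the absorbing set.\<close>

locale quasi_stable_semiflow = attracted_semiflow X sg A
 for X :: "'e::metric_space set" and sg and A +
 fixes \<tau> Lip K :: real and \<Lambda> :: "('e => real) set"
 assumes \<tau>: "0 < \<tau>"
  and Lip: "t \<in> {0..\<tau>} ==> x \<in> absorbing ==> y \<in> absorbing ==> dist (sg t x) (sg t y) <= Lip * dist x y"
  and \<Lambda>_finite: "finite \<Lambda>"
  and \<Lambda>_Lip: "f \<in> \<Lambda> ==> x \<in> absorbing ==> y \<in> absorbing ==> \<bar>f x - f y\<bar> <= K * dist x y"
  and quasi: "x \<in> absorbing ==> y \<in> absorbing ==> dist (sg \<tau> x) (sg \<tau> y) <= dist x y / 4 + (\<Sum>f\<in>\<Lambda>. \<bar>f x - f y\<bar>)"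
  and local_bounded: "B \<subseteq> X ==> bounded B ==> bounded (\<Union>t\<in>{0..T}. sg t ` B)"
begin

text \<open>Pigeonhole on the quantised values of the functionals; by scaling, the number of pieces does not depend on \<open>r\<close>.\<close>

lemma split_pieces:
 "\<exists>N\<ge>1. \<forall>P r. P \<subseteq> absorbing --> 0 < r --> (\<forall>x\<in>P. \<forall>y\<in>P. dist x y <= r) -->
  covered (%x y. dist (sg \<tau> x) (sg \<tau> y)) P (real N) (r / 2)"
proof -
 \<comment> \<open>With this mesh all functionals together contribute at most \<open>r / 4\<close>;
   the contraction in \<open>quasi\<close> contributes another \<open>r / 4\<close>.\<close>
 define \<kappa> where "\<kappa> = 1 / (4 * (real (card \<Lambda>) + 1))"
 have \<kappa>: "0 < \<kappa>" by (simp add: \<kappa>_def add_nonneg_pos)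
 define m where "m = \<lceil>\<bar>K\<bar> / \<kappa>\<rceil> + 1"
 define Z where "Z = Pi\<^sub>E \<Lambda> (%_. {- m..m})"
 have Z: "finite Z" unfolding Z_def using \<Lambda>_finite by (intro finite_PiE) auto
 have cov: "covered (%x y. dist (sg \<tau> x) (sg \<tau> y)) P (real (card Z + 1)) (r / 2)"
  if P: "P \<subseteq> absorbing" and r: "0 < r" and d: "!!x y. x \<in> P ==> y \<in> P ==> dist x y <= r" for P r
 proof (cases "P = {}")
  case True then show ?thesis by (intro coveredI[of "{}"]) auto
 next
  case False
  then obtain x0 where x0: "x0 \<in> P" by blast
  define c where "c x = (\<lambda>f\<in>\<Lambda>. \<lfloor>(f x - f x0) / (\<kappa> * r)\<rfloor>)" for x
  have cZ: "c x \<in> Z" if x: "x \<in> P" for x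
   unfolding Z_def c_def
  proof (rule restrict_PiE_iff[THEN iffD2], rule ballI)
   fix f assume f: "f \<in> \<Lambda>"
   have "\<bar>f x - f x0\<bar> <= K * dist x x0" using \<Lambda>_Lip[OF f] x x0 P by blast
   also have "... <= \<bar>K\<bar> * r" using d[OF x x0] by (intro mult_mono) auto
   finally have "\<bar>(f x - f x0) / (\<kappa> * r)\<bar> <= \<bar>K\<bar> * r / (\<kappa> * r)"
    using \<kappa> r divide_right_mono[of "\<bar>f x - f x0\<bar>" "\<bar>K\<bar> * r" "\<kappa> * r"] by (simp add: abs_mult)
   then have "\<bar>(f x - f x0) / (\<kappa> * r)\<bar> <= \<bar>K\<bar> / \<kappa>" using r by simp
   moreover have "\<bar>K\<bar> / \<kappa> <= real_of_int m - 1" by (simp add: m_def)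
   ultimately have "- real_of_int m <= (f x - f x0) / (\<kappa> * r)" "(f x - f x0) / (\<kappa> * r) < real_of_int m + 1" by linarith+
   then show "\<lfloor>(f x - f x0) / (\<kappa> * r)\<rfloor> \<in> {- m..m}" by (auto simp: le_floor_iff floor_le_iff)
  qed
  show ?thesis
  proof (rule coveredI)
   show "finite ((%z. {x \<in> P. c x = z}) ` Z)" using Z by simp
   show "real (card ((%z. {x \<in> P. c x = z}) ` Z)) <= real (card Z + 1)"
    using card_image_le[OF Z, of "%z. {x \<in> P. c x = z}"] by linarith
   show "P \<subseteq> \<Union> ((%z. {x \<in> P. c x = z}) ` Z)" using cZ by auto
   fix Q x y assume "Q \<in> (%z. {x \<in> P. c x = z}) ` Z" "x \<in> Q" "y \<in> Q"
   then have xy: "x \<in> P" "y \<in> P" "c x = c y" by auto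
   have "\<bar>f x - f y\<bar> <= \<kappa> * r" if f: "f \<in> \<Lambda>" for f
   proof -
    have "\<lfloor>(f x - f x0) / (\<kappa> * r)\<rfloor> = \<lfloor>(f y - f x0) / (\<kappa> * r)\<rfloor>"
     using fun_cong[OF xy(3), of f] f by (simp add: c_def)
    then have "\<bar>(f x - f x0) / (\<kappa> * r) - (f y - f x0) / (\<kappa> * r)\<bar> <= 1" by linarith
    then have "\<bar>(f x - f y) / (\<kappa> * r)\<bar> <= 1" by (simp add: diff_divide_distrib)
    then show ?thesis using \<kappa> r by (simp add: abs_mult pos_divide_le_eq)
   qed
   then have "(\<Sum>f\<in>\<Lambda>. \<bar>f x - f y\<bar>) <= real (card \<Lambda>) * (\<kappa> * r)" by (intro sum_bounded_above)
   also have "... <= r / 4"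
   proof -
    have "real (card \<Lambda>) * \<kappa> <= 1 / 4" by (simp add: \<kappa>_def field_simps)
    then show ?thesis using mult_right_mono[of "real (card \<Lambda>) * \<kappa>" "1 / 4" r] r by (simp add: mult.assoc)
   qed
   finally show "dist (sg \<tau> x) (sg \<tau> y) <= r / 2"
    using quasi[of x y] d[OF xy(1,2)] xy P by fastforce
  qed
 qed
 then show ?thesis by (intro exI[of _ "card Z + 1"]) auto
qed

definition mult_const :: nat where
 "mult_const = (SOME N. 1 <= N & (\<forall>P r. P \<subseteq> absorbing --> 0 < r --> (\<forall>x\<in>P. \<forall>y\<in>P. dist x y <= r) -->
  covered (%x y. dist (sg \<tau> x) (sg \<tau> y)) P (real N) (r / 2)))"

lemma mult_const:
 "1 <= mult_const"
 "P \<subseteq> absorbing ==> 0 < r ==> (!!x y. x \<in> P ==> y \<in> P ==> dist x y <= r) ==>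
  covered (%x y. dist (sg \<tau> x) (sg \<tau> y)) P (real mult_const) (r / 2)"
 using someI_ex[OF split_pieces] unfolding mult_const_def by blast+

definition diam0 :: real where
 "diam0 = (SOME r. 0 < r & (\<forall>x\<in>absorbing. \<forall>y\<in>absorbing. dist x y <= r))"

lemma diam0: "0 < diam0" "x \<in> absorbing ==> y \<in> absorbing ==> dist x y <= diam0"
proof -
 obtain a r where a: "\<forall>x\<in>absorbing. dist a x <= r" using absorbing_sub(3) by (auto simp: bounded_def)
 have "dist x y <= max 1 (2 * r)" if "x \<in> absorbing" "y \<in> absorbing" for x y
  using a that dist_triangle[of x y a] by (smt (verit) dist_commute)
 then have "\<exists>r. 0 < r & (\<forall>x\<in>absorbing. \<forall>y\<in>absorbing. dist x y <= r)" by (intro exI[of _ "max 1 (2 * r)"]) auto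
 from someI_ex[OF this] show "0 < diam0" "x \<in> absorbing ==> y \<in> absorbing ==> dist x y <= diam0"
  by (auto simp: diam0_def)
qed

text \<open>The pieces consist of initial points but their size is measured after time
  \<open>n \<tau>\<close>. One more step splits each piece into \<open>mult_const\<close> parts and
  halves the diameter.\<close>

lemma absorbing_covered:
 "covered (%x y. dist (sg (real n * \<tau>) x) (sg (real n * \<tau>) y)) absorbing (real mult_const ^ n) (diam0 * (1/2) ^ n)"
proof (induction n)
 case 0
 show ?case using diam0 zero absorbing_sub(2) by (intro coveredI[of "{absorbing}"]) (auto simp: subset_iff)
next
 case (Suc n)
 define r where "r = diam0 * (1/2) ^ n"
 have r: "0 < r" using diam0(1) by (simp add: r_def)
 obtain \<Q> where Q: "finite \<Q>" "real (card \<Q>) <= real mult_const ^ n" "absorbing \<subseteq> \<Union>\<Q>" "\<forall>Q\<in>\<Q>. Q \<subseteq> absorbing"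
  "\<forall>Q\<in>\<Q>. \<forall>x\<in>Q. \<forall>y\<in>Q. dist (sg (real n * \<tau>) x) (sg (real n * \<tau>) y) <= r"
  by (rule coveredE[OF Suc[folded r_def]])
 have step: "sg (real (Suc n) * \<tau>) x = sg \<tau> (sg (real n * \<tau>) x)" if "x \<in> absorbing" for x
  using semigroup[of \<tau> "real n * \<tau>" x] \<tau> that absorbing_sub(2) by (auto simp: distrib_right)
 have "covered (%x y. dist (sg (real (Suc n) * \<tau>) x) (sg (real (Suc n) * \<tau>) y)) Q (real mult_const) (r / 2)" if "Q \<in> \<Q>" for Q
 proof (rule covered_vimage[where f = "sg (real n * \<tau>)"])
  show "covered (%x y. dist (sg \<tau> x) (sg \<tau> y)) (sg (real n * \<tau>) ` Q) (real mult_const) (r / 2)"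
   by (rule mult_const(2)) (use r Q that \<tau> in \<open>auto intro!: absorbing_inv\<close>)
  fix x y assume "x \<in> Q" "y \<in> Q"
  then have "x \<in> absorbing" "y \<in> absorbing" using Q(4)[rule_format, OF that] by auto
  then show "dist (sg (real (Suc n) * \<tau>) x) (sg (real (Suc n) * \<tau>) y)
    <= dist (sg \<tau> (sg (real n * \<tau>) x)) (sg \<tau> (sg (real n * \<tau>) y))"
   using step by (simp only:)
 qed simp
 then have "covered (%x y. dist (sg (real (Suc n) * \<tau>) x) (sg (real (Suc n) * \<tau>) y)) (\<Union>Q\<in>\<Q>. Q) (real (card \<Q>) * real mult_const) (r / 2)"
  using Q(1) by (intro covered_UN)
 then show ?case
 proof (rule covered_mono[OF covered_subset])
  show "real (card \<Q>) * real mult_const <= real mult_const ^ Suc n"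
   using mult_right_mono[OF Q(2), of "real mult_const"]
   by (simp only: power_Suc mult.commute of_nat_0_le_iff simp_thms)
 qed (use Q in \<open>auto simp: r_def\<close>)
qed

lemma late_points_covered:
 "covered dist (sg (real n * \<tau>) ` absorbing) (real mult_const ^ n) (diam0 * (1/2) ^ n)"
proof (rule covered_vimage[OF absorbing_covered])
 fix x assume "x \<in> sg (real n * \<tau>) ` absorbing"
 then have "\<exists>y. y \<in> absorbing & sg (real n * \<tau>) y = x" by auto
 from someI_ex[OF this]
 show "(SOME y. y \<in> absorbing & sg (real n * \<tau>) y = x) \<in> absorbing" by blast
next
 fix x y assume "x \<in> sg (real n * \<tau>) ` absorbing" "y \<in> sg (real n * \<tau>) ` absorbing"
 then have "\<exists>z. z \<in> absorbing & sg (real n * \<tau>) z = x" "\<exists>z. z \<in> absorbing & sg (real n * \<tau>) z = y" by auto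
 from this[THEN someI_ex]
 show "dist x y <= dist (sg (real n * \<tau>) (SOME z. z \<in> absorbing & sg (real n * \<tau>) z = x))
   (sg (real n * \<tau>) (SOME z. z \<in> absorbing & sg (real n * \<tau>) z = y))" by simp
qed

lemma A_covered: "covered dist A (real mult_const ^ n) (diam0 * (1/2) ^ n)"
proof (rule covered_subset[OF late_points_covered])
 have "A = sg (real n * \<tau>) ` A" using A_inv[of "real n * \<tau>"] \<tau> by simp
 then show "A \<subseteq> sg (real n * \<tau>) ` absorbing" using A_absorbing by blast
qed

lemma centres_exist:
 "\<exists>R. finite R & card R <= mult_const ^ n & R \<subseteq> absorbing \<and>
  (\<forall>x\<in>absorbing. \<exists>y\<in>R. dist (sg (real n * \<tau>) x) (sg (real n * \<tau>) y) <= diam0 * (1/2) ^ n)"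
proof -
 obtain \<Q> where Q: "finite \<Q>" "real (card \<Q>) <= real mult_const ^ n" "absorbing \<subseteq> \<Union>\<Q>" "\<forall>Q\<in>\<Q>. Q \<subseteq> absorbing"
  "\<forall>Q\<in>\<Q>. \<forall>x\<in>Q. \<forall>y\<in>Q. dist (sg (real n * \<tau>) x) (sg (real n * \<tau>) y) <= diam0 * (1/2) ^ n"
  by (rule coveredE[OF absorbing_covered[of n]])
 define pk where "pk Q = (SOME x. x \<in> Q)" for Q :: "'e set"
 have pk: "pk Q \<in> Q" if "Q ~= {}" for Q using that unfolding pk_def by (simp add: some_in_eq)
 define R where "R = pk ` (\<Q> - {{}})"
 have "card R <= card (\<Q> - {{}})" unfolding R_def using Q(1) by (intro card_image_le) simp
 also have "... <= card \<Q>" using Q(1) by (intro card_mono) auto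
 also have "card \<Q> <= mult_const ^ n" using Q(2) by (simp only: of_nat_power[symmetric] of_nat_le_iff)
 finally have "card R <= mult_const ^ n" .
 moreover have "R \<subseteq> absorbing"
  unfolding R_def by (rule image_subsetI) (use pk Q(4) in blast)
 moreover have "\<exists>y\<in>R. dist (sg (real n * \<tau>) x) (sg (real n * \<tau>) y) <= diam0 * (1/2) ^ n" if x: "x \<in> absorbing" for x
 proof -
  obtain P where P: "P \<in> \<Q>" "x \<in> P" using x Q(3) by blast
  then have "pk P \<in> R" "pk P \<in> P" using pk[of P] by (auto simp: R_def)
  then show ?thesis using Q(5)[rule_format, OF P] by blast
 qed
 ultimately show ?thesis using Q(1) by (intro exI[of _ R]) (auto simp: R_def)
qed

text \<open>Centres are initial points; it is their positions at time \<open>n \<tau>\<close> that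
  form a net of the late points.\<close>

definition centres :: "nat => 'e set" where
 "centres n = (SOME R. finite R & card R <= mult_const ^ n & R \<subseteq> absorbing \<and>
  (\<forall>x\<in>absorbing. \<exists>y\<in>R. dist (sg (real n * \<tau>) x) (sg (real n * \<tau>) y) <= diam0 * (1/2) ^ n))"

lemma centres:
 "finite (centres n)" "card (centres n) <= mult_const ^ n" "centres n \<subseteq> absorbing"
 "x \<in> absorbing ==> \<exists>y\<in>centres n. dist (sg (real n * \<tau>) x) (sg (real n * \<tau>) y) <= diam0 * (1/2) ^ n"
 using someI_ex[OF centres_exist[of n]] unfolding centres_def by blast+

text \<open>A generation-\<open>n\<close> centre is put into the set only from time \<open>n \<tau>\<close> on. Hence all but finitely many of the orbit
 pieces lie near \<open>A\<close>, which makes the set compact without taking a closure.\<close>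

definition exp_attr :: "'e set" where
 "exp_attr = A \<union> (\<Union>n. \<Union>x\<in>centres n. (%t. sg t x) ` {real n * \<tau>..})"

lemma nt: "0 <= real n * \<tau>" using \<tau> by simp

lemma exp_attr_sub: "exp_attr \<subseteq> absorbing"
proof
 fix y assume "y \<in> exp_attr"
 then consider "y \<in> A" | n x t where "x \<in> centres n" "real n * \<tau> <= t" "y = sg t x" by (auto simp: exp_attr_def)
 then show "y \<in> absorbing"
 proof cases
  case 1 then show ?thesis using A_absorbing by blast
 next
  case 2
  then have "0 <= t" "x \<in> absorbing" using nt[of n] centres(3) by auto
  then show ?thesis using absorbing_inv 2(3) by simp
 qed
qed

lemma exp_attr_inv:
 assumes t: "0 <= t" and "y \<in> exp_attr" shows "sg t y \<in> exp_attr"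
proof -
 consider "y \<in> A" | n x s where "x \<in> centres n" "real n * \<tau> <= s" "y = sg s x" using assms(2) by (auto simp: exp_attr_def)
 then show ?thesis
 proof cases
  case 1 then show ?thesis using A_inv[OF t] by (auto simp: exp_attr_def)
 next
  case 2
  have "sg (t + s) x \<in> (%t. sg t x) ` {real n * \<tau>..}" by (rule imageI) (use 2(2) t in simp)
  moreover have "sg t y = sg (t + s) x"
   using semigroup[OF t, of s x] 2 nt[of n] centres(3)[of n] absorbing_sub(2) by auto
  ultimately show ?thesis using 2(1) unfolding exp_attr_def by auto
 qed
qed

text \<open>Only finitely many generations start before the time \<open>T\<close> from which on the
  absorbing set stays close to \<open>A\<close>, and each of them contributes finitely many compact
  arcs up to \<open>T\<close>. All remaining points belong to times after \<open>T\<close> or to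
  \<open>A\<close>.\<close>

lemma exp_attr_near_A:
 assumes "0 < epsz"
 shows "\<exists>G. compact G & G \<subseteq> exp_attr & (\<forall>y\<in>exp_attr - G. \<exists>a\<in>A. dist y a < epsz)"
proof -
 obtain T where T: "\<forall>t\<ge>T. \<forall>x\<in>absorbing. \<exists>a\<in>A. dist (sg t x) a < epsz"
  using attracts[OF absorbing_sub(2,3) assms] by blast
 define I where "I = {n. real n * \<tau> <= T}"
 have "I \<subseteq> {..nat \<lceil>T / \<tau>\<rceil>}"
 proof
  fix n assume "n \<in> I"
  then have "real n <= T / \<tau>" using \<tau> by (simp add: I_def pos_le_divide_eq)
  then show "n \<in> {..nat \<lceil>T / \<tau>\<rceil>}" by simp linarith
 qed
 then have I: "finite I" by (rule finite_subset) simp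
 define G where "G = (\<Union>n\<in>I. \<Union>x\<in>centres n. (%t. sg t x) ` {real n * \<tau>..T})"
 have "compact ((%t. sg t x) ` {real n * \<tau>..T})" if "x \<in> centres n" for n x
  using that centres(3) absorbing_sub(2) nt[of n]
  by (intro compact_continuous_image continuous_on_subset[OF cont]) auto
 then have "compact G" unfolding G_def using I centres(1) by (intro compact_UN) auto
 moreover have "G \<subseteq> exp_attr" unfolding G_def exp_attr_def
  by (rule le_supI2) (intro UN_mono image_mono subset_UNIV, auto)
 moreover have "\<exists>a\<in>A. dist y a < epsz" if y: "y \<in> exp_attr" "y \<notin> G" for y
 proof (cases "y \<in> A")
  case True then show ?thesis using assms by (intro bexI[of _ y]) auto
 next
  case False
  then obtain n x t where h: "x \<in> centres n" "real n * \<tau> <= t" "y = sg t x" using y(1) by (auto simp: exp_attr_def)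
  then have "T <= t" using y(2) nt[of n] by (force simp: G_def I_def)
  then show ?thesis using T h(1,3) centres(3) by blast
 qed
 ultimately show ?thesis by blast
qed

text \<open>Either some compact part contains infinitely many members of the sequence, or the
  distances to \<open>A\<close> tend to zero; then a convergent subsequence of nearest points in
  \<open>A\<close> carries the original sequence with it.\<close>

lemma exp_attr_compact: "compact exp_attr"
 unfolding compact_def
proof (intro allI impI)
 fix f :: "nat => 'e" assume f: "\<forall>j. f j \<in> exp_attr"
 show "\<exists>l\<in>exp_attr. \<exists>r. strict_mono r & (f \<circ> r) \<longlonglongrightarrow> l"
 proof (cases "\<exists>G. compact G & G \<subseteq> exp_attr & infinite {j. f j \<in> G}")
  case True
  then obtain G where G: "compact G" "G \<subseteq> exp_attr" "infinite {j. f j \<in> G}" by blast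
  obtain r where r: "strict_mono (r :: nat => nat)" "\<forall>n. r n \<in> {j. f j \<in> G}" using infinite_enumerate[OF G(3)] by blast
  then obtain l r' where l: "l \<in> G" "strict_mono (r' :: nat => nat)" "((f \<circ> r) \<circ> r') \<longlonglongrightarrow> l"
   using G(1)[unfolded compact_def, rule_format, of "f \<circ> r"] by auto
  then show ?thesis using G(2) r(1) strict_mono_o[of r r'] by (intro bexI[of _ l] exI[of _ "r \<circ> r'"]) (auto simp: o_assoc)
 next
  case False
  have "\<exists>a\<in>A. \<forall>b\<in>A. dist (f j) a <= dist (f j) b" for j
   by (rule continuous_attains_inf[OF A_compact A_ne]) (intro continuous_intros)
  then obtain g where g: "!!j. g j \<in> A" "!!j b. b \<in> A ==> dist (f j) (g j) <= dist (f j) b" by metis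
  have lim: "(%j. dist (f j) (g j)) \<longlonglongrightarrow> 0"
  proof (rule tendstoI)
   fix epsz :: real assume "0 < epsz"
   then obtain G where G: "compact G" "G \<subseteq> exp_attr" "\<forall>y\<in>exp_attr - G. \<exists>a\<in>A. dist y a < epsz" using exp_attr_near_A by blast
   then have "finite {j. f j \<in> G}" using False by blast
   then have "\<forall>\<^sub>F j in sequentially. f j \<notin> G" unfolding cofinite_eq_sequentially[symmetric] by (simp add: eventually_cofinite)
   then show "\<forall>\<^sub>F j in sequentially. dist (dist (f j) (g j)) 0 < epsz"
   proof eventually_elim
    case (elim j)
    then obtain a where "a \<in> A" "dist (f j) a < epsz" using f G(3) by blast
    then show ?case using g(2)[of a j] by simp
   qed
  qed
  obtain l r where l: "l \<in> A" "strict_mono (r :: nat => nat)" "(g \<circ> r) \<longlonglongrightarrow> l"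
   using A_compact[unfolded compact_def, rule_format, of g] g(1) by auto
  have "(%j. dist (f (r j)) (g (r j))) \<longlonglongrightarrow> 0"
   using LIMSEQ_subseq_LIMSEQ[OF lim l(2)] by (simp add: o_def)
  moreover have "(%j. dist (g (r j)) l) \<longlonglongrightarrow> 0" using tendsto_dist_iff[THEN iffD1, OF l(3)] by (simp add: o_def)
  ultimately have "(%j. dist (f (r j)) (g (r j)) + dist (g (r j)) l) \<longlonglongrightarrow> 0" using tendsto_add by fastforce
  then have "(%j. dist (f (r j)) l) \<longlonglongrightarrow> 0"
   by (rule metric_tendsto_imp_tendsto) (rule always_eventually, simp add: dist_triangle)
  then have "(f \<circ> r) \<longlonglongrightarrow> l" by (subst tendsto_dist_iff) (simp add: o_def)
  then show ?thesis using l by (auto simp: exp_attr_def)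
 qed
qed

text \<open>At the last multiple of \<open>\<tau>\<close> before \<open>t\<close> a centre is close;
  the Lipschitz bound covers the remaining time, which is at most \<open>\<tau>\<close>. The factor
  2 pays for rounding \<open>t / \<tau>\<close> down.\<close>

lemma absorbing_attracted:
 assumes x: "x \<in> absorbing" and t: "0 <= t"
 shows "\<exists>y\<in>exp_attr. dist (sg t x) y <= 2 * \<bar>Lip\<bar> * diam0 * exp (- (ln 2 / \<tau>) * t)"
proof -
 define n where "n = nat \<lfloor>t / \<tau>\<rfloor>"
 have q: "0 <= t / \<tau>" using t \<tau> by simp
 then have n: "real n <= t / \<tau>" "t / \<tau> < real n + 1" by (auto simp: n_def)
 define s where "s = t - real n * \<tau>"
 have s: "0 <= s" "s <= \<tau>" using n \<tau> by (auto simp: s_def pos_le_divide_eq pos_divide_less_eq distrib_right)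
 obtain y where y: "y \<in> centres n" "dist (sg (real n * \<tau>) x) (sg (real n * \<tau>) y) <= diam0 * (1/2) ^ n"
  using centres(4)[OF x] by blast
 have ya: "y \<in> absorbing" using y(1) centres(3) by auto
 have "sg t z = sg s (sg (real n * \<tau>) z)" if "z \<in> absorbing" for z
  using semigroup[OF s(1) nt[of n], of z] that absorbing_sub(2) by (auto simp: s_def)
 then have "dist (sg t x) (sg t y) <= Lip * dist (sg (real n * \<tau>) x) (sg (real n * \<tau>) y)"
  using s x ya nt by (simp add: Lip absorbing_inv)
 also have "... <= \<bar>Lip\<bar> * (diam0 * (1/2) ^ n)" using y(2) by (intro mult_mono) auto
 also have "... <= \<bar>Lip\<bar> * (diam0 * (2 * exp (- (ln 2 / \<tau>) * t)))"
 proof -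
  have "(1/2) ^ n = exp (- (real n * ln 2))" by (simp add: exp_minus exp_of_nat_mult power_one_over inverse_eq_divide)
  also have "... <= exp (- ((t / \<tau> - 1) * ln 2))" using n by (simp add: mult_right_mono)
  also have "... = 2 * exp (- (ln 2 / \<tau>) * t)" by (simp add: left_diff_distrib exp_diff exp_minus exp_add field_simps)
  finally show ?thesis using diam0(1) by (intro mult_left_mono) auto
 qed
 finally have "dist (sg t x) (sg t y) <= 2 * \<bar>Lip\<bar> * diam0 * exp (- (ln 2 / \<tau>) * t)" by simp
 moreover have "sg t y \<in> exp_attr"
  using y(1) s by (auto simp: exp_attr_def s_def)
 ultimately show ?thesis by blast
qed

text \<open>Up to the absorption time \<open>T\<close> the orbits are merely bounded; the factor
  \<open>exp (gmz * T)\<close> in the constant hides this initial phase.\<close>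

lemma exp_attr_attracts:
 assumes B: "B \<subseteq> X" "bounded B"
 shows "\<exists>C. \<exists>gmz>0. \<forall>t\<ge>0. \<forall>x\<in>B. \<exists>y\<in>exp_attr. dist (sg t x) y <= C * exp (- gmz * t)"
proof -
 define gmz where "gmz = ln 2 / \<tau>"
 have gmz: "0 < gmz" using \<tau> by (simp add: gmz_def)
 obtain T where T: "0 <= T" "\<forall>t\<ge>T. sg t ` B \<subseteq> absorbing" using absorbing_absorbs[OF B] by blast
 obtain a where a: "a \<in> A" using A_ne by blast
 obtain R where "\<forall>y\<in>(\<Union>t\<in>{0..T}. sg t ` B). dist a y <= R"
  using local_bounded[OF B, of T] unfolding bounded_any_center[of _ a] by (rule exE)
 then have R: "dist a (sg t x) <= R" if "x \<in> B" "t \<in> {0..T}" for x t using that by blast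
 define M where "M = max \<bar>R\<bar> (2 * \<bar>Lip\<bar> * diam0)"
 have M: "0 <= M" "\<bar>R\<bar> <= M" "2 * \<bar>Lip\<bar> * diam0 <= M" by (auto simp: M_def)
 have "\<exists>y\<in>exp_attr. dist (sg t x) y <= M * exp (gmz * T) * exp (- gmz * t)" if t: "0 <= t" and x: "x \<in> B" for t x
 proof (cases "t <= T")
  case True
  have "dist (sg t x) a <= \<bar>R\<bar>" using R[OF x, of t] True t by (simp add: dist_commute)
  also have "... <= M * exp (gmz * (T - t))"
   using M gmz True mult_mono[of "\<bar>R\<bar>" M 1 "exp (gmz * (T - t))"] by simp
  also have "... = M * exp (gmz * T) * exp (- gmz * t)" by (simp add: right_diff_distrib mult.assoc exp_add[symmetric])
  finally show ?thesis using a by (intro bexI[of _ a]) (auto simp: exp_attr_def)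
 next
  case False
  have "sg T x \<in> absorbing" using T x by auto
  then obtain y where y: "y \<in> exp_attr" "dist (sg (t - T) (sg T x)) y <= 2 * \<bar>Lip\<bar> * diam0 * exp (- gmz * (t - T))"
   using absorbing_attracted[of "sg T x" "t - T"] False unfolding gmz_def by auto
  have "sg t x = sg (t - T) (sg T x)" using semigroup[of "t - T" T x] False T x B by auto
  then have "dist (sg t x) y <= 2 * \<bar>Lip\<bar> * diam0 * exp (- gmz * (t - T))" using y(2) by (simp only:)
  also have "... <= M * exp (- gmz * (t - T))" using M(3) by (intro mult_right_mono) auto
  also have "... = M * exp (gmz * T) * exp (- gmz * t)" by (simp add: right_diff_distrib mult.assoc exp_add[symmetric])
  finally show ?thesis using y(1) by blast
 qed
 then show ?thesis using gmz by blast
qed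

text \<open>At level \<open>n\<close> all points that are late by \<open>n \<tau>\<close> are
  covered already. What is left are arcs of the first \<open>n\<close> generations before that time;
  they are cut into time segments so short that the Hoelder bound \<open>Dt\<close> makes their
  \<open>D\<close>-diameter of order \<open>(1/2) ^ n\<close>.\<close>

lemma exp_attr_covered:
 assumes c: "0 <= c" and etz: "0 < etz"
  and Dd: "!!x y. x \<in> absorbing ==> y \<in> absorbing ==> D x y <= c * dist x y"
  and Dt: "!!x s t. x \<in> absorbing ==> 0 <= s ==> 0 <= t ==> D (sg s x) (sg t x) <= c * \<bar>s - t\<bar> powr etz"
 shows "\<exists>C\<ge>1. \<exists>N\<ge>1. \<forall>n. covered D exp_attr (C * N ^ n) (C * (1/2) ^ n)"
proof -
 \<comment> \<open>Chosen so that segments of length \<open>(1 / q) ^ n\<close> have length to the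
   power \<open>etz\<close> equal to \<open>(1/2) ^ n\<close>.\<close>
 define q where "q = 2 powr (1 / etz)"
 have q: "1 <= q" "0 < q" using etz by (auto simp: q_def ge_one_powr_ge_zero)
 have qe: "q powr etz = 2" using etz by (simp add: q_def powr_powr)
 \<comment> \<open>The number of segments is at most \<open>n\<close> generations, times
   \<open>mult_const ^ n\<close> centres, times about \<open>n * \<tau> * q ^ n\<close> segments per
   arc. Each of the two factors \<open>n\<close> is bounded by \<open>2 ^ n\<close>, whence the
   4.\<close>
 define N where "N = 4 * real mult_const * q"
 \<comment> \<open>The first entry is for the number of pieces, segments and late pieces together;
   the second is for the diameters of both kinds of pieces.\<close>
 define C where "C = max (\<tau> + 2) (c * (diam0 + 1))"
 have mc: "1 <= real mult_const" using mult_const(1) by simp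
 have N1: "1 <= N"
 proof -
  have "1 * 1 <= real mult_const * q" using mc q by (intro mult_mono) auto
  then show ?thesis by (simp add: N_def)
 qed
 have C1: "1 <= C" using \<tau> by (simp add: C_def)
 have "covered D exp_attr (C * N ^ n) (C * (1/2) ^ n)" for n
 proof -
  define h where "h = (1 / q) ^ n"
  have h: "0 < h" using q by (simp add: h_def)
  have he: "h powr etz = (1/2) ^ n"
  proof -
   have "h = (1 / q) powr real n" using q by (simp add: h_def powr_realpow)
   then have "h powr etz = ((1 / q) powr etz) powr real n" by (simp add: powr_powr mult.commute)
   also have "(1 / q) powr etz = 1 / 2" using q qe by (simp add: powr_divide)
   also have "(1 / 2) powr real n = (1 / 2 :: real) ^ n" by (simp add: powr_realpow)
   finally show ?thesis .
  qed
  define J where "J = nat \<lfloor>real n * \<tau> / h\<rfloor> + 1"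
  have nh: "0 <= real n * \<tau> / h" using nt h by simp
  have J: "real J <= real n * \<tau> / h + 1" using nh by (simp add: J_def)
  define I where "I = (SIGMA k:{..<n}. centres k \<times> {..<J})"
  define seg where "seg = (%(k::nat, x, j). (%t. sg t x) ` {real j * h..real (Suc j) * h})"
  have fI: "finite I" unfolding I_def using centres(1) by auto
  have cI: "real (card I) <= (\<tau> + 1) * N ^ n"
  proof -
   have "card I = (\<Sum>k<n. card (centres k) * J)" unfolding I_def using centres(1) by (simp add: card_SigmaI)
   also have "... <= (\<Sum>k<n. mult_const ^ n * J)"
   proof (intro sum_mono mult_right_mono)
    fix k assume "k \<in> {..<n}"
    then have "mult_const ^ k <= mult_const ^ n" using mult_const(1) by (intro power_increasing) auto
    then show "card (centres k) <= mult_const ^ n" using centres(2)[of k] by linarith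
   qed simp
   finally have "card I <= n * (mult_const ^ n * J)" by simp
   then have "real (card I) <= real (n * (mult_const ^ n * J))" by (simp only: of_nat_le_iff)
   also have "... = real n * (real mult_const ^ n * real J)" by simp
   also have "... <= 2 ^ n * (real mult_const ^ n * ((\<tau> + 1) * (2 ^ n * q ^ n)))"
   proof (intro mult_mono order_refl)
    have n2: "real n <= 2 ^ n" using of_nat_less_two_power[of n, where 'a = real] by simp
    then show "real n <= 2 ^ n" .
    have "real n * \<tau> / h = real n * \<tau> * q ^ n" by (simp add: h_def power_one_over field_simps)
    also have "... <= 2 ^ n * \<tau> * q ^ n" using n2 \<tau> q by (intro mult_right_mono) auto
    finally have "real J <= \<tau> * (2 ^ n * q ^ n) + 1" using J by (simp add: mult_ac)
    moreover have "1 <= (2::real) ^ n * q ^ n"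
    proof -
     have "(1::real) * 1 <= 2 ^ n * q ^ n" using q by (intro mult_mono one_le_power) auto
     then show ?thesis by simp
    qed
    ultimately show "real J <= (\<tau> + 1) * (2 ^ n * q ^ n)" by (simp add: distrib_right)
   qed (use \<tau> q in auto)
   also have "... = (\<tau> + 1) * N ^ n"
   proof -
    have "(4::real) ^ n = 2 ^ n * 2 ^ n" by (simp flip: power_mult_distrib)
    then show ?thesis by (simp add: N_def power_mult_distrib)
   qed
   finally show ?thesis .
  qed
  have cent: "x \<in> absorbing" if "x \<in> centres k" for k x using that centres(3) by auto
  have s: "covered D (seg i) 1 (C * (1/2) ^ n)" if iI: "i \<in> I" for i
  proof -
   obtain k x j where i: "i = (k, x, j)" "x \<in> centres k" using iI by (auto simp: I_def)
   have "D (sg r x) (sg t x) <= C * (1/2) ^ n" if rt: "r \<in> {real j * h..real (Suc j) * h}" "t \<in> {real j * h..real (Suc j) * h}" for r t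
   proof -
    have "0 <= real j * h" using h by simp
    then have rt0: "0 <= r" "0 <= t" using rt by auto
    have "real (Suc j) * h = real j * h + h" by (simp add: distrib_right)
    then have "\<bar>r - t\<bar> <= h" using rt by auto
    then have "\<bar>r - t\<bar> powr etz <= h powr etz" using etz by (intro powr_mono2) auto
    then have "c * \<bar>r - t\<bar> powr etz <= c * (1/2) ^ n" unfolding he using c by (rule mult_left_mono)
    also have "... <= C * (1/2) ^ n"
    proof (rule mult_right_mono)
     have "c * 1 <= c * (diam0 + 1)" using c diam0(1) by (intro mult_left_mono) auto
     then show "c <= C" by (simp add: C_def)
    qed simp
    finally show ?thesis using Dt[OF cent[OF i(2)] rt0] by linarith
   qed
   then show ?thesis by (intro coveredI[of "{seg i}"]) (auto simp: i(1) seg_def)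
  qed
  have late: "covered D (sg (real n * \<tau>) ` absorbing) (real mult_const ^ n) (C * (1/2) ^ n)"
  proof -
   obtain \<Q> where Q: "finite \<Q>" "real (card \<Q>) <= real mult_const ^ n" "sg (real n * \<tau>) ` absorbing \<subseteq> \<Union>\<Q>"
    "\<forall>Q\<in>\<Q>. Q \<subseteq> sg (real n * \<tau>) ` absorbing" "\<forall>Q\<in>\<Q>. \<forall>x\<in>Q. \<forall>y\<in>Q. dist x y <= diam0 * (1/2) ^ n"
    by (rule coveredE[OF late_points_covered[of n]])
   show ?thesis
   proof (rule coveredI[OF Q(1-3)])
    fix Q x y assume h: "Q \<in> \<Q>" "x \<in> Q" "y \<in> Q" "x \<in> sg (real n * \<tau>) ` absorbing" "y \<in> sg (real n * \<tau>) ` absorbing"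
    then have "x \<in> absorbing" "y \<in> absorbing" using absorbing_inv nt by auto
    then have "D x y <= c * dist x y" by (rule Dd)
    also have "... <= c * (diam0 * (1/2) ^ n)" using Q(5)[rule_format, OF h(1-3)] c by (rule mult_left_mono)
    also have "... <= C * (1/2) ^ n"
    proof -
     have "c * diam0 <= C" using c by (simp add: C_def distrib_left)
     then show ?thesis by (simp add: mult.assoc[symmetric] mult_right_mono)
    qed
    finally show "D x y <= C * (1/2) ^ n" .
   qed
  qed
  have "covered D (sg (real n * \<tau>) ` absorbing \<union> (\<Union>i\<in>I. seg i)) (real mult_const ^ n + real (card I) * 1) (C * (1/2) ^ n)"
   by (intro covered_Un late covered_UN fI s)
  then show ?thesis
  proof (rule covered_mono[OF covered_subset])
   have "real mult_const ^ n <= N ^ n"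
   proof (rule power_mono)
    have "real mult_const * 1 <= real mult_const * (4 * q)" using q by (intro mult_left_mono) auto
    then show "real mult_const <= N" by (simp add: N_def)
   qed simp
   then have "real mult_const ^ n + real (card I) * 1 <= (\<tau> + 2) * N ^ n" using cI by (simp add: distrib_right)
   also have "... <= C * N ^ n" using N1 by (intro mult_right_mono) (auto simp: C_def)
   finally show "real mult_const ^ n + real (card I) * 1 <= C * N ^ n" .
   show "exp_attr \<subseteq> sg (real n * \<tau>) ` absorbing \<union> (\<Union>i\<in>I. seg i)"
   proof
    fix y assume y: "y \<in> exp_attr"
    show "y \<in> sg (real n * \<tau>) ` absorbing \<union> (\<Union>i\<in>I. seg i)"
    proof (cases "y \<in> A")
     case True
     then have "y \<in> sg (real n * \<tau>) ` A" using A_inv[OF nt] by simp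
     then show ?thesis using A_absorbing by blast
    next
     case False
     then obtain k x t where kx: "x \<in> centres k" "real k * \<tau> <= t" "y = sg t x" using y by (auto simp: exp_attr_def)
     show ?thesis
     proof (cases "real n * \<tau> <= t")
      case True
      have "sg (real n * \<tau> + (t - real n * \<tau>)) x = sg (real n * \<tau>) (sg (t - real n * \<tau>) x)"
       using True nt kx cent absorbing_sub(2) by (intro semigroup) auto
      then show ?thesis using kx(3) absorbing_inv[OF _ cent[OF kx(1)], of "t - real n * \<tau>"] True by auto
     next
      case False
      have t0: "0 <= t" using kx(2) nt[of k] by linarith
      have "real k * \<tau> < real n * \<tau>" using kx(2) False by linarith
      then have kn: "k < n" using \<tau> by simp
      define j where "j = nat \<lfloor>t / h\<rfloor>"
      have th: "0 <= t / h" using t0 h by simp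
      have jt: "real j <= t / h" "t / h <= real (Suc j)" using th by (auto simp: j_def) linarith
      have "t / h <= real n * \<tau> / h" using False h by (intro divide_right_mono) auto
      then have "j < J" unfolding j_def J_def using th by (simp add: floor_mono nat_mono less_Suc_eq_le)
      then have "(k, x, j) \<in> I" using kn kx(1) by (simp add: I_def)
      moreover have "y \<in> seg (k, x, j)"
       using jt h kx(3) by (auto simp: seg_def pos_le_divide_eq pos_divide_le_eq)
      ultimately show ?thesis by blast
     qed
    qed
   qed
  qed simp
 qed
 then show ?thesis using N1 C1 by blast
qed

end

section \<open>Triples of functions and composition with smooth nonlinearities\<close>

lemma lebesgue_on_measurable_L2: "L2 L f ==> f \<in> borel_measurable (lebesgue_on {0..L})"
 by (simp add: L2_def measurable_on_iff_borel_measurable)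

lemma L2_bound:
 assumes m: "f \<in> borel_measurable (lebesgue_on {0..L})" and g: "L2 L g"
  and n: "negligible {x \<in> {0..L}. ~ \<bar>f x\<bar> <= \<bar>g x\<bar>}"
 shows "L2 L f"
 unfolding L2_iff
proof (rule sqi_bound)
 show "cut L f \<in> borel_measurable lebesgue" unfolding cut_def using m by (rule borel_measurable_if_I) simp
 show "sqi (cut L g)" using g by (simp add: L2_iff)
 have "{x \<in> {0..L}. ~ \<bar>f x\<bar> <= \<bar>g x\<bar>} \<in> null_sets lebesgue" using n by (simp add: negligible_iff_null_sets)
 then show "AE x in lebesgue. \<bar>cut L f x\<bar> <= \<bar>cut L g x\<bar>" by (rule AE_I') (auto simp: cut_def)
qed

type_synonym r3 = "real \<times> real \<times> real"

definition L2t :: "real => (real => r3) => bool" where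
 "L2t L T \<longleftrightarrow> L2 L (%x. fst (T x)) & L2 L (%x. fst (snd (T x))) & L2 L (%x. snd (snd (T x)))"

definition to3 :: "real => (real => r3) => l2 \<times> l2 \<times> l2" where
 "to3 L T = (toL L (%x. fst (T x)), toL L (%x. fst (snd (T x))), toL L (%x. snd (snd (T x))))"

lemma L2t_diff: "L2t L T ==> L2t L T' ==> L2t L (%x. T x - T' x)"
 by (simp add: L2t_def L2_diff)
lemma L2t_scale: "L2t L T ==> L2t L (%x. c *\<^sub>R T x)"
 by (simp add: L2t_def L2_scale)
lemma to3_diff: "L2t L T ==> L2t L T' ==> to3 L (%x. T x - T' x) = to3 L T - to3 L T'"
 by (simp add: L2t_def to3_def toL_diff)
lemma to3_scale: "L2t L T ==> to3 L (%x. c *\<^sub>R T x) = c *\<^sub>R to3 L T"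
 by (simp add: L2t_def to3_def toL_scale)

lemma measurable_L2t:
 assumes "L2t L T" shows "T \<in> borel_measurable (lebesgue_on {0..L})"
proof -
 have "(%x. (fst (T x), fst (snd (T x)), snd (snd (T x)))) \<in> borel_measurable (lebesgue_on {0..L})"
  using assms by (intro borel_measurable_Pair lebesgue_on_measurable_L2) (auto simp: L2t_def)
 then show ?thesis by simp
qed

lemma norm_L2t:
 assumes "L2t L T"
 shows "L2 L (%x. norm (T x))" "norm (toL L (%x. norm (T x))) = norm (to3 L T)"
proof -
 have m: "(%x. norm (T x)) \<in> borel_measurable (lebesgue_on {0..L})"
  by (rule measurable_compose[OF measurable_L2t[OF assms] borel_measurable_continuous_onI]) (intro continuous_intros)
 define b where "b x = \<bar>fst (T x)\<bar> + \<bar>fst (snd (T x))\<bar> + \<bar>snd (snd (T x))\<bar>" for x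
 have b: "L2 L b" unfolding b_def using assms by (intro L2_add L2_abs) (auto simp: L2t_def)
 have nb: "norm (T x) <= b x" for x
 proof -
  have "norm (T x) <= norm (fst (T x)) + norm (snd (T x))" by (metis norm_Pair_le prod.collapse)
  also have "norm (snd (T x)) <= norm (fst (snd (T x))) + norm (snd (snd (T x)))" by (metis norm_Pair_le prod.collapse)
  finally show ?thesis by (simp add: b_def)
 qed
 show l: "L2 L (%x. norm (T x))"
 proof (rule L2_bound[OF m b])
  have "norm (T x) <= \<bar>b x\<bar>" for x using nb[of x] by linarith
  then show "negligible {x \<in> {0..L}. ~ \<bar>norm (T x)\<bar> <= \<bar>b x\<bar>}" by (intro empty_imp_negligible) auto
 qed
 have sq: "((%x. u x * u x) has_integral inner (toL L u) (toL L u)) {0..L}" if "L2 L u" for u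
  using set_lebesgue_integral_eq_integral(1)[OF L2_mult_abs_integrable[OF that that]] inner_toL[OF that that]
  by (simp add: has_integral_integrable_integral)
 have c: "L2 L (%x. fst (T x))" "L2 L (%x. fst (snd (T x)))" "L2 L (%x. snd (snd (T x)))"
  using assms by (auto simp: L2t_def)
 have "((%x. fst (T x) * fst (T x) + (fst (snd (T x)) * fst (snd (T x)) + snd (snd (T x)) * snd (snd (T x)))) has_integral
  inner (to3 L T) (to3 L T)) {0..L}"
  unfolding to3_def inner_prod_def fst_conv snd_conv by (intro has_integral_add sq c)
 also have "(%x. fst (T x) * fst (T x) + (fst (snd (T x)) * fst (snd (T x)) + snd (snd (T x)) * snd (snd (T x))))
  = (%x. norm (T x) * norm (T x))"
  by (rule ext) (simp add: norm_prod_def power2_eq_square[symmetric])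
 finally have "inner (to3 L T) (to3 L T) = inner (toL L (%x. norm (T x))) (toL L (%x. norm (T x)))"
  using sq[OF l] by (rule has_integral_unique)
 then show "norm (toL L (%x. norm (T x))) = norm (to3 L T)" by (simp add: norm_eq_sqrt_inner)
qed

lemma norm_toL_le_to3:
 assumes "L2 L p" "L2t L T" "0 <= c" "negligible {x \<in> {0..L}. ~ \<bar>p x\<bar> <= c * norm (T x)}"
 shows "norm (toL L p) <= c * norm (to3 L T)"
proof -
 have "norm (toL L p) <= norm (toL L (%x. c * norm (T x)))"
  using assms(3,4) by (intro norm_toL_mono assms(1) L2_scale norm_L2t(1)[OF assms(2)]) (simp add: abs_mult)
 then show ?thesis using assms(3) by (simp add: toL_scale norm_L2t[OF assms(2)])
qed

lemma continuous_bounded_on_cball: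
 fixes f :: "'a::euclidean_space => 'b::real_normed_vector"
 assumes "continuous_on UNIV f"
 obtains B where "B > 0" "!!y. norm y <= R ==> norm (f y) <= B"
proof -
 have "compact (f ` cball 0 R)" using assms by (intro compact_continuous_image) (auto intro: continuous_on_subset)
 then have "bounded (f ` cball 0 R)" by (rule compact_imp_bounded)
 then obtain B where B: "B > 0" "\<forall>z\<in>f ` cball 0 R. norm z <= B" unfolding bounded_pos by blast
 show thesis by (rule that[OF B(1)]) (use B(2) in simp)
qed

lemma L2_compose_bounded:
 assumes f: "continuous_on UNIV f" and T: "L2t L T" and b: "negligible {x \<in> {0..L}. ~ norm (T x) <= R}"
 shows "L2 L (%x. f (T x) :: real)"
proof -
 obtain B where B: "B > 0" "!!y. norm y <= R ==> norm (f y) <= B" using continuous_bounded_on_cball[OF f] by blast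
 show ?thesis
 proof (rule L2_bound[OF _ L2_const[of L B]])
  show "(%x. f (T x)) \<in> borel_measurable (lebesgue_on {0..L})"
   using measurable_L2t[OF T] borel_measurable_continuous_onI[OF f] by (rule measurable_compose)
  show "negligible {x \<in> {0..L}. ~ \<bar>f (T x)\<bar> <= \<bar>B\<bar>}"
  proof (rule negligible_subset[OF b], rule subsetI)
   fix x assume "x \<in> {x \<in> {0..L}. ~ \<bar>f (T x)\<bar> <= \<bar>B\<bar>}"
   then show "x \<in> {x \<in> {0..L}. ~ norm (T x) <= R}" using B(1) B(2)[of "T x"] by auto
  qed
 qed
qed

lemma compose_lipschitz:
 assumes K: "0 <= K" "!!x y. norm x <= R ==> norm y <= R ==> \<bar>f x - f y\<bar> <= K * norm (x - y)"
  and T: "L2t L T" "L2t L T'" "L2 L (%x. f (T x))" "L2 L (%x. f (T' x))"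
  and b: "negligible {x \<in> {0..L}. ~ norm (T x) <= R}" "negligible {x \<in> {0..L}. ~ norm (T' x) <= R}"
 shows "norm (toL L (%x. f (T x)) - toL L (%x. f (T' x))) <= K * norm (to3 L T - to3 L T')"
proof -
 have "norm (toL L (%x. f (T x) - f (T' x))) <= K * norm (to3 L (%x. T x - T' x))"
 proof (rule norm_toL_le_to3[OF L2_diff[OF T(3,4)] L2t_diff[OF T(1,2)] K(1)])
  show "negligible {x \<in> {0..L}. ~ \<bar>f (T x) - f (T' x)\<bar> <= K * norm (T x - T' x)}"
   by (rule negligible_subset[OF negligible_Un[OF b]]) (use K(2) in blast)
 qed
 then show ?thesis using T by (simp add: toL_diff to3_diff)
qed

lemma C1_locally_lipschitz:
 fixes f :: "'a::euclidean_space => real"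
 assumes f: "!!x. (f has_derivative (%h. inner (Df x) h)) (at x)" and Df: "continuous_on UNIV Df"
 shows "\<exists>K\<ge>0. (\<forall>x y. norm x <= R --> norm y <= R --> \<bar>f x - f y\<bar> <= K * norm (x - y)) & (\<forall>x. norm x <= R --> norm (Df x) <= K)"
proof -
 obtain B where B: "B > 0" "!!y. norm y <= R ==> norm (Df y) <= B" using continuous_bounded_on_cball[OF Df] by blast
 have "\<bar>f x - f y\<bar> <= B * norm (x - y)" if "norm x <= R" "norm y <= R" for x y
 proof -
  have "norm (f x - f y) <= B * norm (x - y)"
  proof (rule differentiable_bound[where S = "cball 0 R" and f' = "%x h. inner (Df x) h"])
   fix z :: 'a assume z: "z \<in> cball 0 R"
   show "onorm (%h. inner (Df z) h) <= B"
   proof (rule onorm_bound)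
    fix h show "norm (inner (Df z) h) <= B * norm h"
     using Cauchy_Schwarz_ineq2[of "Df z" h] mult_right_mono[OF B(2)[of z], of "norm h"] z by simp
   qed (use B in simp)
  qed (use that f in \<open>auto intro: has_derivative_at_withinI\<close>)
  then show ?thesis by simp
 qed
 then show ?thesis using B by (intro exI[of _ B]) auto
qed

text \<open>Uniform continuity of the gradient on the ball makes the remainder small relative to the
  increment, uniformly in the base point: the mean value inequality is applied to \<open>f\<close>
  minus its linear part at \<open>y\<close>.\<close>

lemma C1_linearization:
 fixes f :: "'a::euclidean_space => real"
 assumes f: "!!x. (f has_derivative (%h. inner (Df x) h)) (at x)" and Df: "continuous_on UNIV Df" and e: "0 < e"
 shows "\<exists>dlt>0. \<forall>x y. norm x <= R --> norm y <= R --> norm (x - y) <= dlt --> \<bar>f x - f y - inner (Df y) (x - y)\<bar> <= e * norm (x - y)"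
proof -
 have "uniformly_continuous_on (cball 0 R) Df"
  using Df by (intro compact_uniformly_continuous) (auto intro: continuous_on_subset)
 then obtain d where d: "d > 0" "!!x y. x \<in> cball 0 R ==> y \<in> cball 0 R ==> dist y x < d ==> dist (Df y) (Df x) < e"
  using e unfolding uniformly_continuous_on_def by metis
 have "\<bar>f x - f y - inner (Df y) (x - y)\<bar> <= e * norm (x - y)" if h: "norm x <= R" "norm y <= R" "norm (x - y) <= d / 2" for x y
 proof -
  have seg: "z \<in> cball 0 R & dist z y < d" if "z \<in> closed_segment y x" for z
  proof
   show "z \<in> cball 0 R" using that h convex_cball[of "0::'a" R] by (meson closed_segment_subset mem_cball_0 subsetD)
   have "dist z y <= dist y x" using dist_in_closed_segment[OF that] by (simp add: dist_commute)
   then show "dist z y < d" using h(3) d(1) by (simp add: dist_norm norm_minus_commute)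
  qed
  have "norm ((%z. f z - inner (Df y) z) x - (%z. f z - inner (Df y) z) y) <= e * norm (x - y)"
  proof (rule differentiable_bound[where S = "closed_segment y x" and f' = "%z h. inner (Df z) h - inner (Df y) h"])
   fix z assume z: "z \<in> closed_segment y x"
   show "((%z. f z - inner (Df y) z) has_derivative (%h. inner (Df z) h - inner (Df y) h)) (at z within closed_segment y x)"
    by (intro has_derivative_diff has_derivative_at_withinI[OF f] has_derivative_inner_right has_derivative_ident)
   show "onorm (%h. inner (Df z) h - inner (Df y) h) <= e"
   proof (rule onorm_bound)
    fix h
    have "norm (Df z - Df y) <= e" using d(2)[of y z] seg[OF z] h(2) by (simp add: dist_norm)
    then show "norm (inner (Df z) h - inner (Df y) h) <= e * norm h"
     using Cauchy_Schwarz_ineq2[of "Df z - Df y" h] mult_right_mono[of "norm (Df z - Df y)" e "norm h"]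
     by (simp add: inner_diff_left)
   qed (use e in simp)
  qed auto
  then show ?thesis by (simp add: inner_diff_right algebra_simps)
 qed
 then show ?thesis using d(1) by (intro exI[of _ "d / 2"]) auto
qed

section \<open>Sine coefficients and the norms of the extended space\<close>

text \<open>Bessel's inequality for the sine and cosine systems. Orthogonality comes from integrating the derivative of
 \<open>sin (\<lambda>\<^sub>n x) cos (\<lambda>\<^sub>m x)\<close>, with both orders of \<open>n\<close> and \<open>m\<close>.\<close>

definition freq :: "real => nat => real" where "freq L n = real (Suc n) * pi / L"
definition sine :: "real => nat => l2" where "sine L n = sqrt (2 / L) *\<^sub>R toL L (%x. sin (freq L n * x))"
definition cosine :: "real => nat => l2" where "cosine L n = sqrt (2 / L) *\<^sub>R toL L (%x. cos (freq L n * x))"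

lemma L2_sin: "L2 L (%x. sin (c * x))" and L2_cos: "L2 L (%x. cos (c * x))"
 by (intro continuous_L2 continuous_intros)+

lemma has_integral_inner: "L2 L u ==> L2 L v ==> ((%x. u x * v x) has_integral inner (toL L u) (toL L v)) {0..L}"
 using set_lebesgue_integral_eq_integral(1)[OF L2_mult_abs_integrable] inner_toL
 by (simp add: has_integral_integrable_integral)

lemma freq_pos: "0 < L ==> 0 < freq L n" by (simp add: freq_def)

lemma sin_freq: "0 < L ==> sin (freq L n * L) = 0"
 by (simp add: freq_def del: of_nat_Suc)

lemma sin_cos_inner:
 assumes L: "0 < L"
 shows "freq L n * inner (toL L (%x. cos (freq L n * x))) (toL L (%x. cos (freq L m * x)))
  = freq L m * inner (toL L (%x. sin (freq L n * x))) (toL L (%x. sin (freq L m * x)))"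
proof -
 have i1: "((%x. freq L n * (cos (freq L n * x) * cos (freq L m * x)) - freq L m * (sin (freq L n * x) * sin (freq L m * x)))
  has_integral (sin (freq L n * L) * cos (freq L m * L) - sin (freq L n * 0) * cos (freq L m * 0))) {0..L}"
 proof (rule fundamental_theorem_of_calculus)
  fix x :: real
  have "((%x. sin (freq L n * x) * cos (freq L m * x)) has_real_derivative
   freq L n * (cos (freq L n * x) * cos (freq L m * x)) - freq L m * (sin (freq L n * x) * sin (freq L m * x))) (at x within {0..L})"
   by (auto intro!: derivative_eq_intros simp: algebra_simps)
  then show "((%x. sin (freq L n * x) * cos (freq L m * x)) has_vector_derivative
   freq L n * (cos (freq L n * x) * cos (freq L m * x)) - freq L m * (sin (freq L n * x) * sin (freq L m * x))) (at x within {0..L})"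
   by (simp add: has_real_derivative_iff_has_vector_derivative)
 qed (use L in simp)
 have i2: "((%x. freq L n * (cos (freq L n * x) * cos (freq L m * x)) - freq L m * (sin (freq L n * x) * sin (freq L m * x)))
  has_integral (freq L n * inner (toL L (%x. cos (freq L n * x))) (toL L (%x. cos (freq L m * x)))
   - freq L m * inner (toL L (%x. sin (freq L n * x))) (toL L (%x. sin (freq L m * x))))) {0..L}"
  by (intro has_integral_diff has_integral_mult_right has_integral_inner L2_sin L2_cos)
 show ?thesis using has_integral_unique[OF i2 i1] sin_freq[OF L, of n] by simp
qed

lemma orthonormal_sine_cosine:
 assumes L: "0 < L"
 shows "inner (sine L n) (sine L m) = (if n = m then 1 else 0)" "inner (cosine L n) (cosine L m) = (if n = m then 1 else 0)"
proof -
 define s where "s n m = inner (toL L (%x. sin (freq L n * x))) (toL L (%x. sin (freq L m * x)))" for n m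
 define c where "c n m = inner (toL L (%x. cos (freq L n * x))) (toL L (%x. cos (freq L m * x)))" for n m
 have sym: "s n m = s m n" "c n m = c m n" for n m by (simp_all add: s_def c_def inner_commute)
 have e: "freq L n * c n m = freq L m * s n m" for n m using sin_cos_inner[OF L] by (simp add: s_def c_def)
 have z: "s n m = 0 & c n m = 0" if "n ~= m" for n m
 proof -
  have f: "0 < freq L n" "0 < freq L m" "freq L n ~= freq L m" using that L by (auto simp: freq_def)
  have "freq L n * (freq L n * c n m) = freq L n * (freq L m * s n m)" using e by simp
  also have "... = freq L m * (freq L n * s n m)" by simp
  also have "freq L n * s n m = freq L m * c n m" using e[of m n] sym by simp
  finally have "(freq L n * freq L n - freq L m * freq L m) * c n m = 0" by (simp add: algebra_simps)
  moreover have "freq L n * freq L n ~= freq L m * freq L m" using f power2_eq_iff_nonneg[of "freq L n" "freq L m"] by (simp add: power2_eq_square)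
  ultimately have "c n m = 0" by simp
  then show ?thesis using e[of n m] f by simp
 qed
 \<comment> \<open>On the diagonal the relation says that both integrals agree, and they add up to
   \<open>L\<close>.\<close>
 have d: "s n n = L / 2 & c n n = L / 2" for n
 proof -
  have i1: "((%x. sin (freq L n * x) * sin (freq L n * x) + cos (freq L n * x) * cos (freq L n * x)) has_integral (s n n + c n n)) {0..L}"
   unfolding s_def c_def by (intro has_integral_add has_integral_inner L2_sin L2_cos)
  have f1: "(%x. sin (freq L n * x) * sin (freq L n * x) + cos (freq L n * x) * cos (freq L n * x)) = (%x. 1)"
   by (rule ext) (simp add: power2_eq_square[symmetric])
  have i2: "((%x::real. 1::real) has_integral L) {0..L}" using has_integral_const_real[of "1::real" 0 L] L by simp
  have "s n n + c n n = L" by (rule has_integral_unique[OF i1[unfolded f1] i2])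
  moreover have "c n n = s n n" using e[of n n] freq_pos[OF L, of n] by simp
  ultimately show ?thesis by simp
 qed
 have "inner (sine L n) (sine L m) = 2 / L * s n m" using L by (simp add: sine_def s_def mult.assoc[symmetric])
 then show "inner (sine L n) (sine L m) = (if n = m then 1 else 0)"
  using z[of n m] d[of n] L by (cases "n = m") simp_all
 have "inner (cosine L n) (cosine L m) = 2 / L * c n m" using L by (simp add: cosine_def c_def mult.assoc[symmetric])
 then show "inner (cosine L n) (cosine L m) = (if n = m then 1 else 0)"
  using z[of n m] d[of n] L by (cases "n = m") simp_all
qed

lemma bessel:
 fixes e :: "nat => 'a::real_inner"
 assumes "!!n m. inner (e n) (e m) = (if n = m then 1 else 0)"
 shows "(\<Sum>n<N. (inner x (e n))^2) <= (norm x)^2"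
proof -
 define p where "p = (\<Sum>n<N. inner x (e n) *\<^sub>R e n)"
 have "inner x p = (\<Sum>n<N. (inner x (e n))^2)" by (simp add: p_def inner_sum_right power2_eq_square)
 moreover have "inner p p = (\<Sum>n<N. (inner x (e n))^2)"
  by (simp add: p_def inner_sum_right inner_sum_left assms power2_eq_square if_distrib[of "%z. _ * z"] sum.delta cong: if_cong)
 moreover have "0 <= inner (x - p) (x - p)" by simp
 ultimately show ?thesis by (simp add: inner_diff_left inner_diff_right inner_commute power2_norm_eq_inner)
qed

lemma sine_coeff_inner: "L2 L f ==> sine_coeff L f (Suc n) = inner (toL L f) (sine L n)"
proof -
 assume f: "L2 L f"
 have "(%x. f x * sin (real (Suc n) * pi * x / L)) = (%x. f x * sin (freq L n * x))" by (simp add: freq_def)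
 then show ?thesis using f by (simp add: sine_coeff_def sine_def inner_toL L2_sin)
qed

lemma sine_K1:
 assumes L: "0 < L" shows "(sine L n, freq L n *\<^sub>R cosine L n) \<in> K1 L"
proof -
 define g where "g x = freq L n * cos (freq L n * x)" for x
 have g: "L2 L g" unfolding g_def by (intro L2_scale L2_cos)
 have p: "prim g y = sin (freq L n * y)" if "0 <= y" for y
 proof -
  have "(g has_integral (sin (freq L n * y) - sin (freq L n * 0))) {0..y}"
   using that unfolding g_def
   by (intro fundamental_theorem_of_calculus)
    (auto intro!: derivative_eq_intros simp: has_real_derivative_iff_has_vector_derivative[symmetric])
  then show ?thesis by (simp add: prim_def integral_unique)
 qed
 have "(toL L (prim g), toL L g) \<in> K1 L" by (rule K1I[OF g]) (use p L sin_freq in auto)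
 moreover have "toL L (prim g) = toL L (%x. sin (freq L n * x))" by (rule toL_cong) (use p in auto)
 moreover have "toL L g = freq L n *\<^sub>R toL L (%x. cos (freq L n * x))" unfolding g_def by (simp add: toL_scale L2_cos)
 ultimately show ?thesis using K1_scale[of "toL L (prim g)" "toL L g" L "sqrt (2 / L)"] by (simp add: sine_def cosine_def mult.commute)
qed

text \<open>Integration by parts against \<open>cos (freq L n * x) - 1\<close>, the primitive of the
  scaled sine that vanishes at 0. The constant 1 drops out because the derivative of an element of
  \<open>K1\<close> has mean zero.\<close>

lemma K1_sine_cosine:
 assumes L: "0 < L" and k: "(e, d) \<in> K1 L"
 shows "freq L n * inner e (sine L n) = inner d (cosine L n)"
proof -
 obtain g where g: "L2 L g" "prim g L = 0" "e = toL L (prim g)" "d = toL L g" using k by (rule K1E)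
 define h where "h x = - (freq L n * sin (freq L n * x))" for x
 have h: "L2 L h" unfolding h_def using L2_scale[OF L2_sin[of L "freq L n"], of "- freq L n"] by simp
 have p: "prim h y = cos (freq L n * y) - 1" if "0 <= y" for y
 proof -
  have "(h has_integral (cos (freq L n * y) - cos (freq L n * 0))) {0..y}"
   using that unfolding h_def
   by (intro fundamental_theorem_of_calculus)
    (auto intro!: derivative_eq_intros simp: has_real_derivative_iff_has_vector_derivative[symmetric])
  then show ?thesis by (simp add: prim_def integral_unique)
 qed
 have i1: "((%x. g x * prim h x + prim g x * h x) has_integral 0) {0..L}"
  using prim_product[of L g h] L g h by simp
 have i2: "((%x. g x * prim h x + prim g x * h x) has_integral (inner d (toL L (prim h)) + inner e (toL L h))) {0..L}"
  unfolding g(3,4) by (intro has_integral_add has_integral_inner g(1) h prim_L2)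
 have "inner d (toL L (prim h)) + inner e (toL L h) = 0" by (rule has_integral_unique[OF i2 i1])
 moreover have "toL L (prim h) = toL L (%x. cos (freq L n * x)) - toL L (%x. 1)"
  using p by (subst toL_diff[symmetric]) (auto intro!: toL_cong L2_cos L2_const)
 moreover have "toL L h = - (freq L n *\<^sub>R toL L (%x. sin (freq L n * x)))"
  unfolding h_def using toL_scale[OF L2_sin[of L "freq L n"], of "- freq L n"] by simp
 moreover have "inner d (toL L (%x. 1)) = 0" using integral_eq_inner_1[OF g(1)] g by (simp add: prim_def)
 ultimately have "inner d (toL L (%x. cos (freq L n * x))) = freq L n * inner e (toL L (%x. sin (freq L n * x)))"
  by (simp add: inner_diff_right)
 then show ?thesis by (simp add: sine_def cosine_def)
qed

text \<open>Interpolation without the Hoelder inequality: since \<open>y powr \<theta> \<le> 1 + y\<close>, the weight of order \<open>s\<close> is at most a combination of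
 the weights of orders 0 and 1 (or 0 and -1), balanced by the parameter \<open>r\<close>.\<close>

lemma powr_le_one_plus: "0 <= y ==> 0 <= \<theta> ==> \<theta> <= 1 ==> y powr \<theta> <= 1 + (y::real)"
proof (cases "y <= 1")
 case True
 assume "0 <= y" "0 <= \<theta>"
 then have "y powr \<theta> <= 1 powr \<theta>" using True by (intro powr_mono2) auto
 then show ?thesis using \<open>0 <= y\<close> by simp
next
 case False
 assume "\<theta> <= 1"
 then have "y powr \<theta> <= y powr 1" using False by (intro powr_mono) auto
 then show ?thesis using False by simp
qed

text \<open>Everything is done on partial sums: a common bound also yields summability, without
  which the infinite sum in \<open>snorm\<close> could not be estimated.\<close>

lemma snorm_sq_le:
 assumes L: "0 < L" and f: "L2 L f"
  and w: "!!n. freq L n powr (2 * s) <= p + q * (if s \<ge> 0 then (freq L n)^2 else inverse ((freq L n)^2))" "0 <= p" "0 <= q"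
  and b: "!!N. (\<Sum>n<N. (inner (toL L f) (sine L n))^2) <= P"
   "!!N. (\<Sum>n<N. (if s \<ge> 0 then (freq L n)^2 else inverse ((freq L n)^2)) * (inner (toL L f) (sine L n))^2) <= Q"
 shows "(snorm L s f)^2 <= p * P + q * Q"
proof -
 define t where "t n = freq L n powr (2 * s) * (inner (toL L f) (sine L n))^2" for n
 define W where "W n = (if s \<ge> 0 then (freq L n)^2 else inverse ((freq L n)^2))" for n
 have t0: "0 <= t n" for n by (simp add: t_def)
 have ps: "(\<Sum>n<N. t n) <= p * P + q * Q" for N
 proof -
  have "(\<Sum>n<N. t n) <= (\<Sum>n<N. p * (inner (toL L f) (sine L n))^2 + q * (W n * (inner (toL L f) (sine L n))^2))"
  proof (rule sum_mono)
   fix n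
   have "t n <= (p + q * W n) * (inner (toL L f) (sine L n))^2"
    unfolding t_def W_def by (intro mult_right_mono w) simp
   then show "t n <= p * (inner (toL L f) (sine L n))^2 + q * (W n * (inner (toL L f) (sine L n))^2)"
    by (simp add: algebra_simps)
  qed
  also have "... = p * (\<Sum>n<N. (inner (toL L f) (sine L n))^2) + q * (\<Sum>n<N. W n * (inner (toL L f) (sine L n))^2)"
   by (simp add: sum.distrib sum_distrib_left)
  also have "... <= p * P + q * Q" using b w(2,3) unfolding W_def by (intro add_mono mult_left_mono) auto
  finally show ?thesis .
 qed
 have sm: "summable t"
  by (rule bounded_imp_summable[where B = "p * P + q * Q"]) (simp_all only: t0 ps lessThan_Suc_atMost[symmetric])
 have le: "suminf t <= p * P + q * Q" by (rule suminf_le_const[OF sm ps])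
 have "snorm L s f = sqrt (suminf t)"
  unfolding snorm_def t_def using f by (simp add: sine_coeff_inner freq_def)
 then show ?thesis using le suminf_nonneg[OF sm t0] by simp
qed

text \<open>With \<open>r\<close> the length of a time step, a function of \<open>L^2\<close> size
  \<open>r\<close> with bounded derivative obtains a squared norm of order
  \<open>r powr (2 * etz)\<close>.\<close>

lemma snorm_upper:
 assumes L: "0 < L" and etz: "0 < etz" "etz <= 1" and f: "L2 L f" "(toL L f, d) \<in> K1 L" and r: "0 < r"
 shows "(snorm L (1 - etz) f)^2 <= r powr (2 * etz - 2) * ((norm (toL L f))^2 + r^2 * (norm d)^2)"
proof -
 define p where "p = r powr (2 * etz - 2)"
 have "(snorm L (1 - etz) f)^2 <= p * (norm (toL L f))^2 + (p * r^2) * (norm d)^2"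
 proof (rule snorm_sq_le[OF L f(1)])
  fix n
  have fp: "0 < freq L n" by (rule freq_pos[OF L])
  have "freq L n powr (2 * (1 - etz)) = p * ((r * freq L n)^2) powr (1 - etz)"
  proof -
   have "((r * freq L n)^2) powr (1 - etz) = (r * freq L n) powr (2 * (1 - etz))"
    using r fp by (simp add: powr_powr flip: powr_numeral)
   also have "... = r powr (2 * (1 - etz)) * freq L n powr (2 * (1 - etz))" using r fp by (simp add: powr_mult)
   finally have "p * ((r * freq L n)^2) powr (1 - etz) = (r powr (2 * etz - 2) * r powr (2 * (1 - etz))) * freq L n powr (2 * (1 - etz))"
    by (simp add: p_def)
   also have "r powr (2 * etz - 2) * r powr (2 * (1 - etz)) = 1" using r by (simp flip: powr_add)
   finally show ?thesis by simp
  qed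
  also have "... <= p * (1 + (r * freq L n)^2)" using etz by (intro mult_left_mono powr_le_one_plus) (auto simp: p_def)
  finally show "freq L n powr (2 * (1 - etz)) <= p + p * r^2 * (if 0 <= 1 - etz then (freq L n)^2 else inverse ((freq L n)^2))"
   using etz by (simp add: power_mult_distrib algebra_simps)
 next
  fix N
  show "(\<Sum>n<N. (inner (toL L f) (sine L n))^2) <= (norm (toL L f))^2" by (rule bessel[OF orthonormal_sine_cosine(1)[OF L]])
  have "(\<Sum>n<N. (freq L n)^2 * (inner (toL L f) (sine L n))^2) = (\<Sum>n<N. (inner d (cosine L n))^2)"
   by (simp add: K1_sine_cosine[OF L f(2), symmetric] power_mult_distrib)
  also have "... <= (norm d)^2" by (rule bessel[OF orthonormal_sine_cosine(2)[OF L]])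
  finally show "(\<Sum>n<N. (if 0 <= 1 - etz then (freq L n)^2 else inverse ((freq L n)^2)) * (inner (toL L f) (sine L n))^2) <= (norm d)^2"
   using etz by simp
 qed (use r in \<open>auto simp: p_def\<close>)
 then show ?thesis by (simp add: p_def algebra_simps)
qed

text \<open>\<open>D\<close> plays the part of the norm in the dual of the Dirichlet space. If
  \<open>D\<close> is of order \<open>r\<close>, the bound is again of order
  \<open>r powr (2 * etz)\<close>, in balance with the displacement.\<close>

lemma snorm_lower:
 assumes L: "0 < L" and etz: "0 < etz" "etz <= 1" and f: "L2 L f" and r: "0 < r" and D: "0 <= D"
  and dual: "!!e d. (e, d) \<in> K1 L ==> inner (toL L f) e <= D * norm d"
 shows "(snorm L (- etz) f)^2 <= r powr (2 * etz) * ((norm (toL L f))^2 + D^2 / r^2)"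
proof -
 define p where "p = r powr (2 * etz)"
 have "(snorm L (- etz) f)^2 <= p * (norm (toL L f))^2 + (p / r^2) * D^2"
 proof (rule snorm_sq_le[OF L f])
  fix n
  have fp: "0 < freq L n" by (rule freq_pos[OF L])
  have "freq L n powr (2 * - etz) = p * (inverse ((r * freq L n)^2)) powr etz"
  proof -
   have "(inverse ((r * freq L n)^2)) powr etz = (r * freq L n) powr (- (2 * etz))"
    using r fp by (simp add: powr_powr powr_minus flip: powr_numeral) (simp add: powr_def ln_inverse ln_realpow flip: exp_minus)
   also have "... = r powr (- (2 * etz)) * freq L n powr (- (2 * etz))" using r fp by (simp add: powr_mult)
   finally have "p * (inverse ((r * freq L n)^2)) powr etz = (r powr (2 * etz) * r powr (- (2 * etz))) * freq L n powr (- (2 * etz))"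
    by (simp add: p_def)
   also have "r powr (2 * etz) * r powr (- (2 * etz)) = 1" using r by (simp flip: powr_add)
   finally show ?thesis by simp
  qed
  also have "... <= p * (1 + inverse ((r * freq L n)^2))" using etz by (intro mult_left_mono powr_le_one_plus) (auto simp: p_def)
  finally show "freq L n powr (2 * - etz) <= p + p / r^2 * (if 0 <= - etz then (freq L n)^2 else inverse ((freq L n)^2))"
   using etz by (simp add: power_mult_distrib field_simps)
 next
  fix N
  show "(\<Sum>n<N. (inner (toL L f) (sine L n))^2) <= (norm (toL L f))^2" by (rule bessel[OF orthonormal_sine_cosine(1)[OF L]])
  define c where "c n = inner (toL L f) (sine L n)" for n
  \<comment> \<open>\<open>e\<close> is the truncated inverse Dirichlet Laplacian of
    \<open>f\<close> and \<open>d\<close> its derivative. Pairing with \<open>f\<close> and the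
    squared norm of \<open>d\<close> both give \<open>Y\<close>, so the duality hypothesis reads
    \<open>Y \<le> D * sqrt Y\<close>.\<close>
  define Y where "Y = (\<Sum>n<N. inverse ((freq L n)^2) * (c n)^2)"
  define e where "e = (\<Sum>n<N. (inverse ((freq L n)^2) * c n) *\<^sub>R sine L n)"
  define d where "d = (\<Sum>n<N. (inverse ((freq L n)^2) * c n * freq L n) *\<^sub>R cosine L n)"
  have "((\<Sum>n<M. (inverse ((freq L n)^2) * c n) *\<^sub>R sine L n), (\<Sum>n<M. (inverse ((freq L n)^2) * c n * freq L n) *\<^sub>R cosine L n)) \<in> K1 L" for M
  proof (induction M)
   case 0 then show ?case using K1_zero[OF L] by simp
  next
   case (Suc M)
   then show ?case
    using K1_add[OF L Suc K1_scale[OF sine_K1[OF L, of M], of "inverse ((freq L M)^2) * c M"]] by simp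
  qed
  then have k: "(e, d) \<in> K1 L" by (simp add: e_def d_def)
  have fe: "inner (toL L f) e = Y" by (simp add: e_def Y_def inner_sum_right c_def power2_eq_square mult_ac)
  have "inner d d = (\<Sum>n<N. (inverse ((freq L n)^2) * c n * freq L n)^2)"
   by (simp add: d_def inner_sum_right inner_sum_left orthonormal_sine_cosine[OF L] power2_eq_square if_distrib[of "%z. _ * z"] sum.delta cong: if_cong)
  also have "... = Y"
   unfolding Y_def
  proof (rule sum.cong[OF refl])
   fix n show "(inverse ((freq L n)^2) * c n * freq L n)^2 = inverse ((freq L n)^2) * (c n)^2"
    using freq_pos[OF L, of n] by (simp add: power_mult_distrib power2_eq_square field_simps)
  qed
  finally have nd: "norm d = sqrt Y" by (simp add: norm_eq_sqrt_inner)
  have Y0: "0 <= Y" unfolding Y_def by (intro sum_nonneg) simp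
  have "Y <= D * sqrt Y" using dual[OF k] fe nd by simp
  then have "sqrt Y * sqrt Y <= D * sqrt Y" using Y0 by simp
  then have "sqrt Y <= D" using mult_right_le_imp_le[of "sqrt Y" "sqrt Y" D] Y0 D by (cases "Y = 0") auto
  then have "Y <= D^2" using Y0 using power_mono[of "sqrt Y" D 2] by simp
  then show "(\<Sum>n<N. (if 0 <= - etz then (freq L n)^2 else inverse ((freq L n)^2)) * (inner (toL L f) (sine L n))^2) <= D^2"
   using etz by (simp add: Y_def c_def)
 qed (use r in \<open>auto simp: p_def\<close>)
 then show ?thesis by (simp add: p_def algebra_simps)
qed

section \<open>Damping terms, and the Bresse system as an abstract wave equation\<close>

type_synonym h3 = "l2 \<times> l2 \<times> l2"

lemma negl_ball: "negligible {x \<in> {0..L}. ~ P x} ==> (!!x. P x ==> Q x) ==> negligible {x \<in> {0..L::real}. ~ Q x}"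
 by (rule negligible_subset) auto

lemma norm_components:
 "norm (fst x) <= norm x" "norm (fst (snd x)) <= norm x" "norm (snd (snd x)) <= norm x"
 "norm x <= norm (fst x) + norm (fst (snd x)) + norm (snd (snd x))"
 for x :: "'a::real_normed_vector \<times> 'b::real_normed_vector \<times> 'c::real_normed_vector"
proof -
 obtain a b c where x: "x = (a, b, c)" by (cases x) auto
 have 1: "norm a <= norm (a, b, c)" "norm (b, c) <= norm (a, b, c)" "norm b <= norm (b, c)" "norm c <= norm (b, c)"
  by (rule norm_fst_le norm_snd_le)+
 show "norm (fst x) <= norm x" "norm (fst (snd x)) <= norm x" "norm (snd (snd x)) <= norm x" using 1 by (auto simp: x)
 show "norm x <= norm (fst x) + norm (fst (snd x)) + norm (snd (snd x))"
  using norm_Pair_le[of a "(b, c)"] norm_Pair_le[of b c] by (simp add: x)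
qed

lemma damping_bounds:
 assumes "damping_ok g"
 shows "\<exists>m>0. \<exists>M>0. (\<forall>s t. m * (s - t)^2 <= (g s - g t) * (s - t)) & (\<forall>s t. \<bar>g s - g t\<bar> <= M * \<bar>s - t\<bar>)"
proof -
 obtain g' m M where h: "0 < m" "0 < M" "!!s. (g has_real_derivative g' s) (at s)" "!!s. m <= g' s" "!!s. g' s <= M"
  using assms unfolding damping_ok_def by blast
 have e: "\<exists>c. m <= c & c <= M & g s - g t = c * (s - t)" for s t
 proof -
  consider "s = t" | "s < t" | "t < s" by linarith
  then show ?thesis
  proof cases
   case 1 then show ?thesis using h(4)[of 0] h(5)[of 0] by (intro exI[of _ "g' 0"]) simp
  next
   case 2
   then obtain z where "g t - g s = (t - s) * g' z" using MVT2[of s t g g'] h(3) by blast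
   then show ?thesis using h(4,5) by (intro exI[of _ "g' z"]) (simp add: algebra_simps)
  next
   case 3
   then obtain z where "g s - g t = (s - t) * g' z" using MVT2[of t s g g'] h(3) by blast
   then show ?thesis using h(4,5) by (intro exI[of _ "g' z"]) (simp add: algebra_simps)
  qed
 qed
 have "m * (s - t)^2 <= (g s - g t) * (s - t)" for s t
 proof -
  obtain c where "m <= c" "g s - g t = c * (s - t)" using e by blast
  then show ?thesis using mult_right_mono[of m c "(s - t)^2"] by (simp add: power2_eq_square mult.assoc)
 qed
 moreover have "\<bar>g s - g t\<bar> <= M * \<bar>s - t\<bar>" for s t
 proof -
  obtain c where "m <= c" "c <= M" "g s - g t = c * (s - t)" using e by blast
  then show ?thesis using h(1) mult_right_mono[of c M "\<bar>s - t\<bar>"] by (simp add: abs_mult)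
 qed
 ultimately show ?thesis using h(1,2) by blast
qed

lemma damping_compose:
 assumes g0: "g 0 = 0" and lip: "!!s t. \<bar>g s - g t\<bar> <= M * \<bar>s - t\<bar>" and M: "0 < M" and v: "L2 L v"
 shows "L2 L (%x. g (v x))"
proof (rule L2_bound)
 have "continuous_on UNIV g"
  unfolding continuous_on_iff
 proof (intro ballI allI impI)
  fix x e :: real assume "0 < e"
  then show "\<exists>d>0. \<forall>y\<in>UNIV. dist y x < d --> dist (g y) (g x) < e"
   using M lip by (intro exI[of _ "e / M"]) (auto simp: dist_real_def field_simps intro: le_less_trans)
 qed
 then show "(%x. g (v x)) \<in> borel_measurable (lebesgue_on {0..L})"
  by (intro measurable_compose[OF lebesgue_on_measurable_L2[OF v] borel_measurable_continuous_onI])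
 show "L2 L (%x. M * v x)" using v by (rule L2_scale)
 have "\<bar>g s\<bar> <= \<bar>M * s\<bar>" for s using lip[of s 0] g0 M by (simp add: abs_mult)
 then show "negligible {x \<in> {0..L}. ~ \<bar>g (v x)\<bar> <= \<bar>M * v x\<bar>}" by (intro empty_imp_negligible) auto
qed

lemma damping_monotone:
 assumes m: "!!s t. m * (s - t)^2 <= (g s - g t) * (s - t)" and l: "L2 L v" "L2 L w" "L2 L (%x. g (v x))" "L2 L (%x. g (w x))"
 shows "m * (norm (toL L v - toL L w))^2 <= inner (toL L (%x. g (v x)) - toL L (%x. g (w x))) (toL L v - toL L w)"
proof -
 have d: "L2 L (%x. v x - w x)" "L2 L (%x. g (v x) - g (w x))" using l by (simp_all add: L2_diff)
 have "((%x. m * ((v x - w x) * (v x - w x))) has_integral (m * inner (toL L (%x. v x - w x)) (toL L (%x. v x - w x)))) {0..L}"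
  by (intro has_integral_mult_right has_integral_inner d)
 moreover have "((%x. (g (v x) - g (w x)) * (v x - w x)) has_integral inner (toL L (%x. g (v x) - g (w x))) (toL L (%x. v x - w x))) {0..L}"
  by (intro has_integral_inner d)
 ultimately have "m * inner (toL L (%x. v x - w x)) (toL L (%x. v x - w x)) <= inner (toL L (%x. g (v x) - g (w x))) (toL L (%x. v x - w x))"
  by (rule has_integral_le) (use m in \<open>simp add: power2_eq_square\<close>)
 then show ?thesis using l by (simp add: toL_diff power2_norm_eq_inner)
qed

lemma damping_lipschitz:
 assumes lip: "!!s t. \<bar>g s - g t\<bar> <= M * \<bar>s - t\<bar>" and M: "0 < M" and l: "L2 L v" "L2 L w" "L2 L (%x. g (v x))" "L2 L (%x. g (w x))"
 shows "norm (toL L (%x. g (v x)) - toL L (%x. g (w x))) <= M * norm (toL L v - toL L w)"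
proof -
 have "norm (toL L (%x. g (v x) - g (w x))) <= norm (toL L (%x. M * (v x - w x)))"
  using lip M by (intro norm_toL_mono L2_diff L2_scale l empty_imp_negligible) (auto simp: abs_mult)
 then show ?thesis using l M by (simp add: toL_diff L2_diff toL_scale[OF L2_diff[OF l(1,2)]])
qed

locale bresse =
 fixes L \<rho>1 \<rho>2 b k k0 l \<gamma>3 \<beta> mF p Cf :: real
  and F f1 f2 f3 :: "real \<times> real \<times> real => real"
  and g1 g2 g3 :: "real => real"
  and S :: "real => bst => bst"
  and A :: "bst set"
 assumes pos: "L > 0" "\<rho>1 > 0" "\<rho>2 > 0" "b > 0" "k > 0" "k0 > 0" "l > 0"
  and gamma3: "\<gamma>3 > 0"
   "\<forall>\<phi> \<psi> w. H10 L \<phi> & H10 L \<psi> & H10 L w -->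
    (l2norm L (dx L \<phi>))^2 + (l2norm L (dx L \<psi>))^2 + (l2norm L (dx L w))^2
    <= \<gamma>3 * (b * (l2norm L (dx L \<psi>))^2
         + k * (l2norm L (%x. dx L \<phi> x + \<psi> x + l * w x))^2
         + k0 * (l2norm L (%x. dx L w x - l * \<phi> x))^2)"
  and F1: "\<forall>x. (F has_derivative
       (%h. f1 x * fst h + f2 x * fst (snd h) + f3 x * snd (snd h))) (at x)"
  and F2: "0 <= \<beta>" "0 <= mF" "\<beta> < pi^2 / (2 * \<gamma>3 * L^2)"
   "\<forall>u v w. F (u, v, w) \<ge> - \<beta> * (u^2 + v^2 + w^2) - mF"
  and F3: "p \<ge> 1" "Cf > 0" "C1_growth Cf p f1" "C1_growth Cf p f2" "C1_growth Cf p f3"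
  and F4: "\<forall>u v w. f1 (u, v, w) * u + f2 (u, v, w) * v + f3 (u, v, w) * w - F (u, v, w)
          \<ge> - \<beta> * (u^2 + v^2 + w^2) - mF"
  and G: "damping_ok g1" "damping_ok g2" "damping_ok g3"
  and semigroup: "\<forall>U0. Hsp L U0 -->
    bresse_weak_sol L \<rho>1 \<rho>2 b k k0 l g1 g2 g3 f1 f2 f3 (%t. S t U0) & dH L (S 0 U0) U0 = 0"
  and attractor: "global_attractor L S A"
begin

text \<open>Three Dirichlet graphs side by side, ordered as displacement triple and derivative
  triple. The bilinear form is then an expression in the coordinates, and \<open>fst\<close> is the
  embedding into the pivot space.\<close>

definition K3 :: "(h3 \<times> h3) set" where
 "K3 = {x. (fst (fst x), fst (snd x)) \<in> K1 L & (fst (snd (fst x)), fst (snd (snd x))) \<in> K1 L \<and>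
  (snd (snd (fst x)), snd (snd (snd x))) \<in> K1 L}"

definition shear :: "h3 \<times> h3 => l2" where
 "shear x = fst (snd x) + fst (snd (fst x)) + l *\<^sub>R snd (snd (fst x))"
definition axial :: "h3 \<times> h3 => l2" where
 "axial x = snd (snd (snd x)) - l *\<^sub>R fst (fst x)"

definition aform :: "h3 \<times> h3 => h3 \<times> h3 => real" where
 "aform x y = b * inner (fst (snd (snd x))) (fst (snd (snd y))) + k * inner (shear x) (shear y) + k0 * inner (axial x) (axial y)"

definition mass :: "h3 => h3" where
 "mass u = (\<rho>1 *\<^sub>R fst u, \<rho>2 *\<^sub>R fst (snd u), \<rho>1 *\<^sub>R snd (snd u))"

lemma shear_linear: "bounded_linear shear"
 unfolding shear_def
 by (intro bounded_linear_add bounded_linear_scaleR_right[THEN bounded_linear_compose] 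
   bounded_linear_compose[OF bounded_linear_fst] bounded_linear_compose[OF bounded_linear_snd]
   bounded_linear_fst bounded_linear_snd bounded_linear_ident)

lemma axial_linear: "bounded_linear axial"
 unfolding axial_def
 by (intro bounded_linear_sub bounded_linear_scaleR_right[THEN bounded_linear_compose] 
   bounded_linear_compose[OF bounded_linear_fst] bounded_linear_compose[OF bounded_linear_snd]
   bounded_linear_fst bounded_linear_snd bounded_linear_ident)

interpretation sh: bounded_linear shear by (rule shear_linear)
interpretation ax: bounded_linear axial by (rule axial_linear)

lemma K3_exists_H10:
 assumes "(e, d) \<in> K1 L"
 obtains f where "H10 L f" "L2 L f" "L2 L (dx L f)" "toL L f = e" "toL L (dx L f) = d"
proof -
 obtain g where g: "L2 L g" "prim g L = 0" "e = toL L (prim g)" "d = toL L g" using assms by (rule K1E)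
 have "(toL L (prim g), d) \<in> K1 L" using assms g by simp
 note h = K1_H10[OF pos(1) prim_L2[OF g(1)] this]
 show thesis by (rule that[OF h(1) prim_L2[OF g(1)] H10_K1(2)[OF pos(1) h(1)] g(3)[symmetric] h(2)])
qed

lemma K3_coercive: assumes "x \<in> K3" shows "(norm (snd x))^2 <= \<gamma>3 * aform x x"
proof -
 obtain u d where x: "x = (u, d)" by (cases x)
 have k3: "(fst u, fst d) \<in> K1 L" "(fst (snd u), fst (snd d)) \<in> K1 L" "(snd (snd u), snd (snd d)) \<in> K1 L"
  using assms by (auto simp: K3_def x)
 obtain \<phi> where \<phi>: "H10 L \<phi>" "L2 L \<phi>" "L2 L (dx L \<phi>)" "toL L \<phi> = fst u" "toL L (dx L \<phi>) = fst d" using K3_exists_H10[OF k3(1)] .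
 obtain \<psi> where \<psi>: "H10 L \<psi>" "L2 L \<psi>" "L2 L (dx L \<psi>)" "toL L \<psi> = fst (snd u)" "toL L (dx L \<psi>) = fst (snd d)" using K3_exists_H10[OF k3(2)] .
 obtain w where w: "H10 L w" "L2 L w" "L2 L (dx L w)" "toL L w = snd (snd u)" "toL L (dx L w) = snd (snd d)" using K3_exists_H10[OF k3(3)] .
 have s: "L2 L (%x. dx L \<phi> x + \<psi> x + l * w x)" "toL L (%x. dx L \<phi> x + \<psi> x + l * w x) = shear x"
  using \<phi> \<psi> w by (auto simp: L2_add L2_scale toL_add toL_scale shear_def x)
 have a: "L2 L (%x. dx L w x - l * \<phi> x)" "toL L (%x. dx L w x - l * \<phi> x) = axial x"
  using \<phi> w by (auto simp: L2_diff L2_scale toL_diff toL_scale axial_def x)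
 have "(norm (fst d))^2 + (norm (fst (snd d)))^2 + (norm (snd (snd d)))^2 <= \<gamma>3 * (b * (norm (fst (snd d)))^2 + k * (norm (shear x))^2 + k0 * (norm (axial x))^2)"
  using gamma3(2)[rule_format, of \<phi> \<psi> w] \<phi> \<psi> w s a by (simp add: l2norm_eq_norm)
 moreover have "(norm d)^2 = (norm (fst d))^2 + (norm (fst (snd d)))^2 + (norm (snd (snd d)))^2"
  by (simp add: norm_prod_def)
 moreover have "aform x x = b * (norm (fst (snd d)))^2 + k * (norm (shear x))^2 + k0 * (norm (axial x))^2"
  unfolding aform_def power2_norm_eq_inner by (simp only: x snd_conv)
 ultimately show ?thesis by (simp only: x snd_conv)
qed

lemma K3_poincare: assumes "x \<in> K3" shows "norm (fst x) <= L * norm (snd x)"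
proof -
 obtain a b c a' b' c' where x: "x = ((a, b, c), (a', b', c'))" by (metis prod.collapse)
 have "(a, a') \<in> K1 L" "(b, b') \<in> K1 L" "(c, c') \<in> K1 L" using assms by (auto simp: K3_def x)
 then have "(norm a)^2 <= (L * norm a')^2" "(norm b)^2 <= (L * norm b')^2" "(norm c)^2 <= (L * norm c')^2"
  using K1_poincare[OF pos(1)] by (auto intro!: power_mono)
 then have "(norm (fst x))^2 <= (L * norm (snd x))^2"
  by (simp add: x norm_prod_def power_mult_distrib distrib_left)
 then show ?thesis by (rule power2_le_imp_le) (use pos(1) in simp)
qed

lemma K3_wirtinger: assumes "x \<in> K3" shows "(pi / L * norm (fst x))^2 <= (norm (snd x))^2"
proof -
 obtain a b c a' b' c' where x: "x = ((a, b, c), (a', b', c'))" by (metis prod.collapse)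
 have "(a, a') \<in> K1 L" "(b, b') \<in> K1 L" "(c, c') \<in> K1 L" using assms by (auto simp: K3_def x)
 then have "(pi / L * norm a)^2 <= (norm a')^2" "(pi / L * norm b)^2 <= (norm b')^2" "(pi / L * norm c)^2 <= (norm c')^2"
  using K1_wirtinger[OF pos(1)] pos(1) by (auto intro!: power_mono)
 then show ?thesis by (simp add: x norm_prod_def power_mult_distrib power_divide distrib_left add_divide_distrib)
qed

text \<open>The norm on pairs counts displacement and derivative: the Poincare inequality
  contributes \<open>L^2 + 1\<close>, the hypothesis on \<open>\<gamma>3\<close> the rest.\<close>

definition ccoer :: real where "ccoer = 1 / (\<gamma>3 * (L^2 + 1))"
definition cmass :: real where "cmass = min \<rho>1 \<rho>2"

sublocale wave_form K3 fst aform mass ccoer cmass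
proof (rule wave_form.intro)
 show "subspace K3"
  by (rule subspaceI; simp only: K3_def mem_Collect_eq fst_zero snd_zero fst_add snd_add fst_scaleR snd_scaleR)
   (intro conjI K1_zero[OF pos(1)] K1_add[OF pos(1)] K1_scale; simp)+
 show "bounded_linear (fst :: h3 \<times> h3 => h3)" by (rule bounded_linear_fst)
 show "aform x y = aform y x" for x y by (simp add: aform_def inner_commute)
 have d2: "bounded_linear (%x::h3 \<times> h3. fst (snd (snd x)))"
  by (intro bounded_linear_compose[OF bounded_linear_fst] bounded_linear_compose[OF bounded_linear_snd] bounded_linear_snd)
 obtain B1 where B1: "\<forall>x::h3 \<times> h3. norm (fst (snd (snd x))) <= norm x * B1" using bounded_linear.bounded[OF d2] by (rule exE)
 obtain B2 where B2: "\<forall>x. norm (shear x) <= norm x * B2" using bounded_linear.bounded[OF shear_linear] by (rule exE)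
 obtain B3 where B3: "\<forall>x. norm (axial x) <= norm x * B3" using bounded_linear.bounded[OF axial_linear] by (rule exE)
 note B = B1[rule_format] B2[rule_format] B3[rule_format]
 show "bounded_bilinear aform"
 proof
  fix x x' y y' :: "h3 \<times> h3" and r :: real
  show "aform (x + x') y = aform x y + aform x' y" by (simp add: aform_def sh.add ax.add inner_add_left algebra_simps)
  show "aform x (y + y') = aform x y + aform x y'" by (simp add: aform_def sh.add ax.add inner_add_right algebra_simps)
  show "aform (r *\<^sub>R x) y = r *\<^sub>R aform x y" by (simp add: aform_def sh.scaleR ax.scaleR algebra_simps)
  show "aform x (r *\<^sub>R y) = r *\<^sub>R aform x y" by (simp add: aform_def sh.scaleR ax.scaleR algebra_simps)
 next
  have "norm (aform x y) <= norm x * norm y * (b * (B1 * B1) + k * (B2 * B2) + k0 * (B3 * B3))" for x y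
  proof -
   have i: "\<bar>inner (T x) (T y)\<bar> <= norm x * norm y * (B * B)" if "!!x. norm (T x) <= norm x * B" for T :: "h3 \<times> h3 => l2" and B
   proof -
    have "\<bar>inner (T x) (T y)\<bar> <= norm (T x) * norm (T y)" by (rule Cauchy_Schwarz_ineq2)
    also have "... <= (norm x * B) * (norm y * B)"
     by (intro mult_mono that order_trans[OF norm_ge_zero that] norm_ge_zero)
    finally show ?thesis by (simp add: mult_ac)
   qed
   have "\<bar>aform x y\<bar> <= b * \<bar>inner (fst (snd (snd x))) (fst (snd (snd y)))\<bar> + k * \<bar>inner (shear x) (shear y)\<bar> + k0 * \<bar>inner (axial x) (axial y)\<bar>"
    unfolding aform_def using pos by (auto simp: abs_mult intro!: order_trans[OF abs_triangle_ineq] add_mono)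
   also have "... <= b * (norm x * norm y * (B1 * B1)) + k * (norm x * norm y * (B2 * B2)) + k0 * (norm x * norm y * (B3 * B3))"
    using pos by (intro add_mono mult_left_mono i B) auto
   finally show ?thesis by (simp add: algebra_simps)
  qed
  then show "\<exists>K. \<forall>x y. norm (aform x y) <= norm x * norm y * K" by (intro exI allI)
 qed
 show "0 < ccoer" using gamma3(1) by (simp add: ccoer_def add_nonneg_pos)
 show "ccoer * (norm x)^2 <= aform x x" if x: "x \<in> K3" for x
 proof -
  have "(norm x)^2 = (norm (fst x))^2 + (norm (snd x))^2" by (simp add: norm_prod_def)
  also have "(norm (fst x))^2 <= (L * norm (snd x))^2" using K3_poincare[OF x] by (intro power_mono) auto
  finally have "(norm x)^2 <= (L^2 + 1) * (norm (snd x))^2" by (simp add: power_mult_distrib algebra_simps)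
  also have "... <= (L^2 + 1) * (\<gamma>3 * aform x x)" using K3_coercive[OF x] by (intro mult_left_mono) auto
  finally have "(norm x)^2 <= aform x x * (\<gamma>3 * (L^2 + 1))" by (simp add: algebra_simps)
  moreover have "0 < \<gamma>3 * (L^2 + 1)" using gamma3(1) by (simp add: add_nonneg_pos)
  ultimately show ?thesis by (simp add: ccoer_def pos_divide_le_eq)
 qed
 show "bounded_linear mass"
  unfolding mass_def
  by (intro bounded_linear_Pair bounded_linear_scaleR_right[THEN bounded_linear_compose]
   bounded_linear_compose[OF bounded_linear_fst] bounded_linear_compose[OF bounded_linear_snd] bounded_linear_fst bounded_linear_snd)
 show "inner (mass u) v = inner u (mass v)" for u v by (simp add: mass_def inner_prod_def)
 show "0 < cmass" using pos by (simp add: cmass_def)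
 show "cmass * (norm u)^2 <= inner (mass u) u" for u
 proof -
  obtain a b c where u: "u = (a, b, c)" by (cases u) auto
  have "cmass * (norm a)^2 <= \<rho>1 * (norm a)^2" "cmass * (norm b)^2 <= \<rho>2 * (norm b)^2" "cmass * (norm c)^2 <= \<rho>1 * (norm c)^2"
   by (intro mult_right_mono; simp add: cmass_def)+
  then show ?thesis by (simp add: u mass_def inner_prod_def norm_prod_def power2_norm_eq_inner distrib_left)
 qed
qed

end

context bresse
begin

section \<open>States and nonlinear terms in the Hilbert space picture\<close>

definition uT :: "bst => real => r3" where "uT U x = (phi U x, psi U x, ww U x)"
definition vT :: "bst => real => r3" where "vT U x = (phi_t U x, psi_t U x, ww_t U x)"
definition uu :: "bst => h3" where "uu U = to3 L (uT U)"
definition vv :: "bst => h3" where "vv U = to3 L (vT U)"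
definition dd :: "bst => h3" where "dd U = (toL L (dx L (phi U)), toL L (dx L (psi U)), toL L (dx L (ww U)))"
text \<open>Chosen so that \<open>dH\<close> is the norm of a difference. The displacement itself is
  left out because on \<open>K3\<close> it is determined by the derivative.\<close>

definition io :: "bst => h3 \<times> h3" where "io U = (dd U, vv U)"
definition NG :: "bst => h3" where
 "NG U = (toL L (%x. g1 (phi_t U x)), toL L (%x. g2 (psi_t U x)), toL L (%x. g3 (ww_t U x)))"
definition NF :: "bst => h3" where
 "NF U = (toL L (%x. f1 (uT U x)), toL L (%x. f2 (uT U x)), toL L (%x. f3 (uT U x)))"

lemma uu_eq: "uu U = (toL L (phi U), toL L (psi U), toL L (ww U))" by (simp add: uu_def to3_def uT_def)
lemma vv_eq: "vv U = (toL L (phi_t U), toL L (psi_t U), toL L (ww_t U))" by (simp add: vv_def to3_def vT_def)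

lemma HspD:
 assumes "Hsp L U"
 shows "H10 L (phi U)" "H10 L (psi U)" "H10 L (ww U)" "L2 L (phi_t U)" "L2 L (psi_t U)" "L2 L (ww_t U)"
  "L2 L (phi U)" "L2 L (psi U)" "L2 L (ww U)" "L2 L (dx L (phi U))" "L2 L (dx L (psi U))" "L2 L (dx L (ww U))"
  "L2t L (uT U)" "L2t L (vT U)" "(uu U, dd U) \<in> K3"
proof -
 show 1: "H10 L (phi U)" "H10 L (psi U)" "H10 L (ww U)" "L2 L (phi_t U)" "L2 L (psi_t U)" "L2 L (ww_t U)"
  using assms by (auto simp: Hsp_def)
 show 2: "L2 L (phi U)" "L2 L (psi U)" "L2 L (ww U)" "L2 L (dx L (phi U))" "L2 L (dx L (psi U))" "L2 L (dx L (ww U))"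
  using H10_K1(1,2)[OF pos(1)] 1 by auto
 show "L2t L (uT U)" "L2t L (vT U)" using 1 2 by (auto simp: L2t_def uT_def vT_def)
 show "(uu U, dd U) \<in> K3" using H10_K1(4)[OF pos(1)] 1 by (simp add: K3_def uu_eq dd_def)
qed

text \<open>Turns a bound in the energy norm into a bound of the arguments of \<open>F\<close> and
  the \<open>f\<close> terms, so that local properties on balls apply almost everywhere. The 3 comes
  from adding the three components.\<close>

lemma K3_sup:
 assumes x: "x \<in> K3" and T: "L2t L T" "to3 L T = fst x"
 shows "negligible {z \<in> {0..L}. ~ norm (T z) <= 3 * sqrt L * norm (snd x)}"
proof -
 have k: "(fst (fst x), fst (snd x)) \<in> K1 L" "(fst (snd (fst x)), fst (snd (snd x))) \<in> K1 L" "(snd (snd (fst x)), snd (snd (snd x))) \<in> K1 L"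
  using x by (auto simp: K3_def)
 define c where "c = sqrt L * norm (snd x)"
 have c: "0 <= c" using pos(1) by (simp add: c_def)
 have s: "supb e c" if "(e, d) \<in> K1 L" "norm d <= norm (snd x)" for e d
  unfolding c_def by (rule supb_mono[OF K1_supb(2)[OF that(1)]]) (use pos(1) that(2) in \<open>auto intro: mult_left_mono\<close>)
 have e: "fst (fst x) = toL L (%z. fst (T z))" "fst (snd (fst x)) = toL L (%z. fst (snd (T z)))" "snd (snd (fst x)) = toL L (%z. snd (snd (T z)))"
  by (simp_all add: T(2)[symmetric] to3_def)
 have l: "L2 L (%z. fst (T z))" "L2 L (%z. fst (snd (T z)))" "L2 L (%z. snd (snd (T z)))" using T(1) by (auto simp: L2t_def)
 have n: "negligible {z \<in> {0..L}. ~ \<bar>fst (T z)\<bar> <= c}" "negligible {z \<in> {0..L}. ~ \<bar>fst (snd (T z))\<bar> <= c}" "negligible {z \<in> {0..L}. ~ \<bar>snd (snd (T z))\<bar> <= c}"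
  using s[OF k(1)] s[OF k(2)] s[OF k(3)] norm_components(1-3)[of "snd x"] unfolding e by (auto simp: supb_toL_iff[OF _ c] l)
 have "{z \<in> {0..L}. ~ norm (T z) <= 3 * c} \<subseteq> {z \<in> {0..L}. ~ \<bar>fst (T z)\<bar> <= c} \<union> ({z \<in> {0..L}. ~ \<bar>fst (snd (T z))\<bar> <= c} \<union> {z \<in> {0..L}. ~ \<bar>snd (snd (T z))\<bar> <= c})"
 proof
  fix z assume z: "z \<in> {z \<in> {0..L}. ~ norm (T z) <= 3 * c}"
  have "norm (T z) <= \<bar>fst (T z)\<bar> + \<bar>fst (snd (T z))\<bar> + \<bar>snd (snd (T z))\<bar>" using norm_components(4)[of "T z"] by simp
  then show "z \<in> {z \<in> {0..L}. ~ \<bar>fst (T z)\<bar> <= c} \<union> ({z \<in> {0..L}. ~ \<bar>fst (snd (T z))\<bar> <= c} \<union> {z \<in> {0..L}. ~ \<bar>snd (snd (T z))\<bar> <= c})"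
   using z by auto
 qed
 then have "negligible {z \<in> {0..L}. ~ norm (T z) <= 3 * c}" by (rule negligible_subset[rotated]) (intro negligible_Un n)
 then show ?thesis by (simp add: c_def mult.assoc)
qed

lemma uT_sup:
 assumes "Hsp L U" "norm (dd U) <= R"
 shows "negligible {z \<in> {0..L}. ~ norm (uT U z) <= 3 * sqrt L * R}"
proof (rule negl_ball)
 show "negligible {z \<in> {0..L}. ~ norm (uT U z) <= 3 * sqrt L * norm (dd U)}"
  using K3_sup[OF HspD(15)[OF assms(1)] HspD(13)[OF assms(1)]] by (simp add: uu_def)
 have "3 * sqrt L * norm (dd U) <= 3 * sqrt L * R" using assms(2) pos(1) by (intro mult_left_mono) auto
 then show "norm (uT U z) <= 3 * sqrt L * norm (dd U) ==> norm (uT U z) <= 3 * sqrt L * R" for z by linarith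
qed

lemma dx_diff:
 assumes "H10 L f" "H10 L g"
 shows "L2 L (dx L (fdiff f g))" "toL L (dx L (fdiff f g)) = toL L (dx L f) - toL L (dx L g)"
proof -
 note f = H10_K1[OF pos(1) assms(1)] and g = H10_K1[OF pos(1) assms(2)]
 have "toL L (fdiff f g) = toL L f - toL L g" using f g by (simp add: fdiff_def toL_diff)
 moreover have "L2 L (fdiff f g)" using f g by (simp add: fdiff_def L2_diff)
 moreover have "(toL L f - toL L g, toL L (dx L f) - toL L (dx L g)) \<in> K1 L"
  using K1_add[OF pos(1) f(4) K1_scale[OF g(4), of "-1"]] by simp
 ultimately have h: "H10 L (fdiff f g)" "toL L (dx L (fdiff f g)) = toL L (dx L f) - toL L (dx L g)"
  using K1_H10[OF pos(1), of "fdiff f g"] by auto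
 then show "toL L (dx L (fdiff f g)) = toL L (dx L f) - toL L (dx L g)" by simp
 show "L2 L (dx L (fdiff f g))" by (rule H10_K1(2)[OF pos(1) h(1)])
qed

lemma dH_eq: assumes "Hsp L U" "Hsp L V" shows "dH L U V = norm (io U - io V)"
proof -
 note u = HspD[OF assms(1)] and v = HspD[OF assms(2)]
 have t: "l2norm L (fdiff f g) = norm (toL L f - toL L g)" if "L2 L f" "L2 L g" for f g
  using that by (simp add: fdiff_def l2norm_eq_norm L2_diff toL_diff)
 have d: "l2norm L (dx L (fdiff f g)) = norm (toL L (dx L f) - toL L (dx L g))" if "H10 L f" "H10 L g" for f g
  using dx_diff[OF that] by (simp add: l2norm_eq_norm)
 show ?thesis
  unfolding dH_def t[OF u(4) v(4)] t[OF u(5) v(5)] t[OF u(6) v(6)] d[OF u(1) v(1)] d[OF u(2) v(2)] d[OF u(3) v(3)]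
  by (simp add: io_def dd_def vv_eq norm_prod_def add.assoc)
qed

lemma zero_st: "Hsp L zero_st" "io zero_st = 0"
proof -
 have h: "H10 L (%_. 0)" using K1_H10(1)[OF pos(1) L2_const[of L 0], of 0] K1_zero[OF pos(1)] by (simp add: toL_zero)
 then show "Hsp L zero_st" by (simp add: Hsp_def zero_st_def L2_const)
 have "toL L (dx L (%_. 0)) = 0" using K1_H10(2)[OF pos(1) L2_const[of L 0], of 0] K1_zero[OF pos(1)] by (simp add: toL_zero)
 then show "io zero_st = 0" by (simp add: io_def dd_def vv_eq zero_st_def toL_zero zero_prod_def)
qed

definition mD :: real where "mD = (SOME m. 0 < m & (\<exists>M>0. \<forall>g\<in>{g1, g2, g3}. (\<forall>s t. m * (s - t)^2 <= (g s - g t) * (s - t)) & (\<forall>s t. \<bar>g s - g t\<bar> <= M * \<bar>s - t\<bar>)))"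
definition MD :: real where "MD = (SOME M. 0 < M & (\<forall>g\<in>{g1, g2, g3}. (\<forall>s t. mD * (s - t)^2 <= (g s - g t) * (s - t)) & (\<forall>s t. \<bar>g s - g t\<bar> <= M * \<bar>s - t\<bar>)))"

lemma damping_consts:
 "0 < mD" "0 < MD"
 "g \<in> {g1, g2, g3} ==> mD * (s - t)^2 <= (g s - g t) * (s - t)"
 "g \<in> {g1, g2, g3} ==> \<bar>g s - g t\<bar> <= MD * \<bar>s - t\<bar>"
 "g \<in> {g1, g2, g3} ==> g 0 = 0"
proof -
 have ex: "\<exists>m. 0 < m & (\<exists>M>0. \<forall>g\<in>{g1, g2, g3}. (\<forall>s t. m * (s - t)^2 <= (g s - g t) * (s - t)) & (\<forall>s t. \<bar>g s - g t\<bar> <= M * \<bar>s - t\<bar>))"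
 proof -
  define Q where "Q g m M \<longleftrightarrow> (\<forall>s t. m * (s - t)^2 <= (g s - g t) * (s - t)) & (\<forall>s t. \<bar>g s - g t\<bar> <= M * \<bar>s - t\<bar>)" for g :: "real => real" and m M
  obtain m1 M1 where 1: "0 < m1" "0 < M1" "Q g1 m1 M1" using damping_bounds[OF G(1)] unfolding Q_def by blast
  obtain m2 M2 where 2: "0 < m2" "0 < M2" "Q g2 m2 M2" using damping_bounds[OF G(2)] unfolding Q_def by blast
  obtain m3 M3 where 3: "0 < m3" "0 < M3" "Q g3 m3 M3" using damping_bounds[OF G(3)] unfolding Q_def by blast
  have mono: "Q g m' M'" if "Q g m M" "m' <= m" "M <= M'" for g m M m' M'
   unfolding Q_def
  proof (intro conjI allI)
   fix s t
   show "m' * (s - t)^2 <= (g s - g t) * (s - t)" using that mult_right_mono[OF that(2), of "(s - t)^2"] unfolding Q_def by (meson order_trans zero_le_power2)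
   show "\<bar>g s - g t\<bar> <= M' * \<bar>s - t\<bar>" using that mult_right_mono[OF that(3), of "\<bar>s - t\<bar>"] unfolding Q_def by (meson order_trans abs_ge_zero)
  qed
  define m where "m = min m1 (min m2 m3)"
  define M where "M = max M1 (max M2 M3)"
  have "Q g1 m M" "Q g2 m M" "Q g3 m M" by (rule mono[OF 1(3)] mono[OF 2(3)] mono[OF 3(3)]; simp add: m_def M_def)+
  moreover have "0 < m" "0 < M" using 1 2 3 by (auto simp: m_def M_def)
  ultimately show ?thesis unfolding Q_def by (intro exI[of _ m] conjI exI[of _ M]) auto
 qed
 from someI_ex[OF ex] have 1: "0 < mD" "\<exists>M. 0 < M & (\<forall>g\<in>{g1, g2, g3}. (\<forall>s t. mD * (s - t)^2 <= (g s - g t) * (s - t)) & (\<forall>s t. \<bar>g s - g t\<bar> <= M * \<bar>s - t\<bar>))"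
  unfolding mD_def by blast+
 show "0 < mD" by (rule 1)
 from someI_ex[OF 1(2)] have 2: "0 < MD" "\<forall>g\<in>{g1, g2, g3}. (\<forall>s t. mD * (s - t)^2 <= (g s - g t) * (s - t)) & (\<forall>s t. \<bar>g s - g t\<bar> <= MD * \<bar>s - t\<bar>)"
  unfolding MD_def by blast+
 show "0 < MD" by (rule 2)
 show "g \<in> {g1, g2, g3} ==> mD * (s - t)^2 <= (g s - g t) * (s - t)" "g \<in> {g1, g2, g3} ==> \<bar>g s - g t\<bar> <= MD * \<bar>s - t\<bar>"
  using 2(2) by blast+
 show "g \<in> {g1, g2, g3} ==> g 0 = 0" using G by (auto simp: damping_ok_def)
qed

lemma f_C1: "f \<in> {f1, f2, f3} ==> \<exists>Df. continuous_on UNIV Df & (\<forall>x. (f has_derivative (%h. inner (Df x) h)) (at x))"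
 using F3(3-5) unfolding C1_growth_def by blast

lemma f_continuous: "f \<in> {f1, f2, f3} ==> continuous_on UNIV f"
 using f_C1 by (metis continuous_at_imp_continuous_on has_derivative_continuous)

lemma f_lipschitz: "\<exists>K\<ge>0. \<forall>f\<in>{f1, f2, f3}. \<forall>x y. norm x <= R --> norm y <= R --> \<bar>f x - f y\<bar> <= K * norm (x - y)"
proof -
 have e: "\<exists>K\<ge>0. \<forall>x y. norm x <= R --> norm y <= R --> \<bar>f x - f y\<bar> <= K * norm (x - y)" if f: "f \<in> {f1, f2, f3}" for f
 proof -
  obtain Df where "continuous_on UNIV Df" "!!x. (f has_derivative (%h. inner (Df x) h)) (at x)" using f_C1[OF f] by blast
  from C1_locally_lipschitz[OF this(2,1), of R] show ?thesis by blast
 qed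
 obtain K where K: "!!f. f \<in> {f1, f2, f3} ==> 0 <= K f & (\<forall>x y. norm x <= R --> norm y <= R --> \<bar>f x - f y\<bar> <= K f * norm (x - y))"
  using e by metis
 define M where "M = max (K f1) (max (K f2) (K f3))"
 have "\<bar>f x - f y\<bar> <= M * norm (x - y)" if f: "f \<in> {f1, f2, f3}" and n: "norm x <= R" "norm y <= R" for f x y
 proof -
  have "\<bar>f x - f y\<bar> <= K f * norm (x - y)" using K[OF f] n by blast
  also have "... <= M * norm (x - y)" using f by (intro mult_right_mono) (auto simp: M_def)
  finally show ?thesis .
 qed
 moreover have "0 <= M" using K[of f1] by (auto simp: M_def)
 ultimately show ?thesis by blast
qed

lemma L2_NG:
 assumes "Hsp L U"
 shows "L2 L (%x. g1 (phi_t U x))" "L2 L (%x. g2 (psi_t U x))" "L2 L (%x. g3 (ww_t U x))"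
 by (rule damping_compose[where M = MD, OF damping_consts(5) damping_consts(4,2)]; simp add: HspD[OF assms])+

lemma L2_NF:
 assumes "Hsp L U" "f \<in> {f1, f2, f3}"
 shows "L2 L (%x. f (uT U x))"
 by (rule L2_compose_bounded[OF f_continuous[OF assms(2)] HspD(13)[OF assms(1)] uT_sup[OF assms(1) order_refl]])

lemma NG_estimates:
 assumes U: "Hsp L U" and V: "Hsp L V"
 shows "mD * (norm (vv U - vv V))^2 <= inner (NG U - NG V) (vv U - vv V)"
  "norm (NG U - NG V) <= MD * norm (vv U - vv V)"
proof -
 note u = HspD[OF U] L2_NG[OF U] and v = HspD[OF V] L2_NG[OF V]
 have 1: "mD * (norm (toL L (phi_t U) - toL L (phi_t V)))^2 <= inner (toL L (%x. g1 (phi_t U x)) - toL L (%x. g1 (phi_t V x))) (toL L (phi_t U) - toL L (phi_t V))"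
  by (rule damping_monotone[OF damping_consts(3) u(4) v(4) u(16) v(16)]) simp
 have 2: "mD * (norm (toL L (psi_t U) - toL L (psi_t V)))^2 <= inner (toL L (%x. g2 (psi_t U x)) - toL L (%x. g2 (psi_t V x))) (toL L (psi_t U) - toL L (psi_t V))"
  by (rule damping_monotone[OF damping_consts(3) u(5) v(5) u(17) v(17)]) simp
 have 3: "mD * (norm (toL L (ww_t U) - toL L (ww_t V)))^2 <= inner (toL L (%x. g3 (ww_t U x)) - toL L (%x. g3 (ww_t V x))) (toL L (ww_t U) - toL L (ww_t V))"
  by (rule damping_monotone[OF damping_consts(3) u(6) v(6) u(18) v(18)]) simp
 show "mD * (norm (vv U - vv V))^2 <= inner (NG U - NG V) (vv U - vv V)"
  using 1 2 3 by (simp add: NG_def vv_eq inner_prod_def norm_prod_def distrib_left)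
 have l: "norm (toL L (%x. g (a x)) - toL L (%x. g (c x))) <= MD * norm (toL L a - toL L c)"
  if "g \<in> {g1, g2, g3}" "L2 L a" "L2 L c" "L2 L (%x. g (a x))" "L2 L (%x. g (c x))" for g a c
  by (rule damping_lipschitz[OF damping_consts(4,2) that(2-5)]) (rule that(1))
 have "(norm (NG U - NG V))^2 <= (MD * norm (vv U - vv V))^2"
  using power_mono[OF l[OF _ u(4) v(4) u(16) v(16)], of 2] power_mono[OF l[OF _ u(5) v(5) u(17) v(17)], of 2]
   power_mono[OF l[OF _ u(6) v(6) u(18) v(18)], of 2]
  by (simp add: NG_def vv_eq norm_prod_def power_mult_distrib distrib_left)
 then show "norm (NG U - NG V) <= MD * norm (vv U - vv V)"
  by (rule power2_le_imp_le) (use damping_consts(2) in simp)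
qed

text \<open>Only the \<open>L^2\<close> norm of the displacement difference appears on the right,
  not the energy norm; this is where compactness enters the quasi-stability estimate.\<close>

lemma NF_lipschitz:
 "\<exists>K\<ge>0. \<forall>U V. Hsp L U --> Hsp L V --> norm (dd U) <= R --> norm (dd V) <= R --> norm (NF U - NF V) <= K * norm (uu U - uu V)"
proof -
 obtain K where K: "0 <= K" "!!f x y. f \<in> {f1, f2, f3} ==> norm x <= 3 * sqrt L * R ==> norm y <= 3 * sqrt L * R ==> \<bar>f x - f y\<bar> <= K * norm (x - y)"
  using f_lipschitz[of "3 * sqrt L * R"] by blast
 have "norm (NF U - NF V) <= (3 * K) * norm (uu U - uu V)" if U: "Hsp L U" "norm (dd U) <= R" and V: "Hsp L V" "norm (dd V) <= R" for U V
 proof -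
  have c: "norm (toL L (%x. f (uT U x)) - toL L (%x. f (uT V x))) <= K * norm (uu U - uu V)" if f: "f \<in> {f1, f2, f3}" for f
   unfolding uu_def
   by (rule compose_lipschitz[OF K(1) K(2)[OF f] HspD(13)[OF U(1)] HspD(13)[OF V(1)] L2_NF[OF U(1) f] L2_NF[OF V(1) f] uT_sup[OF U] uT_sup[OF V]])
  show ?thesis
   using norm_components(4)[of "NF U - NF V"] c[of f1] c[of f2] c[of f3] by (simp add: NF_def)
 qed
 then show ?thesis using K(1) by (intro exI[of _ "3 * K"]) auto
qed

definition GG :: "bst => h3" where "GG U = NG U + NF U"

text \<open>Exactly the form in which \<open>energy_dissipation\<close> expects the source, with the
  disturbance \<open>K * norm (uu U - uu V)\<close>.\<close>

lemma GG_estimates: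
 "\<exists>K\<ge>0. \<forall>U V. Hsp L U --> Hsp L V --> norm (dd U) <= R --> norm (dd V) <= R -->
  mD * (norm (vv U - vv V))^2 - K * norm (uu U - uu V) * norm (vv U - vv V) <= inner (GG U - GG V) (vv U - vv V) \<and>
  norm (GG U - GG V) <= MD * norm (vv U - vv V) + K * norm (uu U - uu V)"
proof -
 obtain K where K: "0 <= K" "!!U V. Hsp L U ==> Hsp L V ==> norm (dd U) <= R ==> norm (dd V) <= R ==> norm (NF U - NF V) <= K * norm (uu U - uu V)"
  using NF_lipschitz[of R] by blast
 have "mD * (norm (vv U - vv V))^2 - K * norm (uu U - uu V) * norm (vv U - vv V) <= inner (GG U - GG V) (vv U - vv V) \<and>
  norm (GG U - GG V) <= MD * norm (vv U - vv V) + K * norm (uu U - uu V)"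
  if h: "Hsp L U" "Hsp L V" "norm (dd U) <= R" "norm (dd V) <= R" for U V
 proof -
  have e: "GG U - GG V = (NG U - NG V) + (NF U - NF V)" by (simp add: GG_def)
  have "- inner (NF U - NF V) (vv U - vv V) <= norm (NF U - NF V) * norm (vv U - vv V)"
   using Cauchy_Schwarz_ineq2[of "NF U - NF V" "vv U - vv V"] by linarith
  also have "... <= K * norm (uu U - uu V) * norm (vv U - vv V)" by (intro mult_right_mono K(2)[OF h] norm_ge_zero)
  finally have 1: "- inner (NF U - NF V) (vv U - vv V) <= K * norm (uu U - uu V) * norm (vv U - vv V)" .
  have 2: "norm (GG U - GG V) <= norm (NG U - NG V) + norm (NF U - NF V)" unfolding e by (rule norm_triangle_ineq)
  show ?thesis
   using 1 2 NG_estimates[OF h(1,2)] K(2)[OF h] unfolding e inner_add_left by (intro conjI) linarith+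
 qed
 then show ?thesis using K(1) by blast
qed

lemma GG_cong: assumes "Hsp L U" "Hsp L V" "uu U = uu V" "vv U = vv V" shows "GG U = GG V"
proof -
 obtain K where K: "norm (GG U - GG V) <= MD * norm (vv U - vv V) + K * norm (uu U - uu V)"
  using GG_estimates[of "max (norm (dd U)) (norm (dd V))"] assms(1,2) by fastforce
 then show ?thesis using assms by simp
qed

lemma io_eq_imp: assumes "Hsp L U" "Hsp L V" "io U = io V" shows "uu U = uu V" "dd U = dd V" "vv U = vv V" "GG U = GG V"
proof -
 show 1: "dd U = dd V" "vv U = vv V" using assms(3) by (auto simp: io_def)
 have "(uu U, dd U) - (uu V, dd V) \<in> K3" by (rule subspace_diff[OF K HspD(15)[OF assms(1)] HspD(15)[OF assms(2)]])
 then have "norm (uu U - uu V) <= L * norm (dd U - dd V)" using K3_poincare by fastforce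
 then show "uu U = uu V" using 1 by simp
 then show "GG U = GG V" using GG_cong assms 1 by blast
qed

end

section \<open>Weak solutions of the Bresse system as abstract solutions\<close>

lemma L2_deriv_at_iff:
 assumes "!!s. s \<in> X ==> L2 L (u s)" "t \<in> X" "L2 L a"
 shows "L2_deriv_at L u a t X \<longleftrightarrow> ((%s. toL L (u s)) has_vector_derivative toL L a) (at t within X)"
proof -
 have q: "l2norm L (%x. (u s x - u t x) / (s - t) - a x) = norm ((toL L (u s) - toL L (u t)) /\<^sub>R (s - t) - toL L a)" if "s \<in> X" for s
 proof -
  have d: "L2 L (%x. u s x - u t x)" using assms that by (simp add: L2_diff)
  have e: "(%x. (u s x - u t x) / (s - t) - a x) = (%x. inverse (s - t) * (u s x - u t x) - a x)"
   by (simp add: divide_inverse mult.commute)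
  show ?thesis
   unfolding e using assms that d
   by (simp add: l2norm_eq_norm L2_diff L2_scale toL_diff toL_scale[OF d])
 qed
 have "L2_deriv_at L u a t X \<longleftrightarrow> ((%s. norm ((toL L (u s) - toL L (u t)) /\<^sub>R (s - t) - toL L a)) \<longlongrightarrow> 0) (at t within X)"
  unfolding L2_deriv_at_def using assms(3)
  by (simp, intro filterlim_cong refl) (auto simp: eventually_at_filter q)
 then show ?thesis
  by (simp add: has_vector_derivative_iff_quotient tendsto_norm_zero_iff LIM_zero_iff)
qed

context bresse
begin

definition bsol :: "real => (real => bst) => bool" where
 "bsol s trj \<longleftrightarrow> (\<forall>t\<ge>s. Hsp L (trj t)) & sol s (%t. (uu (trj t), dd (trj t))) (%t. vv (trj t)) (%t. GG (trj t))"

lemma diff_K3: "Hsp L U ==> Hsp L V ==> (uu U - uu V, dd U - dd V) \<in> K3"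
 using subspace_diff[OF K HspD(15)[of U] HspD(15)[of V]] by simp

lemma GG_continuous:
 assumes H: "!!t. t \<in> I ==> Hsp L (trj t)" and c: "continuous_on I (%t. io (trj t))"
 shows "continuous_on I (%t. (uu (trj t), dd (trj t)))" "continuous_on I (%t. GG (trj t))"
proof -
 have d: "continuous_on I (%t. dd (trj t))" "continuous_on I (%t. vv (trj t))"
  using continuous_on_fst[OF c] continuous_on_snd[OF c] by (simp_all add: io_def)
 have ul: "norm (uu (trj s) - uu (trj t)) <= L * norm (dd (trj s) - dd (trj t))" if "s \<in> I" "t \<in> I" for s t
  using K3_poincare[OF diff_K3[OF H[OF that(1)] H[OF that(2)]]] by simp
 have dl: "((%s. norm (dd (trj s) - dd (trj t))) \<longlongrightarrow> 0) (at t within I)" if "t \<in> I" for t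
  using d(1) that by (simp add: continuous_on_def LIM_zero tendsto_norm_zero)
 have vl: "((%s. norm (vv (trj s) - vv (trj t))) \<longlongrightarrow> 0) (at t within I)" if "t \<in> I" for t
  using d(2) that by (simp add: continuous_on_def LIM_zero tendsto_norm_zero)
 have uz: "((%s. norm (uu (trj s) - uu (trj t))) \<longlongrightarrow> 0) (at t within I)" if t: "t \<in> I" for t
 proof (rule tendsto_sandwich[OF _ _ tendsto_const])
  show "((%s. L * norm (dd (trj s) - dd (trj t))) \<longlongrightarrow> 0) (at t within I)" by (rule tendsto_mult_right_zero[OF dl[OF t]])
 qed (use ul t in \<open>auto simp: eventually_at_filter\<close>)
 have u: "continuous_on I (%t. uu (trj t))"
  unfolding continuous_on_def using uz by (simp add: tendsto_norm_zero_iff LIM_zero_iff)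
 show "continuous_on I (%t. (uu (trj t), dd (trj t)))" by (intro continuous_on_Pair u d)
 show "continuous_on I (%t. GG (trj t))"
  unfolding continuous_on_def
 proof
  fix t assume t: "t \<in> I"
  define R where "R = norm (dd (trj t)) + 1"
  obtain Kc where Kc: "!!U V. Hsp L U ==> Hsp L V ==> norm (dd U) <= R ==> norm (dd V) <= R ==>
    norm (GG U - GG V) <= MD * norm (vv U - vv V) + Kc * norm (uu U - uu V)"
   using GG_estimates[of R] by blast
  have "\<forall>\<^sub>F s in at t within I. norm (dd (trj s) - dd (trj t)) < 1"
   using dl[OF t] by (rule order_tendstoD) simp
  moreover have "\<forall>\<^sub>F s in at t within I. s \<in> I" by (simp add: eventually_at_filter)
  ultimately have ev: "\<forall>\<^sub>F s in at t within I. norm (GG (trj s) - GG (trj t)) <= MD * norm (vv (trj s) - vv (trj t)) + Kc * norm (uu (trj s) - uu (trj t))"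
  proof eventually_elim
   case (elim s)
   have "norm (dd (trj s)) <= R" using norm_triangle_ineq2[of "dd (trj s)" "dd (trj t)"] elim(1) by (simp add: R_def)
   then show ?case using Kc[of "trj s" "trj t"] H elim(2) t by (simp add: R_def)
  qed
  have "((%s. norm (GG (trj s) - GG (trj t))) \<longlongrightarrow> 0) (at t within I)"
  proof (rule tendsto_sandwich[OF _ ev tendsto_const])
   show "((%s. MD * norm (vv (trj s) - vv (trj t)) + Kc * norm (uu (trj s) - uu (trj t))) \<longlongrightarrow> 0) (at t within I)"
    using tendsto_add[OF tendsto_mult_right_zero[OF vl[OF t], of MD] tendsto_mult_right_zero[OF uz[OF t], of Kc]] by simp
  qed simp
  then show "((%t. GG (trj t)) \<longlongrightarrow> GG (trj t)) (at t within I)"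
   by (simp add: tendsto_norm_zero_iff LIM_zero_iff)
 qed
qed

text \<open>Every element of \<open>K3\<close> comes from three functions in \<open>H10\<close>; the
  three equations tested with them add up to the single abstract equation.\<close>

lemma weak_sol_bsol:
 assumes ws: "bresse_weak_sol L \<rho>1 \<rho>2 b k k0 l g1 g2 g3 f1 f2 f3 U"
 shows "bsol 0 U"
proof -
 have H: "Hsp L (U t)" if "0 <= t" for t using ws that unfolding bresse_weak_sol_def by blast
 have c: "continuous_on {0..} (%t. io (U t))"
  unfolding continuous_on_def
 proof
  fix t :: real assume t: "t \<in> {0..}"
  then have "((%s. dH L (U s) (U t)) \<longlongrightarrow> 0) (at t within {0..})" using ws unfolding bresse_weak_sol_def by simp
  moreover have "\<forall>\<^sub>F s in at t within {0..}. dH L (U s) (U t) = dist (io (U s)) (io (U t))"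
   using t by (auto simp: eventually_at_filter dH_eq H dist_norm)
  ultimately have "((%s. dist (io (U s)) (io (U t))) \<longlongrightarrow> 0) (at t within {0..})" by (rule Lim_transform_eventually)
  then show "((%t. io (U t)) \<longlongrightarrow> io (U t)) (at t within {0..})" by (subst tendsto_dist_iff)
 qed
 have Hs: "Hsp L (U t)" if "t \<in> {0..}" for t using H that by simp
 show ?thesis
  unfolding bsol_def sol_def
 proof (intro conjI allI impI ballI)
  show "continuous_on {0..} (%t. (uu (U t), dd (U t)))" "continuous_on {0..} (%t. GG (U t))"
   using GG_continuous[of "{0..}" U, OF Hs c] by auto
  show "continuous_on {0..} (%t. vv (U t))" using continuous_on_snd[OF c] by (simp add: io_def)
  fix t :: real assume t: "0 <= t"
  show "Hsp L (U t)" "(uu (U t), dd (U t)) \<in> K3" using H[OF t] HspD(15) by auto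
  have ld: "L2_deriv_at L (%s. phi (U s)) (phi_t (U t)) t {0..}" "L2_deriv_at L (%s. psi (U s)) (psi_t (U t)) t {0..}"
   "L2_deriv_at L (%s. ww (U s)) (ww_t (U t)) t {0..}"
   using ws t unfolding bresse_weak_sol_def by blast+
  have "((%t. toL L (phi (U t))) has_vector_derivative toL L (phi_t (U t))) (at t within {0..})"
   "((%t. toL L (psi (U t))) has_vector_derivative toL L (psi_t (U t))) (at t within {0..})"
   "((%t. toL L (ww (U t))) has_vector_derivative toL L (ww_t (U t))) (at t within {0..})"
   by (rule L2_deriv_at_iff[THEN iffD1, rotated -1, OF ld(1)] L2_deriv_at_iff[THEN iffD1, rotated -1, OF ld(2)] L2_deriv_at_iff[THEN iffD1, rotated -1, OF ld(3)];
    use HspD[OF Hs] t in simp)+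
  then show "((%t. fst (uu (U t), dd (U t))) has_vector_derivative vv (U t)) (at t within {0..})"
   unfolding fst_conv uu_eq vv_eq by (intro has_vector_derivative_Pair)
  fix x assume x: "x \<in> K3"
  obtain zet1 where z1: "H10 L zet1" "L2 L zet1" "L2 L (dx L zet1)" "toL L zet1 = fst (fst x)" "toL L (dx L zet1) = fst (snd x)"
   using K3_exists_H10[of "fst (fst x)" "fst (snd x)"] x unfolding K3_def by blast
  obtain zet2 where z2: "H10 L zet2" "L2 L zet2" "L2 L (dx L zet2)" "toL L zet2 = fst (snd (fst x))" "toL L (dx L zet2) = fst (snd (snd x))"
   using K3_exists_H10[of "fst (snd (fst x))" "fst (snd (snd x))"] x unfolding K3_def by blast
  obtain \<zeta>3 where z3: "H10 L \<zeta>3" "L2 L \<zeta>3" "L2 L (dx L \<zeta>3)" "toL L \<zeta>3 = snd (snd (fst x))" "toL L (dx L \<zeta>3) = snd (snd (snd x))"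
   using K3_exists_H10[of "snd (snd (fst x))" "snd (snd (snd x))"] x unfolding K3_def by blast
  note u = HspD[OF H[OF t]] L2_NG[OF H[OF t]] L2_NF[OF H[OF t]]
  have w: "let V = U t;
      sh = (%x. dx L (phi V) x + psi V x + l * ww V x);
      ax = (%x. dx L (ww V) x - l * phi V x);
      nl = (%f x. f (phi V x, psi V x, ww V x))
    in
    ((%s. \<rho>1 * ip L (phi_t (U s)) zet) has_real_derivative
     (- k * ip L sh (dx L zet) + k0 * l * ip L ax zet
      - ip L (%x. g1 (phi_t V x)) zet - ip L (nl f1) zet)) (at t within {0..}) \<and>
    ((%s. \<rho>2 * ip L (psi_t (U s)) zet) has_real_derivative
     (- b * ip L (dx L (psi V)) (dx L zet) - k * ip L sh zet
      - ip L (%x. g2 (psi_t V x)) zet - ip L (nl f2) zet)) (at t within {0..}) \<and>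
    ((%s. \<rho>1 * ip L (ww_t (U s)) zet) has_real_derivative
     (- k0 * ip L ax (dx L zet) - k * l * ip L sh zet
      - ip L (%x. g3 (ww_t V x)) zet - ip L (nl f3) zet)) (at t within {0..})" if "H10 L zet" for zet
   using ws that t unfolding bresse_weak_sol_def by blast
  define sh where "sh = (%x. dx L (phi (U t)) x + psi (U t) x + l * ww (U t) x)"
  define ax where "ax = (%x. dx L (ww (U t)) x - l * phi (U t) x)"
  have sh: "L2 L sh" "toL L sh = shear (uu (U t), dd (U t))"
   using u by (auto simp: sh_def L2_add L2_scale toL_add toL_scale shear_def uu_eq dd_def)
  have ax: "L2 L ax" "toL L ax = axial (uu (U t), dd (U t))"
   using u by (auto simp: ax_def L2_diff L2_scale toL_diff toL_scale axial_def uu_eq dd_def)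
  note w1 = w[OF z1(1), unfolded Let_def, THEN conjunct1, folded sh_def ax_def]
   and w2 = w[OF z2(1), unfolded Let_def, THEN conjunct2, THEN conjunct1, folded sh_def ax_def]
   and w3 = w[OF z3(1), unfolded Let_def, THEN conjunct2, THEN conjunct2, folded sh_def ax_def]
  have sum: "((%s. \<rho>1 * ip L (phi_t (U s)) zet1 + \<rho>2 * ip L (psi_t (U s)) zet2 + \<rho>1 * ip L (ww_t (U s)) \<zeta>3) has_real_derivative
   ((- k * ip L sh (dx L zet1) + k0 * l * ip L ax zet1 - ip L (%x. g1 (phi_t (U t) x)) zet1 - ip L (%x. f1 (phi (U t) x, psi (U t) x, ww (U t) x)) zet1)
   + (- b * ip L (dx L (psi (U t))) (dx L zet2) - k * ip L sh zet2 - ip L (%x. g2 (psi_t (U t) x)) zet2 - ip L (%x. f2 (phi (U t) x, psi (U t) x, ww (U t) x)) zet2)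
   + (- k0 * ip L ax (dx L \<zeta>3) - k * l * ip L sh \<zeta>3 - ip L (%x. g3 (ww_t (U t) x)) \<zeta>3 - ip L (%x. f3 (phi (U t) x, psi (U t) x, ww (U t) x)) \<zeta>3))) (at t within {0..})"
   by (intro DERIV_add w1 w2 w3)
  have lhs: "\<rho>1 * ip L (phi_t (U s)) zet1 + \<rho>2 * ip L (psi_t (U s)) zet2 + \<rho>1 * ip L (ww_t (U s)) \<zeta>3 = inner (mass (vv (U s))) (fst x)" if "0 <= s" for s
   using HspD[OF H[OF that]] z1 z2 z3 by (simp add: ip_eq_inner mass_def vv_eq inner_prod_def)
  have rhs: "((- k * ip L sh (dx L zet1) + k0 * l * ip L ax zet1 - ip L (%x. g1 (phi_t (U t) x)) zet1 - ip L (%x. f1 (phi (U t) x, psi (U t) x, ww (U t) x)) zet1)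
   + (- b * ip L (dx L (psi (U t))) (dx L zet2) - k * ip L sh zet2 - ip L (%x. g2 (psi_t (U t) x)) zet2 - ip L (%x. f2 (phi (U t) x, psi (U t) x, ww (U t) x)) zet2)
   + (- k0 * ip L ax (dx L \<zeta>3) - k * l * ip L sh \<zeta>3 - ip L (%x. g3 (ww_t (U t) x)) \<zeta>3 - ip L (%x. f3 (phi (U t) x, psi (U t) x, ww (U t) x)) \<zeta>3))
   = - aform (uu (U t), dd (U t)) x - inner (GG (U t)) (fst x)"
  proof -
   have sx: "shear x = fst (snd x) + fst (snd (fst x)) + l *\<^sub>R snd (snd (fst x))" and axx: "axial x = snd (snd (snd x)) - l *\<^sub>R fst (fst x)"
    by (simp_all add: shear_def axial_def)
   have gi: "inner (GG (U t)) (fst x) = inner (toL L (%x. g1 (phi_t (U t) x))) (fst (fst x)) + inner (toL L (%x. g2 (psi_t (U t) x))) (fst (snd (fst x)))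
    + inner (toL L (%x. g3 (ww_t (U t) x))) (snd (snd (fst x))) + inner (toL L (%x. f1 (uT (U t) x))) (fst (fst x))
    + inner (toL L (%x. f2 (uT (U t) x))) (fst (snd (fst x))) + inner (toL L (%x. f3 (uT (U t) x))) (snd (snd (fst x)))"
    by (simp add: GG_def NG_def NF_def inner_prod_def inner_add_left)
   have af: "aform (uu (U t), dd (U t)) x = b * inner (toL L (dx L (psi (U t)))) (fst (snd (snd x))) + k * inner (toL L sh) (shear x) + k0 * inner (toL L ax) (axial x)"
    by (simp add: aform_def sh(2) ax(2) dd_def)
   have f: "L2 L (%x. f1 (phi (U t) x, psi (U t) x, ww (U t) x))" "L2 L (%x. f2 (phi (U t) x, psi (U t) x, ww (U t) x))" "L2 L (%x. f3 (phi (U t) x, psi (U t) x, ww (U t) x))"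
    using u(19) by (simp_all add: uT_def)
   show ?thesis
    unfolding gi af sx axx uT_def
    by (simp add: ip_eq_inner u sh(1) ax(1) z1 z2 z3 f inner_add_right inner_diff_right algebra_simps)
  qed
  show "((%t. inner (mass (vv (U t))) (fst x)) has_real_derivative - aform (uu (U t), dd (U t)) x - inner (GG (U t)) (fst x)) (at t within {0..})"
   by (rule has_field_derivative_transform_within[OF sum[unfolded rhs] zero_less_one]) (use t lhs in auto)
 qed
qed

lemma bsolD:
 assumes "bsol s trj"
 shows "s <= t ==> Hsp L (trj t)" "sol s (%t. (uu (trj t), dd (trj t))) (%t. vv (trj t)) (%t. GG (trj t))"
  "continuous_on {s..} (%t. io (trj t))"
proof -
 show "s <= t ==> Hsp L (trj t)" and s: "sol s (%t. (uu (trj t), dd (trj t))) (%t. vv (trj t)) (%t. GG (trj t))"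
  using assms by (auto simp: bsol_def)
 show "continuous_on {s..} (%t. io (trj t))"
  unfolding io_def using continuous_on_snd[OF sol_cont(1)[OF s]] sol_cont(2)[OF s] by (intro continuous_on_Pair) auto
qed

lemma bsol_mono: "bsol s trj ==> s <= s' ==> bsol s' trj"
 unfolding bsol_def using sol_mono by auto

lemma bsol_shift: "bsol s trj ==> bsol (s - h) (%t. trj (t + h))"
 unfolding bsol_def using sol_shift[of s _ _ _ h] by auto

lemma bsol_diff:
 assumes "bsol s trj" "bsol s trk"
 shows "sol s (%t. (uu (trj t) - uu (trk t), dd (trj t) - dd (trk t))) (%t. vv (trj t) - vv (trk t)) (%t. GG (trj t) - GG (trk t))"
 using sol_diff[OF bsolD(2)[OF assms(1)] bsolD(2)[OF assms(2)]] by simp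

text \<open>Full trajectories follow the semigroup only up to distance zero, so being a solution
  must depend on the image under \<open>io\<close> alone.\<close>

lemma bsol_cong:
 assumes "bsol s trk" "!!t. s <= t ==> Hsp L (trj t)" "!!t. s <= t ==> io (trj t) = io (trk t)"
 shows "bsol s trj"
proof -
 have e: "uu (trj t) = uu (trk t)" "dd (trj t) = dd (trk t)" "vv (trj t) = vv (trk t)" "GG (trj t) = GG (trk t)" if "s <= t" for t
  using io_eq_imp[OF assms(2)[OF that] bsolD(1)[OF assms(1) that] assms(3)[OF that]] by auto
 have s: "sol s (%t. (uu (trk t), dd (trk t))) (%t. vv (trk t)) (%t. GG (trk t))" by (rule bsolD(2)[OF assms(1)])
 have c: "continuous_on {s..} f" if "continuous_on {s..} g" "!!t. s <= t ==> f t = g t" for f g :: "real => 'z::topological_space"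
  by (rule continuous_on_eq[OF that(1)]) (simp add: that(2))
 show ?thesis
  unfolding bsol_def sol_def
 proof (intro conjI allI impI ballI)
  show "continuous_on {s..} (%t. (uu (trj t), dd (trj t)))" by (rule c[OF sol_cont(1)[OF s]]) (simp add: e)
  show "continuous_on {s..} (%t. vv (trj t))" by (rule c[OF sol_cont(2)[OF s]]) (simp add: e)
  show "continuous_on {s..} (%t. GG (trj t))" by (rule c[OF sol_cont(3)[OF s]]) (simp add: e)
  fix t assume t: "s <= t"
  show "Hsp L (trj t)" by (rule assms(2)[OF t])
  show "(uu (trj t), dd (trj t)) \<in> K3" using HspD(15)[OF assms(2)[OF t]] .
  show "((%t. fst (uu (trj t), dd (trj t))) has_vector_derivative vv (trj t)) (at t within {s..})"
   unfolding e(3)[OF t]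
   by (rule has_vector_derivative_transform[OF _ _ solD(2)[OF s t]]) (use t e in auto)
  fix x assume x: "x \<in> K3"
  show "((%t. inner (mass (vv (trj t))) (fst x)) has_real_derivative - aform (uu (trj t), dd (trj t)) x - inner (GG (trj t)) (fst x)) (at t within {s..})"
   unfolding e(1,2,4)[OF t]
   by (rule has_field_derivative_transform_within[OF solD(3)[OF s t x] zero_less_one]) (use t e in auto)
 qed
qed

section \<open>Comparison of two solutions: quasi-stability, Lipschitz dependence,
  uniqueness\<close>

lemma energy_io:
 "\<exists>c>0. \<forall>x\<in>K3. \<forall>v. energy x v <= c * (norm (snd x, v))^2 & (norm (snd x, v))^2 <= c * energy x v"
proof -
 obtain C where C: "0 < C" "!!x u. energy x u <= C * ((norm x)^2 + (norm u)^2)" using energy_upper by blast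
 define c where "c = C * (L^2 + 1) + (2 / ccoer + 2 / cmass)"
 have p: "0 < 2 / ccoer" "0 < 2 / cmass" using c0 m0 by auto
 have c: "0 < c" using C p by (simp add: c_def add_pos_pos add_nonneg_pos)
 have "energy x v <= c * (norm (snd x, v))^2 & (norm (snd x, v))^2 <= c * energy x v" if x: "x \<in> K3" for x v
 proof
  have n: "(norm x)^2 = (norm (fst x))^2 + (norm (snd x))^2" "(norm (snd x, v))^2 = (norm (snd x))^2 + (norm v)^2"
   by (simp_all add: norm_prod_def)
  have "(norm (fst x))^2 <= (L * norm (snd x))^2" using K3_poincare[OF x] by (intro power_mono) auto
  then have "(norm x)^2 + (norm v)^2 <= (L^2 + 1) * (norm (snd x, v))^2" unfolding n by (simp add: power_mult_distrib algebra_simps add_increasing)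
  then have "C * ((norm x)^2 + (norm v)^2) <= C * ((L^2 + 1) * (norm (snd x, v))^2)" using C(1) by (intro mult_left_mono) auto
  also have "... <= c * (norm (snd x, v))^2"
   unfolding mult.assoc[symmetric] by (rule mult_right_mono) (use p in \<open>simp_all add: c_def\<close>)
  finally show "energy x v <= c * (norm (snd x, v))^2" using C(2)[of x v] by linarith
  have "(norm (snd x, v))^2 <= 2 / ccoer * energy x v + 2 / cmass * energy x v"
   using energy_bounds(1)[OF x, of v] energy_bounds(2)[OF x, of v] unfolding n by (smt (verit) zero_le_power2)
  also have "... <= c * energy x v"
   unfolding distrib_right[symmetric] using energy_nonneg[OF x, of v] C by (intro mult_right_mono) (auto simp: c_def)
  finally show "(norm (snd x, v))^2 <= c * energy x v" .
 qed
 then show ?thesis using c by blast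
qed

definition cE :: real where
 "cE = (SOME c. 0 < c & (\<forall>x\<in>K3. \<forall>v. energy x v <= c * (norm (snd x, v))^2 & (norm (snd x, v))^2 <= c * energy x v))"

lemma cE: "0 < cE" "x \<in> K3 ==> energy x v <= cE * (norm (snd x, v))^2" "x \<in> K3 ==> (norm (snd x, v))^2 <= cE * energy x v"
proof -
 have "\<exists>c. 0 < c & (\<forall>x\<in>K3. \<forall>v. energy x v <= c * (norm (snd x, v))^2 & (norm (snd x, v))^2 <= c * energy x v)" using energy_io by blast
 from someI_ex[OF this, folded cE_def] show "0 < cE" "x \<in> K3 ==> energy x v <= cE * (norm (snd x, v))^2" "x \<in> K3 ==> (norm (snd x, v))^2 <= cE * energy x v" by blast+
qed

lemma io_diff: "(dd U - dd V, vv U - vv V) = io U - io V" by (simp add: io_def)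

text \<open>The order of quantifiers matters: the decay constants \<open>C\<close> and
  \<open>gmz\<close> come from damping and form alone, and the size \<open>R\<close> of the
  solutions influences only the factor of the disturbance.\<close>

lemma bsol_quasi_stable:
 "\<exists>C>0. \<exists>gmz>0. \<forall>R. \<exists>Kc\<ge>0. \<forall>s t trj trk \<rho>. bsol s trj --> bsol s trk --> s <= t --> 0 <= \<rho> -->
  (\<forall>r\<in>{s..t}. norm (dd (trj r)) <= R & norm (dd (trk r)) <= R & norm (uu (trj r) - uu (trk r)) <= \<rho>) -->
  (norm (io (trj t) - io (trk t)))^2 <= C * (exp (- gmz * (t - s)) * (norm (io (trj s) - io (trk s)))^2 + (Kc * \<rho>)^2)"
proof -
 obtain C gmz where C: "0 < C" "0 < gmz" and dis: "!!s t W v G \<rho>. sol s W v G ==> s <= t ==> 0 <= \<rho> ==>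
  (!!r. r \<in> {s..t} ==> mD * (norm (v r))^2 - \<rho> * norm (v r) <= inner (G r) (v r) & norm (G r) <= MD * norm (v r) + \<rho>) ==>
  energy (W t) (v t) <= C * (exp (- gmz * (t - s)) * energy (W s) (v s) + \<rho>^2)"
  using energy_dissipation[OF damping_consts(1), of MD] damping_consts(2) by (metis less_imp_le)
 have "\<exists>Kc\<ge>0. \<forall>s t trj trk \<rho>. bsol s trj --> bsol s trk --> s <= t --> 0 <= \<rho> -->
  (\<forall>r\<in>{s..t}. norm (dd (trj r)) <= R & norm (dd (trk r)) <= R & norm (uu (trj r) - uu (trk r)) <= \<rho>) -->
  (norm (io (trj t) - io (trk t)))^2 <= (cE * C * (cE + 1)) * (exp (- gmz * (t - s)) * (norm (io (trj s) - io (trk s)))^2 + (Kc * \<rho>)^2)" for R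
 proof -
  obtain Kc where Kc: "0 <= Kc" "!!U V. Hsp L U ==> Hsp L V ==> norm (dd U) <= R ==> norm (dd V) <= R ==>
   mD * (norm (vv U - vv V))^2 - Kc * norm (uu U - uu V) * norm (vv U - vv V) <= inner (GG U - GG V) (vv U - vv V) \<and>
   norm (GG U - GG V) <= MD * norm (vv U - vv V) + Kc * norm (uu U - uu V)"
   using GG_estimates[of R] by blast
  show ?thesis
  proof (intro exI[of _ Kc] conjI Kc(1) allI impI)
   fix s t trj trk \<rho>
   assume b: "bsol s trj" "bsol s trk" and st: "s <= t" and r0: "0 <= \<rho>"
    and h: "\<forall>r\<in>{s..t}. norm (dd (trj r)) <= R & norm (dd (trk r)) <= R & norm (uu (trj r) - uu (trk r)) <= \<rho>"
   have E: "energy (uu (trj t) - uu (trk t), dd (trj t) - dd (trk t)) (vv (trj t) - vv (trk t))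
    <= C * (exp (- gmz * (t - s)) * energy (uu (trj s) - uu (trk s), dd (trj s) - dd (trk s)) (vv (trj s) - vv (trk s)) + (Kc * \<rho>)^2)"
   proof (rule dis[OF bsol_diff[OF b] st])
    show "0 <= Kc * \<rho>" using Kc(1) r0 by simp
    fix r assume r: "r \<in> {s..t}"
    have e: "mD * (norm (vv (trj r) - vv (trk r)))^2 - Kc * norm (uu (trj r) - uu (trk r)) * norm (vv (trj r) - vv (trk r)) <= inner (GG (trj r) - GG (trk r)) (vv (trj r) - vv (trk r)) \<and>
     norm (GG (trj r) - GG (trk r)) <= MD * norm (vv (trj r) - vv (trk r)) + Kc * norm (uu (trj r) - uu (trk r))"
     using Kc(2)[OF bsolD(1)[OF b(1)] bsolD(1)[OF b(2)], of r r] r h by auto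
    have k: "Kc * norm (uu (trj r) - uu (trk r)) <= Kc * \<rho>" using h r Kc(1) by (intro mult_left_mono) auto
    have k2: "Kc * norm (uu (trj r) - uu (trk r)) * norm (vv (trj r) - vv (trk r)) <= Kc * \<rho> * norm (vv (trj r) - vv (trk r))"
     by (rule mult_right_mono[OF k]) simp
    show "mD * (norm (vv (trj r) - vv (trk r)))^2 - Kc * \<rho> * norm (vv (trj r) - vv (trk r)) <= inner (GG (trj r) - GG (trk r)) (vv (trj r) - vv (trk r)) \<and>
     norm (GG (trj r) - GG (trk r)) <= MD * norm (vv (trj r) - vv (trk r)) + Kc * \<rho>"
     using e k k2 by linarith
   qed
   have k3: "(uu (trj r) - uu (trk r), dd (trj r) - dd (trk r)) \<in> K3" if "s <= r" for r
    by (rule diff_K3[OF bsolD(1)[OF b(1) that] bsolD(1)[OF b(2) that]])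
   have "(norm (io (trj t) - io (trk t)))^2 <= cE * energy (uu (trj t) - uu (trk t), dd (trj t) - dd (trk t)) (vv (trj t) - vv (trk t))"
    using cE(3)[OF k3[OF st], of "vv (trj t) - vv (trk t)"] by (simp add: io_diff)
   also have "... <= cE * (C * (exp (- gmz * (t - s)) * energy (uu (trj s) - uu (trk s), dd (trj s) - dd (trk s)) (vv (trj s) - vv (trk s)) + (Kc * \<rho>)^2))"
    using E cE(1) by (intro mult_left_mono) auto
   \<comment> \<open>Replacing \<open>cE\<close> by \<open>cE + 1\<close>, which exceeds 1, lets the
     initial term and the disturbance share one constant.\<close>
   also have "... <= cE * (C * (exp (- gmz * (t - s)) * ((cE + 1) * (norm (io (trj s) - io (trk s)))^2) + (cE + 1) * (Kc * \<rho>)^2))"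
   proof -
    have "energy (uu (trj s) - uu (trk s), dd (trj s) - dd (trk s)) (vv (trj s) - vv (trk s)) <= (cE + 1) * (norm (io (trj s) - io (trk s)))^2"
     using cE(2)[OF k3[of s], of "vv (trj s) - vv (trk s)"] by (simp add: io_diff distrib_right) (smt (verit) zero_le_power2)
    moreover have "(Kc * \<rho>)^2 <= (cE + 1) * (Kc * \<rho>)^2" using cE(1) by (simp add: distrib_right)
    ultimately show ?thesis using cE(1) C by (intro mult_left_mono add_mono) auto
   qed
   finally show "(norm (io (trj t) - io (trk t)))^2 <= cE * C * (cE + 1) * (exp (- gmz * (t - s)) * (norm (io (trj s) - io (trk s)))^2 + (Kc * \<rho>)^2)"
    by (simp add: algebra_simps)
  qed
 qed
 moreover have "0 < cE * C * (cE + 1)" using cE(1) C by (simp add: add_pos_pos)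
 ultimately show ?thesis using C(2) by blast
qed

text \<open>The damping is monotone and can only help, so the Lipschitz source is the only term left
  for the Gronwall estimate.\<close>

lemma bsol_lipschitz:
 "\<exists>\<kappa>\<ge>0. \<forall>s t trj trk. bsol s trj --> bsol s trk --> s <= t --> (\<forall>r\<in>{s..t}. norm (dd (trj r)) <= R & norm (dd (trk r)) <= R) -->
  norm (io (trj t) - io (trk t)) <= cE * exp (\<kappa> * (t - s)) * norm (io (trj s) - io (trk s))"
proof -
 obtain Kc where Kc: "0 <= Kc" "!!U V. Hsp L U ==> Hsp L V ==> norm (dd U) <= R ==> norm (dd V) <= R ==>
   mD * (norm (vv U - vv V))^2 - Kc * norm (uu U - uu V) * norm (vv U - vv V) <= inner (GG U - GG V) (vv U - vv V)"
  using GG_estimates[of R] by blast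
 define \<kappa> where "\<kappa> = Kc * L * cE"
 have \<kappa>: "0 <= \<kappa>" using Kc(1) pos(1) cE(1) by (simp add: \<kappa>_def)
 show ?thesis
 proof (intro exI[of _ \<kappa>] conjI \<kappa> allI impI)
  fix s t trj trk assume b: "bsol s trj" "bsol s trk" and st: "s <= t" and h: "\<forall>r\<in>{s..t}. norm (dd (trj r)) <= R & norm (dd (trk r)) <= R"
  define E where "E r = energy (uu (trj r) - uu (trk r), dd (trj r) - dd (trk r)) (vv (trj r) - vv (trk r))" for r
  have k3: "(uu (trj r) - uu (trk r), dd (trj r) - dd (trk r)) \<in> K3" if "s <= r" for r
   by (rule diff_K3[OF bsolD(1)[OF b(1) that] bsolD(1)[OF b(2) that]])
  have "E t <= exp (\<kappa> * (t - s)) * E s"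
   unfolding E_def
  proof (rule energy_gronwall[OF bsol_diff[OF b] st])
   fix r assume r: "s <= r" "r <= t"
   have "mD * (norm (vv (trj r) - vv (trk r)))^2 - Kc * norm (uu (trj r) - uu (trk r)) * norm (vv (trj r) - vv (trk r)) <= inner (GG (trj r) - GG (trk r)) (vv (trj r) - vv (trk r))"
    using Kc(2)[OF bsolD(1)[OF b(1) r(1)] bsolD(1)[OF b(2) r(1)]] h r by auto
   moreover have "0 <= mD * (norm (vv (trj r) - vv (trk r)))^2" using damping_consts(1) by simp
   ultimately have "- inner (GG (trj r) - GG (trk r)) (vv (trj r) - vv (trk r)) <= Kc * (norm (uu (trj r) - uu (trk r)) * norm (vv (trj r) - vv (trk r)))" by (simp add: mult.assoc)
   also have "... <= Kc * ((L * norm (io (trj r) - io (trk r))) * norm (io (trj r) - io (trk r)))"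
   proof (intro mult_left_mono mult_mono Kc(1))
    have "norm (uu (trj r) - uu (trk r)) <= L * norm (dd (trj r) - dd (trk r))" using K3_poincare[OF k3[OF r(1)]] by simp
    also have "... <= L * norm (io (trj r) - io (trk r))" using pos(1) norm_fst_le[of "dd (trj r) - dd (trk r)" "vv (trj r) - vv (trk r)"] by (simp add: io_diff)
    finally show "norm (uu (trj r) - uu (trk r)) <= L * norm (io (trj r) - io (trk r))" .
    show "norm (vv (trj r) - vv (trk r)) <= norm (io (trj r) - io (trk r))" using norm_snd_le[of "vv (trj r) - vv (trk r)" "dd (trj r) - dd (trk r)"] by (simp add: io_diff)
   qed (use pos(1) in auto)
   also have "... = Kc * L * (norm (io (trj r) - io (trk r)))^2" by (simp add: power2_eq_square)
   also have "... <= Kc * L * (cE * E r)"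
    using cE(3)[OF k3[OF r(1)], of "vv (trj r) - vv (trk r)"] Kc(1) pos(1) by (intro mult_left_mono) (auto simp: io_diff E_def)
   finally show "- inner (GG (trj r) - GG (trk r)) (vv (trj r) - vv (trk r)) <= \<kappa> * energy (uu (trj r) - uu (trk r), dd (trj r) - dd (trk r)) (vv (trj r) - vv (trk r))"
    by (simp add: \<kappa>_def E_def mult.assoc)
  qed
  have "(norm (io (trj t) - io (trk t)))^2 <= cE * E t"
   using cE(3)[OF k3[OF st], of "vv (trj t) - vv (trk t)"] by (simp add: io_diff E_def)
  also have "... <= cE * (exp (\<kappa> * (t - s)) * E s)" using \<open>E t <= _\<close> cE(1) by (intro mult_left_mono) auto
  also have "... <= cE * (exp (\<kappa> * (t - s)) * (cE * (norm (io (trj s) - io (trk s)))^2))"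
   using cE(2)[OF k3[of s], of "vv (trj s) - vv (trk s)"] cE(1) by (intro mult_left_mono) (auto simp: io_diff E_def)
  also have "... <= cE * ((exp (\<kappa> * (t - s)))^2 * (cE * (norm (io (trj s) - io (trk s)))^2))"
  proof -
   have "1 <= exp (\<kappa> * (t - s))" using \<kappa> st by simp
   then have "exp (\<kappa> * (t - s)) <= (exp (\<kappa> * (t - s)))^2" by (simp add: power2_eq_square)
   then show ?thesis using cE(1) by (intro mult_left_mono mult_right_mono) auto
  qed
  also have "... = (cE * exp (\<kappa> * (t - s)) * norm (io (trj s) - io (trk s)))^2" by (simp add: power_mult_distrib power2_eq_square)
  finally show "norm (io (trj t) - io (trk t)) <= cE * exp (\<kappa> * (t - s)) * norm (io (trj s) - io (trk s))"
   by (rule power2_le_imp_le) (use cE(1) in simp)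
 qed
qed

lemma bsol_unique:
 assumes b: "bsol s trj" "bsol s trk" and e: "io (trj s) = io (trk s)" and st: "s <= t"
 shows "io (trj t) = io (trk t)"
proof -
 have bd: "\<exists>R. \<forall>r\<in>{s..t}. norm (dd (\<Theta> r)) <= R" if "bsol s \<Theta>" for \<Theta>
 proof -
  have "continuous_on {s..t} (%r. dd (\<Theta> r))"
   using continuous_on_fst[OF bsolD(3)[OF that]] by (auto simp: io_def intro: continuous_on_subset)
  then have "bounded ((%r. dd (\<Theta> r)) ` {s..t})" by (intro compact_imp_bounded compact_continuous_image) auto
  then show ?thesis unfolding bounded_iff by blast
 qed
 obtain R1 where R1: "\<forall>r\<in>{s..t}. norm (dd (trj r)) <= R1" using bd[OF b(1)] by blast
 obtain R2 where R2: "\<forall>r\<in>{s..t}. norm (dd (trk r)) <= R2" using bd[OF b(2)] by blast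
 have "\<forall>r\<in>{s..t}. norm (dd (trj r)) <= max R1 R2 & norm (dd (trk r)) <= max R1 R2" using R1 R2 by (simp add: le_max_iff_disj)
 then obtain \<kappa> where "norm (io (trj t) - io (trk t)) <= cE * exp (\<kappa> * (t - s)) * norm (io (trj s) - io (trk s))"
  using bsol_lipschitz[of "max R1 R2"] b st by blast
 then show ?thesis using e by simp
qed

end

section \<open>Potential energy and boundedness of orbits\<close>

lemma has_integral_bound_ae:
 fixes q h :: "real => real"
 assumes "(q has_integral a) {0..L}" "(h has_integral c) {0..L}" "negligible {x \<in> {0..L}. ~ \<bar>q x\<bar> <= h x}"
 shows "\<bar>a\<bar> <= c"
proof -
 define N where "N = {x \<in> {0..L}. ~ \<bar>q x\<bar> <= h x}"
 define q' where "q' x = (if x \<in> N then 0 else q x)" for x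
 define h' where "h' x = (if x \<in> N then 0 else h x)" for x
 have q': "(q' has_integral a) {0..L}"
  by (rule has_integral_spike[OF assms(3)[folded N_def] _ assms(1)]) (auto simp: q'_def)
 have h': "(h' has_integral c) {0..L}"
  by (rule has_integral_spike[OF assms(3)[folded N_def] _ assms(2)]) (auto simp: h'_def)
 have le: "q' x <= h' x" "- q' x <= h' x" if "x \<in> {0..L}" for x
  using that by (auto simp: q'_def h'_def N_def)
 have "a <= c" by (rule has_integral_le[OF q' h']) (use le in auto)
 moreover have "- a <= c" by (rule has_integral_le[OF has_integral_neg[OF q'] h']) (use le in auto)
 ultimately show ?thesis by linarith
qed

text \<open>The functionals of a quasi-stable semiflow form a set, in which functions of different
  indices may coincide. Scaling by the number of indices makes the sum over the set dominate in any
  case.\<close>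

lemma sum_index_le_sum_set:
 assumes "finite I"
 shows "(\<Sum>i\<in>I. \<bar>h i x - h i y\<bar>) <= (\<Sum>f\<in>(%i z. real (card I) * h i z) ` I. \<bar>f x - f y :: real\<bar>)"
proof (cases "I = {}")
 case False
 then have c: "0 < real (card I)" using assms by (simp add: card_gt_0_iff)
 define T where "T = (\<Sum>f\<in>(%i z. real (card I) * h i z) ` I. \<bar>f x - f y\<bar>)"
 have "\<bar>h i x - h i y\<bar> <= T / real (card I)" if i: "i \<in> I" for i
 proof -
  have "\<bar>real (card I) * h i x - real (card I) * h i y\<bar> <= T"
   unfolding T_def using assms i
   by (intro member_le_sum[of "%z. real (card I) * h i z" _ "%f. \<bar>f x - f y\<bar>"]) auto
  then have "real (card I) * \<bar>h i x - h i y\<bar> <= T" by (simp add: right_diff_distrib[symmetric] abs_mult)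
  then show ?thesis using c by (simp add: field_simps)
 qed
 then have "(\<Sum>i\<in>I. \<bar>h i x - h i y\<bar>) <= real (card I) * (T / real (card I))" by (rule sum_bounded_above)
 then show ?thesis using c by (simp add: T_def)
qed simp

context bresse
begin

definition pot :: "bst => real" where "pot U = integral {0..L} (%x. F (uT U x))"

definition gradF :: "r3 => r3" where "gradF y = (f1 y, f2 y, f3 y)"

lemma F_deriv: "(F has_derivative (%h. inner (gradF x) h)) (at x)"
 using F1[rule_format, of x] by (simp add: gradF_def inner_prod_def add.assoc)

lemma gradF_continuous: "continuous_on UNIV gradF"
 unfolding gradF_def by (intro continuous_on_Pair f_continuous) auto

lemma F_continuous: "continuous_on UNIV F"
 by (rule continuous_at_imp_continuous_on) (use F_deriv has_derivative_continuous in blast)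

lemma L2_F: "Hsp L U ==> L2 L (%x. F (uT U x))"
 by (rule L2_compose_bounded[OF F_continuous HspD(13) uT_sup[OF _ order_refl]])

lemma pot_integral: "Hsp L U ==> ((%x. F (uT U x)) has_integral pot U) {0..L}"
 unfolding pot_def by (intro integrable_integral L2_integrable L2_F)

text \<open>States close in the energy norm are close in the sup norm, so the uniform linearisation
  of \<open>F\<close> holds almost everywhere and can be integrated.\<close>

lemma pot_linearization:
 assumes e: "0 < e"
 shows "\<exists>dlt>0. \<forall>U V. Hsp L U --> Hsp L V --> norm (dd U) <= R --> norm (dd V) <= R --> norm (dd V - dd U) <= dlt -->
  \<bar>pot V - pot U - inner (NF U) (uu V - uu U)\<bar> <= e * norm (uu V - uu U)"
proof -
 \<comment> \<open>The integral of a pointwise norm over \<open>{0..L}\<close> costs a factor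
   \<open>sqrt L\<close> against the \<open>L^2\<close> norm.\<close>
 define e' where "e' = e / sqrt L"
 have e': "0 < e'" using e pos(1) by (simp add: e'_def)
 obtain d where d: "0 < d" "!!x y. norm x <= 3 * sqrt L * R ==> norm y <= 3 * sqrt L * R ==> norm (x - y) <= d ==>
   \<bar>F x - F y - inner (gradF y) (x - y)\<bar> <= e' * norm (x - y)"
  using C1_linearization[OF F_deriv gradF_continuous e', of "3 * sqrt L * R"] by blast
 define dlt where "dlt = d / (3 * sqrt L)"
 have dlt: "0 < dlt" using d pos(1) by (simp add: dlt_def)
 have "\<bar>pot V - pot U - inner (NF U) (uu V - uu U)\<bar> <= e * norm (uu V - uu U)"
  if U: "Hsp L U" "norm (dd U) <= R" and V: "Hsp L V" "norm (dd V) <= R" and dl: "norm (dd V - dd U) <= dlt" for U V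
 proof -
  note u = HspD[OF U(1)] and v = HspD[OF V(1)]
  define T where "T x = uT V x - uT U x" for x
  have T: "L2t L T" "to3 L T = uu V - uu U" unfolding T_def using u v by (auto simp: L2t_diff to3_diff uu_def)
  have sT: "negligible {x \<in> {0..L}. ~ norm (T x) <= d}"
  proof (rule negl_ball)
   show "negligible {x \<in> {0..L}. ~ norm (T x) <= 3 * sqrt L * norm (dd V - dd U)}"
    using K3_sup[OF diff_K3[OF V(1) U(1)] T(1)] T(2) by simp
   have "3 * sqrt L * norm (dd V - dd U) <= 3 * sqrt L * dlt" using dl pos(1) by (intro mult_left_mono) auto
   also have "... = d" using pos(1) by (simp add: dlt_def)
   finally show "norm (T x) <= 3 * sqrt L * norm (dd V - dd U) ==> norm (T x) <= d" for x by linarith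
  qed
  have c: "L2 L (%x. fst (T x))" "L2 L (%x. fst (snd (T x)))" "L2 L (%x. snd (snd (T x)))" using T(1) by (auto simp: L2t_def)
  have "((%x. f1 (uT U x) * fst (T x) + (f2 (uT U x) * fst (snd (T x)) + f3 (uT U x) * snd (snd (T x)))) has_integral
   (inner (toL L (%x. f1 (uT U x))) (toL L (%x. fst (T x))) + (inner (toL L (%x. f2 (uT U x))) (toL L (%x. fst (snd (T x))))
   + inner (toL L (%x. f3 (uT U x))) (toL L (%x. snd (snd (T x))))))) {0..L}"
   by (intro has_integral_add has_integral_inner c L2_NF U(1)) auto
  moreover have "(%x. f1 (uT U x) * fst (T x) + (f2 (uT U x) * fst (snd (T x)) + f3 (uT U x) * snd (snd (T x)))) = (%x. inner (gradF (uT U x)) (T x))"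
   by (rule ext) (simp add: gradF_def inner_prod_def)
  moreover have "inner (toL L (%x. f1 (uT U x))) (toL L (%x. fst (T x))) + (inner (toL L (%x. f2 (uT U x))) (toL L (%x. fst (snd (T x))))
   + inner (toL L (%x. f3 (uT U x))) (toL L (%x. snd (snd (T x))))) = inner (NF U) (to3 L T)"
   by (simp add: NF_def to3_def inner_prod_def)
  ultimately have i1: "((%x. inner (gradF (uT U x)) (T x)) has_integral inner (NF U) (uu V - uu U)) {0..L}" by (simp only: T(2))
  have i2: "((%x. F (uT V x) - F (uT U x) - inner (gradF (uT U x)) (T x)) has_integral (pot V - pot U - inner (NF U) (uu V - uu U))) {0..L}"
   by (intro has_integral_diff pot_integral U V i1)
  have i3: "((%x. e' * (norm (T x) * 1)) has_integral (e' * inner (toL L (%x. norm (T x))) (toL L (%x. 1)))) {0..L}"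
   by (intro has_integral_mult_right has_integral_inner norm_L2t(1)[OF T(1)] L2_const)
  have "\<bar>pot V - pot U - inner (NF U) (uu V - uu U)\<bar> <= e' * inner (toL L (%x. norm (T x))) (toL L (%x. 1))"
  proof (rule has_integral_bound_ae[OF i2 i3])
   show "negligible {x \<in> {0..L}. ~ \<bar>F (uT V x) - F (uT U x) - inner (gradF (uT U x)) (T x)\<bar> <= e' * (norm (T x) * 1)}"
   proof (rule negligible_subset[OF negligible_Un[OF sT negligible_Un[OF uT_sup[OF U] uT_sup[OF V]]]], rule subsetI)
    fix x assume x: "x \<in> {x \<in> {0..L}. ~ \<bar>F (uT V x) - F (uT U x) - inner (gradF (uT U x)) (T x)\<bar> <= e' * (norm (T x) * 1)}"
    then show "x \<in> {x \<in> {0..L}. ~ norm (T x) <= d} \<union> ({x \<in> {0..L}. ~ norm (uT U x) <= 3 * sqrt L * R} \<union> {x \<in> {0..L}. ~ norm (uT V x) <= 3 * sqrt L * R})"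
     using d(2)[of "uT V x" "uT U x"] by (auto simp: T_def)
   qed
  qed
  also have "... <= e' * (norm (to3 L T) * sqrt L)"
   using norm_cauchy_schwarz[of "toL L (%x. norm (T x))" "toL L (%x. 1)"] e' pos(1)
   by (intro mult_left_mono) (auto simp: norm_L2t[OF T(1)] norm_toL_const)
  finally show ?thesis using pos(1) by (simp add: e'_def T(2))
 qed
 then show ?thesis using dlt by blast
qed

text \<open>The displacement is differentiable in \<open>L^2\<close> only. This suffices, because
  the linearisation error of \<open>pot\<close> is a small multiple of the \<open>L^2\<close>
  increment and the difference quotients are bounded.\<close>

lemma pot_deriv:
 assumes b: "bsol s trj" and t: "s <= t"
 shows "((%t. pot (trj t)) has_real_derivative inner (NF (trj t)) (vv (trj t))) (at t within {s..})"
proof -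
 define q where "q r = (uu (trj r) - uu (trj t)) /\<^sub>R (r - t)" for r
 have q: "(q \<longlongrightarrow> vv (trj t)) (at t within {s..})"
  using solD(2)[OF bsolD(2)[OF b] t] unfolding has_vector_derivative_iff_quotient q_def by simp
 define p where "p r = (pot (trj r) - pot (trj t)) / (r - t)" for r
 have "((%r. p r - inner (NF (trj t)) (q r)) \<longlongrightarrow> 0) (at t within {s..})"
 proof (rule tendstoI)
  fix etz :: real assume etz: "0 < etz"
  define R where "R = norm (dd (trj t)) + 1"
  define e where "e = etz / (norm (vv (trj t)) + 2)"
  have vp: "0 < norm (vv (trj t)) + 2" by (simp add: add_nonneg_pos)
  have e: "0 < e" using etz vp by (simp add: e_def)
  obtain dlt where dlt: "0 < dlt" "!!U V. Hsp L U ==> Hsp L V ==> norm (dd U) <= R ==> norm (dd V) <= R ==> norm (dd V - dd U) <= dlt ==>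
   \<bar>pot V - pot U - inner (NF U) (uu V - uu U)\<bar> <= e * norm (uu V - uu U)"
   using pot_linearization[OF e, of R] by blast
  have "((%r. dd (trj r)) \<longlongrightarrow> dd (trj t)) (at t within {s..})"
   using continuous_on_fst[OF bsolD(3)[OF b]] t by (auto simp: io_def continuous_on_def)
  then have "((%r. norm (dd (trj r) - dd (trj t))) \<longlongrightarrow> 0) (at t within {s..})" by (simp add: LIM_zero tendsto_norm_zero)
  then have 1: "\<forall>\<^sub>F r in at t within {s..}. norm (dd (trj r) - dd (trj t)) < min 1 dlt"
   by (rule order_tendstoD) (use dlt in simp)
  have 2: "\<forall>\<^sub>F r in at t within {s..}. norm (q r) < norm (vv (trj t)) + 1"
   using tendsto_norm[OF q] by (rule order_tendstoD) simp
  have 3: "\<forall>\<^sub>F r in at t within {s..}. r \<in> {s..} & r ~= t" by (simp add: eventually_at_filter)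
  from 1 2 3 show "\<forall>\<^sub>F r in at t within {s..}. dist (p r - inner (NF (trj t)) (q r)) 0 < etz"
  proof eventually_elim
   case (elim r)
   have "norm (dd (trj r)) <= R" using norm_triangle_ineq2[of "dd (trj r)" "dd (trj t)"] elim(1) by (simp add: R_def)
   then have "\<bar>pot (trj r) - pot (trj t) - inner (NF (trj t)) (uu (trj r) - uu (trj t))\<bar> <= e * norm (uu (trj r) - uu (trj t))"
    using elim t by (intro dlt(2) bsolD(1)[OF b]) (auto simp: R_def)
   then have "\<bar>pot (trj r) - pot (trj t) - inner (NF (trj t)) (uu (trj r) - uu (trj t))\<bar> / \<bar>r - t\<bar> <= e * norm (uu (trj r) - uu (trj t)) / \<bar>r - t\<bar>"
    by (rule divide_right_mono) simp
   also have "... = e * norm (q r)" by (simp add: q_def divide_inverse mult.commute)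
   also have "... < etz"
   proof -
    have "e * norm (q r) <= e * (norm (vv (trj t)) + 1)" using elim(2) e by (intro mult_left_mono) auto
    also have "... < e * (norm (vv (trj t)) + 2)" using e by simp
    also have "... = etz" using vp by (simp add: e_def)
    finally show ?thesis .
   qed
   also have "\<bar>pot (trj r) - pot (trj t) - inner (NF (trj t)) (uu (trj r) - uu (trj t))\<bar> / \<bar>r - t\<bar> = \<bar>p r - inner (NF (trj t)) (q r)\<bar>"
   proof -
    have "p r - inner (NF (trj t)) (q r) = (pot (trj r) - pot (trj t) - inner (NF (trj t)) (uu (trj r) - uu (trj t))) / (r - t)"
     unfolding p_def q_def inner_scaleR_right by (simp only: diff_divide_distrib divide_inverse right_diff_distrib mult.commute)
    then show ?thesis by (simp only: abs_divide)
   qed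
   finally show ?case by (simp add: dist_real_def)
  qed
 qed
 then have "((%r. (p r - inner (NF (trj t)) (q r)) + inner (NF (trj t)) (q r)) \<longlongrightarrow> 0 + inner (NF (trj t)) (vv (trj t))) (at t within {s..})"
  by (intro tendsto_add tendsto_inner tendsto_const q)
 then show ?thesis unfolding has_field_derivative_iff by (simp add: p_def)
qed

lemma NG_nonneg: assumes "Hsp L U" shows "0 <= inner (NG U) (vv U)"
proof -
 have "vv zero_st = 0" using zero_st(2) by (simp add: io_def zero_prod_def)
 moreover have "NG zero_st = 0" using damping_consts(5)[of g1] damping_consts(5)[of g2] damping_consts(5)[of g3] by (simp add: NG_def zero_st_def toL_zero zero_prod_def)
 moreover have "0 <= mD * (norm (vv U - vv zero_st))^2" using damping_consts(1) by simp
 ultimately show ?thesis using NG_estimates(1)[OF assms zero_st(1)] by simp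
qed

lemma total_energy_decreasing:
 assumes b: "bsol s trj" and st: "s <= t"
 shows "energy (uu (trj t), dd (trj t)) (vv (trj t)) + pot (trj t) <= energy (uu (trj s), dd (trj s)) (vv (trj s)) + pot (trj s)"
proof (cases "s = t")
 case False
 show ?thesis
 proof (rule DERIV_nonpos_imp_decreasing_open[of s t "%t. energy (uu (trj t), dd (trj t)) (vv (trj t)) + pot (trj t)"])
  fix r assume r: "s < r" "r < t"
  have "((%t. pot (trj t)) has_real_derivative inner (NF (trj r)) (vv (trj r))) (at r)"
   using pot_deriv[OF b, of r] r by (simp add: at_within_interior[of r "{s..}"])
  then have "((%t. energy (uu (trj t), dd (trj t)) (vv (trj t)) + pot (trj t)) has_real_derivative
    - inner (GG (trj r)) (vv (trj r)) + inner (NF (trj r)) (vv (trj r))) (at r)"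
   by (intro DERIV_add energy_deriv[OF bsolD(2)[OF b] r(1)])
  moreover have "- inner (GG (trj r)) (vv (trj r)) + inner (NF (trj r)) (vv (trj r)) <= 0"
   using NG_nonneg[OF bsolD(1)[OF b, of r]] r by (simp add: GG_def inner_add_left)
  ultimately show "\<exists>y. ((%t. energy (uu (trj t), dd (trj t)) (vv (trj t)) + pot (trj t)) has_real_derivative y) (at r) & y <= 0" by blast
 next
  have "continuous_on {s..} (%t. pot (trj t))"
   by (rule DERIV_continuous_on[OF pot_deriv[OF b]]) simp
  then show "continuous_on {s..t} (%t. energy (uu (trj t), dd (trj t)) (vv (trj t)) + pot (trj t))"
   by (intro continuous_on_add continuous_on_subset[OF energy_continuous[OF bsolD(2)[OF b]]]) (auto intro: continuous_on_subset)
 qed (use st False in auto)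
qed simp

lemma pot_lower:
 assumes U: "Hsp L U" shows "- \<beta> * (norm (uu U))^2 - mF * L <= pot U"
proof -
 have n: "((%x. norm (uT U x) * norm (uT U x)) has_integral inner (toL L (%x. norm (uT U x))) (toL L (%x. norm (uT U x)))) {0..L}"
  by (intro has_integral_inner norm_L2t(1) HspD(13) U)
 have "((%x. - \<beta> * (norm (uT U x) * norm (uT U x)) - mF) has_integral
   (- \<beta> * inner (toL L (%x. norm (uT U x))) (toL L (%x. norm (uT U x))) - mF * L)) {0..L}"
  using has_integral_diff[OF has_integral_mult_right[OF n, of "- \<beta>"] has_integral_const_real[of mF 0 L]] pos(1) by (simp add: mult.commute)
 then have "- \<beta> * inner (toL L (%x. norm (uT U x))) (toL L (%x. norm (uT U x))) - mF * L <= pot U"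
 proof (rule has_integral_le[OF _ pot_integral[OF U]])
  fix x
  show "- \<beta> * (norm (uT U x) * norm (uT U x)) - mF <= F (uT U x)"
   using F2(4)[rule_format, of "phi U x" "psi U x" "ww U x"] by (simp add: uT_def norm_prod_def add.assoc)
 qed
 then show ?thesis using norm_L2t(2)[OF HspD(13)[OF U]] by (simp add: power2_norm_eq_inner[symmetric] uu_def)
qed

text \<open>The total energy does not increase, and by \<open>F2\<close> with the sharp Wirtinger
  constant it controls the quadratic energy from above.\<close>

lemma bounded_orbits:
 "\<exists>R'\<ge>0. \<forall>s t trj. bsol s trj --> s <= t --> norm (io (trj s)) <= R --> norm (io (trj t)) <= R'"
proof -
 \<comment> \<open>Wirtinger and \<open>K3_coercive\<close> bound \<open>\<beta>\<close> times the
   squared displacement norm by \<open>\<theta>\<close> times the form. The hypothesis on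
   \<open>\<beta>\<close> says \<open>\<theta> < 1 / 2\<close>, so the potential consumes only the
   fraction \<open>2 * \<theta>\<close> of the energy.\<close>
 define \<theta> where "\<theta> = \<beta> * (L^2 * \<gamma>3 / pi^2)"
 have \<theta>: "0 <= \<theta>" "\<theta> < 1 / 2"
 proof -
  show "0 <= \<theta>" using F2(1) gamma3(1) by (simp add: \<theta>_def)
  have p: "0 < L^2 * \<gamma>3 / pi^2" using pos(1) gamma3(1) by simp
  have "\<theta> < pi^2 / (2 * \<gamma>3 * L^2) * (L^2 * \<gamma>3 / pi^2)" unfolding \<theta>_def by (rule mult_strict_right_mono[OF F2(3) p])
  also have "... = 1 / 2" using pos(1) gamma3(1) by (simp add: field_simps)
  finally show "\<theta> < 1 / 2" .
 qed
 have low: "(1 - 2 * \<theta>) * energy (uu U, dd U) (vv U) - mF * L <= energy (uu U, dd U) (vv U) + pot U" if U: "Hsp L U" for U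
 proof -
  have "(pi / L * norm (uu U))^2 <= \<gamma>3 * aform (uu U, dd U) (uu U, dd U)"
   using K3_wirtinger[OF HspD(15)[OF U]] K3_coercive[OF HspD(15)[OF U]] by simp
  then have "(norm (uu U))^2 <= (L^2 * \<gamma>3 / pi^2) * aform (uu U, dd U) (uu U, dd U)"
   using pos(1) by (simp add: power_mult_distrib power_divide field_simps)
  then have "\<beta> * (norm (uu U))^2 <= \<theta> * aform (uu U, dd U) (uu U, dd U)"
   unfolding \<theta>_def mult.assoc by (rule mult_left_mono[OF _ F2(1)])
  moreover have "0 <= inner (mass (vv U)) (vv U)" using M_pos[of "vv U"] m0 by (smt (verit) mult_nonneg_nonneg zero_le_power2)
  then have "0 <= \<theta> * inner (mass (vv U)) (vv U)" using \<theta> by simp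
  moreover have "energy (uu U, dd U) (vv U) = (aform (uu U, dd U) (uu U, dd U) + inner (mass (vv U)) (vv U)) / 2" by (simp add: energy_def)
  ultimately show ?thesis using pot_lower[OF U] by (simp add: algebra_simps)
 qed
 obtain B where B: "B > 0" "!!y. norm y <= 3 * sqrt L * R ==> norm (F y) <= B" using continuous_bounded_on_cball[OF F_continuous] by blast
 have pu: "\<bar>pot U\<bar> <= B * L" if U: "Hsp L U" "norm (dd U) <= R" for U
 proof (rule has_integral_bound_ae[OF pot_integral[OF U(1)]])
  show "((%x. B) has_integral B * L) {0..L}" using has_integral_const_real[of B 0 L] pos(1) by (simp add: mult.commute)
  show "negligible {x \<in> {0..L}. ~ \<bar>F (uT U x)\<bar> <= B}" by (rule negl_ball[OF uT_sup[OF U]]) (use B(2) in auto)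
 qed
 \<comment> \<open>Quadratic energy and potential at the initial time, plus the constant
   \<open>mF * L\<close> lost in the lower bound.\<close>
 define V0 where "V0 = cE * R^2 + B * L + mF * L"
 define R' where "R' = sqrt (\<bar>cE * (V0 / (1 - 2 * \<theta>))\<bar>)"
 have "norm (io (trj t)) <= R'" if b: "bsol s trj" and st: "s <= t" and h: "norm (io (trj s)) <= R" for s t trj
 proof -
  have Us: "Hsp L (trj s)" and Ut: "Hsp L (trj t)" using bsolD(1)[OF b] st by auto
  have "norm (dd (trj s)) <= R" using norm_fst_le[of "dd (trj s)" "vv (trj s)"] h by (simp add: io_def)
  note p = pu[OF Us this]
  have "energy (uu (trj s), dd (trj s)) (vv (trj s)) <= cE * (norm (io (trj s)))^2"
   using cE(2)[OF HspD(15)[OF Us], of "vv (trj s)"] by (simp add: io_def)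
  also have "... <= cE * R^2" using h cE(1) by (intro mult_left_mono power_mono) auto
  finally have "(1 - 2 * \<theta>) * energy (uu (trj t), dd (trj t)) (vv (trj t)) <= V0"
   using total_energy_decreasing[OF b st] low[OF Ut] p by (simp add: V0_def)
  then have "energy (uu (trj t), dd (trj t)) (vv (trj t)) <= V0 / (1 - 2 * \<theta>)" using \<theta> by (simp add: pos_le_divide_eq mult.commute)
  then have "cE * energy (uu (trj t), dd (trj t)) (vv (trj t)) <= cE * (V0 / (1 - 2 * \<theta>))" using cE(1) by (intro mult_left_mono) auto
  then have "(norm (io (trj t)))^2 <= cE * (V0 / (1 - 2 * \<theta>))"
   using cE(3)[OF HspD(15)[OF Ut], of "vv (trj t)"] unfolding io_def snd_conv by linarith
  then have "(norm (io (trj t)))^2 <= \<bar>cE * (V0 / (1 - 2 * \<theta>))\<bar>" by (rule order_trans) (rule abs_ge_self)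
  then show ?thesis unfolding R'_def by (rule real_le_rsqrt)
 qed
 moreover have "0 <= R'" by (simp add: R'_def)
 ultimately show ?thesis by blast
qed

section \<open>The semiflow on the Hilbert space and its attractor\<close>

definition X :: "(h3 \<times> h3) set" where "X = io ` {U. Hsp L U}"
definition pick :: "h3 \<times> h3 => bst" where "pick e = (SOME U. Hsp L U & io U = e)"
definition sig :: "real => h3 \<times> h3 => h3 \<times> h3" where "sig t e = io (S t (pick e))"

lemma pick: "e \<in> X ==> Hsp L (pick e)" "e \<in> X ==> io (pick e) = e"
proof -
 assume "e \<in> X"
 then have "\<exists>U. Hsp L U & io U = e" by (auto simp: X_def)
 from someI_ex[OF this] show "Hsp L (pick e)" "io (pick e) = e" by (auto simp: pick_def)
qed

lemma S_bsol:
 assumes "Hsp L U" shows "bsol 0 (%t. S t U)" "io (S 0 U) = io U" "0 <= t ==> Hsp L (S t U)"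
proof -
 show b: "bsol 0 (%t. S t U)" using semigroup assms weak_sol_bsol by blast
 show "0 <= t ==> Hsp L (S t U)" by (rule bsolD(1)[OF b])
 have "dH L (S 0 U) U = 0" using semigroup assms by blast
 then show "io (S 0 U) = io U" using dH_eq[OF bsolD(1)[OF b] assms] by simp
qed

text \<open>Uniqueness of solutions makes \<open>sig\<close> independent of the state that
  \<open>pick\<close> selects, so \<open>S\<close> on functions descends to classes.\<close>

lemma sig_io: assumes "Hsp L U" "0 <= t" shows "sig t (io U) = io (S t U)"
proof -
 have x: "io U \<in> X" using assms by (auto simp: X_def)
 note p = pick[OF x]
 show ?thesis
  unfolding sig_def
  by (rule bsol_unique[OF S_bsol(1)[OF p(1)] S_bsol(1)[OF assms(1)] _ assms(2)]) (simp add: S_bsol(2) p assms)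
qed

lemma sig_pick_bsol: "e \<in> X ==> bsol 0 (%t. S t (pick e))"
 using S_bsol(1) pick(1) by blast

lemma io_A_compact: "compact (io ` A)"
 unfolding compact_def
proof (intro allI impI)
 fix f :: "nat => h3 \<times> h3" assume "\<forall>n. f n \<in> io ` A"
 then have "\<forall>n. \<exists>U. U \<in> A & f n = io U" by blast
 then obtain U where U: "!!n. U n \<in> A" "!!n. f n = io (U n)" by metis
 have "pcompact (dH L) A" using attractor by (simp add: global_attractor_def)
 then obtain r a where r: "strict_mono (r :: nat => nat)" "a \<in> A" "(%n. dH L (U (r n)) a) \<longlonglongrightarrow> 0"
  using U(1) unfolding pcompact_def by blast
 have H: "Hsp L V" if "V \<in> A" for V using attractor that by (auto simp: global_attractor_def)
 have "(f \<circ> r) \<longlonglongrightarrow> io a"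
  using r(3) by (subst tendsto_dist_iff) (simp add: U dH_eq H r(2) dist_norm)
 then show "\<exists>l\<in>io ` A. \<exists>r. strict_mono r & (f \<circ> r) \<longlonglongrightarrow> l" using r by blast
qed

sublocale att: attracted_semiflow X sig "io ` A"
proof (rule attracted_semiflow.intro)
 have H: "Hsp L V" if "V \<in> A" for V using attractor that by (auto simp: global_attractor_def)
 show "sig t x \<in> X" if "0 <= t" "x \<in> X" for t x
  using S_bsol(3)[OF pick(1)[OF that(2)] that(1)] by (auto simp: sig_def X_def)
 show "sig 0 x = x" if "x \<in> X" for x using S_bsol(2)[OF pick(1)[OF that]] pick(2)[OF that] by (simp add: sig_def)
 show "sig (s + t) x = sig s (sig t x)" if st: "0 <= s" "0 <= t" and x: "x \<in> X" for s t x
 proof -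
  define U where "U = pick x"
  have U: "Hsp L U" by (simp add: U_def pick(1) x)
  have b: "bsol 0 (%r. S (r + t) U)" by (rule bsol_mono[OF bsol_shift[OF S_bsol(1)[OF U]]]) (use st in simp)
  have Ut: "Hsp L (S t U)" by (rule S_bsol(3)[OF U st(2)])
  have "io (S (s + t) U) = io (S s (S t U))"
   by (rule bsol_unique[OF b S_bsol(1)[OF Ut] _ st(1)]) (simp add: S_bsol(2)[OF Ut])
  then show ?thesis using sig_io[OF Ut st(1)] by (simp add: sig_def U_def)
 qed
 show "continuous_on {0..} (%t. sig t x)" if "x \<in> X" for x
  unfolding sig_def by (rule bsolD(3)[OF sig_pick_bsol[OF that]])
 show "X ~= {}" using zero_st(1) by (auto simp: X_def)
 show "io ` A \<subseteq> X" using H by (auto simp: X_def)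
 show "compact (io ` A)" by (rule io_A_compact)
 show "sig t ` io ` A = io ` A" if t: "0 <= t" for t
 proof -
  have inv: "\<forall>a\<in>A. \<exists>b\<in>A. dH L (S t a) b = 0" "\<forall>b\<in>A. \<exists>a\<in>A. dH L (S t a) b = 0"
   using attractor t by (auto simp: global_attractor_def)
  have e: "sig t (io a) = io b" if "a \<in> A" "b \<in> A" "dH L (S t a) b = 0" for a b
   using sig_io[OF H[OF that(1)] t] dH_eq[OF S_bsol(3)[OF H[OF that(1)] t] H[OF that(2)]] that(3) by simp
  show ?thesis
  proof
   show "sig t ` io ` A \<subseteq> io ` A" using inv(1) e by fastforce
   show "io ` A \<subseteq> sig t ` io ` A"
   proof
    fix z assume "z \<in> io ` A"
    then obtain b where b: "b \<in> A" "z = io b" by blast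
    then obtain a where "a \<in> A" "dH L (S t a) b = 0" using inv(2) by blast
    then show "z \<in> sig t ` io ` A" using e b by (metis imageI)
   qed
  qed
 qed
 show "\<exists>T. \<forall>t\<ge>T. \<forall>x\<in>B. \<exists>a\<in>io ` A. dist (sig t x) a < epsz" if B: "B \<subseteq> X" "bounded B" and epsz: "0 < epsz" for B epsz
 proof -
  obtain R where R: "\<forall>x\<in>B. norm x <= R" using B(2) by (auto simp: bounded_iff)
  have "Hbounded L (pick ` B)"
   unfolding Hbounded_def
  proof (intro conjI exI[of _ R] ballI)
   show "pick ` B \<subseteq> {U. Hsp L U}" using pick(1) B(1) by blast
   fix U assume "U \<in> pick ` B"
   then obtain x where x: "x \<in> B" "U = pick x" by blast
   then have "x \<in> X" using B(1) by blast
   then show "dH L U zero_st <= R" using R x dH_eq[OF pick(1) zero_st(1)] zero_st(2) pick(2) by simp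
  qed
  then obtain T where T: "\<forall>t\<ge>T. \<forall>U\<in>pick ` B. \<exists>a\<in>A. dH L (S t U) a < epsz"
   using attractor epsz unfolding global_attractor_def by blast
  have "\<exists>a\<in>io ` A. dist (sig t x) a < epsz" if t: "max 0 T <= t" and x: "x \<in> B" for t x
  proof -
   obtain a where a: "a \<in> A" "dH L (S t (pick x)) a < epsz" using T t x by (meson imageI max.boundedE)
   have "x \<in> X" using x B(1) by blast
   then have "dH L (S t (pick x)) a = dist (sig t x) (io a)"
    using dH_eq[OF S_bsol(3)[OF pick(1)] H[OF a(1)]] t by (simp add: sig_def dist_norm)
   then show ?thesis using a by (intro bexI[of _ "io a"]) auto
  qed
  then show ?thesis by (intro exI[of _ "max 0 T"]) auto
 qed
qed

end

context bresse
begin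

section \<open>Quasi-stability of the Bresse semiflow\<close>

text \<open>Total in \<open>i\<close>: every index from 2 on means the third component, so a
  statement for all \<open>i\<close> speaks of exactly three components.\<close>

definition sel :: "nat => h3 => l2" where "sel i d = (if i = 0 then fst d else if i = 1 then fst (snd d) else snd (snd d))"

lemma K3_finite_functionals:
 assumes e: "0 < (epsz::real)"
 shows "\<exists>W. finite W & (\<forall>x\<in>K3. norm (fst x) <= epsz * norm (snd x) + (\<Sum>(i, a)\<in>{..<3} \<times> W. \<bar>inner (sel i (snd x)) a\<bar>))"
proof -
 obtain W where W: "finite W" "!!e d. (e, d) \<in> K1 L ==> norm e <= epsz / 3 * norm d + (\<Sum>a\<in>W. \<bar>inner d a\<bar>)"
  using K1_finite_functionals[OF pos(1), of "epsz / 3"] e by auto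
 have "norm (fst x) <= epsz * norm (snd x) + (\<Sum>(i, a)\<in>{..<3} \<times> W. \<bar>inner (sel i (snd x)) a\<bar>)" if x: "x \<in> K3" for x
 proof -
  have k: "(fst (fst x), fst (snd x)) \<in> K1 L" "(fst (snd (fst x)), fst (snd (snd x))) \<in> K1 L" "(snd (snd (fst x)), snd (snd (snd x))) \<in> K1 L"
   using x by (auto simp: K3_def)
  have m: "epsz / 3 * norm y <= epsz / 3 * norm (snd x)" if "norm y <= norm (snd x)" for y :: l2 using that e by (intro mult_left_mono) auto
  have "(\<Sum>(i, a)\<in>{..<3} \<times> W. \<bar>inner (sel i (snd x)) a\<bar>) = (\<Sum>i<3. \<Sum>a\<in>W. \<bar>inner (sel i (snd x)) a\<bar>)"
   by (simp add: sum.cartesian_product)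
  also have "... = (\<Sum>a\<in>W. \<bar>inner (fst (snd x)) a\<bar>) + (\<Sum>a\<in>W. \<bar>inner (fst (snd (snd x))) a\<bar>) + (\<Sum>a\<in>W. \<bar>inner (snd (snd (snd x))) a\<bar>)"
   by (simp add: numeral_3_eq_3 sel_def)
  finally show ?thesis
   using norm_components(4)[of "fst x"] W(2)[OF k(1)] W(2)[OF k(2)] W(2)[OF k(3)]
    m[OF norm_components(1)[of "snd x"]] m[OF norm_components(2)[of "snd x"]] m[OF norm_components(3)[of "snd x"]] by linarith
 qed
 then show ?thesis using W(1) by blast
qed

lemma sel_bound: "\<bar>inner (sel i d - sel i d') a\<bar> <= norm (d - d') * norm a"
proof -
 have "norm (sel i d - sel i d') <= norm (d - d')" using norm_components(1-3)[of "d - d'"] by (auto simp: sel_def)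
 then show ?thesis using Cauchy_Schwarz_ineq2[of "sel i d - sel i d'" a] mult_right_mono[of "norm (sel i d - sel i d')" "norm (d - d')" "norm a"] by simp
qed

text \<open>The disturbance is the largest displacement difference on \<open>{0..\<tau>}\<close>. It
  is sampled at finitely many times, where finitely many functionals of the derivative control it;
  between the samples it is Lipschitz in time.\<close>

lemma semiflow_quasi_stable: "\<exists>\<tau> Lp Kl \<Lambda>. quasi_stable_semiflow X sig (io ` A) \<tau> Lp Kl \<Lambda>"
proof -
 obtain R where R: "!!x. x \<in> att.absorbing ==> norm x <= R" using att.absorbing_sub(3) by (auto simp: bounded_iff)
 obtain C gmz where C: "0 < C" "0 < gmz" and qs: "!!R. \<exists>Kc\<ge>0. \<forall>s t trj trk \<rho>. bsol s trj --> bsol s trk --> s <= t --> 0 <= \<rho> -->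
  (\<forall>r\<in>{s..t}. norm (dd (trj r)) <= R & norm (dd (trk r)) <= R & norm (uu (trj r) - uu (trk r)) <= \<rho>) -->
  (norm (io (trj t) - io (trk t)))^2 <= C * (exp (- gmz * (t - s)) * (norm (io (trj s) - io (trk s)))^2 + (Kc * \<rho>)^2)"
  using bsol_quasi_stable by blast
 obtain Kc where Kc: "0 <= Kc" "!!s t trj trk \<rho>. bsol s trj ==> bsol s trk ==> s <= t ==> 0 <= \<rho> ==>
  (\<forall>r\<in>{s..t}. norm (dd (trj r)) <= R & norm (dd (trk r)) <= R & norm (uu (trj r) - uu (trk r)) <= \<rho>) ==>
  (norm (io (trj t) - io (trk t)))^2 <= C * (exp (- gmz * (t - s)) * (norm (io (trj s) - io (trk s)))^2 + (Kc * \<rho>)^2)"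
  using qs[of R] by blast
 obtain \<kappa> where \<kappa>: "0 <= \<kappa>" "!!s t trj trk. bsol s trj ==> bsol s trk ==> s <= t ==> (\<forall>r\<in>{s..t}. norm (dd (trj r)) <= R & norm (dd (trk r)) <= R) ==>
  norm (io (trj t) - io (trk t)) <= cE * exp (\<kappa> * (t - s)) * norm (io (trj s) - io (trk s))"
  using bsol_lipschitz[of R] by blast
 \<comment> \<open>Makes \<open>C * exp (- gmz * \<tau>)\<close> at most 1/64, so the decaying part
   contributes an eighth of the initial distance after taking roots; the maximum with 1 keeps
   \<open>\<tau>\<close> positive.\<close>
 define \<tau> where "\<tau> = max 1 (ln (64 * C) / gmz)"
 have \<tau>: "0 < \<tau>" by (simp add: \<tau>_def)
 have Ce: "C * exp (- gmz * \<tau>) <= 1 / 64"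
 proof -
  have c: "0 < 64 * C" using C(1) by simp
  have "ln (64 * C) / gmz <= \<tau>" by (simp add: \<tau>_def)
  then have "ln (64 * C) <= gmz * \<tau>" using C(2) by (simp only: pos_divide_le_eq mult.commute)
  then have "exp (- (gmz * \<tau>)) <= exp (- ln (64 * C))" by (simp only: exp_le_cancel_iff neg_le_iff_le)
  also have "... = inverse (64 * C)" using exp_ln[OF c] by (simp only: exp_minus)
  finally have "C * exp (- gmz * \<tau>) <= C * inverse (64 * C)" using C(1) by (simp only: mult_minus_left mult_le_cancel_left_pos)
  also have "... = 1 / 64" using C(1) by (simp only: inverse_eq_divide) (simp add: nonzero_eq_divide_eq)
  finally show ?thesis .
 qed
 define Lp where "Lp = cE * exp (\<kappa> * \<tau>)"
 have Lp: "0 <= Lp" using cE(1) by (simp add: Lp_def)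
 define c2 where "c2 = sqrt C * Kc"
 have c2: "0 <= c2" using C Kc(1) by (simp add: c2_def)
 define orb where "orb x t = S t (pick x)" for x t
 have absX: "x \<in> X" if "x \<in> att.absorbing" for x using that att.absorbing_sub(2) by blast
 have orb: "bsol 0 (orb x)" "!!t. io (orb x t) = sig t x" "io (orb x 0) = x" if "x \<in> att.absorbing" for x
  using sig_pick_bsol[OF absX[OF that]] att.zero[OF absX[OF that]] by (simp_all add: orb_def[abs_def] sig_def)
 have dR: "norm (dd (orb x t)) <= R" if "x \<in> att.absorbing" "0 <= t" for x t
  using R[OF att.absorbing_inv[OF that(2,1)]] norm_fst_le[of "dd (orb x t)" "vv (orb x t)"] orb(2)[OF that(1), of t] by (simp add: io_def)
 have lip: "norm (sig t x - sig t y) <= Lp * norm (x - y)" if t: "t \<in> {0..\<tau>}" and xy: "x \<in> att.absorbing" "y \<in> att.absorbing" for t x y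
 proof -
  have "norm (io (orb x t) - io (orb y t)) <= cE * exp (\<kappa> * (t - 0)) * norm (io (orb x 0) - io (orb y 0))"
   using t dR xy by (intro \<kappa>(2) orb(1)) auto
  also have "... <= Lp * norm (io (orb x 0) - io (orb y 0))"
   unfolding Lp_def using t \<kappa>(1) cE(1) by (intro mult_right_mono mult_left_mono) (auto intro: mult_left_mono)
  finally show ?thesis using orb(2,3) xy by simp
 qed
 \<comment> \<open>Calibrated so that the compactness error contributes one sixteenth of the
   distance. The sampling error contributes another, and 1/8 + 1/16 + 1/16 is the required
   1/4.\<close>
 define epsz where "epsz = 1 / (16 * (c2 + 1) * (Lp + 1))"
 have epsz: "0 < epsz" using c2 Lp by (simp add: epsz_def)
 have cle: "c2 * Lp <= (c2 + 1) * (Lp + 1)" using c2 Lp by (intro mult_mono) auto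
 have e1: "c2 * (epsz * Lp) <= 1 / 16"
 proof -
  have "c2 * (epsz * Lp) = epsz * (c2 * Lp)" by simp
  also have "... <= epsz * ((c2 + 1) * (Lp + 1))" using epsz cle by (intro mult_left_mono) auto
  also have "... = 1 / 16" using c2 Lp by (simp add: epsz_def)
  finally show ?thesis .
 qed
 obtain W where W: "finite W" "!!x. x \<in> K3 ==> norm (fst x) <= epsz * norm (snd x) + (\<Sum>(i, a)\<in>{..<3} \<times> W. \<bar>inner (sel i (snd x)) a\<bar>)"
  using K3_finite_functionals[OF epsz] by blast
 \<comment> \<open>The number of sampling intervals, large enough that the Lipschitz motion within
   one of them costs at most a sixteenth of the distance.\<close>
 obtain J :: nat where J0: "16 * \<tau> * ((c2 + 1) * (Lp + 1)) < real J" using reals_Archimedean2 by blast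
 have "0 < 16 * \<tau> * ((c2 + 1) * (Lp + 1))" using \<tau> c2 Lp by (intro mult_pos_pos) auto
 then have J: "0 < J" using J0 by (auto intro: gr0I)
 have e2: "c2 * (\<tau> / real J * Lp) <= 1 / 16"
 proof -
  have "c2 * (\<tau> / real J * Lp) = \<tau> * (c2 * Lp) / real J" by simp
  also have "... <= \<tau> * ((c2 + 1) * (Lp + 1)) / real J" using \<tau> cle by (intro divide_right_mono mult_left_mono) auto
  also have "... <= 1 / 16" using J0 J by (simp add: pos_divide_le_eq)
  finally show ?thesis .
 qed
 define tm where "tm j = real j * (\<tau> / real J)" for j :: nat
 have tm: "tm j \<in> {0..\<tau>}" if "j <= J" for j
 proof -
  have "real j * (\<tau> / real J) <= real J * (\<tau> / real J)" using that \<tau> by (intro mult_right_mono) auto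
  then show ?thesis using \<tau> J by (simp add: tm_def)
 qed
 define h where "h = (%(j, i, a) x. c2 * inner (sel i (fst (sig (tm j) x))) a)"
 define I where "I = {..J} \<times> {..<3::nat} \<times> W"
 have I: "finite I" using W(1) by (simp add: I_def)
 \<comment> \<open>The functionals evaluate the orbit at the sampling times, but are functions of
   the initial point; the flow is built into \<open>h\<close>. The factor \<open>card I\<close>
   allows the sum over a set.\<close>
 define \<Lambda> where "\<Lambda> = (%i z. real (card I) * h i z) ` I"
 define Kl where "Kl = real (card I) * (c2 * (Lp * (\<Sum>a\<in>W. norm a)))"
 have hd: "\<bar>h (j, i, a) x - h (j, i, a) y\<bar> = c2 * \<bar>inner (sel i (fst (sig (tm j) x)) - sel i (fst (sig (tm j) y))) a\<bar>" for j i a x y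
  using c2 by (simp add: h_def abs_mult inner_diff_left flip: right_diff_distrib)
 have quasi: "norm (sig \<tau> x - sig \<tau> y) <= norm (x - y) / 4 + (\<Sum>f\<in>\<Lambda>. \<bar>f x - f y\<bar>)" if xy: "x \<in> att.absorbing" "y \<in> att.absorbing" for x y
 proof -
  define D where "D = norm (x - y)"
  define Z where "Z = (\<Sum>j\<in>{..J}. \<Sum>(i, a)\<in>{..<3} \<times> W. \<bar>inner (sel i (fst (sig (tm j) x)) - sel i (fst (sig (tm j) y))) a\<bar>)"
  define \<rho> where "\<rho> = \<tau> / real J * Lp * D + (epsz * Lp * D + Z)"
  have D: "0 <= D" by (simp add: D_def)
  have Z: "0 <= Z" unfolding Z_def by (intro sum_nonneg) auto
  have \<rho>0: "0 <= \<rho>" using \<tau> Lp D Z epsz by (simp add: \<rho>_def)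
  note bx = orb(1)[OF xy(1)] and bY = orb(1)[OF xy(2)]
  have dv: "(dd (orb x r) - dd (orb y r), vv (orb x r) - vv (orb y r)) = sig r x - sig r y" for r
   using orb(2)[OF xy(1), of r] orb(2)[OF xy(2), of r] by (simp add: io_diff)
  have dvn: "norm (dd (orb x r) - dd (orb y r)) <= Lp * D" "norm (vv (orb x r) - vv (orb y r)) <= Lp * D" if "r \<in> {0..\<tau>}" for r
   using lip[OF that xy] norm_fst_le[of "dd (orb x r) - dd (orb y r)" "vv (orb x r) - vv (orb y r)"]
    norm_snd_le[of "vv (orb x r) - vv (orb y r)" "dd (orb x r) - dd (orb y r)"] unfolding dv D_def by linarith+
  have un: "norm (uu (orb x r) - uu (orb y r)) <= \<rho>" if r: "r \<in> {0..\<tau>}" for r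
  proof -
   define j where "j = nat \<lfloor>r / (\<tau> / real J)\<rfloor>"
   have hp: "0 < \<tau> / real J" using \<tau> J by simp
   have r0: "0 <= r / (\<tau> / real J)" using r hp by simp
   have j: "real j <= r / (\<tau> / real J)" "r / (\<tau> / real J) < real j + 1" using r0 by (auto simp: j_def)
   have "r / (\<tau> / real J) <= \<tau> / (\<tau> / real J)" using r hp by (intro divide_right_mono) auto
   also have "... = real J" using \<tau> by simp
   finally have jJ: "j <= J" using j(1) by linarith
   have tr: "tm j <= r" "r - tm j <= \<tau> / real J"
   proof -
    show "tm j <= r" using j(1) hp unfolding tm_def by (simp only: pos_le_divide_eq)
    have "r < (real j + 1) * (\<tau> / real J)" using j(2) hp by (simp only: pos_divide_less_eq)
    then show "r - tm j <= \<tau> / real J" unfolding tm_def distrib_right by linarith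
   qed
   note tj = tm[OF jJ]
   have "norm (fst (uu (orb x r) - uu (orb y r), dd (orb x r) - dd (orb y r)) - fst (uu (orb x (tm j)) - uu (orb y (tm j)), dd (orb x (tm j)) - dd (orb y (tm j)))) <= (r - tm j) * (Lp * D)"
   proof (rule sol_lipschitz[OF bsol_diff[OF bx bY] _ tr(1)])
    show "norm (vv (orb x q) - vv (orb y q)) <= Lp * D" if "q \<in> {tm j..r}" for q using dvn(2)[of q] that r tj by auto
   qed (use tj in simp)
   also have "... <= \<tau> / real J * (Lp * D)" using tr Lp D by (intro mult_right_mono) auto
   finally have 1: "norm (uu (orb x r) - uu (orb y r)) <= norm (uu (orb x (tm j)) - uu (orb y (tm j))) + \<tau> / real J * Lp * D"
    using norm_triangle_ineq2[of "uu (orb x r) - uu (orb y r)" "uu (orb x (tm j)) - uu (orb y (tm j))"] by simp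
   have d: "dd (orb x (tm j)) = fst (sig (tm j) x)" "dd (orb y (tm j)) = fst (sig (tm j) y)"
    using arg_cong[OF orb(2)[OF xy(1), of "tm j"], of fst] arg_cong[OF orb(2)[OF xy(2), of "tm j"], of fst] by (simp_all add: io_def)
   have "norm (uu (orb x (tm j)) - uu (orb y (tm j))) <= epsz * norm (dd (orb x (tm j)) - dd (orb y (tm j))) + (\<Sum>(i, a)\<in>{..<3} \<times> W. \<bar>inner (sel i (dd (orb x (tm j)) - dd (orb y (tm j)))) a\<bar>)"
    using W(2)[OF diff_K3[OF bsolD(1)[OF bx, of "tm j"] bsolD(1)[OF bY, of "tm j"]]] tj by simp
   also have "(\<Sum>(i, a)\<in>{..<3} \<times> W. \<bar>inner (sel i (dd (orb x (tm j)) - dd (orb y (tm j)))) a\<bar>) <= Z"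
   proof -
    have "(\<Sum>(i, a)\<in>{..<3} \<times> W. \<bar>inner (sel i (dd (orb x (tm j)) - dd (orb y (tm j)))) a\<bar>) = (\<Sum>(i, a)\<in>{..<3} \<times> W. \<bar>inner (sel i (fst (sig (tm j) x)) - sel i (fst (sig (tm j) y))) a\<bar>)"
     unfolding d by (rule sum.cong) (auto simp: sel_def)
    also have "... <= Z" unfolding Z_def
     by (rule member_le_sum[of j "{..J}" "%j. \<Sum>(i, a)\<in>{..<3} \<times> W. \<bar>inner (sel i (fst (sig (tm j) x)) - sel i (fst (sig (tm j) y))) a\<bar>"])
      (use jJ in \<open>auto intro!: sum_nonneg\<close>)
    finally show ?thesis .
   qed
   also have "epsz * norm (dd (orb x (tm j)) - dd (orb y (tm j))) <= epsz * (Lp * D)" using dvn(1)[OF tj] epsz by (intro mult_left_mono) auto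
   finally show ?thesis using 1 by (simp add: \<rho>_def mult.assoc)
  qed
  have "(norm (io (orb x \<tau>) - io (orb y \<tau>)))^2 <= C * (exp (- gmz * (\<tau> - 0)) * (norm (io (orb x 0) - io (orb y 0)))^2 + (Kc * \<rho>)^2)"
   using \<tau> \<rho>0 un dR xy by (intro Kc(2)[OF bx bY]) auto
  then have "(norm (sig \<tau> x - sig \<tau> y))^2 <= C * exp (- gmz * \<tau>) * D^2 + C * (Kc * \<rho>)^2"
   using orb(2,3) xy by (simp add: D_def algebra_simps)
  also have "... <= 1 / 64 * D^2 + (c2 * \<rho>)^2"
  proof (rule add_mono)
   show "C * exp (- gmz * \<tau>) * D^2 <= 1 / 64 * D^2" by (rule mult_right_mono[OF Ce]) simp
   show "C * (Kc * \<rho>)^2 <= (c2 * \<rho>)^2" using C by (simp add: c2_def power_mult_distrib)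
  qed
  also have "... <= (D / 8 + c2 * \<rho>)^2" using D c2 \<rho>0 by (simp add: power2_eq_square algebra_simps)
  finally have 2: "norm (sig \<tau> x - sig \<tau> y) <= D / 8 + c2 * \<rho>" by (rule power2_le_imp_le) (use D c2 \<rho>0 in simp)
  have "c2 * \<rho> = c2 * (\<tau> / real J * Lp) * D + c2 * (epsz * Lp) * D + c2 * Z" by (simp add: \<rho>_def algebra_simps)
  also have "... <= 1 / 16 * D + 1 / 16 * D + c2 * Z" using D by (intro add_mono mult_right_mono e1 e2 order_refl)
  finally have 3: "c2 * \<rho> <= D / 8 + c2 * Z" by simp
  have "c2 * Z = (\<Sum>i\<in>I. \<bar>h i x - h i y\<bar>)"
  proof -
   have "(\<Sum>i\<in>I. \<bar>h i x - h i y\<bar>) = (\<Sum>j\<in>{..J}. \<Sum>(i, a)\<in>{..<3} \<times> W. \<bar>h (j, i, a) x - h (j, i, a) y\<bar>)"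
    unfolding I_def by (simp add: sum.cartesian_product)
   then show ?thesis by (simp add: Z_def hd sum_distrib_left case_prod_unfold)
  qed
  also have "... <= (\<Sum>f\<in>\<Lambda>. \<bar>f x - f y\<bar>)" unfolding \<Lambda>_def by (rule sum_index_le_sum_set[OF I])
  finally show ?thesis using 2 3 by (simp add: D_def)
 qed
 have "quasi_stable_semiflow X sig (io ` A) \<tau> Lp Kl \<Lambda>"
 proof (rule quasi_stable_semiflow.intro[OF att.attracted_semiflow_axioms], rule quasi_stable_semiflow_axioms.intro)
  show "0 < \<tau>" by (rule \<tau>)
  show "dist (sig t x) (sig t y) <= Lp * dist x y" if "t \<in> {0..\<tau>}" "x \<in> att.absorbing" "y \<in> att.absorbing" for t x y
   using lip[OF that] by (simp add: dist_norm)
  show "finite \<Lambda>" using I by (simp add: \<Lambda>_def)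
  show "dist (sig \<tau> x) (sig \<tau> y) <= dist x y / 4 + (\<Sum>f\<in>\<Lambda>. \<bar>f x - f y\<bar>)" if "x \<in> att.absorbing" "y \<in> att.absorbing" for x y
   using quasi[OF that] by (simp add: dist_norm)
  show "\<bar>f x - f y\<bar> <= Kl * dist x y" if f: "f \<in> \<Lambda>" and xy: "x \<in> att.absorbing" "y \<in> att.absorbing" for f x y
  proof -
   obtain j i a where jia: "j <= J" "a \<in> W" "f = (%z. real (card I) * h (j, i, a) z)" using f by (auto simp: \<Lambda>_def I_def)
   have "\<bar>inner (sel i (fst (sig (tm j) x)) - sel i (fst (sig (tm j) y))) a\<bar> <= norm (fst (sig (tm j) x) - fst (sig (tm j) y)) * norm a" by (rule sel_bound)
   also have "... <= (Lp * norm (x - y)) * (\<Sum>a\<in>W. norm a)"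
   proof (rule mult_mono)
    have "norm (fst (sig (tm j) x - sig (tm j) y)) <= norm (sig (tm j) x - sig (tm j) y)" by (metis norm_fst_le prod.collapse)
    then show "norm (fst (sig (tm j) x) - fst (sig (tm j) y)) <= Lp * norm (x - y)" using lip[OF tm[OF jia(1)] xy] by simp
    show "norm a <= (\<Sum>a\<in>W. norm a)" using W(1) jia(2) by (intro member_le_sum) auto
   qed (use Lp in auto)
   finally have "real (card I) * (c2 * \<bar>inner (sel i (fst (sig (tm j) x)) - sel i (fst (sig (tm j) y))) a\<bar>) <= real (card I) * (c2 * ((Lp * norm (x - y)) * (\<Sum>a\<in>W. norm a)))"
    using c2 by (intro mult_left_mono) auto
   moreover have "\<bar>f x - f y\<bar> = real (card I) * \<bar>h (j, i, a) x - h (j, i, a) y\<bar>" by (simp add: jia(3) abs_mult flip: right_diff_distrib)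
   ultimately show ?thesis by (simp add: hd Kl_def dist_norm mult_ac)
  qed
  show "bounded (\<Union>t\<in>{0..T}. sig t ` B)" if B: "B \<subseteq> X" "bounded B" for B T
  proof -
   obtain Q where Q: "\<forall>x\<in>B. norm x <= Q" using B(2) by (auto simp: bounded_iff)
   obtain R' where R': "!!s t trj. bsol s trj ==> s <= t ==> norm (io (trj s)) <= Q ==> norm (io (trj t)) <= R'" using bounded_orbits[of Q] by blast
   have "norm (sig t x) <= R'" if "t \<in> {0..T}" "x \<in> B" for t x
   proof -
    have x: "x \<in> X" using that B by blast
    have "io (S 0 (pick x)) = x" using S_bsol(2)[OF pick(1)[OF x]] pick(2)[OF x] by simp
    then show ?thesis using R'[OF sig_pick_bsol[OF x], of t] Q that by (simp add: sig_def)
   qed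
   then show ?thesis unfolding bounded_iff by blast
  qed
 qed
 then show ?thesis by blast
qed

end

context bresse
begin

section \<open>Time regularity in the extended norm; finite dimension and the exponential
  attractor\<close>

lemma mass_diff: "mass (u - v) = mass u - mass v" by (simp add: mass_def scaleR_right_diff_distrib)

text \<open>Read as a bound on the acceleration: every term of the equation, tested with
  \<open>x\<close>, is controlled by the derivative of \<open>x\<close>. The velocity is therefore
  Lipschitz in time with values in the dual space.\<close>

lemma velocity_dual_lipschitz:
 "\<exists>B\<ge>0. \<forall>s p q trj x. bsol s trj --> s <= p --> p <= q --> (\<forall>r\<in>{p..q}. norm (io (trj r)) <= R) --> x \<in> K3 -->
  \<bar>inner (mass (vv (trj q) - vv (trj p))) (fst x)\<bar> <= B * (q - p) * norm (snd x)"
proof -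
 obtain Ka where Ka: "0 < Ka" "!!x y. norm (aform x y) <= norm x * norm y * Ka" using bounded_bilinear.pos_bounded[OF a] by blast
 obtain Kc where Kc: "0 <= Kc" "!!U V. Hsp L U ==> Hsp L V ==> norm (dd U) <= R ==> norm (dd V) <= R ==>
   norm (GG U - GG V) <= MD * norm (vv U - vv V) + Kc * norm (uu U - uu V)"
  using GG_estimates[of R] by blast
 \<comment> \<open>The source at the zero state enters because the \<open>f\<close> terms may be
   nonzero there.\<close>
 define B where "B = (L + 1) * \<bar>R\<bar> * (L + 1) * Ka + (MD * \<bar>R\<bar> + Kc * (L * \<bar>R\<bar>) + norm (GG zero_st)) * L"
 have B: "0 <= B" using Ka(1) Kc(1) damping_consts(2) pos(1) by (simp add: B_def)
 have K3_norm: "norm x <= (L + 1) * norm (snd x)" if "x \<in> K3" for x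
  using K3_poincare[OF that] norm_Pair_le[of "fst x" "snd x"] by (simp add: distrib_right)
 have Gb: "\<bar>aform (uu U, dd U) x + inner (GG U) (fst x)\<bar> <= B * norm (snd x)"
  if U: "Hsp L U" "norm (io U) <= R" and x: "x \<in> K3" for U x
 proof -
  have R: "0 <= R" using order_trans[OF norm_ge_zero U(2)] .
  have dv: "norm (dd U) <= R" "norm (vv U) <= R"
   using norm_fst_le[of "dd U" "vv U"] norm_snd_le[of "vv U" "dd U"] U(2) by (auto simp: io_def)
  have z: "dd zero_st = 0" "vv zero_st = 0" "uu zero_st = 0"
   using zero_st(2) by (auto simp: io_def zero_prod_def uu_eq zero_st_def toL_zero)
  have u: "norm (uu U) <= L * R" 
   by (rule order_trans[OF K3_poincare[OF HspD(15)[OF U(1)], unfolded fst_conv snd_conv] mult_left_mono[OF dv(1)]]) (use pos(1) in simp)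
  have "norm (uu U, dd U) <= (L + 1) * R"
   by (rule order_trans[OF K3_norm[OF HspD(15)[OF U(1)], unfolded snd_conv] mult_left_mono[OF dv(1)]]) (use pos(1) in simp)
  then have "norm (uu U, dd U) * norm x * Ka <= ((L + 1) * R) * ((L + 1) * norm (snd x)) * Ka"
   using K3_norm[OF x] Ka(1) R pos(1) by (intro mult_right_mono mult_mono) auto
  then have 1: "\<bar>aform (uu U, dd U) x\<bar> <= (L + 1) * R * (L + 1) * Ka * norm (snd x)"
   using Ka(2)[of "(uu U, dd U)" x] by (simp add: mult_ac)
  have "norm (GG U - GG zero_st) <= MD * norm (vv U) + Kc * norm (uu U)"
   using Kc(2)[OF U(1) zero_st(1) dv(1)] R by (simp add: z)
  also have "... <= MD * R + Kc * (L * R)" using dv u Kc(1) damping_consts(2) by (intro add_mono mult_left_mono) auto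
  finally have g: "norm (GG U) <= MD * R + Kc * (L * R) + norm (GG zero_st)"
   using norm_triangle_ineq2[of "GG U" "GG zero_st"] by simp
  have "\<bar>inner (GG U) (fst x)\<bar> <= norm (GG U) * norm (fst x)" by (rule Cauchy_Schwarz_ineq2)
  also have "... <= (MD * R + Kc * (L * R) + norm (GG zero_st)) * (L * norm (snd x))"
   using g K3_poincare[OF x] order_trans[OF norm_ge_zero g] by (intro mult_mono) auto
  finally show ?thesis using 1 R by (simp add: B_def distrib_right mult.assoc)
 qed
 have "\<bar>inner (mass (vv (trj q) - vv (trj p))) (fst x)\<bar> <= B * (q - p) * norm (snd x)"
  if b: "bsol s trj" and st: "s <= p" "p <= q" and R: "\<forall>r\<in>{p..q}. norm (io (trj r)) <= R" and x: "x \<in> K3" for s p q trj x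
 proof -
  have "norm (inner (mass (vv (trj q))) (fst x) - inner (mass (vv (trj p))) (fst x)) <= (B * norm (snd x)) * norm (q - p)"
  proof (rule field_differentiable_bound)
   fix r assume r: "r \<in> {p..q}"
   show "((%t. inner (mass (vv (trj t))) (fst x)) has_field_derivative
     (- aform (uu (trj r), dd (trj r)) x - inner (GG (trj r)) (fst x))) (at r within {p..q})"
    using solD(3)[OF bsolD(2)[OF b] _ x, of r] r st by (auto intro: DERIV_subset)
   show "norm (- aform (uu (trj r), dd (trj r)) x - inner (GG (trj r)) (fst x)) <= B * norm (snd x)"
    using Gb[OF bsolD(1)[OF b] _ x, of r] R r st by auto
  qed (use st in auto)
  then show ?thesis using st mass_diff by (simp add: inner_diff_left mult_ac)
 qed
 then show ?thesis using B by blast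
qed

lemma dext_bound:
 assumes U: "Hsp L U" and V: "Hsp L V" and etz: "0 < etz" "etz <= 1" and r: "0 < r" and D: "0 <= D"
  and dual: "!!x. x \<in> K3 ==> \<bar>inner (mass (vv U - vv V)) (fst x)\<bar> <= D * norm (snd x)"
 shows "(dext L etz U V)^2 <= r powr (2 * etz - 2) * ((norm (uu U - uu V))^2 + r^2 * (norm (dd U - dd V))^2)
  + r powr (2 * etz) * ((norm (vv U - vv V))^2 + 3 * (D / cmass)^2 / r^2)"
proof -
 note u = HspD[OF U] and v = HspD[OF V]
 define P where "P = r powr (2 * etz - 2)"
 define Q where "Q = r powr (2 * etz)"
 define D' where "D' = D / cmass"
 define E where "E = D'^2 / r^2"
 have c: "0 < cmass" "cmass <= \<rho>1" "cmass <= \<rho>2" using pos by (simp_all add: cmass_def)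
 have up: "(snorm L (1 - etz) (fdiff f g))^2 <= P * ((norm (toL L f - toL L g))^2 + r^2 * (norm (toL L (dx L f) - toL L (dx L g)))^2)"
  if "H10 L f" "H10 L g" for f g
 proof -
  note f = H10_K1[OF pos(1) that(1)] and g = H10_K1[OF pos(1) that(2)]
  have e: "toL L (fdiff f g) = toL L f - toL L g" "L2 L (fdiff f g)" using f(1) g(1) by (simp_all add: fdiff_def toL_diff L2_diff)
  have "(toL L f - toL L g, toL L (dx L f) - toL L (dx L g)) \<in> K1 L"
   using K1_add[OF pos(1) f(4) K1_scale[OF g(4), of "-1"]] by simp
  then show ?thesis using snorm_upper[OF pos(1) etz e(2) _ r] e(1) unfolding P_def by metis
 qed
 have lo: "(snorm L (- etz) (fdiff f g))^2 <= Q * ((norm (toL L f - toL L g))^2 + E)"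
  if "L2 L f" "L2 L g" and h: "!!e d. (e, d) \<in> K1 L ==> \<exists>\<rho>\<ge>cmass. \<bar>\<rho> * inner (toL L f - toL L g) e\<bar> <= D * norm d" for f g
 proof -
  have e: "toL L (fdiff f g) = toL L f - toL L g" "L2 L (fdiff f g)" using that(1,2) by (simp_all add: fdiff_def toL_diff L2_diff)
  have "inner (toL L f - toL L g) e <= D' * norm d" if "(e, d) \<in> K1 L" for e d
  proof -
   obtain \<rho> where \<rho>: "\<rho> \<ge> cmass" "\<bar>\<rho> * inner (toL L f - toL L g) e\<bar> <= D * norm d" using h[OF \<open>(e, d) \<in> K1 L\<close>] by blast
   have "cmass * \<bar>inner (toL L f - toL L g) e\<bar> <= \<rho> * \<bar>inner (toL L f - toL L g) e\<bar>" by (rule mult_right_mono[OF \<rho>(1)]) simp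
   also have "... <= D * norm d" using \<rho> c(1) by (simp add: abs_mult)
   finally have "\<bar>inner (toL L f - toL L g) e\<bar> <= D' * norm d" using c(1) by (simp add: D'_def field_simps)
   then show ?thesis by simp
  qed
  then show ?thesis using snorm_lower[OF pos(1) etz e(2) r, of D'] e(1) D c(1) unfolding Q_def D'_def E_def by simp
 qed
 have z: "(0, 0) \<in> K1 L" by (rule K1_zero[OF pos(1)])
 \<comment> \<open>Testing with a single nonzero component isolates one velocity; the two densities
   \<open>\<rho>1\<close> and \<open>\<rho>2\<close> are both at least \<open>cmass\<close>.\<close>
 have l1: "\<exists>\<rho>\<ge>cmass. \<bar>\<rho> * inner (toL L (phi_t U) - toL L (phi_t V)) e\<bar> <= D * norm d" if "(e, d) \<in> K1 L" for e d
  using dual[of "((e, 0, 0), (d, 0, 0))"] that z c by (intro exI[of _ \<rho>1]) (simp add: K3_def mass_def vv_eq inner_prod_def norm_prod_def)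
 have l2: "\<exists>\<rho>\<ge>cmass. \<bar>\<rho> * inner (toL L (psi_t U) - toL L (psi_t V)) e\<bar> <= D * norm d" if "(e, d) \<in> K1 L" for e d
  using dual[of "((0, e, 0), (0, d, 0))"] that z c by (intro exI[of _ \<rho>2]) (simp add: K3_def mass_def vv_eq inner_prod_def norm_prod_def)
 have l3: "\<exists>\<rho>\<ge>cmass. \<bar>\<rho> * inner (toL L (ww_t U) - toL L (ww_t V)) e\<bar> <= D * norm d" if "(e, d) \<in> K1 L" for e d
  using dual[of "((0, 0, e), (0, 0, d))"] that z c by (intro exI[of _ \<rho>1]) (simp add: K3_def mass_def vv_eq inner_prod_def norm_prod_def)
 note ups = up[OF u(1) v(1)] up[OF u(2) v(2)] up[OF u(3) v(3)]
 note los = lo[OF u(4) v(4) l1] lo[OF u(5) v(5) l2] lo[OF u(6) v(6) l3]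
 have n3: "(norm (a, b, c))^2 = (norm a)^2 + (norm b)^2 + (norm c)^2" for a b c :: l2 by (simp add: norm_prod_def)
 have "(dext L etz U V)^2 = (snorm L (1 - etz) (fdiff (phi U) (phi V)))^2 + (snorm L (1 - etz) (fdiff (psi U) (psi V)))^2
 + (snorm L (1 - etz) (fdiff (ww U) (ww V)))^2
 + (snorm L (- etz) (fdiff (phi_t U) (phi_t V)))^2 + (snorm L (- etz) (fdiff (psi_t U) (psi_t V)))^2
 + (snorm L (- etz) (fdiff (ww_t U) (ww_t V)))^2" unfolding dext_def by simp
 also have "... <= P * ((norm (uu U - uu V))^2 + r^2 * (norm (dd U - dd V))^2) + Q * ((norm (vv U - vv V))^2 + 3 * E)"
  using ups los by (simp add: uu_eq dd_def vv_eq n3 distrib_left)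
 finally show ?thesis by (simp only: P_def Q_def E_def D'_def times_divide_eq_right)
qed

definition Dext :: "real => h3 \<times> h3 => h3 \<times> h3 => real" where
 "Dext etz e e' = dext L etz (pick e) (pick e')"

text \<open>The balance parameter is taken to be 1, since no time step is involved; the dual bound
  comes from Cauchy-Schwarz and the Poincare inequality.\<close>

lemma Dext_lipschitz:
 assumes etz: "0 < etz" "etz <= 1"
 shows "\<exists>c\<ge>0. \<forall>x\<in>X. \<forall>y\<in>X. Dext etz x y <= c * dist x y"
proof -
 obtain Bm where Bm: "Bm > 0" "!!x. norm (mass x) <= norm x * Bm" using bounded_linear.pos_bounded[OF M] by blast
 define c where "c = sqrt (L^2 + 2 + 3 * (Bm * L / cmass)^2)"
 have "Dext etz x y <= c * dist x y" if x: "x \<in> X" and y: "y \<in> X" for x y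
 proof -
  note px = pick[OF x] and py = pick[OF y]
  define n where "n = norm (io (pick x) - io (pick y))"
  have dv: "norm (dd (pick x) - dd (pick y)) <= n" "norm (vv (pick x) - vv (pick y)) <= n"
   using norm_fst_le[of "dd (pick x) - dd (pick y)" "vv (pick x) - vv (pick y)"]
    norm_snd_le[of "vv (pick x) - vv (pick y)" "dd (pick x) - dd (pick y)"] by (simp_all add: n_def io_diff)
  have n: "0 <= n" by (simp add: n_def)
  have u: "norm (uu (pick x) - uu (pick y)) <= L * n"
   by (rule order_trans[OF K3_poincare[OF diff_K3[OF px(1) py(1)], unfolded fst_conv snd_conv] mult_left_mono[OF dv(1)]]) (use pos(1) in simp)
  have "\<bar>inner (mass (vv (pick x) - vv (pick y))) (fst z)\<bar> <= (Bm * L * n) * norm (snd z)" if z: "z \<in> K3" for z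
  proof -
   have "\<bar>inner (mass (vv (pick x) - vv (pick y))) (fst z)\<bar> <= norm (mass (vv (pick x) - vv (pick y))) * norm (fst z)"
    by (rule Cauchy_Schwarz_ineq2)
   also have "... <= (n * Bm) * (L * norm (snd z))"
    using order_trans[OF Bm(2) mult_right_mono[OF dv(2)]] Bm(1) n K3_poincare[OF z] by (intro mult_mono) auto
   finally show ?thesis by (simp add: mult_ac)
  qed
  then have "(dext L etz (pick x) (pick y))^2 <= (norm (uu (pick x) - uu (pick y)))^2 + (norm (dd (pick x) - dd (pick y)))^2
    + ((norm (vv (pick x) - vv (pick y)))^2 + 3 * (Bm * L * n / cmass)^2)"
   using dext_bound[OF px(1) py(1) etz zero_less_one, of "Bm * L * n"] Bm(1) n pos(1) by simp
  also have "... <= (L * n)^2 + n^2 + (n^2 + 3 * (Bm * L * n / cmass)^2)"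
   using u dv by (intro add_mono power_mono order_refl) auto
  also have "... = (c * n)^2" by (simp add: c_def power_mult_distrib power_divide algebra_simps add_divide_distrib)
  finally have "dext L etz (pick x) (pick y) <= c * n" by (rule power2_le_imp_le) (simp add: c_def n)
  then show ?thesis using px py by (simp add: Dext_def n_def dist_norm)
 qed
 moreover have "0 <= c" by (simp add: c_def)
 ultimately show ?thesis by blast
qed

text \<open>The balance parameter is the time step \<open>h\<close>: displacement and dual velocity
  differ by order \<open>h\<close>, derivative and velocity stay bounded, so all terms are of order
  \<open>h powr (2 * etz)\<close>. Both orders of the arguments are stated, in place of symmetry of
  \<open>dext\<close>.\<close>

lemma Dext_holder:
 assumes etz: "0 < etz" "etz <= 1"
 shows "\<exists>c\<ge>0. \<forall>x s t. x \<in> X --> 0 <= s --> s <= t --> (\<forall>r\<ge>0. norm (sig r x) <= R) -->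
  Dext etz (sig s x) (sig t x) <= c * \<bar>s - t\<bar> powr etz & Dext etz (sig t x) (sig s x) <= c * \<bar>s - t\<bar> powr etz"
proof -
 obtain B where B: "0 <= B" "!!s p q trj x. bsol s trj ==> s <= p ==> p <= q ==> (\<forall>r\<in>{p..q}. norm (io (trj r)) <= R) ==> x \<in> K3 ==>
  \<bar>inner (mass (vv (trj q) - vv (trj p))) (fst x)\<bar> <= B * (q - p) * norm (snd x)"
  using velocity_dual_lipschitz[of R] by blast
 \<comment> \<open>The 9 collects 1 and 4 from displacement and derivative and 4 from the
   velocities.\<close>
 define c where "c = sqrt (9 * R^2 + 3 * (B / cmass)^2)"
 have main: "dext L etz U V <= c * h powr etz"
  if H: "Hsp L U" "Hsp L V" and h: "0 <= h" and u: "norm (uu U - uu V) <= h * R" and dv: "norm (dd U - dd V) <= 2 * R" "norm (vv U - vv V) <= 2 * R"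
   and z: "h = 0 ==> io U = io V" and dual: "!!x. x \<in> K3 ==> \<bar>inner (mass (vv U - vv V)) (fst x)\<bar> <= B * h * norm (snd x)" for U V h
 \<comment> \<open>For a vanishing step the bound is zero and \<open>h\<close> cannot serve as
   balance parameter; the states then have equal images.\<close>
 proof (cases "h = 0")
  case True
  note e = io_eq_imp[OF H z[OF True]]
  have "mass 0 = 0" by (simp add: mass_def zero_prod_def)
  then have "(dext L etz U V)^2 <= 0" using dext_bound[OF H etz zero_less_one order_refl] e by simp
  then show ?thesis by (simp add: True)
 next
  case False
  then have h0: "0 < h" using h by simp
  have p2: "h powr (2 * etz - 2) * h^2 = h powr (2 * etz)"
  proof -
   have "h^2 = h powr 2" using h0 by simp
   then show ?thesis by (simp only: powr_add[symmetric]) simp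
  qed
  have "(dext L etz U V)^2 <= h powr (2 * etz - 2) * ((norm (uu U - uu V))^2 + h^2 * (norm (dd U - dd V))^2)
   + h powr (2 * etz) * ((norm (vv U - vv V))^2 + 3 * (B * h / cmass)^2 / h^2)"
   using B(1) h0 dual by (intro dext_bound H etz) auto
  also have "... <= h powr (2 * etz - 2) * ((h * R)^2 + h^2 * (2 * R)^2)
   + h powr (2 * etz) * ((2 * R)^2 + 3 * (B * h / cmass)^2 / h^2)"
   using u dv by (intro add_mono mult_left_mono power_mono order_refl) auto
  also have "... = (h powr (2 * etz - 2) * h^2) * (5 * R^2) + h powr (2 * etz) * (4 * R^2 + 3 * (B / cmass)^2)"
   using False by (simp add: power_mult_distrib power_divide algebra_simps)
  also have "... = (c * h powr etz)^2"
  proof -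
   have "(h powr etz)^2 = h powr (2 * etz)" using h0 by (simp add: power2_eq_square flip: powr_add)
   then show ?thesis unfolding p2 by (simp add: c_def power_mult_distrib algebra_simps)
  qed
  finally show ?thesis by (rule power2_le_imp_le) (simp add: c_def)
 qed
 have "Dext etz (sig s x) (sig t x) <= c * \<bar>s - t\<bar> powr etz & Dext etz (sig t x) (sig s x) <= c * \<bar>s - t\<bar> powr etz"
  if x: "x \<in> X" and st: "0 <= s" "s <= t" and R: "\<forall>r\<ge>0. norm (sig r x) <= R" for x s t
 proof -
  define trj where "trj r = S r (pick x)" for r
  have b: "bsol 0 trj" using sig_pick_bsol[OF x] by (simp add: trj_def[abs_def])
  have io: "io (trj r) = sig r x" for r by (simp add: trj_def sig_def)
  have n: "norm (io (trj r)) <= R" if "0 <= r" for r using R that by (simp add: io)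
  have dv: "norm (dd (trj r)) <= R" "norm (vv (trj r)) <= R" if "0 <= r" for r
   using n[OF that] norm_fst_le[of "dd (trj r)" "vv (trj r)"] norm_snd_le[of "vv (trj r)" "dd (trj r)"] by (auto simp: io_def)
  have u: "norm (uu (trj t) - uu (trj s)) <= (t - s) * R"
   using sol_lipschitz[OF bsolD(2)[OF b] st] dv(2) st by simp
  note G = bsolD(1)[OF b]
  have sx: "sig r x \<in> X" if "0 <= r" for r by (rule att.maps[OF that x])
  have e: "Hsp L (pick (sig r x))" "uu (pick (sig r x)) = uu (trj r)" "dd (pick (sig r x)) = dd (trj r)" "vv (pick (sig r x)) = vv (trj r)"
   if "0 <= r" for r
   using io_eq_imp[OF pick(1)[OF sx[OF that]] G[OF that]] pick[OF sx[OF that]] by (auto simp: io)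
  have s0: "0 <= t" using st by simp
  note es = e[OF st(1)] and et = e[OF s0]
  have du: "norm (dd (trj t) - dd (trj s)) <= 2 * R" "norm (vv (trj t) - vv (trj s)) <= 2 * R"
   using norm_triangle_ineq4[of "dd (trj t)" "dd (trj s)"] norm_triangle_ineq4[of "vv (trj t)" "vv (trj s)"] dv[OF st(1)] dv[OF s0] by linarith+
  have dual: "\<bar>inner (mass (vv (trj t) - vv (trj s))) (fst z)\<bar> <= B * (t - s) * norm (snd z)" if "z \<in> K3" for z
   using B(2)[OF b st _ that] n st by simp
  have dual': "\<bar>inner (mass (vv (trj s) - vv (trj t))) (fst z)\<bar> <= B * (t - s) * norm (snd z)" if "z \<in> K3" for z
   using dual[OF that] by (simp add: mass_diff inner_diff_left abs_minus_commute)
  have "dext L etz (pick (sig t x)) (pick (sig s x)) <= c * (t - s) powr etz"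
   using st u du dual by (intro main) (simp_all add: es et io_def)
  moreover have "dext L etz (pick (sig s x)) (pick (sig t x)) <= c * (t - s) powr etz"
   using st u du dual' by (intro main) (simp_all add: es et io_def norm_minus_commute)
  ultimately show ?thesis using st by (simp add: Dext_def)
 qed
 moreover have "0 <= c" by (simp add: c_def)
 ultimately show ?thesis by blast
qed

lemma attractor_fractal_dim: "fractal_dim (dH L) A < \<infinity>"
proof -
 obtain \<tau> Lp Kl \<Lambda> where "quasi_stable_semiflow X sig (io ` A) \<tau> Lp Kl \<Lambda>" using semiflow_quasi_stable by blast
 then interpret qs: quasi_stable_semiflow X sig "io ` A" \<tau> Lp Kl \<Lambda> .
 have H: "Hsp L V" if "V \<in> A" for V using attractor that by (auto simp: global_attractor_def)
 have N: "1 <= real qs.mult_const" using qs.mult_const(1) by simp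
 show ?thesis
 proof (rule fractal_dim_finite[of "max 1 qs.diam0" "real qs.mult_const" "1/2"])
  fix n
  have "covered (dH L) A (real qs.mult_const ^ n) (qs.diam0 * (1/2) ^ n)"
   by (rule covered_vimage[OF qs.A_covered, of A io]) (auto simp: dH_eq H dist_norm)
  then show "covered (dH L) A (max 1 qs.diam0 * real qs.mult_const ^ n) (max 1 qs.diam0 * (1/2) ^ n)"
  proof (rule covered_mono)
   show "real qs.mult_const ^ n <= max 1 qs.diam0 * real qs.mult_const ^ n"
    using mult_right_mono[of 1 "max 1 qs.diam0" "real qs.mult_const ^ n"] by simp
   show "qs.diam0 * (1/2) ^ n <= max 1 qs.diam0 * (1/2) ^ n" by (rule mult_right_mono) auto
  qed
 qed (use N in auto)
qed

text \<open>The set is constructed in the energy space without reference to \<open>etz\<close>, so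
  one set serves all exponents at once.\<close>

lemma exponential_attractor:
 "\<exists>E. exp_attracting_set L S E & (\<forall>etz\<in>{0<..1}. fractal_dim (dext L etz) E < \<infinity>)"
proof -
 obtain \<tau> Lp Kl \<Lambda> where "quasi_stable_semiflow X sig (io ` A) \<tau> Lp Kl \<Lambda>" using semiflow_quasi_stable by blast
 then interpret qs: quasi_stable_semiflow X sig "io ` A" \<tau> Lp Kl \<Lambda> .
 have EX: "e \<in> X" if "e \<in> qs.exp_attr" for e using that qs.exp_attr_sub att.absorbing_sub(2) by blast
 have E: "exp_attracting_set L S (pick ` qs.exp_attr)"
  unfolding exp_attracting_set_def
 proof (intro conjI allI impI ballI)
  show "pick ` qs.exp_attr \<subseteq> {U. Hsp L U}" using pick(1) EX by blast
  show "pcompact (dH L) (pick ` qs.exp_attr)"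
   unfolding pcompact_def
  proof (intro allI impI)
   fix U :: "nat => bst" assume U: "\<forall>n. U n \<in> pick ` qs.exp_attr"
   have "\<forall>n. \<exists>e. e \<in> qs.exp_attr & U n = pick e" using U by blast
   then obtain e where e: "!!n. e n \<in> qs.exp_attr" "!!n. U n = pick (e n)" by metis
   obtain z r where z: "z \<in> qs.exp_attr" "strict_mono (r :: nat => nat)" "(e \<circ> r) \<longlonglongrightarrow> z"
    using qs.exp_attr_compact e(1) unfolding compact_def by metis
   have "dH L (U (r n)) (pick z) = dist ((e \<circ> r) n) z" for n
    using dH_eq[OF pick(1)[OF EX[OF e(1)]] pick(1)[OF EX[OF z(1)]]] pick(2)[OF EX[OF e(1)]] pick(2)[OF EX[OF z(1)]]
    by (simp add: e(2) dist_norm)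
   then have "(%n. dH L (U (r n)) (pick z)) \<longlonglongrightarrow> 0" using tendsto_dist[OF z(3) tendsto_const[of z]] by simp
   then show "\<exists>r a. strict_mono r & a \<in> pick ` qs.exp_attr & (%n. dH L (U (r n)) a) \<longlonglongrightarrow> 0" using z by blast
  qed
  fix t :: real and U assume t: "0 <= t" and U: "U \<in> pick ` qs.exp_attr"
  obtain e where e: "e \<in> qs.exp_attr" "U = pick e" using U by blast
  have i: "sig t e \<in> qs.exp_attr" by (rule qs.exp_attr_inv[OF t e(1)])
  have "dH L (S t U) (pick (sig t e)) = 0"
   using dH_eq[OF S_bsol(3)[OF pick(1)[OF EX[OF e(1)]] t] pick(1)[OF EX[OF i]]] pick(2)[OF EX[OF i]] by (simp add: e(2) sig_def)
  then show "\<exists>b\<in>pick ` qs.exp_attr. dH L (S t U) b = 0" using i by blast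
 next
  fix B assume B: "Hbounded L B"
  then obtain R where R: "B \<subseteq> {U. Hsp L U}" "\<forall>U\<in>B. dH L U zero_st <= R" unfolding Hbounded_def by blast
  have "norm (io U) <= R" if "U \<in> B" for U
  proof -
   have "Hsp L U" using that R(1) by blast
   then show ?thesis using R(2) that dH_eq[OF _ zero_st(1), of U] zero_st(2) by auto
  qed
  then have "bounded (io ` B)" by (auto simp: bounded_iff)
  moreover have "io ` B \<subseteq> X" using R(1) by (auto simp: X_def)
  ultimately obtain C gmz where C: "0 < gmz" "\<forall>t\<ge>0. \<forall>x\<in>io ` B. \<exists>y\<in>qs.exp_attr. dist (sig t x) y <= C * exp (- gmz * t)"
   using qs.exp_attr_attracts by metis
  have "\<exists>a\<in>pick ` qs.exp_attr. dH L (S t U) a <= C * exp (- gmz * t)" if t: "0 <= t" and U: "U \<in> B" for t U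
  proof -
   have HU: "Hsp L U" using R(1) U by blast
   obtain y where y: "y \<in> qs.exp_attr" "dist (sig t (io U)) y <= C * exp (- gmz * t)" using C(2) t U by blast
   have "dH L (S t U) (pick y) = dist (sig t (io U)) y"
    using dH_eq[OF S_bsol(3)[OF HU t] pick(1)[OF EX[OF y(1)]]] pick(2)[OF EX[OF y(1)]] sig_io[OF HU t] by (simp add: dist_norm)
   then show ?thesis using y by (intro bexI[of _ "pick y"]) auto
  qed
  then show "\<exists>C gmz. gmz > 0 & (\<forall>t\<ge>0. \<forall>U\<in>B. \<exists>a\<in>pick ` qs.exp_attr. dH L (S t U) a <= C * exp (- gmz * t))" using C(1) by blast
 qed
 have "fractal_dim (dext L etz) (pick ` qs.exp_attr) < \<infinity>" if etz: "0 < etz" "etz <= 1" for etz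
 proof -
  obtain R where R: "!!x. x \<in> att.absorbing ==> norm x <= R" using att.absorbing_sub(3) by (auto simp: bounded_iff)
  obtain c1 where c1: "0 <= c1" "!!x y. x \<in> X ==> y \<in> X ==> Dext etz x y <= c1 * dist x y" using Dext_lipschitz[OF etz] by blast
  obtain c2 where c2: "0 <= c2" "!!x s t. x \<in> X ==> 0 <= s ==> s <= t ==> (\<forall>r\<ge>0. norm (sig r x) <= R) ==>
   Dext etz (sig s x) (sig t x) <= c2 * \<bar>s - t\<bar> powr etz & Dext etz (sig t x) (sig s x) <= c2 * \<bar>s - t\<bar> powr etz"
   using Dext_holder[OF etz, of R] by blast
  define c where "c = max c1 c2"
  have "\<exists>C\<ge>1. \<exists>N\<ge>1. \<forall>n. covered (Dext etz) qs.exp_attr (C * N ^ n) (C * (1/2) ^ n)"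
  proof (rule qs.exp_attr_covered)
   show "0 <= c" using c1(1) by (simp add: c_def)
   show "0 < etz" by (rule etz)
   show "Dext etz x y <= c * dist x y" if "x \<in> att.absorbing" "y \<in> att.absorbing" for x y
   proof -
    have "x \<in> X" "y \<in> X" using that att.absorbing_sub(2) by auto
    then have "Dext etz x y <= c1 * dist x y" by (rule c1(2))
    also have "... <= c * dist x y" by (rule mult_right_mono) (simp_all add: c_def)
    finally show ?thesis .
   qed
   show "Dext etz (sig s x) (sig t x) <= c * \<bar>s - t\<bar> powr etz" if x: "x \<in> att.absorbing" and st: "0 <= s" "0 <= t" for x s t
   proof -
    have xX: "x \<in> X" using x att.absorbing_sub(2) by auto
    have Rr: "\<forall>r\<ge>0. norm (sig r x) <= R" using R att.absorbing_inv[OF _ x] by blast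
    have "Dext etz (sig s x) (sig t x) <= c2 * \<bar>s - t\<bar> powr etz"
    proof (cases "s <= t")
     case True then show ?thesis using c2(2)[OF xX st(1) True Rr] by simp
    next
     case False then show ?thesis using c2(2)[OF xX st(2) _ Rr, of s] by (simp add: abs_minus_commute)
    qed
    also have "... <= c * \<bar>s - t\<bar> powr etz" by (rule mult_right_mono) (simp_all add: c_def)
    finally show ?thesis .
   qed
  qed
  then obtain C N where CN: "1 <= C" "1 <= N" "!!n. covered (Dext etz) qs.exp_attr (C * N ^ n) (C * (1/2) ^ n)" by blast
  have "covered (dext L etz) (pick ` qs.exp_attr) (C * N ^ n) (C * (1/2) ^ n)" for n
   by (rule covered_vimage[OF CN(3), of _ io]) (use pick(2) EX in \<open>auto simp: Dext_def\<close>)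
  then show ?thesis by (intro fractal_dim_finite[OF CN(1,2)]) auto
 qed
 then show ?thesis using E by auto
qed

end

section \<open>Tools for regularity: backward limits, second derivatives, second differences\<close>

text \<open>A full trajectory in the attractor is bounded for all past times, so \<open>B\<close> is
  independent of \<open>s\<close> and letting \<open>s\<close> tend to minus infinity removes the
  initial term.\<close>

lemma decay_limit:
 fixes x C :: real
 assumes "0 < gmz" "!!s. s <= t ==> x <= C * (exp (- gmz * (t - s)) * B + y)"
 shows "x <= C * y"
proof (rule LIMSEQ_le_const)
 have "(%n. exp (- gmz) ^ n) \<longlonglongrightarrow> 0" by (rule LIMSEQ_realpow_zero) (use assms(1) in auto)
 then have "(%n. C * (exp (- gmz) ^ n * B + y)) \<longlonglongrightarrow> C * (0 * B + y)" by (intro tendsto_mult tendsto_add tendsto_const)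
 then show "(%n. C * (exp (- gmz) ^ n * B + y)) \<longlonglongrightarrow> C * y" by simp
 show "\<exists>N. \<forall>n\<ge>N. x <= C * (exp (- gmz) ^ n * B + y)"
 proof (intro exI allI impI)
  fix n :: nat
  show "x <= C * (exp (- gmz) ^ n * B + y)"
   using assms(2)[of "t - real n"] by (simp add: exp_of_nat_mult[symmetric] mult.commute)
 qed
qed

lemma K1_by_parts:
 assumes L: "0 < L" and k: "(e, d) \<in> K1 L" "(e', d') \<in> K1 L"
 shows "inner e d' = - inner d e'"
proof -
 obtain f where f: "L2 L f" "prim f L = 0" "e = toL L (prim f)" "d = toL L f" using k(1) by (rule K1E)
 obtain g where g: "L2 L g" "prim g L = 0" "e' = toL L (prim g)" "d' = toL L g" using k(2) by (rule K1E)
 have "((%x. f x * prim g x + prim f x * g x) has_integral (inner d e' + inner e d')) {0..L}"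
  unfolding f(3,4) g(3,4) by (intro has_integral_add has_integral_inner prim_L2 f(1) g(1))
 moreover have "((%x. f x * prim g x + prim f x * g x) has_integral 0) {0..L}"
  using prim_product[of L f g] L f g by simp
 ultimately have "inner d e' + inner e d' = 0" by (rule has_integral_unique)
 then show ?thesis by simp
qed

text \<open>The tested equation says that \<open>r\<close> is the distributional derivative of
  \<open>dx L f\<close>, and du Bois-Reymond makes it a weak derivative.\<close>

lemma H2_I:
 assumes L: "0 < L" and f: "H10 L f" and r: "L2 L r"
  and t: "!!e d. (e, d) \<in> K1 L ==> inner (toL L (dx L f)) d = - inner (toL L r) e"
 shows "H2 L f" "h2norm L f <= norm (toL L f) + norm (toL L (dx L f)) + norm (toL L r)"
proof -
 note h = H10_K1[OF L f]
 have w: "weak_deriv L (dx L f) r" by (rule K1_weak_deriv[OF L h(2) r t])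
 then show "H2 L f" using h unfolding H2_def by blast
 have e: "l2norm L f = norm (toL L f)" "l2norm L (dx L f) = norm (toL L (dx L f))" "l2norm L (dx L (dx L f)) = norm (toL L r)"
  using h weak_deriv_dx[OF L w] by (simp_all add: l2norm_eq_norm)
 show "h2norm L f <= norm (toL L f) + norm (toL L (dx L f)) + norm (toL L r)"
  unfolding h2norm_def e by (rule real_le_lsqrt) (simp_all add: power2_eq_square algebra_simps)
qed

lemma sqrt_sum3_le: "0 <= x ==> 0 <= y ==> 0 <= z ==> sqrt (x^2 + y^2 + z^2) <= x + y + z"
 by (rule real_le_lsqrt) (simp_all add: power2_eq_square algebra_simps)

text \<open>The classes that come from functions on \<open>{0..L}\<close>. It is closed under
  limits, so limits of difference quotients again have representatives in \<open>L2\<close>.\<close>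

definition TL :: "real => l2 set" where "TL L = toL L ` {f. L2 L f}"

lemma TL_I: "L2 L f ==> toL L f \<in> TL L" by (simp add: TL_def)

lemma TL_add: "x \<in> TL L ==> y \<in> TL L ==> x + y \<in> TL L"
 unfolding TL_def by (auto simp flip: toL_add simp: L2_add)

lemma TL_scale: "x \<in> TL L ==> c *\<^sub>R x \<in> TL L"
 unfolding TL_def by (auto simp flip: toL_scale simp: L2_scale)

lemma TL_diff: "x \<in> TL L ==> y \<in> TL L ==> x - y \<in> TL L"
 unfolding TL_def by (auto simp flip: toL_diff simp: L2_diff)

lemma TL_limit:
 assumes "!!n. x n \<in> TL L" "x \<longlonglongrightarrow> d" shows "d \<in> TL L"
proof -
 have "\<forall>n. \<exists>f. L2 L f & x n = toL L f" using assms(1) by (auto simp: TL_def)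
 then obtain f where f: "!!n. L2 L (f n)" "!!n. x n = toL L (f n)" by metis
 have "toL L (rep d) = d" by (rule toL_limit[of L f d, OF f(1)]) (use assms(2) in \<open>simp add: f(2)[symmetric]\<close>)
 then show ?thesis using TL_I[OF L2_rep, of L d] by simp
qed

text \<open>With \<open>1/h\<close> and \<open>1/k\<close> for the two weights this is the
  difference of two difference quotients with common base point \<open>u\<close>; \<open>sn\<close>
  is the sum of the norms of the two quotients.\<close>

definition sd :: "real => real => 'a => 'a => 'a => 'a::real_vector" where
 "sd alp \<beta> u v w = alp *\<^sub>R (v - u) - \<beta> *\<^sub>R (w - u)"
definition sn :: "real => real => 'a::real_normed_vector => 'a => 'a => real" where
 "sn alp \<beta> u v w = norm (alp *\<^sub>R (v - u)) + norm (\<beta> *\<^sub>R (w - u))"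

lemma sd_pair: "sd alp \<beta> (u, u') (v, v') (w, w') = (sd alp \<beta> u v w, sd alp \<beta> u' v' w')" by (simp add: sd_def)
lemma sn_nonneg: "0 <= sn alp \<beta> u v w" by (simp add: sn_def)
lemma sn_fst: "sn alp \<beta> (fst u) (fst v) (fst w) <= sn alp \<beta> u v w"
 unfolding sn_def fst_diff[symmetric] fst_scaleR[symmetric] by (intro add_mono) (metis norm_fst_le prod.collapse)+
lemma sn_snd: "sn alp \<beta> (snd u) (snd v) (snd w) <= sn alp \<beta> u v w"
 unfolding sn_def snd_diff[symmetric] snd_scaleR[symmetric] by (intro add_mono) (metis norm_snd_le prod.collapse)+

lemma toL_sd:
 assumes "L2 L u" "L2 L v" "L2 L w"
 shows "L2 L (%x. sd alp \<beta> (u x) (v x) (w x))" "toL L (%x. sd alp \<beta> (u x) (v x) (w x)) = sd alp \<beta> (toL L u) (toL L v) (toL L w)"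
 unfolding sd_def real_scaleR_def using assms by (simp_all add: toL_diff toL_scale L2_diff L2_scale)

lemma to3_sd:
 assumes "L2t L u" "L2t L v" "L2t L w"
 shows "L2t L (%x. sd alp \<beta> (u x) (v x) (w x))" "to3 L (%x. sd alp \<beta> (u x) (v x) (w x)) = sd alp \<beta> (to3 L u) (to3 L v) (to3 L w)"
 unfolding sd_def using assms by (simp_all add: to3_diff to3_scale L2t_diff L2t_scale)

text \<open>The linear part of \<open>f\<close> at \<open>u\<close> commutes with \<open>sd\<close>,
  so only the two linearisation remainders are left, each small relative to its own increment. The
  estimate does not depend on the weights.\<close>

lemma C1_second_difference:
 fixes f :: "'a::euclidean_space => real"
 assumes f: "!!x. (f has_derivative (%h. inner (Df x) h)) (at x)" and Df: "continuous_on UNIV Df" and e: "0 < e"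
 shows "\<exists>dlt>0. \<forall>u v w alp \<beta>. norm u <= R --> norm v <= R --> norm w <= R --> norm (v - u) <= dlt --> norm (w - u) <= dlt -->
  \<bar>sd alp \<beta> (f u) (f v) (f w) - inner (Df u) (sd alp \<beta> u v w)\<bar> <= e * sn alp \<beta> u v w"
proof -
 obtain dlt where dlt: "0 < dlt" "!!x y. norm x <= R ==> norm y <= R ==> norm (x - y) <= dlt ==> \<bar>f x - f y - inner (Df y) (x - y)\<bar> <= e * norm (x - y)"
  using C1_linearization[OF f Df e, of R] by blast
 have "\<bar>sd alp \<beta> (f u) (f v) (f w) - inner (Df u) (sd alp \<beta> u v w)\<bar> <= e * sn alp \<beta> u v w"
  if n: "norm u <= R" "norm v <= R" "norm w <= R" "norm (v - u) <= dlt" "norm (w - u) <= dlt" for u v w alp \<beta>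
 proof -
  define p where "p = f v - f u - inner (Df u) (v - u)"
  define q where "q = f w - f u - inner (Df u) (w - u)"
  have "sd alp \<beta> (f u) (f v) (f w) - inner (Df u) (sd alp \<beta> u v w) = alp * p - \<beta> * q"
   by (simp add: sd_def p_def q_def inner_diff_right algebra_simps)
  moreover have "\<bar>alp * p\<bar> <= e * norm (alp *\<^sub>R (v - u))"
   using mult_left_mono[OF dlt(2)[OF n(2,1,4)], of "\<bar>alp\<bar>"] by (simp add: p_def abs_mult mult_ac)
  moreover have "\<bar>\<beta> * q\<bar> <= e * norm (\<beta> *\<^sub>R (w - u))"
   using mult_left_mono[OF dlt(2)[OF n(3,1,5)], of "\<bar>\<beta>\<bar>"] by (simp add: q_def abs_mult mult_ac)
  ultimately show ?thesis unfolding sn_def distrib_left by linarith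
 qed
 then show ?thesis using dlt(1) by blast
qed

lemma negligible_subset_Un5:
 assumes "negligible A" "negligible B" "negligible C" "negligible D" "negligible E" "S \<subseteq> A \<union> (B \<union> (C \<union> (D \<union> E)))"
 shows "negligible S"
 by (rule negligible_subset[OF _ assms(6)]) (intro negligible_Un assms)

context bresse
begin

text \<open>The slope bounds are recovered as limits of secants, so that the common constants
  \<open>mD\<close> and \<open>MD\<close> also bound the derivatives.\<close>

lemma damping_deriv:
 assumes g: "g \<in> {g1, g2, g3}"
 shows "\<exists>g'. continuous_on UNIV g' & (\<forall>s. (g has_real_derivative g' s) (at s) & mD <= g' s & g' s <= MD)"
proof -
 have "damping_ok g" using g G by auto
 then obtain g' where g': "continuous_on UNIV g'" "!!s. (g has_real_derivative g' s) (at s)" unfolding damping_ok_def by blast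
 have "mD <= g' s & g' s <= MD" for s
 proof
  have lim: "((%y. (g y - g s) / (y - s)) \<longlongrightarrow> g' s) (at s)" using g'(2)[of s] by (simp add: has_field_derivative_iff)
  have ne: "\<forall>\<^sub>F y in at s. y ~= s" by (simp add: eventually_at_filter)
  show "mD <= g' s"
  proof (rule tendsto_lowerbound[OF lim])
   show "\<forall>\<^sub>F y in at s. mD <= (g y - g s) / (y - s)"
   proof (rule eventually_mono[OF ne])
    fix y assume y: "y ~= s"
    then have "mD <= ((g y - g s) * (y - s)) / (y - s)^2" using damping_consts(3)[OF g, of y s] by (simp add: pos_le_divide_eq)
    then show "mD <= (g y - g s) / (y - s)" using y by (simp add: power2_eq_square)
   qed
  qed simp
  show "g' s <= MD"
  proof (rule tendsto_upperbound[OF lim])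
   show "\<forall>\<^sub>F y in at s. (g y - g s) / (y - s) <= MD"
   proof (rule eventually_mono[OF ne])
    fix y assume y: "y ~= s"
    then have "\<bar>(g y - g s) / (y - s)\<bar> <= MD" using damping_consts(4)[OF g, of y s] by (simp add: abs_divide pos_divide_le_eq)
    then show "(g y - g s) / (y - s) <= MD" by (rule abs_le_D1)
   qed
  qed simp
 qed
 then show ?thesis using g' by blast
qed

text \<open>Pointwise the second difference of \<open>g\<close> is \<open>g'\<close> at the base
  point times the second difference of the argument, up to \<open>e\<close> times the quotients.
  Smallness of the increments is needed pointwise, hence the essential bounds on
  \<open>v - u\<close> and \<open>w - u\<close>.\<close>

lemma g_second_difference:
 assumes g: "g \<in> {g1, g2, g3}" and e: "0 < e"
 shows "\<exists>dlt>0. \<forall>u v w alp \<beta>. L2 L u --> L2 L v --> L2 L w --> negligible {x \<in> {0..L}. ~ \<bar>u x\<bar> <= R} --> negligible {x \<in> {0..L}. ~ \<bar>v x\<bar> <= R} -->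
  negligible {x \<in> {0..L}. ~ \<bar>w x\<bar> <= R} --> negligible {x \<in> {0..L}. ~ \<bar>v x - u x\<bar> <= dlt} --> negligible {x \<in> {0..L}. ~ \<bar>w x - u x\<bar> <= dlt} -->
  mD * (norm (sd alp \<beta> (toL L u) (toL L v) (toL L w)))^2 - e * sn alp \<beta> (toL L u) (toL L v) (toL L w) * norm (sd alp \<beta> (toL L u) (toL L v) (toL L w))
   <= inner (sd alp \<beta> (toL L (%x. g (u x))) (toL L (%x. g (v x))) (toL L (%x. g (w x)))) (sd alp \<beta> (toL L u) (toL L v) (toL L w)) \<and>
  norm (sd alp \<beta> (toL L (%x. g (u x))) (toL L (%x. g (v x))) (toL L (%x. g (w x))))
   <= MD * norm (sd alp \<beta> (toL L u) (toL L v) (toL L w)) + e * sn alp \<beta> (toL L u) (toL L v) (toL L w)"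
proof -
 obtain g' where g': "continuous_on UNIV g'" "!!s. (g has_real_derivative g' s) (at s)" "!!s. mD <= g' s" "!!s. g' s <= MD"
  using damping_deriv[OF g] by blast
 have d: "(g has_derivative (%h. inner (g' s) h)) (at s)" for s using g'(2)[of s] by (simp add: has_field_derivative_def)
 obtain dlt where dlt: "0 < dlt" "!!u v w alp \<beta>. norm u <= R ==> norm v <= R ==> norm w <= R ==> norm (v - u) <= dlt ==> norm (w - u) <= dlt ==>
  \<bar>sd alp \<beta> (g u) (g v) (g w) - inner (g' u) (sd alp \<beta> u v w)\<bar> <= e * sn alp \<beta> u v w"
  using C1_second_difference[OF d g'(1) e, of R] by blast
 show ?thesis
 proof (rule exI[of _ dlt], rule conjI[OF dlt(1)], intro allI impI conjI)
  fix u v w :: "real => real" and alp \<beta> :: real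
  assume l: "L2 L u" "L2 L v" "L2 L w"
   and neg: "negligible {x \<in> {0..L}. ~ \<bar>u x\<bar> <= R}" "negligible {x \<in> {0..L}. ~ \<bar>v x\<bar> <= R}" "negligible {x \<in> {0..L}. ~ \<bar>w x\<bar> <= R}"
    "negligible {x \<in> {0..L}. ~ \<bar>v x - u x\<bar> <= dlt}" "negligible {x \<in> {0..L}. ~ \<bar>w x - u x\<bar> <= dlt}"
  define \<xi> where "\<xi> x = sd alp \<beta> (u x) (v x) (w x)" for x
  define Y where "Y x = sd alp \<beta> (g (u x)) (g (v x)) (g (w x))" for x
  define n where "n x = sn alp \<beta> (u x) (v x) (w x)" for x
  have lg: "L2 L (%x. g (u x))" "L2 L (%x. g (v x))" "L2 L (%x. g (w x))"
   by (rule damping_compose[where M = MD, OF damping_consts(5)[OF g] damping_consts(4)[OF g] damping_consts(2)]; rule l)+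
  have \<xi>: "L2 L \<xi>" "toL L \<xi> = sd alp \<beta> (toL L u) (toL L v) (toL L w)" unfolding \<xi>_def[abs_def] using toL_sd[OF l] by auto
  have Y: "L2 L Y" "toL L Y = sd alp \<beta> (toL L (%x. g (u x))) (toL L (%x. g (v x))) (toL L (%x. g (w x)))"
   unfolding Y_def[abs_def] using toL_sd[OF lg] by auto
  define p where "p x = alp * (v x - u x)" for x
  define q where "q x = \<beta> * (w x - u x)" for x
  have pq: "L2 L p" "L2 L q" "toL L p = alp *\<^sub>R (toL L v - toL L u)" "toL L q = \<beta> *\<^sub>R (toL L w - toL L u)"
   unfolding p_def[abs_def] q_def[abs_def] using l by (simp_all add: L2_scale L2_diff toL_scale toL_diff)
  have n: "n = (%x. \<bar>p x\<bar> + \<bar>q x\<bar>)" by (rule ext) (simp add: n_def sn_def p_def q_def abs_mult)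
  have nn: "0 <= n x" for x by (simp add: n)
  have ln: "L2 L n" unfolding n by (intro L2_add L2_abs pq)
  have nle: "norm (toL L n) <= sn alp \<beta> (toL L u) (toL L v) (toL L w)"
   unfolding n sn_def pq(3,4)[symmetric] toL_add[OF L2_abs[OF pq(1)] L2_abs[OF pq(2)]]
   by (rule order_trans[OF norm_triangle_ineq]) (simp add: norm_toL_abs pq(1,2))
  have main: "negligible {x \<in> {0..L}. ~ \<bar>Y x - g' (u x) * \<xi> x\<bar> <= e * n x}"
  proof (rule negligible_subset_Un5[OF neg], rule subsetI)
   fix x assume x: "x \<in> {x \<in> {0..L}. ~ \<bar>Y x - g' (u x) * \<xi> x\<bar> <= e * n x}"
   then show "x \<in> {x \<in> {0..L}. ~ \<bar>u x\<bar> <= R} \<union> ({x \<in> {0..L}. ~ \<bar>v x\<bar> <= R} \<union> ({x \<in> {0..L}. ~ \<bar>w x\<bar> <= R} \<union>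
    ({x \<in> {0..L}. ~ \<bar>v x - u x\<bar> <= dlt} \<union> {x \<in> {0..L}. ~ \<bar>w x - u x\<bar> <= dlt})))"
    using dlt(2)[of "u x" "v x" "w x" alp \<beta>] by (auto simp: Y_def \<xi>_def n_def)
  qed
  have "norm (toL L Y) <= norm (toL L (%x. MD * \<bar>\<xi> x\<bar> + e * n x))"
  proof (rule norm_toL_mono)
   show "L2 L Y" "L2 L (%x. MD * \<bar>\<xi> x\<bar> + e * n x)" by (intro L2_add L2_scale L2_abs \<xi> Y ln)+
   show "negligible {x \<in> {0..L}. ~ \<bar>Y x\<bar> <= \<bar>MD * \<bar>\<xi> x\<bar> + e * n x\<bar>}"
   proof (rule negl_ball[OF main])
    fix x assume a: "\<bar>Y x - g' (u x) * \<xi> x\<bar> <= e * n x"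
    have "\<bar>g' (u x) * \<xi> x\<bar> <= MD * \<bar>\<xi> x\<bar>"
     using g'(3)[of "u x"] g'(4)[of "u x"] damping_consts(1) by (auto simp: abs_mult intro: mult_right_mono)
    then show "\<bar>Y x\<bar> <= \<bar>MD * \<bar>\<xi> x\<bar> + e * n x\<bar>" using a by linarith
   qed
  qed
  also have "... <= MD * norm (toL L \<xi>) + e * norm (toL L n)"
   using norm_triangle_ineq[of "MD *\<^sub>R toL L (%x. \<bar>\<xi> x\<bar>)" "e *\<^sub>R toL L n"] damping_consts(2) e
   by (simp add: toL_add toL_scale L2_scale L2_abs norm_toL_abs \<xi>(1) ln)
  finally have 1: "norm (toL L Y) <= MD * norm (toL L \<xi>) + e * norm (toL L n)" .
  have i: "((%x. Y x * \<xi> x - mD * (\<xi> x * \<xi> x) + e * (n x * \<bar>\<xi> x\<bar>)) has_integral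
   (inner (toL L Y) (toL L \<xi>) - mD * inner (toL L \<xi>) (toL L \<xi>) + e * inner (toL L n) (toL L (%x. \<bar>\<xi> x\<bar>)))) {0..L}"
   by (intro has_integral_add has_integral_diff has_integral_mult_right has_integral_inner \<xi> Y ln L2_abs)
  define N where "N = {x \<in> {0..L}. ~ \<bar>Y x - g' (u x) * \<xi> x\<bar> <= e * n x}"
  have pw: "0 <= Y x * \<xi> x - mD * (\<xi> x * \<xi> x) + e * (n x * \<bar>\<xi> x\<bar>)" if "\<bar>Y x - g' (u x) * \<xi> x\<bar> <= e * n x" for x
  proof -
   have "\<bar>(Y x - g' (u x) * \<xi> x) * \<xi> x\<bar> <= e * n x * \<bar>\<xi> x\<bar>" unfolding abs_mult by (rule mult_right_mono[OF that]) simp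
   then have "- (e * n x * \<bar>\<xi> x\<bar>) <= (Y x - g' (u x) * \<xi> x) * \<xi> x" by linarith
   moreover have "mD * (\<xi> x * \<xi> x) <= g' (u x) * (\<xi> x * \<xi> x)" by (rule mult_right_mono[OF g'(3)]) simp
   ultimately show ?thesis by (simp add: algebra_simps)
  qed
  have "0 <= inner (toL L Y) (toL L \<xi>) - mD * inner (toL L \<xi>) (toL L \<xi>) + e * inner (toL L n) (toL L (%x. \<bar>\<xi> x\<bar>))"
  proof (rule has_integral_nonneg)
   show "((%x. if x \<in> N then 0 else Y x * \<xi> x - mD * (\<xi> x * \<xi> x) + e * (n x * \<bar>\<xi> x\<bar>)) has_integral
    (inner (toL L Y) (toL L \<xi>) - mD * inner (toL L \<xi>) (toL L \<xi>) + e * inner (toL L n) (toL L (%x. \<bar>\<xi> x\<bar>)))) {0..L}"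
    by (rule has_integral_spike[OF main[folded N_def] _ i]) auto
   show "0 <= (if x \<in> N then 0 else Y x * \<xi> x - mD * (\<xi> x * \<xi> x) + e * (n x * \<bar>\<xi> x\<bar>))" if "x \<in> {0..L}" for x
    using pw[of x] that by (auto simp: N_def)
  qed
  moreover have "inner (toL L n) (toL L (%x. \<bar>\<xi> x\<bar>)) <= norm (toL L n) * norm (toL L \<xi>)"
   using norm_cauchy_schwarz[of "toL L n" "toL L (%x. \<bar>\<xi> x\<bar>)"] by (simp add: norm_toL_abs \<xi>(1))
  then have "e * inner (toL L n) (toL L (%x. \<bar>\<xi> x\<bar>)) <= e * (norm (toL L n) * norm (toL L \<xi>))" using e by (intro mult_left_mono) auto
  moreover have sn: "e * norm (toL L n) <= e * sn alp \<beta> (toL L u) (toL L v) (toL L w)" using nle e by (intro mult_left_mono) auto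
  then have "e * norm (toL L n) * norm (toL L \<xi>) <= e * sn alp \<beta> (toL L u) (toL L v) (toL L w) * norm (toL L \<xi>)" by (rule mult_right_mono) simp
  ultimately show "mD * (norm (sd alp \<beta> (toL L u) (toL L v) (toL L w)))^2 - e * sn alp \<beta> (toL L u) (toL L v) (toL L w) * norm (sd alp \<beta> (toL L u) (toL L v) (toL L w))
   <= inner (sd alp \<beta> (toL L (%x. g (u x))) (toL L (%x. g (v x))) (toL L (%x. g (w x)))) (sd alp \<beta> (toL L u) (toL L v) (toL L w))"
   unfolding \<xi>(2)[symmetric] Y(2)[symmetric] by (simp add: power2_norm_eq_inner mult.assoc)
  show "norm (sd alp \<beta> (toL L (%x. g (u x))) (toL L (%x. g (v x))) (toL L (%x. g (w x))))
   <= MD * norm (sd alp \<beta> (toL L u) (toL L v) (toL L w)) + e * sn alp \<beta> (toL L u) (toL L v) (toL L w)"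
   using 1 sn unfolding \<xi>(2)[symmetric] Y(2)[symmetric] by linarith
 qed
qed

text \<open>\<open>K\<close> is fixed before \<open>e\<close>: it multiplies a displacement
  difference that tends to zero with the steps, while \<open>e\<close> multiplies quotients that are
  only bounded.\<close>

lemma f_second_difference:
 assumes f: "f \<in> {f1, f2, f3}"
 shows "\<exists>K\<ge>0. \<forall>e>0. \<exists>dlt>0. \<forall>U V Z alp \<beta>. Hsp L U --> Hsp L V --> Hsp L Z --> norm (dd U) <= R --> norm (dd V) <= R --> norm (dd Z) <= R -->
  norm (dd V - dd U) <= dlt --> norm (dd Z - dd U) <= dlt -->
  norm (sd alp \<beta> (toL L (%x. f (uT U x))) (toL L (%x. f (uT V x))) (toL L (%x. f (uT Z x))))
   <= K * norm (sd alp \<beta> (uu U) (uu V) (uu Z)) + e * sn alp \<beta> (uu U) (uu V) (uu Z)"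
proof -
 define R' where "R' = 3 * sqrt L * R"
 obtain Df where Df: "continuous_on UNIV Df" "!!x. (f has_derivative (%h. inner (Df x) h)) (at x)" using f_C1[OF f] by blast
 obtain K where K: "0 <= K" "!!x. norm x <= R' ==> norm (Df x) <= K" using C1_locally_lipschitz[OF Df(2,1), of R'] by blast
 have "\<exists>dlt>0. \<forall>U V Z alp \<beta>. Hsp L U --> Hsp L V --> Hsp L Z --> norm (dd U) <= R --> norm (dd V) <= R --> norm (dd Z) <= R -->
  norm (dd V - dd U) <= dlt --> norm (dd Z - dd U) <= dlt -->
  norm (sd alp \<beta> (toL L (%x. f (uT U x))) (toL L (%x. f (uT V x))) (toL L (%x. f (uT Z x))))
   <= K * norm (sd alp \<beta> (uu U) (uu V) (uu Z)) + e * sn alp \<beta> (uu U) (uu V) (uu Z)" if e: "0 < e" for e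
 proof -
  obtain dlt where dlt: "0 < dlt" "!!u v w alp \<beta>. norm u <= R' ==> norm v <= R' ==> norm w <= R' ==> norm (v - u) <= dlt ==> norm (w - u) <= dlt ==>
   \<bar>sd alp \<beta> (f u) (f v) (f w) - inner (Df u) (sd alp \<beta> u v w)\<bar> <= e * sn alp \<beta> u v w"
   using C1_second_difference[OF Df(2,1) e, of R'] by blast
  define dlt' where "dlt' = dlt / (3 * sqrt L)"
  have dlt': "0 < dlt'" "3 * sqrt L * dlt' = dlt" using dlt(1) pos(1) by (simp_all add: dlt'_def)
  have "norm (sd alp \<beta> (toL L (%x. f (uT U x))) (toL L (%x. f (uT V x))) (toL L (%x. f (uT Z x))))
   <= K * norm (sd alp \<beta> (uu U) (uu V) (uu Z)) + e * sn alp \<beta> (uu U) (uu V) (uu Z)"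
   if U: "Hsp L U" "norm (dd U) <= R" and V: "Hsp L V" "norm (dd V) <= R" and Z: "Hsp L Z" "norm (dd Z) <= R"
    and n: "norm (dd V - dd U) <= dlt'" "norm (dd Z - dd U) <= dlt'" for U V Z alp \<beta>
  proof -
   note lt = HspD(13)[OF U(1)] HspD(13)[OF V(1)] HspD(13)[OF Z(1)]
   define \<xi> where "\<xi> x = sd alp \<beta> (uT U x) (uT V x) (uT Z x)" for x
   define p where "p x = alp *\<^sub>R (uT V x - uT U x)" for x
   define q where "q x = \<beta> *\<^sub>R (uT Z x - uT U x)" for x
   define Y where "Y x = sd alp \<beta> (f (uT U x)) (f (uT V x)) (f (uT Z x))" for x
   have \<xi>: "L2t L \<xi>" "to3 L \<xi> = sd alp \<beta> (uu U) (uu V) (uu Z)" unfolding \<xi>_def[abs_def] uu_def using to3_sd[OF lt] by auto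
   have Y: "L2 L Y" "toL L Y = sd alp \<beta> (toL L (%x. f (uT U x))) (toL L (%x. f (uT V x))) (toL L (%x. f (uT Z x)))"
    unfolding Y_def[abs_def] using toL_sd[OF L2_NF[OF U(1) f] L2_NF[OF V(1) f] L2_NF[OF Z(1) f]] by auto
   have pq: "L2t L p" "L2t L q" "to3 L p = alp *\<^sub>R (uu V - uu U)" "to3 L q = \<beta> *\<^sub>R (uu Z - uu U)"
    unfolding p_def[abs_def] q_def[abs_def] uu_def using lt by (simp_all add: L2t_diff L2t_scale to3_diff to3_scale)
   have small: "negligible {x \<in> {0..L}. ~ norm (uT P x - uT U x) <= dlt}" if P: "Hsp L P" "norm (dd P - dd U) <= dlt'" for P
   proof (rule negl_ball)
    show "negligible {x \<in> {0..L}. ~ norm (uT P x - uT U x) <= 3 * sqrt L * norm (dd P - dd U)}"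
     using K3_sup[OF diff_K3[OF P(1) U(1)], of "%x. uT P x - uT U x"] HspD(13)[OF P(1)] lt(1) by (simp add: L2t_diff to3_diff uu_def)
    have "3 * sqrt L * norm (dd P - dd U) <= 3 * sqrt L * dlt'" using P(2) pos(1) by (intro mult_left_mono) auto
    then show "norm (uT P x - uT U x) <= 3 * sqrt L * norm (dd P - dd U) ==> norm (uT P x - uT U x) <= dlt" for x unfolding dlt'(2) by linarith
   qed
   have "norm (toL L Y) <= norm (toL L (%x. K * norm (\<xi> x) + e * (norm (p x) + norm (q x))))"
   proof (rule norm_toL_mono)
    show "L2 L Y" "L2 L (%x. K * norm (\<xi> x) + e * (norm (p x) + norm (q x)))" by (intro L2_add L2_scale norm_L2t \<xi> Y pq)+
    show "negligible {x \<in> {0..L}. ~ \<bar>Y x\<bar> <= \<bar>K * norm (\<xi> x) + e * (norm (p x) + norm (q x))\<bar>}"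
    proof (rule negligible_subset_Un5[OF uT_sup[OF U, folded R'_def] uT_sup[OF V, folded R'_def] uT_sup[OF Z, folded R'_def] small[OF V(1) n(1)] small[OF Z(1) n(2)]], rule subsetI, rule ccontr)
     fix x assume x: "x \<in> {x \<in> {0..L}. ~ \<bar>Y x\<bar> <= \<bar>K * norm (\<xi> x) + e * (norm (p x) + norm (q x))\<bar>}"
      and "x \<notin> {x \<in> {0..L}. ~ norm (uT U x) <= R'} \<union> ({x \<in> {0..L}. ~ norm (uT V x) <= R'} \<union> ({x \<in> {0..L}. ~ norm (uT Z x) <= R'} \<union>
       ({x \<in> {0..L}. ~ norm (uT V x - uT U x) <= dlt} \<union> {x \<in> {0..L}. ~ norm (uT Z x - uT U x) <= dlt})))"
     then have h: "norm (uT U x) <= R'" "norm (uT V x) <= R'" "norm (uT Z x) <= R'" "norm (uT V x - uT U x) <= dlt" "norm (uT Z x - uT U x) <= dlt" by auto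
     have 1: "\<bar>Y x - inner (Df (uT U x)) (\<xi> x)\<bar> <= e * (norm (p x) + norm (q x))" using dlt(2)[OF h] by (simp add: Y_def \<xi>_def p_def q_def sn_def)
     have "\<bar>inner (Df (uT U x)) (\<xi> x)\<bar> <= norm (Df (uT U x)) * norm (\<xi> x)" by (rule Cauchy_Schwarz_ineq2)
     also have "... <= K * norm (\<xi> x)" using K(2)[OF h(1)] by (intro mult_right_mono) auto
     finally show False using 1 x by auto
    qed
   qed
   also have "... <= K * norm (to3 L \<xi>) + e * (norm (to3 L p) + norm (to3 L q))"
   proof -
    have l: "L2 L (%x. norm (\<xi> x))" "L2 L (%x. norm (p x))" "L2 L (%x. norm (q x))" by (intro norm_L2t \<xi> pq)+
    have "toL L (%x. K * norm (\<xi> x) + e * (norm (p x) + norm (q x))) = K *\<^sub>R toL L (%x. norm (\<xi> x)) + e *\<^sub>R (toL L (%x. norm (p x)) + toL L (%x. norm (q x)))"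
     using l by (simp add: toL_add toL_scale L2_scale L2_add)
    also have "norm ... <= norm (K *\<^sub>R toL L (%x. norm (\<xi> x))) + norm (e *\<^sub>R (toL L (%x. norm (p x)) + toL L (%x. norm (q x))))" by (rule norm_triangle_ineq)
    also have "... <= K * norm (to3 L \<xi>) + e * (norm (to3 L p) + norm (to3 L q))"
     using norm_triangle_ineq[of "toL L (%x. norm (p x))" "toL L (%x. norm (q x))"] K(1) e by (simp add: norm_L2t \<xi> pq)
    finally show ?thesis .
   qed
   finally show ?thesis by (simp add: \<xi> Y pq sn_def)
  qed
  then show ?thesis using dlt'(1) by blast
 qed
 then show ?thesis using K(1) by blast
qed

definition sd_triple :: "real => real => bst => bst => bst => bool" where
 "sd_triple R dlt U V Z \<longleftrightarrow> (\<forall>P\<in>{U, V, Z}. Hsp L P & norm (dd P) <= R & (\<forall>i. supb (sel i (vv P)) R)) \<and>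
  (\<forall>P\<in>{V, Z}. norm (dd P - dd U) <= dlt & (\<forall>i. supb (sel i (vv P) - sel i (vv U)) dlt))"

text \<open>The hypothesis of \<open>energy_dissipation\<close> for second differences, with
  \<open>3 * MD\<close> as growth constant and the bracket as disturbance.\<close>

definition sd_est :: "real => real => real => real => bst => bst => bst => bool" where
 "sd_est Kc e alp \<kappa> U V Z \<longleftrightarrow> mD * (norm (sd alp \<kappa> (vv U) (vv V) (vv Z)))^2 - (Kc * norm (sd alp \<kappa> (uu U) (uu V) (uu Z)) + e * (sn alp \<kappa> (uu U) (uu V) (uu Z) + sn alp \<kappa> (vv U) (vv V) (vv Z)))
   * norm (sd alp \<kappa> (vv U) (vv V) (vv Z)) <= inner (sd alp \<kappa> (GG U) (GG V) (GG Z)) (sd alp \<kappa> (vv U) (vv V) (vv Z)) \<and>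
  norm (sd alp \<kappa> (GG U) (GG V) (GG Z)) <= 3 * MD * norm (sd alp \<kappa> (vv U) (vv V) (vv Z))
   + (Kc * norm (sd alp \<kappa> (uu U) (uu V) (uu Z)) + e * (sn alp \<kappa> (uu U) (uu V) (uu Z) + sn alp \<kappa> (vv U) (vv V) (vv Z)))"

lemma GG_second_difference:
 assumes R: "0 <= R"
 shows "\<exists>Kc\<ge>0. \<forall>e>0. \<exists>dlt>0. \<forall>U V Z alp \<beta>. sd_triple R dlt U V Z --> sd_est Kc e alp \<beta> U V Z"
proof -
 define PF where "PF f K e dlt \<longleftrightarrow> (\<forall>U V Z alp \<beta>. Hsp L U --> Hsp L V --> Hsp L Z --> norm (dd U) <= R --> norm (dd V) <= R --> norm (dd Z) <= R -->
  norm (dd V - dd U) <= dlt --> norm (dd Z - dd U) <= dlt -->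
  norm (sd alp \<beta> (toL L (%x. f (uT U x))) (toL L (%x. f (uT V x))) (toL L (%x. f (uT Z x))))
   <= K * norm (sd alp \<beta> (uu U) (uu V) (uu Z)) + e * sn alp \<beta> (uu U) (uu V) (uu Z))" for f :: "r3 => real" and K e dlt
 have PFD: "norm (sd alp \<beta> (toL L (%x. f (uT U x))) (toL L (%x. f (uT V x))) (toL L (%x. f (uT Z x))))
   <= K * norm (sd alp \<beta> (uu U) (uu V) (uu Z)) + e * sn alp \<beta> (uu U) (uu V) (uu Z)"
  if "PF f K e d" "\<forall>P\<in>{U, V, Z}. Hsp L P & norm (dd P) <= R" "\<forall>P\<in>{V, Z}. norm (dd P - dd U) <= dlt" "dlt <= d" for f K e d dlt U V Z alp \<beta>
  using that(1) by (rule PF_def[THEN iffD1, rule_format]) (use that in auto)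
 obtain K1' where K1: "0 <= K1'" "!!e. 0 < e ==> \<exists>dlt>0. PF f1 K1' e dlt" using f_second_difference[of f1 R] unfolding PF_def by blast
 obtain K2' where K2: "0 <= K2'" "!!e. 0 < e ==> \<exists>dlt>0. PF f2 K2' e dlt" using f_second_difference[of f2 R] unfolding PF_def by blast
 obtain K3' where K3: "0 <= K3'" "!!e. 0 < e ==> \<exists>dlt>0. PF f3 K3' e dlt" using f_second_difference[of f3 R] unfolding PF_def by blast
 define PG where "PG g e dlt \<longleftrightarrow> (\<forall>u v w alp \<beta>. L2 L u --> L2 L v --> L2 L w --> negligible {x \<in> {0..L}. ~ \<bar>u x\<bar> <= R} --> negligible {x \<in> {0..L}. ~ \<bar>v x\<bar> <= R} -->
  negligible {x \<in> {0..L}. ~ \<bar>w x\<bar> <= R} --> negligible {x \<in> {0..L}. ~ \<bar>v x - u x\<bar> <= dlt} --> negligible {x \<in> {0..L}. ~ \<bar>w x - u x\<bar> <= dlt} -->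
  mD * (norm (sd alp \<beta> (toL L u) (toL L v) (toL L w)))^2 - e * sn alp \<beta> (toL L u) (toL L v) (toL L w) * norm (sd alp \<beta> (toL L u) (toL L v) (toL L w))
   <= inner (sd alp \<beta> (toL L (%x. g (u x))) (toL L (%x. g (v x))) (toL L (%x. g (w x)))) (sd alp \<beta> (toL L u) (toL L v) (toL L w)) \<and>
  norm (sd alp \<beta> (toL L (%x. g (u x))) (toL L (%x. g (v x))) (toL L (%x. g (w x))))
   <= MD * norm (sd alp \<beta> (toL L u) (toL L v) (toL L w)) + e * sn alp \<beta> (toL L u) (toL L v) (toL L w))" for g e dlt
 have PGex: "\<exists>dlt>0. PG g e dlt" if "g \<in> {g1, g2, g3}" "0 < e" for g e unfolding PG_def by (rule g_second_difference[OF that])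
 define Kc where "Kc = K1' + K2' + K3'"
 have Kc: "0 <= Kc" using K1 K2 K3 by (simp add: Kc_def)
 show ?thesis
 proof (rule exI[of _ Kc], rule conjI[OF Kc], intro allI impI)
  fix e :: real assume e0: "0 < e"
  \<comment> \<open>The norm of a triple is estimated by the sum over its components, which costs a
    factor 3 in the error and in \<open>MD\<close>.\<close>
  define e' where "e' = e / 3"
  have e: "0 < e'" "e = 3 * e'" using e0 by (simp_all add: e'_def)
  obtain d1 d2 d3 where d: "0 < d1" "0 < d2" "0 < d3" "PF f1 K1' e' d1" "PF f2 K2' e' d2" "PF f3 K3' e' d3" using K1(2)[OF e(1)] K2(2)[OF e(1)] K3(2)[OF e(1)] by blast
  obtain c1 c2 c3 where c: "0 < c1" "0 < c2" "0 < c3" "PG g1 e' c1" "PG g2 e' c2" "PG g3 e' c3" using PGex[of g1 e'] PGex[of g2 e'] PGex[of g3 e'] e(1) by blast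
  define dlt where "dlt = min (min d1 (min d2 d3)) (min c1 (min c2 c3))"
  have dlt: "0 < dlt" "dlt <= d1" "dlt <= d2" "dlt <= d3" "dlt <= c1" "dlt <= c2" "dlt <= c3" using c d by (auto simp: dlt_def)
  show "\<exists>dlt>0. \<forall>U V Z alp \<beta>. sd_triple R dlt U V Z --> sd_est Kc e alp \<beta> U V Z"
  proof (rule exI[of _ dlt], rule conjI[OF dlt(1)], intro allI impI conjI)
   fix U V Z :: bst and alp \<beta> :: real
   assume hn: "sd_triple R dlt U V Z"
   have h: "\<forall>P\<in>{U, V, Z}. Hsp L P & norm (dd P) <= R & (\<forall>i. supb (sel i (vv P)) R)" using hn unfolding sd_triple_def by (rule conjunct1)
   have n: "\<forall>P\<in>{V, Z}. norm (dd P - dd U) <= dlt & (\<forall>i. supb (sel i (vv P) - sel i (vv U)) dlt)" using hn unfolding sd_triple_def by (rule conjunct2)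
   define x where "x = sd alp \<beta> (vv U) (vv V) (vv Z)"
   define s where "s = sn alp \<beta> (vv U) (vv V) (vv Z)"
   define y where "y = sd alp \<beta> (uu U) (uu V) (uu Z)"
   define su where "su = sn alp \<beta> (uu U) (uu V) (uu Z)"
   define YG where "YG = sd alp \<beta> (NG U) (NG V) (NG Z)"
   define YF where "YF = sd alp \<beta> (NF U) (NF V) (NF Z)"
   have HU: "Hsp L U" "Hsp L V" "Hsp L Z" using h by auto
   have fd: "\<forall>P\<in>{U, V, Z}. Hsp L P & norm (dd P) <= R" "\<forall>P\<in>{V, Z}. norm (dd P - dd U) <= dlt" using h n by auto
   have F: "norm YF <= Kc * norm y + 3 * e' * su"
    using norm_components(4)[of YF] PFD[OF d(4) fd dlt(2), of alp \<beta>] PFD[OF d(5) fd dlt(3), of alp \<beta>] PFD[OF d(6) fd dlt(4), of alp \<beta>]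
    by (simp add: YF_def NF_def sd_pair y_def su_def Kc_def algebra_simps)
   have s0: "0 <= s" by (simp add: s_def sn_nonneg)
   have gc: "mD * (norm \<xi>)^2 - e' * s * norm x <= inner Y \<xi> & norm Y <= MD * norm x + e' * s"
    if pg: "PG g e' c'" "dlt <= c'" and l: "L2 L u" "L2 L v" "L2 L w" and su: "supb (toL L u) R" "supb (toL L v) R" "supb (toL L w) R"
     "supb (toL L v - toL L u) dlt" "supb (toL L w - toL L u) dlt" and \<xi>: "\<xi> = sd alp \<beta> (toL L u) (toL L v) (toL L w)"
     and Y: "Y = sd alp \<beta> (toL L (%x. g (u x))) (toL L (%x. g (v x))) (toL L (%x. g (w x)))"
     and le: "norm \<xi> <= norm x" "sn alp \<beta> (toL L u) (toL L v) (toL L w) <= s" for g c' u v w \<xi> Y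
   proof -
    have ng: "negligible {x \<in> {0..L}. ~ \<bar>u x\<bar> <= R}" "negligible {x \<in> {0..L}. ~ \<bar>v x\<bar> <= R}" "negligible {x \<in> {0..L}. ~ \<bar>w x\<bar> <= R}"
     using su(1-3) l by (simp_all add: supb_toL_iff R)
    have nd: "negligible {x \<in> {0..L}. ~ \<bar>q x - u x\<bar> <= c'}" if "L2 L q" "supb (toL L q - toL L u) dlt" for q
    proof (rule negl_ball)
     show "negligible {x \<in> {0..L}. ~ \<bar>q x - u x\<bar> <= dlt}"
      using that l(1) dlt(1) supb_toL_iff[OF L2_diff[OF that(1) l(1)], of dlt] by (simp add: toL_diff)
    qed (use pg(2) in simp)
    have "mD * (norm \<xi>)^2 - e' * sn alp \<beta> (toL L u) (toL L v) (toL L w) * norm \<xi> <= inner Y \<xi> \<and>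
     norm Y <= MD * norm \<xi> + e' * sn alp \<beta> (toL L u) (toL L v) (toL L w)"
     unfolding \<xi> Y using pg(1)[unfolded PG_def, rule_format, OF l ng nd[OF l(2) su(4)] nd[OF l(3) su(5)]] .
    moreover have "e' * sn alp \<beta> (toL L u) (toL L v) (toL L w) * norm \<xi> <= e' * s * norm x"
     using le e s0 by (intro mult_mono) (auto simp: sn_nonneg)
    moreover have "e' * sn alp \<beta> (toL L u) (toL L v) (toL L w) <= e' * s" using le e by (intro mult_left_mono) auto
    moreover have "MD * norm \<xi> <= MD * norm x" using le damping_consts(2) by (intro mult_left_mono) auto
    ultimately show ?thesis by linarith
   qed
   have sb: "supb (sel i (vv U)) R" "supb (sel i (vv V)) R" "supb (sel i (vv Z)) R"
    "supb (sel i (vv V) - sel i (vv U)) dlt" "supb (sel i (vv Z) - sel i (vv U)) dlt" for i using h n by auto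
   note nx = norm_components(1-3)[of x]
   note HD = HspD(4-6)[OF HU(1)] HspD(4-6)[OF HU(2)] HspD(4-6)[OF HU(3)]
   have sle: "sn alp \<beta> (fst (vv U)) (fst (vv V)) (fst (vv Z)) <= s" "sn alp \<beta> (fst (snd (vv U))) (fst (snd (vv V))) (fst (snd (vv Z))) <= s"
    "sn alp \<beta> (snd (snd (vv U))) (snd (snd (vv V))) (snd (snd (vv Z))) <= s"
    unfolding s_def using sn_fst[of alp \<beta> "vv U" "vv V" "vv Z"] sn_snd[of alp \<beta> "vv U" "vv V" "vv Z"]
     sn_fst[of alp \<beta> "snd (vv U)" "snd (vv V)" "snd (vv Z)"] sn_snd[of alp \<beta> "snd (vv U)" "snd (vv V)" "snd (vv Z)"] by linarith+
   have 1: "mD * (norm (fst x))^2 - e' * s * norm x <= inner (fst YG) (fst x) & norm (fst YG) <= MD * norm x + e' * s"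
    by (rule gc[OF c(4) dlt(5) HD(1,4,7)]) (use sb[of 0] nx sle in \<open>simp_all add: x_def YG_def NG_def vv_eq sd_pair sel_def\<close>)
   have 2: "mD * (norm (fst (snd x)))^2 - e' * s * norm x <= inner (fst (snd YG)) (fst (snd x)) & norm (fst (snd YG)) <= MD * norm x + e' * s"
    by (rule gc[OF c(5) dlt(6) HD(2,5,8)]) (use sb[of 1] nx sle in \<open>simp_all add: x_def YG_def NG_def vv_eq sd_pair sel_def\<close>)
   have 3: "mD * (norm (snd (snd x)))^2 - e' * s * norm x <= inner (snd (snd YG)) (snd (snd x)) & norm (snd (snd YG)) <= MD * norm x + e' * s"
    by (rule gc[OF c(6) dlt(7) HD(3,6,9)]) (use sb[of 2] nx sle in \<open>simp_all add: x_def YG_def NG_def vv_eq sd_pair sel_def\<close>)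
   have GGe: "sd alp \<beta> (GG U) (GG V) (GG Z) = YG + YF" by (simp add: YG_def YF_def GG_def sd_def algebra_simps)
   have xx: "(norm x)^2 = (norm (fst x))^2 + (norm (fst (snd x)))^2 + (norm (snd (snd x)))^2"
    by (cases x; cases "snd x") (auto simp: norm_prod_def)
   have "inner YG x = inner (fst YG) (fst x) + inner (fst (snd YG)) (fst (snd x)) + inner (snd (snd YG)) (snd (snd x))"
    by (simp add: inner_prod_def)
   then have i1: "mD * (norm x)^2 - 3 * e' * s * norm x <= inner YG x" using 1 2 3 unfolding xx distrib_left by linarith
   have "\<bar>inner YF x\<bar> <= norm YF * norm x" by (rule Cauchy_Schwarz_ineq2)
   also have "... <= (Kc * norm y + 3 * e' * su) * norm x" by (rule mult_right_mono[OF F]) simp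
   finally have "mD * (norm x)^2 - (Kc * norm y + e * (su + s)) * norm x <= inner (YG + YF) x"
    using i1 by (simp add: inner_add_left e(2) algebra_simps)
   moreover have "norm (YG + YF) <= 3 * MD * norm x + (Kc * norm y + e * (su + s))"
    using norm_triangle_ineq[of YG YF] norm_components(4)[of YG] 1 2 3 F by (simp add: e(2) algebra_simps)
   ultimately show "sd_est Kc e alp \<beta> U V Z" unfolding sd_est_def by (simp only: GGe x_def y_def s_def su_def simp_thms)
  qed
 qed
qed

end

context bresse
begin

section \<open>Full trajectories: Lipschitz continuity and differentiability in time\<close>

lemma sel_norm: "norm (sel i d) <= norm d"
 using norm_components(1-3)[of d] by (simp add: sel_def)

lemma sel_scale_diff: "sel i (c *\<^sub>R (x - y)) = c *\<^sub>R (sel i x - sel i y)" "sel i (x - y) = sel i x - sel i y"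
 by (simp_all add: sel_def)

lemma sel_tendsto: "(f \<longlongrightarrow> d) H ==> ((%x. sel i (f x)) \<longlongrightarrow> sel i d) H"
 unfolding sel_def by (auto intro: tendsto_fst tendsto_snd)

lemma K3_sel: "x \<in> K3 ==> (sel i (fst x), sel i (snd x)) \<in> K1 L"
 by (simp add: K3_def sel_def)

lemma full_traj_bsol:
 assumes f: "full_traj L S A trj"
 shows "bsol s trj" "io (trj t) \<in> io ` A"
proof -
 have A: "trj t \<in> A" for t using f by (simp add: full_traj_def)
 then show "io (trj t) \<in> io ` A" by simp
 have H: "Hsp L (trj t)" for t using attractor A by (auto simp: global_attractor_def)
 show "bsol s trj"
 proof (rule bsol_cong[where trk = "%t. S (t + - s) (trj s)"])
  show b: "bsol s (%t. S (t + - s) (trj s))" using bsol_shift[OF S_bsol(1)[OF H[of s]], of "- s"] by simp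
  show "Hsp L (trj t)" for t by (rule H)
  show "io (trj t) = io (S (t + - s) (trj s))" if "s <= t" for t
  proof -
   have "dH L (S (t - s) (trj s)) (trj (s + (t - s))) = 0" using spec[OF spec[OF conjunct2[OF f[unfolded full_traj_def]], of s], of "t - s"] that by simp
   then show ?thesis using dH_eq[OF S_bsol(3)[OF H[of s], of "t - s"] H[of t]] that by simp
  qed
 qed
qed

text \<open>A bounded trajectory on the whole time axis, expressed as a solution on every half-line
  because \<open>bsol\<close> has an initial time.\<close>

definition ctraj :: "real => (real => bst) => bool" where
 "ctraj R trj \<longleftrightarrow> (\<forall>s. bsol s trj) & (\<forall>t. norm (io (trj t)) <= R)"

lemma ctrajD:
 assumes "ctraj R trj"
 shows "bsol s trj" "norm (io (trj t)) <= R" "Hsp L (trj t)" "norm (dd (trj t)) <= R" "norm (vv (trj t)) <= R"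
proof -
 show b: "bsol s trj" for s using assms by (simp add: ctraj_def)
 show i: "norm (io (trj t)) <= R" using assms by (simp add: ctraj_def)
 show "Hsp L (trj t)" by (rule bsolD(1)[OF b order_refl])
 show "norm (dd (trj t)) <= R" "norm (vv (trj t)) <= R"
  using i norm_fst_le[of "dd (trj t)" "vv (trj t)"] norm_snd_le[of "vv (trj t)" "dd (trj t)"] by (auto simp: io_def)
qed

lemma ctraj_uu:
 assumes c: "ctraj R trj"
 shows "norm (uu (trj (t + h)) - uu (trj t)) <= \<bar>h\<bar> * R"
proof -
 have 1: "norm (uu (trj q) - uu (trj p)) <= (q - p) * R" if "p <= q" for p q
  using sol_lipschitz[OF bsolD(2)[OF ctrajD(1)[OF c, of p]] order_refl that ctrajD(5)[OF c]] by simp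
 show ?thesis using 1[of t "t + h"] 1[of "t + h" t] by (cases "0 <= h") (auto simp: norm_minus_commute)
qed

text \<open>The trajectory is compared with its own translate. Their displacements differ by at most
  \<open>R\<close> times the shift at all times, which is the disturbance; the initial distance is
  forgotten in the backward limit.\<close>

lemma ctraj_lipschitz:
 assumes R: "0 <= R"
 shows "\<exists>C1\<ge>0. \<forall>trj. ctraj R trj --> (\<forall>t h. norm (io (trj (t + h)) - io (trj t)) <= C1 * \<bar>h\<bar>)"
proof -
 obtain C gmz where C: "0 < C" "0 < gmz" and qs: "!!R. \<exists>Kc\<ge>0. \<forall>s t trj trk \<rho>. bsol s trj --> bsol s trk --> s <= t --> 0 <= \<rho> -->
  (\<forall>r\<in>{s..t}. norm (dd (trj r)) <= R & norm (dd (trk r)) <= R & norm (uu (trj r) - uu (trk r)) <= \<rho>) -->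
  (norm (io (trj t) - io (trk t)))^2 <= C * (exp (- gmz * (t - s)) * (norm (io (trj s) - io (trk s)))^2 + (Kc * \<rho>)^2)"
  using bsol_quasi_stable by blast
 obtain Kc where Kc: "0 <= Kc" "!!s t trj trk \<rho>. bsol s trj ==> bsol s trk ==> s <= t ==> 0 <= \<rho> ==>
  (\<forall>r\<in>{s..t}. norm (dd (trj r)) <= R & norm (dd (trk r)) <= R & norm (uu (trj r) - uu (trk r)) <= \<rho>) ==>
  (norm (io (trj t) - io (trk t)))^2 <= C * (exp (- gmz * (t - s)) * (norm (io (trj s) - io (trk s)))^2 + (Kc * \<rho>)^2)"
  using qs[of R] by blast
 define C1 where "C1 = sqrt C * Kc * R"
 have C1: "0 <= C1" using C(1) Kc(1) R by (simp add: C1_def)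
 have "norm (io (trj (t + h)) - io (trj t)) <= C1 * \<bar>h\<bar>" if c: "ctraj R trj" for trj t h
 proof -
  have "(norm (io (trj (t + h)) - io (trj t)))^2 <= C * (Kc * (\<bar>h\<bar> * R))^2"
  proof (rule decay_limit[OF C(2)])
   fix s assume st: "s <= t"
   have b: "bsol s (%t. trj (t + h))" using bsol_shift[OF ctrajD(1)[OF c, of "s + h"], of h] by simp
   have "(norm (io (trj (t + h)) - io (trj t)))^2 <= C * (exp (- gmz * (t - s)) * (norm (io (trj (s + h)) - io (trj s)))^2 + (Kc * (\<bar>h\<bar> * R))^2)"
    by (rule Kc(2)[OF b ctrajD(1)[OF c] st]) (use R ctrajD(4)[OF c] ctraj_uu[OF c] in auto)
   also have "... <= C * (exp (- gmz * (t - s)) * (2 * R)^2 + (Kc * (\<bar>h\<bar> * R))^2)"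
   proof (intro mult_left_mono add_mono power_mono order_refl)
    show "norm (io (trj (s + h)) - io (trj s)) <= 2 * R"
     using norm_triangle_ineq4[of "io (trj (s + h))" "io (trj s)"] ctrajD(2)[OF c, of "s + h"] ctrajD(2)[OF c, of s] by linarith
   qed (use C Kc(1) R in auto)
   finally show "(norm (io (trj (t + h)) - io (trj t)))^2 <= C * (exp (- gmz * (t - s)) * (2 * R)^2 + (Kc * (\<bar>h\<bar> * R))^2)" .
  qed
  also have "... = (C1 * \<bar>h\<bar>)^2" using C(1) by (simp add: C1_def power_mult_distrib)
  finally show ?thesis by (rule power2_le_imp_le) (use C1 in simp)
 qed
 then show ?thesis using C1 by blast
qed

definition ltraj :: "real => real => (real => bst) => bool" where
 "ltraj R C1 trj \<longleftrightarrow> 0 <= R & 0 <= C1 & ctraj R trj & (\<forall>t h. norm (io (trj (t + h)) - io (trj t)) <= C1 * \<bar>h\<bar>)"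

lemma ltrajD:
 assumes "ltraj R C1 trj"
 shows "0 <= R" "0 <= C1" "ctraj R trj" "norm (io (trj (t + h)) - io (trj t)) <= C1 * \<bar>h\<bar>"
  "norm (dd (trj (t + h)) - dd (trj t)) <= C1 * \<bar>h\<bar>" "norm (vv (trj (t + h)) - vv (trj t)) <= C1 * \<bar>h\<bar>"
proof -
 show a: "0 <= R" "0 <= C1" "ctraj R trj" "norm (io (trj (t + h)) - io (trj t)) <= C1 * \<bar>h\<bar>" using assms by (auto simp: ltraj_def)
 show "norm (dd (trj (t + h)) - dd (trj t)) <= C1 * \<bar>h\<bar>" "norm (vv (trj (t + h)) - vv (trj t)) <= C1 * \<bar>h\<bar>"
  using a(4) norm_fst_le[of "dd (trj (t + h)) - dd (trj t)" "vv (trj (t + h)) - vv (trj t)"]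
   norm_snd_le[of "vv (trj (t + h)) - vv (trj t)" "dd (trj (t + h)) - dd (trj t)"] by (auto simp: io_def)
qed

definition quot :: "real => (real => 'a) => real => 'a::real_vector" where
 "quot h f t = (1 / h) *\<^sub>R (f (t + h) - f t)"

lemma norm_quot_le:
 fixes f :: "real => 'a::real_normed_vector"
 assumes "h ~= 0" "norm (f (t + h) - f t) <= C * \<bar>h\<bar>" shows "norm (quot h f t) <= C"
 using assms by (simp add: quot_def pos_divide_le_eq)

lemma quot_bounds:
 assumes c: "ltraj R C1 trj" and h: "h ~= 0"
 shows "norm (quot h (%t. io (trj t)) t) <= C1" "norm (quot h (%t. dd (trj t)) t) <= C1" "norm (quot h (%t. vv (trj t)) t) <= C1"
 by (rule norm_quot_le[OF h]; rule ltrajD[OF c])+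

lemma quot_velocity:
 assumes c: "ltraj R C1 trj" and h: "h ~= 0"
 shows "norm (quot h (%t. uu (trj t)) t - vv (trj t)) <= C1 * \<bar>h\<bar>"
proof -
 note l = ltrajD[OF c]
 have "norm (uu (trj (t + h)) - uu (trj t) - h *\<^sub>R vv (trj t)) <= \<bar>h\<bar> * (C1 * \<bar>h\<bar>)"
 proof (cases "0 <= h")
  case True
  then have m: "t <= t + h" "t \<in> {t..t + h}" by auto
  have v: "norm (vv (trj r) - vv (trj t)) <= C1 * \<bar>h\<bar>" if "r \<in> {t..t + h}" for r
   using order_trans[OF l(6)[of t "r - t"] mult_left_mono[OF _ l(2), of "\<bar>r - t\<bar>" "\<bar>h\<bar>"]] that by simp
  show ?thesis using sol_velocity_bound[OF bsolD(2)[OF ctrajD(1)[OF l(3), of t]] order_refl m v] True by simp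
 next
  case False
  then have m: "t + h <= t" "t \<in> {t + h..t}" by auto
  have v: "norm (vv (trj r) - vv (trj t)) <= C1 * \<bar>h\<bar>" if "r \<in> {t + h..t}" for r
   using order_trans[OF l(6)[of t "r - t"] mult_left_mono[OF _ l(2), of "\<bar>r - t\<bar>" "\<bar>h\<bar>"]] that False by simp
  have e: "uu (trj t) - uu (trj (t + h)) - (t - (t + h)) *\<^sub>R vv (trj t) = - (uu (trj (t + h)) - uu (trj t) - h *\<^sub>R vv (trj t))" by simp
  have "norm (uu (trj (t + h)) - uu (trj t) - h *\<^sub>R vv (trj t)) <= (t - (t + h)) * (C1 * \<bar>h\<bar>)"
   using sol_velocity_bound[OF bsolD(2)[OF ctrajD(1)[OF l(3), of "t + h"]] order_refl m v] unfolding fst_conv e norm_minus_cancel .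
  then show ?thesis using False by simp
 qed
 moreover have "quot h (%t. uu (trj t)) t - vv (trj t) = (1 / h) *\<^sub>R (uu (trj (t + h)) - uu (trj t) - h *\<^sub>R vv (trj t))"
  using h by (simp add: quot_def scaleR_right_diff_distrib)
 ultimately show ?thesis using h by (simp add: pos_divide_le_eq mult_ac)
qed

lemma quot_K3:
 assumes c: "ltraj R C1 trj"
 shows "(quot h (%t. uu (trj t)) t, quot h (%t. dd (trj t)) t) \<in> K3"
 using subspace_scale[OF K diff_K3[OF ctrajD(3)[OF ltrajD(3)[OF c], of "t + h"] ctrajD(3)[OF ltrajD(3)[OF c], of t]], of "1 / h"]
 by (simp add: quot_def)

lemma quot_tendsto:
 assumes c: "ltraj R C1 trj" and dlt: "dlt \<longlonglongrightarrow> 0" "!!n. dlt n ~= 0"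
 shows "(%n. quot (dlt n) (%t. uu (trj t)) t) \<longlonglongrightarrow> vv (trj t)"
proof (rule LIM_zero_cancel, rule Lim_null_comparison)
 show "\<forall>\<^sub>F n in sequentially. norm (quot (dlt n) (%t. uu (trj t)) t - vv (trj t)) <= C1 * \<bar>dlt n\<bar>"
  using quot_velocity[OF c dlt(2)] by simp
 show "(%n. C1 * \<bar>dlt n\<bar>) \<longlonglongrightarrow> 0" using tendsto_mult[OF tendsto_const[of C1] tendsto_rabs[OF dlt(1)]] by simp
qed

text \<open>The velocity is an \<open>L\<^sup>2\<close> limit of difference quotients that are bounded in \<open>H\<^sup>1\<close>; interpolation
 \<open>\<parallel>e\<parallel>\<^sub>\<infinity>\<^sup>2 \<le> 2 \<parallel>e\<parallel> \<parallel>e'\<parallel>\<close> turns this into uniform bounds.\<close>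

lemma velocity_sup:
 assumes c: "ltraj R C1 trj"
 shows "supb (sel i (vv (trj t))) (sqrt L * C1)" "supb (sel i (vv (trj (t + h)) - vv (trj t))) (sqrt (12 * C1^2 * \<bar>h\<bar>))"
proof -
 note l = ltrajD[OF c]
 have qd: "norm (sel i (quot dlt (%t. dd (trj t)) r)) <= C1" if "dlt ~= 0" for dlt r
  using order_trans[OF sel_norm quot_bounds(2)[OF c that]] .
 have inv0: "(%n. c / real (Suc n)) \<longlonglongrightarrow> 0" for c :: real using LIMSEQ_Suc[OF lim_const_over_n[of c]] by simp
 show "supb (sel i (vv (trj t))) (sqrt L * C1)"
 proof (rule supb_limit)
  show "0 <= sqrt L * C1" using l(2) pos(1) by simp
  show "supb (sel i (quot (1 / real (Suc n)) (%t. uu (trj t)) t)) (sqrt L * C1)" for n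
  proof -
   have "sqrt L * norm (sel i (quot (1 / real (Suc n)) (%t. dd (trj t)) t)) <= sqrt L * C1"
    using qd[of "1 / real (Suc n)" t] pos(1) by (intro mult_left_mono) auto
   then show ?thesis using supb_mono[OF K1_supb(2)[OF K3_sel[OF quot_K3[OF c], unfolded fst_conv snd_conv]]] pos(1) by simp
  qed
  show "(%n. sel i (quot (1 / real (Suc n)) (%t. uu (trj t)) t)) \<longlonglongrightarrow> sel i (vv (trj t))"
   by (intro sel_tendsto quot_tendsto[OF c] inv0) simp
 qed
 show "supb (sel i (vv (trj (t + h)) - vv (trj t))) (sqrt (12 * C1^2 * \<bar>h\<bar>))"
 proof (cases "h = 0")
  case True
  have "supb (toL L (%x. 0)) 0" by (subst supb_toL_iff) (simp_all add: L2_const)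
  then show ?thesis using True by (simp add: sel_def toL_zero)
 next
  case False
  define dlt where "dlt n = \<bar>h\<bar> / real (Suc n)" for n
  have dlt: "dlt n ~= 0" "\<bar>dlt n\<bar> <= \<bar>h\<bar>" for n using False by (auto simp: dlt_def field_simps)
  define y where "y n = quot (dlt n) (%t. uu (trj t)) (t + h) - quot (dlt n) (%t. uu (trj t)) t" for n
  define z where "z n = quot (dlt n) (%t. dd (trj t)) (t + h) - quot (dlt n) (%t. dd (trj t)) t" for n
  have yz: "(sel i (y n), sel i (z n)) \<in> K1 L" for n
   using K3_sel[OF subspace_diff[OF K quot_K3[OF c, of "dlt n" "t + h"] quot_K3[OF c, of "dlt n" t]]] by (simp add: y_def z_def)
  \<comment> \<open>The velocity moves by at most \<open>C1\<close> times
    \<open>\<bar>h\<bar>\<close>, and each of the two quotients misses the velocity by no more than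
    that, since the step \<open>dlt n\<close> is at most \<open>\<bar>h\<bar>\<close>.\<close>
  have ny: "norm (y n) <= 3 * C1 * \<bar>h\<bar>" for n
  proof -
   have "y n = (quot (dlt n) (%t. uu (trj t)) (t + h) - vv (trj (t + h))) - (quot (dlt n) (%t. uu (trj t)) t - vv (trj t)) + (vv (trj (t + h)) - vv (trj t))"
    by (simp add: y_def)
   also have "norm ... <= C1 * \<bar>dlt n\<bar> + C1 * \<bar>dlt n\<bar> + C1 * \<bar>h\<bar>"
    by (intro norm_triangle_le add_mono norm_triangle_le_diff quot_velocity[OF c dlt(1)] l(6))
   also have "... <= 3 * C1 * \<bar>h\<bar>" using mult_left_mono[OF dlt(2) l(2), of n] by simp
   finally show ?thesis .
  qed
  have nz: "norm (sel i (z n)) <= 2 * C1" for n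
   using norm_triangle_ineq4[of "sel i (quot (dlt n) (%t. dd (trj t)) (t + h))" "sel i (quot (dlt n) (%t. dd (trj t)) t)"]
    qd[OF dlt(1), of n "t + h"] qd[OF dlt(1), of n t] by (simp add: z_def sel_scale_diff)
  show ?thesis
  proof (rule supb_limit)
   show "supb (sel i (y n)) (sqrt (12 * C1^2 * \<bar>h\<bar>))" for n
   proof (rule supb_mono[OF K1_supb(1)[OF yz]])
    \<comment> \<open>The 12 is the 2 of the interpolation inequality times the constants 3 and 2 of
      \<open>ny\<close> and \<open>nz\<close>.\<close>
    have "norm (sel i (y n)) * norm (sel i (z n)) <= (3 * C1 * \<bar>h\<bar>) * (2 * C1)"
     using order_trans[OF sel_norm ny] nz l(2) by (intro mult_mono) auto
    then show "sqrt (2 * norm (sel i (y n)) * norm (sel i (z n))) <= sqrt (12 * C1^2 * \<bar>h\<bar>)"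
     by (simp add: power2_eq_square mult_ac)
   qed
   have "dlt \<longlonglongrightarrow> 0" unfolding dlt_def by (rule inv0)
   then show "(%n. sel i (y n)) \<longlonglongrightarrow> sel i (vv (trj (t + h)) - vv (trj t))"
    unfolding y_def by (intro sel_tendsto tendsto_diff quot_tendsto[OF c] dlt)
  qed simp
 qed
qed

text \<open>The difference of the two quotients solves a damped equation whose disturbance can be
  made arbitrarily small, and it is bounded for all past times; dissipation and the backward limit
  leave only the disturbance. The threshold \<open>dlt\<close> does not depend on
  \<open>t\<close>.\<close>

lemma quot_cauchy:
 assumes c: "ltraj R C1 trj" and epsz: "0 < epsz"
 shows "\<exists>dlt>0. \<forall>h k t. h ~= 0 --> k ~= 0 --> \<bar>h\<bar> < dlt --> \<bar>k\<bar> < dlt --> norm (quot h (%t. io (trj t)) t - quot k (%t. io (trj t)) t) <= epsz"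
proof -
 note l = ltrajD[OF c]
 define R' where "R' = max R (sqrt L * C1)"
 have R': "0 <= R'" "R <= R'" "sqrt L * C1 <= R'" using l(1) by (auto simp: R'_def)
 obtain Kc where Kc: "0 <= Kc" "!!e. 0 < e ==> \<exists>dlt>0. \<forall>U V Z alp \<beta>. sd_triple R' dlt U V Z --> sd_est Kc e alp \<beta> U V Z"
  using GG_second_difference[OF R'(1)] by blast
 have "0 <= 3 * MD" using damping_consts(2) by simp
 from energy_dissipation[OF damping_consts(1) this] obtain C gmz where C: "0 < C" "0 < gmz" and dis: "!!s t W v G \<rho>. sol s W v G ==> s <= t ==> 0 <= \<rho> ==>
  (\<forall>r\<in>{s..t}. mD * (norm (v r))^2 - \<rho> * norm (v r) <= inner (G r) (v r) & norm (G r) <= 3 * MD * norm (v r) + \<rho>) ==>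
  energy (W t) (v t) <= C * (exp (- gmz * (t - s)) * energy (W s) (v s) + \<rho>^2)" by blast
 define Q where "Q = sqrt (cE * C)"
 have Q: "0 <= Q" using cE(1) C(1) by (simp add: Q_def)
 \<comment> \<open>\<open>Q\<close> converts disturbance into distance in the energy space. The
   linearisation errors, bounded through \<open>2 * L * C1 + 2 * C1\<close>, receive half of the
   admissible disturbance \<open>epsz / (Q + 1)\<close>.\<close>
 define e where "e = epsz / (2 * (Q + 1) * (2 * L * C1 + 2 * C1 + 1))"
 have ep: "0 < 2 * L * C1 + 2 * C1 + 1" using l(2) pos(1) by (simp add: add_nonneg_pos)
 have e: "0 < e" using epsz Q ep by (simp add: e_def)
 have ee: "e * (2 * L * C1 + 2 * C1) <= epsz / (2 * (Q + 1))"
 proof -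
  have "e * (2 * L * C1 + 2 * C1) <= e * (2 * L * C1 + 2 * C1 + 1)" using e by simp
  also have "... = epsz / (2 * (Q + 1))" using ep by (simp add: e_def)
  finally show ?thesis .
 qed
 obtain dlt1 where dlt1: "0 < dlt1" "!!U V Z alp \<beta>. sd_triple R' dlt1 U V Z ==> sd_est Kc e alp \<beta> U V Z"
  using Kc(2)[OF e] by blast
 \<comment> \<open>Three demands on the steps: the velocity moves at most \<open>dlt1\<close> in the
   sup norm, the derivative of the displacement at most \<open>dlt1\<close> in norm, and the
   Lipschitz part of the source uses at most the other half of the disturbance.\<close>
 define dlt where "dlt = min (dlt1^2 / (12 * C1^2 + 1)) (min (dlt1 / (C1 + 1)) (epsz / (2 * (Q + 1) * (2 * Kc * C1 + 1))))"
 have d0: "0 < 12 * C1^2 + 1" "0 < C1 + 1" "0 < 2 * Kc * C1 + 1" using l(2) Kc(1) by (simp_all add: add_nonneg_pos)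
 have dlt: "0 < dlt" using dlt1(1) epsz Q d0 by (simp add: dlt_def)
 have dl: "(12 * C1^2 + 1) * dlt <= dlt1^2" "(C1 + 1) * dlt <= dlt1" "(2 * Kc * C1 + 1) * dlt <= epsz / (2 * (Q + 1))"
 proof -
  have "dlt <= dlt1^2 / (12 * C1^2 + 1)" "dlt <= dlt1 / (C1 + 1)" "dlt <= epsz / (2 * (Q + 1)) / (2 * Kc * C1 + 1)" by (simp_all add: dlt_def)
  then show "(12 * C1^2 + 1) * dlt <= dlt1^2" "(C1 + 1) * dlt <= dlt1" "(2 * Kc * C1 + 1) * dlt <= epsz / (2 * (Q + 1))"
   using d0 by (simp_all only: pos_le_divide_eq mult.commute)
 qed
 have "norm (quot h (%t. io (trj t)) t - quot k (%t. io (trj t)) t) <= epsz" if h: "h ~= 0" "\<bar>h\<bar> < dlt" and k: "k ~= 0" "\<bar>k\<bar> < dlt" for h k t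
 proof -
  define u v d G where "u r = sd (1/h) (1/k) (uu (trj r)) (uu (trj (r + h))) (uu (trj (r + k)))"
   and "v r = sd (1/h) (1/k) (vv (trj r)) (vv (trj (r + h))) (vv (trj (r + k)))"
   and "d r = sd (1/h) (1/k) (dd (trj r)) (dd (trj (r + h))) (dd (trj (r + k)))"
   and "G r = sd (1/h) (1/k) (GG (trj r)) (GG (trj (r + h))) (GG (trj (r + k)))" for r
  have b: "bsol s (%t. trj (t + h))" for s h using bsol_shift[OF ctrajD(1)[OF l(3), of "s + h"], of h] by simp
  have sol: "sol s (%r. (u r, d r)) v G" for s
   using sol_diff[OF sol_scale[OF bsol_diff[OF b[of s h] ctrajD(1)[OF l(3)]], of "1/h"] sol_scale[OF bsol_diff[OF b[of s k] ctrajD(1)[OF l(3)]], of "1/k"]]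
   by (simp add: u_def[abs_def] v_def[abs_def] d_def[abs_def] G_def[abs_def] sd_def)
  have io: "(d r, v r) = quot h (%t. io (trj t)) r - quot k (%t. io (trj t)) r" for r
   by (simp add: d_def v_def sd_def quot_def io_def)
  have K3: "(u r, d r) \<in> K3" for r using solD(1)[OF sol order_refl] .
  have nio: "norm (d r, v r) <= 2 * C1" for r
   unfolding io using norm_triangle_ineq4[of "quot h (%t. io (trj t)) r" "quot k (%t. io (trj t)) r"]
    quot_bounds(1)[OF c h(1), of r] quot_bounds(1)[OF c k(1), of r] by linarith
  have u2: "norm (u r) <= 2 * C1 * dlt" for r
  proof -
   have "u r = (quot h (%t. uu (trj t)) r - vv (trj r)) - (quot k (%t. uu (trj t)) r - vv (trj r))" by (simp add: u_def sd_def quot_def)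
   also have "norm ... <= C1 * \<bar>h\<bar> + C1 * \<bar>k\<bar>" by (intro norm_triangle_le_diff add_mono quot_velocity[OF c] h k)
   also have "... <= 2 * C1 * dlt" using mult_left_mono[of "\<bar>h\<bar>" dlt C1] mult_left_mono[of "\<bar>k\<bar>" dlt C1] h k l(2) by simp
   finally show ?thesis .
  qed
  have snv: "sn (1/h) (1/k) (vv (trj r)) (vv (trj (r + h))) (vv (trj (r + k))) <= 2 * C1" for r
   using quot_bounds(3)[OF c h(1), of r] quot_bounds(3)[OF c k(1), of r] by (simp add: sn_def quot_def)
  have snu: "sn (1/h) (1/k) (uu (trj r)) (uu (trj (r + h))) (uu (trj (r + k))) <= 2 * L * C1" for r
  proof -
   have "norm (quot j (%t. uu (trj t)) r) <= L * C1" if "j ~= 0" for j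
    by (rule order_trans[OF K3_poincare[OF quot_K3[OF c], unfolded fst_conv snd_conv] mult_left_mono[OF quot_bounds(2)[OF c that]]]) (use pos(1) in simp)
   from this[OF h(1)] this[OF k(1)] show ?thesis by (simp add: sn_def quot_def)
  qed
  define \<rho> where "\<rho> = epsz / (Q + 1)"
  have \<rho>: "0 <= \<rho>" using epsz Q by (simp add: \<rho>_def)
  have rle: "Kc * norm (u r) + e * (sn (1/h) (1/k) (uu (trj r)) (uu (trj (r + h))) (uu (trj (r + k)))
   + sn (1/h) (1/k) (vv (trj r)) (vv (trj (r + h))) (vv (trj (r + k)))) <= \<rho>" for r
  proof -
   have "Kc * norm (u r) <= Kc * (2 * C1 * dlt)" using u2 Kc(1) by (intro mult_left_mono) auto
   also have "... <= (2 * Kc * C1 + 1) * dlt" using dlt by (simp add: algebra_simps)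
   finally have "Kc * norm (u r) <= epsz / (2 * (Q + 1))" using dl(3) by linarith
   moreover have "e * (sn (1/h) (1/k) (uu (trj r)) (uu (trj (r + h))) (uu (trj (r + k)))
   + sn (1/h) (1/k) (vv (trj r)) (vv (trj (r + h))) (vv (trj (r + k)))) <= e * (2 * L * C1 + 2 * C1)"
    using add_mono[OF snu snv] e by (intro mult_left_mono) auto
   moreover have "epsz / (2 * (Q + 1)) = \<rho> / 2" unfolding \<rho>_def divide_divide_eq_left by (simp only: mult.commute)
   ultimately show ?thesis using ee by linarith
  qed
  have cond: "mD * (norm (v r))^2 - \<rho> * norm (v r) <= inner (G r) (v r) & norm (G r) <= 3 * MD * norm (v r) + \<rho>" for r
  proof -
   have s: "supb (sel i (vv (trj q))) R'" for i q by (rule supb_mono[OF velocity_sup(1)[OF c] R'(3)])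
   have near: "norm (dd (trj (r + j)) - dd (trj r)) <= dlt1 & (\<forall>i. supb (sel i (vv (trj (r + j))) - sel i (vv (trj r))) dlt1)" if j: "\<bar>j\<bar> < dlt" for j
   proof (intro conjI allI)
    have "C1 * \<bar>j\<bar> <= (C1 + 1) * dlt" using j l(2) by (intro mult_mono) auto
    then show "norm (dd (trj (r + j)) - dd (trj r)) <= dlt1" using l(5)[of r j] dl(2) by linarith
    have "12 * C1^2 * \<bar>j\<bar> <= (12 * C1^2 + 1) * dlt" using j by (intro mult_mono) auto
    then have "sqrt (12 * C1^2 * \<bar>j\<bar>) <= dlt1" using dl(1) dlt1(1) by (intro real_le_lsqrt) auto
    then show "supb (sel i (vv (trj (r + j))) - sel i (vv (trj r))) dlt1" for i
     using supb_mono[OF velocity_sup(2)[OF c, of i r j]] by (simp add: sel_scale_diff)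
   qed
   have 1: "\<forall>P\<in>{trj r, trj (r + h), trj (r + k)}. Hsp L P & norm (dd P) <= R' & (\<forall>i. supb (sel i (vv P)) R')"
    using ctrajD(3)[OF l(3)] order_trans[OF ctrajD(4)[OF l(3)] R'(2)] s by auto
   have 2: "\<forall>P\<in>{trj (r + h), trj (r + k)}. norm (dd P - dd (trj r)) <= dlt1 & (\<forall>i. supb (sel i (vv P) - sel i (vv (trj r))) dlt1)"
    using near[OF h(2)] near[OF k(2)] by blast
   note E = dlt1(2)[unfolded sd_triple_def sd_est_def, OF conjI[OF 1 2], of "1/h" "1/k", folded u_def v_def G_def]
   show ?thesis using E mult_right_mono[OF rle[of r] norm_ge_zero[of "v r"]] rle[of r] by linarith
  qed
  have "energy (u t, d t) (v t) <= C * \<rho>^2"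
  proof (rule decay_limit[OF C(2)])
   fix s assume st: "s <= t"
   have "energy (u s, d s) (v s) <= cE * (norm (d s, v s))^2" using cE(2)[OF K3[of s]] by simp
   also have "... <= cE * (2 * C1)^2" using nio cE(1) by (intro mult_left_mono power_mono) auto
   finally have es: "energy (u s, d s) (v s) <= cE * (2 * C1)^2" .
   have "energy (u t, d t) (v t) <= C * (exp (- gmz * (t - s)) * energy (u s, d s) (v s) + \<rho>^2)"
    using dis[OF sol st \<rho>] cond by blast
   also have "... <= C * (exp (- gmz * (t - s)) * (cE * (2 * C1)^2) + \<rho>^2)"
    using es C(1) by (intro mult_left_mono add_mono order_refl) auto
   finally show "energy (u t, d t) (v t) <= C * (exp (- gmz * (t - s)) * (cE * (2 * C1)^2) + \<rho>^2)" .
  qed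
  then have "cE * energy (u t, d t) (v t) <= cE * (C * \<rho>^2)" using cE(1) by (intro mult_left_mono) auto
  also have "... = (Q * \<rho>)^2" using cE(1) C(1) by (simp add: Q_def power_mult_distrib)
  finally have "(norm (d t, v t))^2 <= (Q * \<rho>)^2" using cE(3)[OF K3[of t], of "v t"] unfolding snd_conv by linarith
  then have "norm (d t, v t) <= Q * \<rho>" by (rule power2_le_imp_le) (use Q \<rho> in simp)
  also have "... <= epsz" using Q epsz by (simp add: \<rho>_def pos_divide_le_eq algebra_simps)
  finally show ?thesis by (simp add: io)
 qed
 then show ?thesis using dlt by blast
qed

lemma trajectory_differentiable:
 assumes c: "ltraj R C1 trj"
 shows "\<exists>zet. ((%t. io (trj t)) has_vector_derivative zet) (at t) & norm zet <= C1"
proof -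
 note l = ltrajD[OF c]
 define hn where "hn n = 1 / real (Suc n)" for n
 have hn: "hn n ~= 0" for n by (simp add: hn_def)
 have hn0: "hn \<longlonglongrightarrow> 0" unfolding hn_def using LIMSEQ_Suc[OF lim_const_over_n[of "1::real"]] by simp
 define q where "q h = quot h (%t. io (trj t)) t" for h
 have ev: "\<exists>N. \<forall>n\<ge>N. \<bar>hn n\<bar> < dlt" if "0 < dlt" for dlt
  using order_tendstoD(2)[OF tendsto_rabs[OF hn0], of dlt] that by (simp add: eventually_sequentially)
 have "Cauchy (%n. q (hn n))"
  unfolding Cauchy_def
 proof (intro allI impI)
  fix epsz :: real assume epsz: "0 < epsz"
  obtain dlt where dlt: "0 < dlt" "!!h k. h ~= 0 ==> k ~= 0 ==> \<bar>h\<bar> < dlt ==> \<bar>k\<bar> < dlt ==> norm (q h - q k) <= epsz / 2"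
   using quot_cauchy[OF c, of "epsz / 2"] epsz unfolding q_def by auto
  obtain N where N: "\<forall>n\<ge>N. \<bar>hn n\<bar> < dlt" using ev[OF dlt(1)] by blast
  have "dist (q (hn m)) (q (hn n)) < epsz" if "m \<ge> N" "n \<ge> N" for m n
   using dlt(2)[OF hn[of m] hn[of n]] N that epsz unfolding dist_norm by (smt (verit) field_sum_of_halves)
  then show "\<exists>N. \<forall>m\<ge>N. \<forall>n\<ge>N. dist (q (hn m)) (q (hn n)) < epsz" by blast
 qed
 then obtain zet where zet: "(%n. q (hn n)) \<longlonglongrightarrow> zet" unfolding Cauchy_convergent_iff convergent_def by blast
 have "norm zet <= C1"
  by (rule LIMSEQ_le_const2[OF tendsto_norm[OF zet]]) (use quot_bounds(1)[OF c hn] in \<open>auto simp: q_def\<close>)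
 moreover have "((%t. io (trj t)) has_vector_derivative zet) (at t)"
  unfolding has_vector_derivative_iff_quotient
 proof (rule tendstoI)
  fix epsz :: real assume epsz: "0 < epsz"
  obtain dlt where dlt: "0 < dlt" "!!h k. h ~= 0 ==> k ~= 0 ==> \<bar>h\<bar> < dlt ==> \<bar>k\<bar> < dlt ==> norm (q h - q k) <= epsz / 2"
   using quot_cauchy[OF c, of "epsz / 2"] epsz unfolding q_def by auto
  obtain N where N: "\<forall>n\<ge>N. \<bar>hn n\<bar> < dlt" using ev[OF dlt(1)] by blast
  show "\<forall>\<^sub>F y in at t. dist ((io (trj y) - io (trj t)) /\<^sub>R (y - t)) zet < epsz"
   unfolding eventually_at
  proof (intro exI[of _ dlt] conjI[OF dlt(1)] ballI impI)
   fix y assume y: "y \<in> UNIV" "y ~= t & dist y t < dlt"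
   have "norm (q (y - t) - zet) <= epsz / 2"
   proof (rule LIMSEQ_le_const2[OF tendsto_norm[OF tendsto_diff[OF tendsto_const zet]]], intro exI[of _ N] allI impI)
    fix n assume "N <= n"
    then show "norm (q (y - t) - q (hn n)) <= epsz / 2" using y N hn by (intro dlt(2)) (auto simp: dist_real_def)
   qed
   moreover have "(io (trj y) - io (trj t)) /\<^sub>R (y - t) = q (y - t)" by (simp add: q_def quot_def divide_inverse)
   ultimately show "dist ((io (trj y) - io (trj t)) /\<^sub>R (y - t)) zet < epsz" using epsz by (simp add: dist_norm)
  qed
 qed
 ultimately show ?thesis by blast
qed

end

context bresse
begin

section \<open>Spatial regularity on the attractor\<close>

lemma K3_TL_H10:
 assumes f: "L2 L f" and k: "(toL L f, d) \<in> K1 L"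
 shows "H10 L f" "l2norm L (dx L f) = norm d"
 using K1_H10[OF pos(1) f k] H10_K1(2)[OF pos(1) K1_H10(1)[OF pos(1) f k]] by (simp_all add: l2norm_eq_norm)

text \<open>Difference quotients of the displacement lie in the closed graph \<open>K1\<close>
  together with those of its derivative. Their limits are the velocity and the first half of
  \<open>zet\<close>, so the velocity is in the Dirichlet space with derivative
  \<open>fst zet\<close>.\<close>

lemma velocity_regularity:
 assumes c: "ltraj R C1 trj" and d: "((%t. io (trj t)) has_vector_derivative zet) (at t)"
 shows "(sel i (vv (trj t)), sel i (fst zet)) \<in> K1 L" "sel i (snd zet) \<in> TL L"
proof -
 note H = ctrajD(3)[OF ltrajD(3)[OF c]]
 define hn where "hn n = 1 / real (Suc n)" for n
 have hn: "hn n ~= 0" for n by (simp add: hn_def)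
 have hn0: "hn \<longlonglongrightarrow> 0" unfolding hn_def using LIMSEQ_Suc[OF lim_const_over_n[of "1::real"]] by simp
 have "((%y. (io (trj y) - io (trj t)) /\<^sub>R (y - t)) \<longlongrightarrow> zet) (at t)" using d by (simp add: has_vector_derivative_iff_quotient)
 moreover have "filterlim (%n. t + hn n) (at t) sequentially"
  unfolding filterlim_at using tendsto_add[OF tendsto_const[of t] hn0] hn by (auto intro: always_eventually)
 ultimately have q: "(%n. quot (hn n) (%t. io (trj t)) t) \<longlonglongrightarrow> zet"
  by (auto dest: filterlim_compose simp: quot_def divide_inverse)
 have q1: "(%n. quot (hn n) (%t. dd (trj t)) t) \<longlonglongrightarrow> fst zet" and q2: "(%n. quot (hn n) (%t. vv (trj t)) t) \<longlonglongrightarrow> snd zet"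
  using tendsto_fst[OF q] tendsto_snd[OF q] by (simp_all add: quot_def io_def)
 show "(sel i (vv (trj t)), sel i (fst zet)) \<in> K1 L"
 proof (rule closed_sequentially[OF K1_closed[OF pos(1)]])
  show "(sel i (quot (hn n) (%t. uu (trj t)) t), sel i (quot (hn n) (%t. dd (trj t)) t)) \<in> K1 L" for n
   using K3_sel[OF quot_K3[OF c]] by simp
  show "(%n. (sel i (quot (hn n) (%t. uu (trj t)) t), sel i (quot (hn n) (%t. dd (trj t)) t))) \<longlonglongrightarrow> (sel i (vv (trj t)), sel i (fst zet))"
   by (intro tendsto_Pair sel_tendsto quot_tendsto[OF c hn0 hn] q1)
 qed
 show "sel i (snd zet) \<in> TL L"
 proof (rule TL_limit[OF _ sel_tendsto[OF q2]])
  have "sel i (vv (trj r)) \<in> TL L" for r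
   unfolding vv_eq sel_def using HspD(4-6)[OF H[of r]] by (auto intro: TL_I)
  then show "sel i (quot (hn n) (%t. vv (trj t)) t) \<in> TL L" for n
   unfolding quot_def sel_scale_diff by (intro TL_scale TL_diff)
 qed
qed

lemma weak_equation:
 assumes c: "ltraj R C1 trj" and d: "((%t. io (trj t)) has_vector_derivative zet) (at t)" and x: "x \<in> K3"
 shows "aform (uu (trj t), dd (trj t)) x = - inner (mass (snd zet) + GG (trj t)) (fst x)"
proof -
 have "((%t. snd (io (trj t))) has_vector_derivative snd zet) (at t)"
  by (rule bounded_linear.has_vector_derivative[OF bounded_linear_snd d])
 then have v: "((%t. vv (trj t)) has_vector_derivative snd zet) (at t)" by (simp add: io_def)
 have "bounded_linear (%v. inner (mass v) (fst x))" by (rule bounded_linear_compose[OF bounded_linear_inner_left M])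
 from bounded_linear.has_vector_derivative[OF this v]
 have 1: "((%t. inner (mass (vv (trj t))) (fst x)) has_real_derivative inner (mass (snd zet)) (fst x)) (at t)"
  by (simp add: has_real_derivative_iff_has_vector_derivative)
 have "((%t. inner (mass (vv (trj t))) (fst x)) has_real_derivative (- aform (uu (trj t), dd (trj t)) x - inner (GG (trj t)) (fst x))) (at t)"
  using solD(3)[OF bsolD(2)[OF ctrajD(1)[OF ltrajD(3)[OF c], of "t - 1"]] _ x, of t] by (simp add: at_within_interior[of t "{t - 1..}"])
 from DERIV_unique[OF 1 this] show ?thesis by (simp add: inner_add_left)
qed

text \<open>In each component the equation expresses the second derivative through quantities
  already in \<open>L2\<close>; lower order terms inside \<open>shear\<close> and
  \<open>axial\<close> are moved by parts.\<close>

lemma elliptic_regularity: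
 assumes H: "Hsp L U" and h: "!!i. sel i h \<in> TL L"
  and eq: "!!x. x \<in> K3 ==> aform (uu U, dd U) x = - inner h (fst x)"
 shows "H2 L (phi U)" "H2 L (psi U)" "H2 L (ww U)"
  "h2norm L (phi U) <= norm (uu U) + norm (dd U) + norm ((1 / k) *\<^sub>R (sel 0 h - (k0 * l) *\<^sub>R axial (uu U, dd U)) - sel 1 (dd U) - l *\<^sub>R sel 2 (dd U))"
  "h2norm L (psi U) <= norm (uu U) + norm (dd U) + norm ((1 / b) *\<^sub>R (sel 1 h + k *\<^sub>R shear (uu U, dd U)))"
  "h2norm L (ww U) <= norm (uu U) + norm (dd U) + norm ((1 / k0) *\<^sub>R (sel 2 h + (k * l) *\<^sub>R shear (uu U, dd U)) + l *\<^sub>R sel 0 (dd U))"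
proof -
 note u = HspD[OF H]
 have z: "(0, 0) \<in> K1 L" by (rule K1_zero[OF pos(1)])
 note kk = H10_K1(4)[OF pos(1) u(1)] H10_K1(4)[OF pos(1) u(2)] H10_K1(4)[OF pos(1) u(3)]
 note tl = TL_I[OF u(7)] TL_I[OF u(8)] TL_I[OF u(9)] TL_I[OF u(10)] TL_I[OF u(11)] TL_I[OF u(12)]
 have se: "shear (uu U, dd U) = toL L (dx L (phi U)) + toL L (psi U) + l *\<^sub>R toL L (ww U)"
  "axial (uu U, dd U) = toL L (dx L (ww U)) - l *\<^sub>R toL L (phi U)" by (simp_all add: shear_def axial_def uu_eq dd_def)
 define sh where "sh = shear (uu U, dd U)"
 define ax where "ax = axial (uu U, dd U)"
 have she: "sh = toL L (dx L (phi U)) + toL L (psi U) + l *\<^sub>R toL L (ww U)" and axe: "ax = toL L (dx L (ww U)) - l *\<^sub>R toL L (phi U)"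
  unfolding sh_def ax_def by (rule se)+
 have dds: "sel 0 (dd U) = toL L (dx L (phi U))" "sel 1 (dd U) = toL L (dx L (psi U))" "sel 2 (dd U) = toL L (dx L (ww U))" by (simp_all add: dd_def sel_def)
 have st: "sh \<in> TL L" "ax \<in> TL L" unfolding sh_def ax_def se by (intro TL_add TL_diff TL_scale tl)+
 \<comment> \<open>The second derivatives of the three displacements, read off the system. For the
   first one, \<open>k\<close> times the derivative of the shear equals \<open>sel 0 h\<close> minus
   \<open>k0 * l\<close> times the axial term, and the derivatives of the other displacements in the
   shear are subtracted.\<close>
 define q0 where "q0 = (1 / k) *\<^sub>R (sel 0 h - (k0 * l) *\<^sub>R ax) - sel 1 (dd U) - l *\<^sub>R sel 2 (dd U)"
 define q1 where "q1 = (1 / b) *\<^sub>R (sel 1 h + k *\<^sub>R sh)"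
 define q2 where "q2 = (1 / k0) *\<^sub>R (sel 2 h + (k * l) *\<^sub>R sh) + l *\<^sub>R sel 0 (dd U)"
 have dt: "sel i (dd U) \<in> TL L" for i unfolding dd_def sel_def using tl by auto
 have "q0 \<in> TL L" "q1 \<in> TL L" "q2 \<in> TL L" unfolding q0_def q1_def q2_def by (simp_all add: TL_add TL_diff TL_scale h st dt)
 then obtain r1 r2 r3 where rr: "L2 L r1" "toL L r1 = q0" "L2 L r2" "toL L r2 = q1" "L2 L r3" "toL L r3 = q2"
  by (auto simp: TL_def)
 have e1: "inner (toL L (dx L (phi U))) d = - inner (toL L r1) e" if ed: "(e, d) \<in> K1 L" for e d
 proof -
  have "k * inner sh d - k0 * (l * inner ax e) = - inner (sel 0 h) e"
   using eq[of "((e, 0, 0), (d, 0, 0))"] ed z by (simp add: K3_def aform_def shear_def[of "((e, 0, 0), (d, 0, 0))"] axial_def[of "((e, 0, 0), (d, 0, 0))"] sh_def ax_def inner_prod_def sel_def)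
  then have "inner sh d = - inner ((1 / k) *\<^sub>R (sel 0 h - (k0 * l) *\<^sub>R ax)) e" using pos(5) by (simp add: inner_diff_left field_simps)
  moreover have "inner (toL L (psi U)) d = - inner (toL L (dx L (psi U))) e" "inner (toL L (ww U)) d = - inner (toL L (dx L (ww U))) e"
   using K1_by_parts[OF pos(1) kk(2) ed] K1_by_parts[OF pos(1) kk(3) ed] by auto
  ultimately show ?thesis by (simp add: rr q0_def she dds[simplified] inner_add_left inner_diff_left)
 qed
 have e2: "inner (toL L (dx L (psi U))) d = - inner (toL L r2) e" if ed: "(e, d) \<in> K1 L" for e d
 proof -
  have "b * inner (toL L (dx L (psi U))) d + k * inner sh e = - inner (sel 1 h) e"
   using eq[of "((0, e, 0), (0, d, 0))"] ed z by (simp add: K3_def aform_def shear_def[of "((0, e, 0), (0, d, 0))"] axial_def[of "((0, e, 0), (0, d, 0))"] sh_def ax_def inner_prod_def sel_def dd_def)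
  then show ?thesis using pos(4) by (simp add: rr q1_def inner_add_left field_simps)
 qed
 have e3: "inner (toL L (dx L (ww U))) d = - inner (toL L r3) e" if ed: "(e, d) \<in> K1 L" for e d
 proof -
  have "k * (l * inner sh e) + k0 * inner ax d = - inner (sel 2 h) e"
   using eq[of "((0, 0, e), (0, 0, d))"] ed z by (simp add: K3_def aform_def shear_def[of "((0, 0, e), (0, 0, d))"] axial_def[of "((0, 0, e), (0, 0, d))"] sh_def ax_def inner_prod_def sel_def)
  then have "inner ax d = - inner ((1 / k0) *\<^sub>R (sel 2 h + (k * l) *\<^sub>R sh)) e" using pos(6) by (simp add: inner_add_left field_simps)
  moreover have "inner (toL L (phi U)) d = - inner (toL L (dx L (phi U))) e" using K1_by_parts[OF pos(1) kk(1) ed] by auto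
  ultimately show ?thesis by (simp add: rr q2_def axe dds[simplified] inner_add_left inner_diff_left)
 qed
 note h1 = H2_I[OF pos(1) u(1) rr(1) e1] and h2 = H2_I[OF pos(1) u(2) rr(3) e2] and h3 = H2_I[OF pos(1) u(3) rr(5) e3]
 have un: "norm (toL L (phi U)) <= norm (uu U)" "norm (toL L (psi U)) <= norm (uu U)" "norm (toL L (ww U)) <= norm (uu U)"
  "norm (toL L (dx L (phi U))) <= norm (dd U)" "norm (toL L (dx L (psi U))) <= norm (dd U)" "norm (toL L (dx L (ww U))) <= norm (dd U)"
  using norm_components(1-3)[of "uu U"] norm_components(1-3)[of "dd U"] by (simp_all add: uu_eq dd_def)
 show "H2 L (phi U)" by (rule h1(1))
 show "H2 L (psi U)" by (rule h2(1))
 show "H2 L (ww U)" by (rule h3(1))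
 show "h2norm L (phi U) <= norm (uu U) + norm (dd U) + norm ((1 / k) *\<^sub>R (sel 0 h - (k0 * l) *\<^sub>R axial (uu U, dd U)) - sel 1 (dd U) - l *\<^sub>R sel 2 (dd U))"
  using h1(2) un unfolding rr q0_def ax_def by linarith
 show "h2norm L (psi U) <= norm (uu U) + norm (dd U) + norm ((1 / b) *\<^sub>R (sel 1 h + k *\<^sub>R shear (uu U, dd U)))"
  using h2(2) un unfolding rr q1_def sh_def by linarith
 show "h2norm L (ww U) <= norm (uu U) + norm (dd U) + norm ((1 / k0) *\<^sub>R (sel 2 h + (k * l) *\<^sub>R shear (uu U, dd U)) + l *\<^sub>R sel 0 (dd U))"
  using h3(2) un unfolding rr q2_def sh_def by linarith
qed

lemma attractor_regularity:
 "\<exists>C>0. \<forall>trj. full_traj L S A trj -->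
  (\<forall>t. H2 L (phi (trj t)) & H2 L (psi (trj t)) & H2 L (ww (trj t))
    & H10 L (phi_t (trj t)) & H10 L (psi_t (trj t)) & H10 L (ww_t (trj t))
    & (\<exists>a1 a2 a3.
      L2_deriv_at L (%s. phi_t (trj s)) a1 t UNIV
     & L2_deriv_at L (%s. psi_t (trj s)) a2 t UNIV
     & L2_deriv_at L (%s. ww_t (trj s)) a3 t UNIV
     & sqrt ((h2norm L (phi (trj t)))^2 + (h2norm L (psi (trj t)))^2 + (h2norm L (ww (trj t)))^2)
      + sqrt ((l2norm L (dx L (phi_t (trj t))))^2 + (l2norm L (dx L (psi_t (trj t))))^2
          + (l2norm L (dx L (ww_t (trj t))))^2)
      + sqrt ((l2norm L a1)^2 + (l2norm L a2)^2 + (l2norm L a3)^2) <= C))"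
proof -
 obtain R where R: "0 < R" "\<forall>x\<in>io ` A. norm x <= R" using compact_imp_bounded[OF io_A_compact] by (auto simp: bounded_pos)
 obtain C1 where C1: "0 <= C1" "!!trj. ctraj R trj ==> (\<forall>t h. norm (io (trj (t + h)) - io (trj t)) <= C1 * \<bar>h\<bar>)"
  using ctraj_lipschitz[OF less_imp_le[OF R(1)]] by blast
 obtain Bm where Bm: "Bm > 0" "!!x. norm (mass x) <= norm x * Bm" using bounded_linear.pos_bounded[OF M] by blast
 obtain Bs where Bs: "Bs > 0" "!!x. norm (shear x) <= norm x * Bs" using bounded_linear.pos_bounded[OF shear_linear] by blast
 obtain Ba where Ba: "Ba > 0" "!!x. norm (axial x) <= norm x * Ba" using bounded_linear.pos_bounded[OF axial_linear] by blast
 obtain Kc where Kc: "0 <= Kc" "!!U V. Hsp L U ==> Hsp L V ==> norm (dd U) <= R ==> norm (dd V) <= R ==>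
   norm (GG U - GG V) <= MD * norm (vv U - vv V) + Kc * norm (uu U - uu V)"
  using GG_estimates[of R] by blast
 \<comment> \<open>\<open>Bh\<close> bounds acceleration plus source, \<open>W\<close> the
   displacement with its derivative, and \<open>E\<close> is the sum of the bounds for all three
   second derivatives. They depend on the attractor and the coefficients only, so the final constant
   is the same for all full trajectories.\<close>
 define Bh where "Bh = C1 * Bm + (MD * R + Kc * (L * R) + norm (GG zero_st))"
 define W where "W = L * R + R"
 define E where "E = W + (1 / k * (Bh + k0 * l * (W * Ba)) + R + l * R) + (1 / b * (Bh + k * (W * Bs))) + (1 / k0 * (Bh + k * l * (W * Bs)) + l * R)"
 have MD: "0 < MD" by (rule damping_consts(2))
 have nn: "0 <= Bh" "0 <= W" using C1(1) Bm(1) MD R(1) Kc(1) pos(1) by (simp_all add: Bh_def W_def)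
 define C where "C = 3 * E + 6 * C1 + 1"
 have E0: "0 <= E" using nn pos R(1) Bs(1) Ba(1) by (simp add: E_def)
 have "0 < C" using E0 C1(1) by (simp add: C_def)
 moreover
 {
  fix trj t assume f: "full_traj L S A trj"
  have c: "ltraj R C1 trj" 
  proof -
   have "ctraj R trj" unfolding ctraj_def using full_traj_bsol[OF f] R(2) by blast
   then show ?thesis using C1 R(1) by (simp add: ltraj_def)
  qed
  note l = ltrajD[OF c]
  note H = ctrajD(3)[OF l(3)]
  obtain zet where zet: "((%t. io (trj t)) has_vector_derivative zet) (at t)" "norm zet <= C1" using trajectory_differentiable[OF c] by blast
  have zetn: "norm (fst zet) <= C1" "norm (snd zet) <= C1"
   using zet(2) norm_fst_le[of "fst zet" "snd zet"] norm_snd_le[of "snd zet" "fst zet"] by auto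
  note reg = velocity_regularity[OF c zet(1)]
  define h where "h = mass (snd zet) + GG (trj t)"
  have GT: "sel i (GG (trj t)) \<in> TL L" for i
   unfolding GG_def NG_def NF_def sel_def using L2_NG[OF H[of t]] L2_NF[OF H[of t]] by (auto intro!: TL_add TL_I)
  have mT: "sel i (mass (snd zet)) \<in> TL L" for i
   using reg(2)[of 0] reg(2)[of 1] reg(2)[of 2] by (auto simp: sel_def mass_def intro: TL_scale)
  have hT: "sel i h \<in> TL L" for i
  proof -
   have "sel i h = sel i (mass (snd zet)) + sel i (GG (trj t))" by (simp add: h_def sel_def)
   then show ?thesis using GT mT by (simp add: TL_add)
  qed
  have dv: "norm (dd (trj t)) <= R" "norm (vv (trj t)) <= R" by (rule ctrajD[OF l(3)])+
  have un: "norm (uu (trj t)) <= L * R"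
   by (rule order_trans[OF K3_poincare[OF HspD(15)[OF H[of t]], unfolded fst_conv snd_conv] mult_left_mono[OF dv(1)]]) (use pos(1) in simp)
  have z: "dd zero_st = 0" "vv zero_st = 0" "uu zero_st = 0"
   using zero_st(2) by (auto simp: io_def zero_prod_def uu_eq zero_st_def toL_zero)
  have "norm (GG (trj t) - GG zero_st) <= MD * norm (vv (trj t)) + Kc * norm (uu (trj t))"
   using Kc(2)[OF H[of t] zero_st(1) dv(1)] R(1) by (simp add: z)
  also have "... <= MD * R + Kc * (L * R)" using dv un Kc(1) MD by (intro add_mono mult_left_mono) auto
  finally have g: "norm (GG (trj t)) <= MD * R + Kc * (L * R) + norm (GG zero_st)"
   using norm_triangle_ineq2[of "GG (trj t)" "GG zero_st"] by simp
  have hn: "norm h <= Bh"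
   unfolding h_def Bh_def by (rule order_trans[OF norm_triangle_ineq add_mono[OF order_trans[OF Bm(2) mult_right_mono[OF zetn(2)]] g]]) (use Bm(1) in simp)
  have wn: "norm (uu (trj t), dd (trj t)) <= W"
   using norm_Pair_le[of "uu (trj t)" "dd (trj t)"] un dv(1) by (simp add: W_def)
  have sh: "norm (shear (uu (trj t), dd (trj t))) <= W * Bs" and ax: "norm (axial (uu (trj t), dd (trj t))) <= W * Ba"
   by (rule order_trans[OF Bs(2) mult_right_mono[OF wn]], use Bs(1) in simp) (rule order_trans[OF Ba(2) mult_right_mono[OF wn]], use Ba(1) in simp)
  note h2 = elliptic_regularity[OF H[of t] hT weak_equation[OF c zet(1), folded h_def]]
  have sd: "norm (sel i (dd (trj t))) <= R" "norm (sel i h) <= Bh" for i using order_trans[OF sel_norm dv(1)] order_trans[OF sel_norm hn] by auto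
  have mono: "norm (alp *\<^sub>R x) <= alp * B" if "0 <= alp" "norm x <= B" for alp B and x :: l2 using that by (simp add: mult_left_mono)
  have "norm ((1 / k) *\<^sub>R (sel 0 h - (k0 * l) *\<^sub>R axial (uu (trj t), dd (trj t))) - sel 1 (dd (trj t)) - l *\<^sub>R sel 2 (dd (trj t))) <= 1 / k * (Bh + k0 * l * (W * Ba)) + R + l * R"
   using pos by (intro norm_triangle_le_diff add_mono mono sd ax; simp)
  moreover have "norm ((1 / b) *\<^sub>R (sel 1 h + k *\<^sub>R shear (uu (trj t), dd (trj t)))) <= 1 / b * (Bh + k * (W * Bs))"
   using pos by (intro mono norm_triangle_le add_mono sd sh; simp)
  moreover have "norm ((1 / k0) *\<^sub>R (sel 2 h + (k * l) *\<^sub>R shear (uu (trj t), dd (trj t))) + l *\<^sub>R sel 0 (dd (trj t))) <= 1 / k0 * (Bh + k * l * (W * Bs)) + l * R"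
   using pos by (intro norm_triangle_le add_mono mono sd sh; simp)
  moreover have "0 <= 1 / k * (Bh + k0 * l * (W * Ba)) + R + l * R" "0 <= 1 / b * (Bh + k * (W * Bs))" "0 <= 1 / k0 * (Bh + k * l * (W * Bs)) + l * R"
   using nn pos R(1) Bs(1) Ba(1) by simp_all
  ultimately have h2E: "h2norm L (phi (trj t)) <= E" "h2norm L (psi (trj t)) <= E" "h2norm L (ww (trj t)) <= E"
   using h2(4-6) un dv(1) unfolding E_def W_def by linarith+
  have h20: "0 <= h2norm L f" for f by (simp add: h2norm_def)
  have v: "(toL L (phi_t (trj t)), sel 0 (fst zet)) \<in> K1 L" "(toL L (psi_t (trj t)), sel 1 (fst zet)) \<in> K1 L" "(toL L (ww_t (trj t)), sel 2 (fst zet)) \<in> K1 L"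
   using reg(1)[of 0] reg(1)[of 1] reg(1)[of 2] by (simp_all add: sel_def vv_eq)
  note v1 = K3_TL_H10[OF HspD(4)[OF H[of t]] v(1)] and v2 = K3_TL_H10[OF HspD(5)[OF H[of t]] v(2)] and v3 = K3_TL_H10[OF HspD(6)[OF H[of t]] v(3)]
  have zs: "norm (sel i (fst zet)) <= C1" "norm (sel i (snd zet)) <= C1" for i
   using order_trans[OF sel_norm zetn(1)] order_trans[OF sel_norm zetn(2)] by auto
  have aex: "\<exists>a. L2 L a & toL L a = sel i (snd zet)" for i
  proof -
   have "sel i (snd zet) \<in> toL L ` {f. L2 L f}" using reg(2)[of i] by (simp only: TL_def)
   then show ?thesis by (rule imageE) (rule exI, auto)
  qed
  obtain a1 where a1: "L2 L a1" "toL L a1 = sel 0 (snd zet)" using aex[of 0] by blast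
  obtain a2 where a2: "L2 L a2" "toL L a2 = sel 1 (snd zet)" using aex[of 1] by blast
  obtain a3 where a3: "L2 L a3" "toL L a3 = sel 2 (snd zet)" using aex[of 2] by blast
  note a = a1 a2 a3
  have sv: "((%t. sel i (vv (trj t))) has_vector_derivative sel i (snd zet)) (at t)" for i
  proof -
   have "bounded_linear (%x::h3 \<times> h3. sel i (snd x))"
    unfolding sel_def by (cases "i = 0"; cases "i = 1"; simp only: if_True if_False)
     (intro bounded_linear_compose[OF bounded_linear_fst] bounded_linear_compose[OF bounded_linear_snd] bounded_linear_fst bounded_linear_snd | simp)+
   from bounded_linear.has_vector_derivative[OF this zet(1)] show ?thesis by (simp add: io_def)
  qed
  have "L2_deriv_at L (%s. phi_t (trj s)) a1 t UNIV"
   using sv[of 0] HspD(4)[OF H] a by (subst L2_deriv_at_iff) (simp_all add: sel_def vv_eq)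
  moreover have "L2_deriv_at L (%s. psi_t (trj s)) a2 t UNIV"
   using sv[of 1] HspD(5)[OF H] a by (subst L2_deriv_at_iff) (simp_all add: sel_def vv_eq)
  moreover have "L2_deriv_at L (%s. ww_t (trj s)) a3 t UNIV"
   using sv[of 2] HspD(6)[OF H] a by (subst L2_deriv_at_iff) (simp_all add: sel_def vv_eq)
  moreover have "sqrt ((h2norm L (phi (trj t)))^2 + (h2norm L (psi (trj t)))^2 + (h2norm L (ww (trj t)))^2)
      + sqrt ((l2norm L (dx L (phi_t (trj t))))^2 + (l2norm L (dx L (psi_t (trj t))))^2 + (l2norm L (dx L (ww_t (trj t))))^2)
      + sqrt ((l2norm L a1)^2 + (l2norm L a2)^2 + (l2norm L a3)^2) <= C"
  proof -
   have "sqrt ((h2norm L (phi (trj t)))^2 + (h2norm L (psi (trj t)))^2 + (h2norm L (ww (trj t)))^2) <= 3 * E"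
    using sqrt_sum3_le[OF h20 h20 h20, of "phi (trj t)" "psi (trj t)" "ww (trj t)"] h2E by linarith
   moreover have "sqrt ((l2norm L (dx L (phi_t (trj t))))^2 + (l2norm L (dx L (psi_t (trj t))))^2 + (l2norm L (dx L (ww_t (trj t))))^2) <= 3 * C1"
    unfolding v1(2) v2(2) v3(2)
    using sqrt_sum3_le[OF norm_ge_zero norm_ge_zero norm_ge_zero, of "sel 0 (fst zet)" "sel 1 (fst zet)" "sel 2 (fst zet)"] zs(1)[of 0] zs(1)[of 1] zs(1)[of 2] by linarith
   moreover have "sqrt ((l2norm L a1)^2 + (l2norm L a2)^2 + (l2norm L a3)^2) <= 3 * C1"
    unfolding l2norm_eq_norm[OF a(1)] l2norm_eq_norm[OF a(3)] l2norm_eq_norm[OF a(5)] a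
    using sqrt_sum3_le[OF norm_ge_zero norm_ge_zero norm_ge_zero, of "sel 0 (snd zet)" "sel 1 (snd zet)" "sel 2 (snd zet)"] zs(2)[of 0] zs(2)[of 1] zs(2)[of 2] by linarith
   ultimately show ?thesis unfolding C_def by linarith
  qed
  ultimately have "H2 L (phi (trj t)) & H2 L (psi (trj t)) & H2 L (ww (trj t))
    & H10 L (phi_t (trj t)) & H10 L (psi_t (trj t)) & H10 L (ww_t (trj t))
    & (\<exists>a1 a2 a3.
      L2_deriv_at L (%s. phi_t (trj s)) a1 t UNIV
     & L2_deriv_at L (%s. psi_t (trj s)) a2 t UNIV
     & L2_deriv_at L (%s. ww_t (trj s)) a3 t UNIV
     & sqrt ((h2norm L (phi (trj t)))^2 + (h2norm L (psi (trj t)))^2 + (h2norm L (ww (trj t)))^2)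
      + sqrt ((l2norm L (dx L (phi_t (trj t))))^2 + (l2norm L (dx L (psi_t (trj t))))^2
          + (l2norm L (dx L (ww_t (trj t))))^2)
      + sqrt ((l2norm L a1)^2 + (l2norm L a2)^2 + (l2norm L a3)^2) <= C)"
   using h2(1-3) v1(1) v2(1) v3(1) by blast
 }
 ultimately show ?thesis by blast
qed

end

theorem theorem5p1:
  fixes L \<rho>1 \<rho>2 b k k0 l \<gamma>3 \<beta> mF p Cf :: real
    and F f1 f2 f3 :: "real \<times> real \<times> real \<Rightarrow> real"
    and g1 g2 g3 :: "real \<Rightarrow> real"
    and S :: "real \<Rightarrow> bst \<Rightarrow> bst"
    and A :: "bst set"
  assumes pos: "L > 0" "\<rho>1 > 0" "\<rho>2 > 0" "b > 0" "k > 0" "k0 > 0" "l > 0"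
    and gamma3: "\<gamma>3 > 0"
      "\<forall>\<phi> \<psi> w. H10 L \<phi> \<and> H10 L \<psi> \<and> H10 L w \<longrightarrow>
         (l2norm L (dx L \<phi>))^2 + (l2norm L (dx L \<psi>))^2 + (l2norm L (dx L w))^2
         \<le> \<gamma>3 * (b * (l2norm L (dx L \<psi>))^2
                  + k * (l2norm L (\<lambda>x. dx L \<phi> x + \<psi> x + l * w x))^2
                  + k0 * (l2norm L (\<lambda>x. dx L w x - l * \<phi> x))^2)"
    and F1: "\<forall>x. (F has_derivative
               (\<lambda>h. f1 x * fst h + f2 x * fst (snd h) + f3 x * snd (snd h))) (at x)"
    and F2: "0 \<le> \<beta>" "0 \<le> mF" "\<beta> < pi^2 / (2 * \<gamma>3 * L^2)"
      "\<forall>u v w. F (u, v, w) \<ge> - \<beta> * (u^2 + v^2 + w^2) - mF"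
    and F3: "p \<ge> 1" "Cf > 0" "C1_growth Cf p f1" "C1_growth Cf p f2" "C1_growth Cf p f3"
    and F4: "\<forall>u v w. f1 (u, v, w) * u + f2 (u, v, w) * v + f3 (u, v, w) * w - F (u, v, w)
                     \<ge> - \<beta> * (u^2 + v^2 + w^2) - mF"
    and G: "damping_ok g1" "damping_ok g2" "damping_ok g3"
    and semigroup: "\<forall>U0. Hsp L U0 \<longrightarrow>
        bresse_weak_sol L \<rho>1 \<rho>2 b k k0 l g1 g2 g3 f1 f2 f3 (\<lambda>t. S t U0) \<and> dH L (S 0 U0) U0 = 0"
    and attractor: "global_attractor L S A"
  shows "fractal_dim (dH L) A < \<infinity>
    \<and> (\<exists>C>0. \<forall>\<Gamma>. full_traj L S A \<Gamma> \<longrightarrow>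
         (\<forall>t. H2 L (phi (\<Gamma> t)) \<and> H2 L (psi (\<Gamma> t)) \<and> H2 L (ww (\<Gamma> t))
            \<and> H10 L (phi_t (\<Gamma> t)) \<and> H10 L (psi_t (\<Gamma> t)) \<and> H10 L (ww_t (\<Gamma> t))
            \<and> (\<exists>a1 a2 a3.
                 L2_deriv_at L (\<lambda>s. phi_t (\<Gamma> s)) a1 t UNIV
               \<and> L2_deriv_at L (\<lambda>s. psi_t (\<Gamma> s)) a2 t UNIV
               \<and> L2_deriv_at L (\<lambda>s. ww_t (\<Gamma> s)) a3 t UNIV
               \<and> sqrt ((h2norm L (phi (\<Gamma> t)))^2 + (h2norm L (psi (\<Gamma> t)))^2 + (h2norm L (ww (\<Gamma> t)))^2)
                 + sqrt ((l2norm L (dx L (phi_t (\<Gamma> t))))^2 + (l2norm L (dx L (psi_t (\<Gamma> t))))^2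
                         + (l2norm L (dx L (ww_t (\<Gamma> t))))^2)
                 + sqrt ((l2norm L a1)^2 + (l2norm L a2)^2 + (l2norm L a3)^2) \<le> C)))
    \<and> (\<exists>Aexp. exp_attracting_set L S Aexp \<and>
         (\<forall>\<eta>\<in>{0<..1}. fractal_dim (dext L \<eta>) Aexp < \<infinity>))"
proof -
  interpret bresse L \<rho>1 \<rho>2 b k k0 l \<gamma>3 \<beta> mF p Cf F f1 f2 f3 g1 g2 g3 S A
    by (rule bresse.intro; fact assms)
  show ?thesis using attractor_fractal_dim attractor_regularity exponential_attractor by blast
qed

end
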